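(* Let $s\in(0,1)$, $k\in\mathbb{N}$ and $u:\mathbb{R}^n\to\mathbb{R}$. Assume that $u$ is continuous and $\int_{\mathbb{R}^n}\frac{|u(y)|}{1+|y|^{n+2s+k}}\,dy<+\infty$. Let $d(k,s):=k+1$ if $s\in\left(\frac12,1\right)$ and $d(k,s):=k$ if $s\in\left(0,\frac12\right]$. Then $(-\Delta)^s u\overset{k}{=}0$ in $\mathbb{R}^n$ if and only if $u$ is a polynomial of degree at most $d(k,s)$.
   Context: $\mathbb{N}=\{0,1,2,\dots\}$; $B_r$ is the open ball of radius $r$ centered at the origin of $\mathbb{R}^n$; polynomials of negative degree are set to be zero. For $s\in(0,1)$, $(-\Delta)^s u(x):=\lim_{\varepsilon\to0}\int_{\mathbb{R}^n\setminus B_\varepsilon(x)}\frac{u(x)-u(y)}{|x-y|^{n+2s}}\,dy$. Viscosity sense (standard): for an open set $\Omega$, $w:\mathbb{R}^n\to\mathbb{R}$ continuous in $\Omega$ with $\int_{\mathbb{R}^n}\frac{|w(y)|}{1+|y|^{n+2s}}dy<+\infty$, and $g$ continuous in $\Omega$, one says $(-\Delta)^s w=g$ in $\Omega$ in the viscosity sense if, whenever $x_0\in\Omega$, $N\subset\Omega$ is a neighborhood of $x_0$, $\varphi\in C^2(N)$, $\varphi(x_0)=w(x_0)$ and $\varphi\ge w$ in $N$ (resp. $\varphi\le w$ in $N$), the function equal to $\varphi$ in $N$ and to $w$ outside $N$ has $(-\Delta)^s$ at $x_0$ that is $\le g(x_0)$ (resp. $\ge g(x_0)$). Let $\chi_R$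 be the function equal to $1$ in $B_R$ and $0$ elsewhere. For $k\in\mathbb{N}$, $M>0$, $f:B_M\to\mathbb{R}$ and $u:\mathbb{R}^n\to\mathbb{R}$ continuous in $B_M$ with $\int_{\mathbb{R}^n}\frac{|u(y)|}{1+|y|^{n+2s+k}}dy<+\infty$, one writes $(-\Delta)^s u\overset{k}{=}f$ in $B_M$ if there exist polynomials $P_R$ of degree at most $k-1$ and functions $f_R:B_M\to\mathbb{R}$ (for all sufficiently large $R$) such that $(-\Delta)^s(\chi_R u)=f_R+P_R$ in $B_M$ in the viscosity sense and $\lim_{R\to+\infty}f_R(x)=f(x)$ for every $x\in B_M$. One writes $(-\Delta)^s u\overset{k}{=}f$ in $\mathbb{R}^n$ if $(-\Delta)^s u\overset{k}{=}f$ in $B_M$ for all $M>0$. *)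

theory Defs
  imports "HOL-Analysis.Analysis"
begin

(* The degree bound is an integer, so that "degree at most -1" means the zero polynomial. *)
definition polynomial_deg_le :: "int \<Rightarrow> (real ^ 'n \<Rightarrow> real) \<Rightarrow> bool" where
  "polynomial_deg_le d p \<longleftrightarrow>
     (\<exists>c :: ('n \<Rightarrow> nat) \<Rightarrow> real. \<forall>x.
        p x = (\<Sum>\<alpha> \<in> {\<alpha>. int (\<Sum>i\<in>UNIV. \<alpha> i) \<le> d}. c \<alpha> * (\<Prod>i\<in>UNIV. (x $ i) ^ \<alpha> i)))"

lemma finite_multi_indices: "finite {\<alpha> :: 'n::finite \<Rightarrow> nat. int (\<Sum>i\<in>UNIV. \<alpha> i) \<le> d}"
proof (rule finite_subset)
  show "{\<alpha> :: 'n \<Rightarrow> nat. int (\<Sum>i\<in>UNIV. \<alpha> i) \<le> d} \<subseteq> PiE UNIV (\<lambda>_. {..nat d})"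
  proof
    fix \<alpha> :: "'n \<Rightarrow> nat"
    assume "\<alpha> \<in> {\<alpha>. int (\<Sum>i\<in>UNIV. \<alpha> i) \<le> d}"
    then have "(\<Sum>i\<in>UNIV. \<alpha> i) \<le> nat d" by (simp del: of_nat_sum)
    moreover have "\<alpha> j \<le> (\<Sum>i\<in>UNIV. \<alpha> i)" for j
      by (rule member_le_sum) auto
    ultimately have "\<alpha> j \<le> nat d" for j
      using le_trans by blast
    then show "\<alpha> \<in> PiE UNIV (\<lambda>_. {..nat d})" by auto
  qed
qed (rule finite_PiE, auto)

definition C2_on :: "(real ^ 'n) set \<Rightarrow> (real ^ 'n \<Rightarrow> real) \<Rightarrow> bool" where
  "C2_on N \<phi> \<longleftrightarrow>
     (\<exists>(D1 :: real ^ 'n \<Rightarrow> (real ^ 'n) \<Rightarrow>\<^sub>L real)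
       (D2 :: real ^ 'n \<Rightarrow> (real ^ 'n) \<Rightarrow>\<^sub>L ((real ^ 'n) \<Rightarrow>\<^sub>L real)).
        (\<forall>x\<in>N. (\<phi> has_derivative blinfun_apply (D1 x)) (at x)) \<and>
        (\<forall>x\<in>N. (D1 has_derivative blinfun_apply (D2 x)) (at x)) \<and>
        continuous_on N D2)"

definition weighted_integrable :: "real \<Rightarrow> (real ^ 'n \<Rightarrow> real) \<Rightarrow> bool" where
  "weighted_integrable a u \<longleftrightarrow>
     u \<in> borel_measurable lebesgue \<and>
     integrable lebesgue (\<lambda>y. \<bar>u y\<bar> / (1 + norm y powr (real CARD('n) + a)))"

(* Integrals of the positive and of the negative part of (v x - v y) / |x - y|^(n+2s)
   outside the ball of radius e; ennreal sends negative numbers to 0. *)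
definition frac_pos_part :: "real \<Rightarrow> (real ^ 'n \<Rightarrow> real) \<Rightarrow> real ^ 'n \<Rightarrow> real \<Rightarrow> ennreal" where
  "frac_pos_part s v x e =
     (\<integral>\<^sup>+ y \<in> - ball x e.
        ennreal ((v x - v y) / norm (x - y) powr (real CARD('n) + 2 * s)) \<partial>lebesgue)"

definition frac_neg_part :: "real \<Rightarrow> (real ^ 'n \<Rightarrow> real) \<Rightarrow> real ^ 'n \<Rightarrow> real \<Rightarrow> ennreal" where
  "frac_neg_part s v x e =
     (\<integral>\<^sup>+ y \<in> - ball x e.
        ennreal (- ((v x - v y) / norm (x - y) powr (real CARD('n) + 2 * s))) \<partial>lebesgue)"

(* The fractional Laplacian of v at x exists, as an extended real, and equals L.  Infinite
   values are needed for viscosity test functions: a C^2 function on an open set N need not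
   be integrable near the boundary of N, and then the integral is infinite (with a sign)
   rather than undefined.  The first conjunct excludes the form infinity - infinity. *)
definition has_frac_laplacian ::
  "real \<Rightarrow> (real ^ 'n \<Rightarrow> real) \<Rightarrow> real ^ 'n \<Rightarrow> ereal \<Rightarrow> bool" where
  "has_frac_laplacian s v x L \<longleftrightarrow>
     (\<forall>e>0. frac_pos_part s v x e < \<infinity> \<or> frac_neg_part s v x e < \<infinity>) \<and>
     ((\<lambda>e. enn2ereal (frac_pos_part s v x e) - enn2ereal (frac_neg_part s v x e)) \<longlongrightarrow> L)
       (at_right 0)"

definition visc_frac_laplacian_eq ::
  "real \<Rightarrow> (real ^ 'n) set \<Rightarrow> (real ^ 'n \<Rightarrow> real) \<Rightarrow> (real ^ 'n \<Rightarrow> real) \<Rightarrow> bool" where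
  "visc_frac_laplacian_eq s \<Omega> w g \<longleftrightarrow>
     open \<Omega> \<and> continuous_on \<Omega> w \<and> weighted_integrable (2 * s) w \<and> continuous_on \<Omega> g \<and>
     (\<forall>x0\<in>\<Omega>. \<forall>N \<phi>. open N \<and> x0 \<in> N \<and> N \<subseteq> \<Omega> \<and> C2_on N \<phi> \<and> \<phi> x0 = w x0 \<longrightarrow>
        ((\<forall>y\<in>N. w y \<le> \<phi> y) \<longrightarrow>
           (\<exists>L. has_frac_laplacian s (\<lambda>y. if y \<in> N then \<phi> y else w y) x0 L \<and> L \<le> ereal (g x0))) \<and>
        ((\<forall>y\<in>N. \<phi> y \<le> w y) \<longrightarrow>
           (\<exists>L. has_frac_laplacian s (\<lambda>y. if y \<in> N then \<phi> y else w y) x0 L \<and> ereal (g x0) \<le> L)))"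

definition frac_laplacian_eq_mod_on ::
  "real \<Rightarrow> nat \<Rightarrow> real \<Rightarrow> (real ^ 'n \<Rightarrow> real) \<Rightarrow> (real ^ 'n \<Rightarrow> real) \<Rightarrow> bool" where
  "frac_laplacian_eq_mod_on s k M u f \<longleftrightarrow>
     continuous_on (ball 0 M) u \<and> weighted_integrable (2 * s + real k) u \<and>
     (\<exists>(P :: real \<Rightarrow> real ^ 'n \<Rightarrow> real) (F :: real \<Rightarrow> real ^ 'n \<Rightarrow> real).
        (\<forall>\<^sub>F R in at_top.
           polynomial_deg_le (int k - 1) (P R) \<and>
           visc_frac_laplacian_eq s (ball 0 M)
             (\<lambda>y. indicator (ball 0 R) y * u y) (\<lambda>x. F R x + P R x)) \<and>
        (\<forall>x\<in>ball 0 M. ((\<lambda>R. F R x) \<longlongrightarrow> f x) at_top))"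

definition frac_laplacian_eq_mod ::
  "real \<Rightarrow> nat \<Rightarrow> (real ^ 'n \<Rightarrow> real) \<Rightarrow> (real ^ 'n \<Rightarrow> real) \<Rightarrow> bool" where
  "frac_laplacian_eq_mod s k u f \<longleftrightarrow> (\<forall>M>0. frac_laplacian_eq_mod_on s k M u f)"

definition liouville_degree :: "nat \<Rightarrow> real \<Rightarrow> nat" where
  "liouville_degree k s = (if s > 1 / 2 then k + 1 else k)"

end

theory Submission
  imports Defs "HOL-Real_Asymp.Real_Asymp"
begin

text \<open>Write \<open>\<Delta>\<^sub>h\<^sup>m\<close> for the \<open>m\<close>-th iterated difference with step \<open>h\<close>. By a theorem of Frechet a continuous
  function annihilated by all \<open>\<Delta>\<^sub>h\<^sup>m\<close> is a polynomial of degree less than \<open>m\<close>.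

  Let \<open>u\<close> be a solution and \<open>m = d(k,s) + 1\<close>. Sup-convolutions turn the viscosity equation for \<open>\<chi>\<^sub>R u\<close> into a
  pointwise equation for its mollification: where the sup-convolution is attained, \<open>\<chi>\<^sub>R u\<close> is touched by a
  paraboloid. Applying \<open>\<Delta>\<^sub>h\<^sup>m\<close> kills \<open>P\<^sub>R\<close> and makes the kernel decay like \<open>\<bar>y\<bar>\<^bsup>-n-2s-m\<^esup>\<close>, so \<open>R\<close> can tend to
  infinity. Written as a mixture of heat kernels, the limit equation says that the caloric extension \<open>F t\<close> of
  \<open>\<Delta>\<^sub>h\<^sup>m u\<close> (mollified) at a point satisfies \<open>\<integral> (F t - F (t + \<tau>)) \<tau>\<^bsup>-1-s\<^esup> d\<tau> = 0\<close> for all \<open>t \<ge> 0\<close>; since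
  \<open>F\<close> tends to 0 at infinity, the maximum principle in the single variable \<open>t\<close> gives \<open>F = 0\<close>, and
  \<open>\<Delta>\<^sub>h\<^sup>m u = 0\<close>.

  Conversely, for a polynomial \<open>u\<close> let \<open>G\<^sub>R\<close> be the fractional Laplacian of \<open>\<chi>\<^sub>R u\<close> and subtract from the kernel
  its Taylor polynomial of degree below \<open>k\<close>: this adds to \<open>G\<^sub>R\<close> a polynomial \<open>Q\<^sub>R\<close> such that \<open>G\<^sub>R + Q\<^sub>R\<close>
  converges locally uniformly. Since \<open>\<Delta>\<^sub>h\<^sup>k G\<^sub>R\<close> tends to 0, the limit is itself a polynomial of degree below \<open>k\<close>,
  and \<open>P\<^sub>R\<close> is the limit minus \<open>Q\<^sub>R\<close>.\<close>

text \<open>The number d(k,s) + 1 is the least integer m with 2 s + k \<le> m. For such m the decay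
  |y|^(-n-m) of a differenced bump or heat kernel can be integrated against u, because the
  hypothesis controls u with the weight |y|^(-n-2s-k). The remainders F_R converge only pointwise
  and come without a bound, so the limit cannot be taken under a mollifier at once. The missing
  bound comes from comparing two cut-offs: their difference vanishes on a large ball, and after
  \<Delta>_h^m its fractional Laplacian is an integral against a decaying kernel, bounded by the
  weighted norm of u. Since u may grow, no maximum principle is at hand in x. But the limit equation
  holds at every x, and averaging it with the heat kernel of time t gives the equation at time t at
  one fixed x. Conversely, degree k + 1 is allowed because a centred second difference lowers the
  degree by two: the second differences of \<Delta>_h^k u vanish identically, and \<Delta>_h^k G_R
  only sees u outside B_R and a kernel that is smooth at scale R.\<close>

hide_fact (open) Henstock_Kurzweil_Integration.integrable_add Henstock_Kurzweil_Integration.integrable_bound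
  Henstock_Kurzweil_Integration.integrable_diff Henstock_Kurzweil_Integration.integrable_sum
  Henstock_Kurzweil_Integration.integral_add Henstock_Kurzweil_Integration.integral_cong
  Henstock_Kurzweil_Integration.integral_diff Henstock_Kurzweil_Integration.integral_nonneg
  Henstock_Kurzweil_Integration.integral_sum

section \<open>Iterated differences and polynomials\<close>

text \<open>Pascal's rule. Every induction on the order of a difference goes through it.\<close>

lemma alternating_binomial_Suc:
 fixes a :: "nat => real"
 shows "(\<Sum>j\<le>Suc m. (-1)^j * real (Suc m choose j) * a j) =
  (\<Sum>j\<le>m. (-1)^j * real (m choose j) * a j) - (\<Sum>j\<le>m. (-1)^j * real (m choose j) * a (Suc j))"
proof -
 have "(\<Sum>j\<le>Suc m. (-1)^j * real (Suc m choose j) * a j) =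
   a 0 + (\<Sum>j\<le>m. (-1)^Suc j * real (Suc m choose Suc j) * a (Suc j))"
  by (simp add: sum.atMost_Suc_shift del: sum.atMost_Suc)
 also have "... = a 0 + (\<Sum>j\<le>m. (-1)^Suc j * real (m choose Suc j) * a (Suc j))
   - (\<Sum>j\<le>m. (-1)^j * real (m choose j) * a (Suc j))"
  by (simp add: sum_subtractf [symmetric] sum.distrib [symmetric] algebra_simps)
 also have "a 0 + (\<Sum>j\<le>m. (-1)^Suc j * real (m choose Suc j) * a (Suc j)) =
   (\<Sum>j\<le>Suc m. (-1)^j * real (m choose j) * a j)"
  by (simp add: sum.atMost_Suc_shift del: sum.atMost_Suc)
 also have "... = (\<Sum>j\<le>m. (-1)^j * real (m choose j) * a j)"
  by simp
 finally show ?thesis .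
qed

text \<open>Pascal's rule leaves the difference of (j + 1 + c)^p and (j + c)^p, in which the leading
  powers cancel, so the order and the exponent drop together. The shift c lets the same statement
  serve later for arbitrary base points.\<close>

lemma alternating_binomial_shifted_power:
 "p < m ==> (\<Sum>j\<le>m. (-1)^j * real (m choose j) * (real j + c)^p) = 0"
proof (induction m arbitrary: p c)
 case 0
 then show ?case by simp
next
 case (Suc m)
 have *: "(real (Suc j) + c)^p = (real j + c)^p + (\<Sum>i<p. real (p choose i) * (real j + c)^i)" for j
 proof -
  have "(real (Suc j) + c)^p = ((real j + c) + 1)^p"
   by (simp add: algebra_simps)
  also have "... = (\<Sum>i\<le>p. real (p choose i) * (real j + c)^i)"
   by (simp add: binomial_ring)
  also have "... = (real j + c)^p + (\<Sum>i<p. real (p choose i) * (real j + c)^i)"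
   by (simp add: lessThan_Suc_atMost [symmetric])
  finally show ?thesis .
 qed
 have "(\<Sum>j\<le>m. (-1)^j * real (m choose j) * (\<Sum>i<p. real (p choose i) * (real j + c)^i)) =
   (\<Sum>i<p. real (p choose i) * (\<Sum>j\<le>m. (-1)^j * real (m choose j) * (real j + c)^i))"
  unfolding sum_distrib_left by (subst sum.swap) (simp add: algebra_simps)
 also have "... = 0"
  using Suc by (intro sum.neutral) auto
 finally show ?case
  unfolding alternating_binomial_Suc *
  by (simp add: distrib_left sum.distrib del: of_nat_Suc)
qed

text \<open>The alternative p = 0 covers m = 0, where no degree is less than m; it is the form in
  which \<open>degree_interpolant\<close> is stated.\<close>

lemma alternating_binomial_poly:
 assumes "p = 0 \<or> degree p < m"
 shows "(\<Sum>j\<le>m. (-1)^j * real (m choose j) * poly p (x + real j * h)) = 0"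
proof (cases "p = 0")
 case False
 then have d: "degree p < m" using assms by simp
 have mono: "(\<Sum>j\<le>m. (-1)^j * real (m choose j) * (x + real j * h)^i) = 0" if "i < m" for i
 proof (cases "h = 0")
  case True
  have "(\<Sum>j\<le>m. (-1)^j * real (m choose j) * (real j + 0)^0) = 0"
   using that by (intro alternating_binomial_shifted_power) simp
  then show ?thesis using True by (simp add: sum_distrib_right [symmetric])
 next
  case False
  have "(\<Sum>j\<le>m. (-1)^j * real (m choose j) * (x + real j * h)^i) =
   h^i * (\<Sum>j\<le>m. (-1)^j * real (m choose j) * (real j + x/h)^i)"
   unfolding sum_distrib_left
  proof (rule sum.cong)
   fix j
   have "(x + real j * h)^i = h^i * (real j + x/h)^i"
    using False by (simp add: power_mult_distrib [symmetric] field_simps)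
   then show "(-1)^j * real (m choose j) * (x + real j * h)^i = h^i * ((-1)^j * real (m choose j) * (real j + x/h)^i)"
    by simp
  qed simp
  then show ?thesis using alternating_binomial_shifted_power [OF that] by simp
 qed
 have "(\<Sum>j\<le>m. (-1)^j * real (m choose j) * poly p (x + real j * h)) =
   (\<Sum>i\<le>degree p. coeff p i * (\<Sum>j\<le>m. (-1)^j * real (m choose j) * (x + real j * h)^i))"
  unfolding poly_altdef sum_distrib_left by (subst sum.swap) (simp add: algebra_simps)
 also have "... = 0"
  using d by (intro sum.neutral) (auto simp: mono)
 finally show ?thesis .
qed simp

text \<open>This is (-1)^m times the usual forward difference: the sum begins with + f x, so that
  one step is f x - f (x + h), the expression that occurs in the fractional Laplacian.\<close>

definition fdiff :: "nat => 'a::real_vector => ('a => real) => 'a => real" where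
 "fdiff m h f x = (\<Sum>j\<le>m. (-1)^j * real (m choose j) * f (x + real j *\<^sub>R h))"

lemma fdiff_Suc: "fdiff (Suc m) h f x = fdiff m h (\<lambda>y. f y - f (y + h)) x"
 unfolding fdiff_def alternating_binomial_Suc
 by (simp add: sum_subtractf [symmetric] algebra_simps)

section \<open>Polynomials of bounded degree and their increments\<close>

lemma polynomial_deg_le_zero: "polynomial_deg_le d (\<lambda>_. 0)"
 unfolding polynomial_deg_le_def by (intro exI [of _ "\<lambda>_. 0"]) simp

lemma polynomial_deg_le_add:
 assumes "polynomial_deg_le d p" "polynomial_deg_le d q"
 shows "polynomial_deg_le d (\<lambda>x. p x + q x)"
proof -
 from assms obtain a b where
  "\<forall>x. p x = (\<Sum>\<alpha> \<in> {\<alpha>. int (\<Sum>i\<in>UNIV. \<alpha> i) \<le> d}. a \<alpha> * (\<Prod>i\<in>UNIV. (x $ i) ^ \<alpha> i))"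
  "\<forall>x. q x = (\<Sum>\<alpha> \<in> {\<alpha>. int (\<Sum>i\<in>UNIV. \<alpha> i) \<le> d}. b \<alpha> * (\<Prod>i\<in>UNIV. (x $ i) ^ \<alpha> i))"
  unfolding polynomial_deg_le_def by blast
 then show ?thesis
  unfolding polynomial_deg_le_def
  by (intro exI [of _ "\<lambda>\<alpha>. a \<alpha> + b \<alpha>"]) (simp add: sum.distrib distrib_right)
qed

lemma polynomial_deg_le_cmult:
 assumes "polynomial_deg_le d p"
 shows "polynomial_deg_le d (\<lambda>x. c * p x)"
proof -
 from assms obtain a where
  "\<forall>x. p x = (\<Sum>\<alpha> \<in> {\<alpha>. int (\<Sum>i\<in>UNIV. \<alpha> i) \<le> d}. a \<alpha> * (\<Prod>i\<in>UNIV. (x $ i) ^ \<alpha> i))"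
  unfolding polynomial_deg_le_def by blast
 then show ?thesis
  unfolding polynomial_deg_le_def
  by (intro exI [of _ "\<lambda>\<alpha>. c * a \<alpha>"]) (simp add: sum_distrib_left algebra_simps)
qed

lemma polynomial_deg_le_diff:
 assumes "polynomial_deg_le d p" "polynomial_deg_le d q"
 shows "polynomial_deg_le d (\<lambda>x. p x - q x)"
 using polynomial_deg_le_add [OF assms(1) polynomial_deg_le_cmult [OF assms(2), of "-1"]] by simp

lemma polynomial_deg_le_sum:
 assumes "\<And>i. i \<in> I ==> polynomial_deg_le d (p i)"
 shows "polynomial_deg_le d (\<lambda>x. \<Sum>i\<in>I. p i x)"
 using assms
 by (induction I rule: infinite_finite_induct)
   (auto intro: polynomial_deg_le_zero polynomial_deg_le_add)

lemma polynomial_deg_le_monomial: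
 fixes \<alpha> :: "'n::finite => nat"
 assumes "int (\<Sum>i\<in>UNIV. \<alpha> i) \<le> d"
 shows "polynomial_deg_le d (\<lambda>x. \<Prod>i\<in>UNIV. (x $ i) ^ \<alpha> i)"
 unfolding polynomial_deg_le_def
proof (intro exI allI)
 fix x :: "real ^ 'n"
 show "(\<Prod>i\<in>UNIV. (x $ i) ^ \<alpha> i) = (\<Sum>\<beta> \<in> {\<beta>. int (\<Sum>i\<in>UNIV. \<beta> i) \<le> d}.
   (if \<beta> = \<alpha> then 1 else 0) * (\<Prod>i\<in>UNIV. (x $ i) ^ \<beta> i))"
  using assms
  by (simp add: if_distrib [of "\<lambda>t. t * _"] sum.delta finite_multi_indices cong: if_cong del: of_nat_sum)
qed

lemma polynomial_deg_leE:
 assumes "polynomial_deg_le d p"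
 obtains c where "p = (\<lambda>x. \<Sum>\<alpha> \<in> {\<alpha>. int (\<Sum>i\<in>UNIV. \<alpha> i) \<le> d}. c \<alpha> * (\<Prod>i\<in>UNIV. (x $ i) ^ \<alpha> i))"
 using assms unfolding polynomial_deg_le_def by blast

lemma polynomial_deg_le_mono:
 assumes "polynomial_deg_le d p" "d \<le> e"
 shows "polynomial_deg_le e p"
proof -
 from assms(1) obtain c where
  p: "p = (\<lambda>x. \<Sum>\<alpha> \<in> {\<alpha>. int (\<Sum>i\<in>UNIV. \<alpha> i) \<le> d}. c \<alpha> * (\<Prod>i\<in>UNIV. (x $ i) ^ \<alpha> i))"
  by (rule polynomial_deg_leE)
 show ?thesis unfolding p
  using assms(2)
  by (intro polynomial_deg_le_sum polynomial_deg_le_cmult polynomial_deg_le_monomial) auto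
qed

lemma polynomial_deg_le_mult:
 assumes "polynomial_deg_le d p" "polynomial_deg_le e q"
 shows "polynomial_deg_le (d + e) (\<lambda>x. p x * q x)"
proof -
 from assms(1) obtain a where
  p: "p = (\<lambda>x. \<Sum>\<alpha> \<in> {\<alpha>. int (\<Sum>i\<in>UNIV. \<alpha> i) \<le> d}. a \<alpha> * (\<Prod>i\<in>UNIV. (x $ i) ^ \<alpha> i))"
  by (rule polynomial_deg_leE)
 from assms(2) obtain b where
  q: "q = (\<lambda>x. \<Sum>\<alpha> \<in> {\<alpha>. int (\<Sum>i\<in>UNIV. \<alpha> i) \<le> e}. b \<alpha> * (\<Prod>i\<in>UNIV. (x $ i) ^ \<alpha> i))"
  by (rule polynomial_deg_leE)
 have eq: "(\<lambda>x. p x * q x) = (\<lambda>x. \<Sum>\<alpha> \<in> {\<alpha>. int (\<Sum>i\<in>UNIV. \<alpha> i) \<le> d}.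
   \<Sum>\<beta> \<in> {\<alpha>. int (\<Sum>i\<in>UNIV. \<alpha> i) \<le> e}. a \<alpha> * (b \<beta> * (\<Prod>i\<in>UNIV. (x $ i) ^ (\<alpha> i + \<beta> i))))"
  unfolding p q sum_product
  by (simp add: power_add prod.distrib algebra_simps)
 show ?thesis unfolding eq
  by (intro polynomial_deg_le_sum polynomial_deg_le_cmult polynomial_deg_le_monomial)
    (auto simp: sum.distrib)
qed

lemma polynomial_deg_le_const: "0 \<le> d ==> polynomial_deg_le d (\<lambda>_ :: real ^ 'n. c)"
 using polynomial_deg_le_cmult [OF polynomial_deg_le_monomial [where ?'n = 'n and \<alpha> = "\<lambda>_. 0" and d = d], of c] by simp

lemma polynomial_deg_le_coord: "polynomial_deg_le 1 (\<lambda>x :: real ^ 'n. x $ k)"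
proof -
 have "(\<Prod>i\<in>UNIV. (x $ i) ^ (if i = k then 1 else 0)) = x $ k" for x :: "real ^ 'n"
  by (simp add: if_distrib [of "\<lambda>t. _ ^ t"] prod.delta cong: if_cong)
 moreover have "polynomial_deg_le 1 (\<lambda>x :: real ^ 'n. \<Prod>i\<in>UNIV. (x $ i) ^ (if i = k then 1 else 0))"
  by (rule polynomial_deg_le_monomial) simp
 ultimately show ?thesis by simp
qed

text \<open>Monomials are products of coordinates, so the degree is tracked through products:
  \<open>good e f\<close> says that f has degree at most e and its increment degree at most e - 1,
  and the Leibniz rule for increments makes this class multiplicative.\<close>

lemma polynomial_deg_le_increment:
 fixes p :: "real ^ 'n => real"
 assumes "polynomial_deg_le d p"
 shows "polynomial_deg_le (d - 1) (\<lambda>x. p (x + z) - p x)"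
proof -
 define good where "good e f \<longleftrightarrow> polynomial_deg_le e f \<and> polynomial_deg_le (e - 1) (\<lambda>x. f (x + z) - f x)"
  for e and f :: "real ^ 'n => real"
 have good_mult: "good (e1 + e2) (\<lambda>x. f x * g x)" if "good e1 f" "good e2 g" for e1 e2 f g
 proof -
  have "polynomial_deg_le (e1 + e2 - 1) (\<lambda>x. (f (x + z) - f x) * g x + f x * (g (x + z) - g x)
    + (f (x + z) - f x) * (g (x + z) - g x))"
   using that unfolding good_def
   by (intro polynomial_deg_le_add)
     (auto intro: polynomial_deg_le_mono [OF polynomial_deg_le_mult])
  then show ?thesis
   using that unfolding good_def by (auto intro: polynomial_deg_le_mult simp: algebra_simps)
 qed
 have good_one: "good 0 (\<lambda>_. 1)"
  unfolding good_def by (auto intro: polynomial_deg_le_const polynomial_deg_le_zero)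
 have good_coord: "good 1 (\<lambda>x. x $ k)" for k
  unfolding good_def by (auto intro: polynomial_deg_le_coord polynomial_deg_le_const)
 have good_power: "good (int a) (\<lambda>x. (x $ k) ^ a)" for k a
  by (induction a) (auto intro: good_one good_mult [OF good_coord, of "int _"])
 have good_prod: "good (int (\<Sum>i\<in>S. \<alpha> i)) (\<lambda>x. \<Prod>i\<in>S. (x $ i) ^ \<alpha> i)" if "finite S" for \<alpha> S
  using that by induction (auto intro: good_one good_mult good_power simp del: of_nat_sum simp: of_nat_add)
 from assms obtain c where
  p: "p = (\<lambda>x. \<Sum>\<alpha> \<in> {\<alpha>. int (\<Sum>i\<in>UNIV. \<alpha> i) \<le> d}. c \<alpha> * (\<Prod>i\<in>UNIV. (x $ i) ^ \<alpha> i))"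
  by (rule polynomial_deg_leE)
 have "(\<lambda>x. p (x + z) - p x) = (\<lambda>x. \<Sum>\<alpha> \<in> {\<alpha>. int (\<Sum>i\<in>UNIV. \<alpha> i) \<le> d}.
    c \<alpha> * ((\<Prod>i\<in>UNIV. ((x + z) $ i) ^ \<alpha> i) - (\<Prod>i\<in>UNIV. (x $ i) ^ \<alpha> i)))"
  unfolding p by (simp add: sum_subtractf [symmetric] algebra_simps)
 moreover have "polynomial_deg_le (d - 1) ..."
 proof (intro polynomial_deg_le_sum polynomial_deg_le_cmult)
  fix \<alpha> :: "'n => nat"
  assume "\<alpha> \<in> {\<alpha>. int (\<Sum>i\<in>UNIV. \<alpha> i) \<le> d}"
  then have le: "int (\<Sum>i\<in>UNIV. \<alpha> i) - 1 \<le> d - 1" by simp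
  have "good (int (\<Sum>i\<in>UNIV. \<alpha> i)) (\<lambda>x. \<Prod>i\<in>UNIV. (x $ i) ^ \<alpha> i)"
   by (rule good_prod) (rule finite)
  from this [unfolded good_def, THEN conjunct2] le
  show "polynomial_deg_le (d - 1) (\<lambda>x. (\<Prod>i\<in>UNIV. ((x + z) $ i) ^ \<alpha> i) - (\<Prod>i\<in>UNIV. (x $ i) ^ \<alpha> i))"
   by (rule polynomial_deg_le_mono)
 qed
 ultimately show ?thesis by simp
qed

lemma polynomial_deg_le_neg:
 "polynomial_deg_le d p ==> d < 0 ==> p x = 0"
proof -
 assume "polynomial_deg_le d p" "d < 0"
 moreover have "{\<alpha> :: 'a => nat. int (\<Sum>i\<in>UNIV. \<alpha> i) \<le> d} = {}"
  using \<open>d < 0\<close> by (auto simp del: of_nat_sum)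
 ultimately show ?thesis unfolding polynomial_deg_le_def by auto
qed

text \<open>Each difference lowers the degree bound by one. As the bound is an integer, the
  induction can start at m = 0 with d < 0, where the polynomial is zero.\<close>

lemma fdiff_polynomial_eq_0:
 assumes "polynomial_deg_le d p" "d < int m"
 shows "fdiff m h p x = 0"
 using assms
proof (induction m arbitrary: p d)
 case 0
 then show ?case by (simp add: fdiff_def polynomial_deg_le_neg)
next
 case (Suc m)
 have "polynomial_deg_le (d - 1) (\<lambda>x. (-1) * (p (x + h) - p x))"
  by (intro polynomial_deg_le_cmult polynomial_deg_le_increment Suc)
 then have "polynomial_deg_le (d - 1) (\<lambda>x. p x - p (x + h))" by simp
 then show ?case unfolding fdiff_Suc using Suc by force
qed

text \<open>The sign is that of minus a second derivative, so that the fractional Laplacian is half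
  the integral of \<open>sdiff f x\<close> against the kernel.\<close>

definition sdiff :: "('a::real_vector => real) => 'a => 'a => real" where
 "sdiff f x h = 2 * f x - f (x + h) - f (x - h)"

text \<open>A centred second difference is an increment with step z of an increment with step - z,
  up to translation. The gain of two degrees is what admits polynomials of degree k + 1 as
  solutions.\<close>

lemma polynomial_deg_le_sdiff:
 assumes "polynomial_deg_le d p"
 shows "polynomial_deg_le (d - 2) (\<lambda>x. sdiff p x z)"
proof -
 have "polynomial_deg_le (d - 1 - 1) (\<lambda>x. (p (x + - z + z) - p (x + - z)) - (p (x + z) - p x))"
  using polynomial_deg_le_cmult [OF polynomial_deg_le_increment [OF polynomial_deg_le_increment [OF assms, of z], of "-z"], of "1"]
  by simp
 then show ?thesis by (simp add: sdiff_def algebra_simps)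
qed

section \<open>Lagrange interpolation at the nodes 0, ..., m - 1 and Frechet's theorem\<close>

definition lagrange_poly :: "nat => nat => real poly" where
 "lagrange_poly m j = smult (1 / (\<Prod>i\<in>{..<m} - {j}. real j - real i)) (\<Prod>i\<in>{..<m} - {j}. [:- real i, 1:])"

lemma poly_lagrange_poly:
 assumes "i < m" "j < m"
 shows "poly (lagrange_poly m j) (real i) = (if i = j then 1 else 0)"
proof -
 have "(\<Prod>l\<in>{..<m} - {j}. real i - real l) = 0" if "i \<noteq> j"
  using assms that by (intro prod_zero) auto
 moreover have "(\<Prod>l\<in>{..<m} - {j}. real j - real l) \<noteq> 0"
  by (simp add: prod_zero_iff)
 ultimately show ?thesis by (auto simp: lagrange_poly_def poly_prod)
qed

lemma degree_lagrange_poly: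
 assumes "j < m"
 shows "degree (lagrange_poly m j) < m"
proof -
 have "degree (\<Prod>i\<in>{..<m} - {j}. [:- real i, 1:]) \<le> (\<Sum>i\<in>{..<m} - {j}. 1)"
  by (rule order.trans [OF degree_prod_sum_le]) (auto intro!: sum_mono)
 also have "... < m" using assms by simp
 finally show ?thesis unfolding lagrange_poly_def
  by (rule le_less_trans [OF degree_smult_le])
qed

definition interpolant :: "nat => (nat => real) => real poly" where
 "interpolant m a = (\<Sum>j<m. smult (a j) (lagrange_poly m j))"

lemma poly_interpolant:
 "poly (interpolant m a) t = (\<Sum>j<m. a j * poly (lagrange_poly m j) t)"
 by (simp add: interpolant_def poly_sum)

lemma poly_interpolant_node: "i < m ==> poly (interpolant m a) (real i) = a i"
 by (simp add: poly_interpolant poly_lagrange_poly if_distrib [of "\<lambda>t. _ * t"] sum.delta cong: if_cong)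

lemma degree_interpolant: "interpolant m a = 0 \<or> degree (interpolant m a) < m"
proof (cases "m = 0")
 case False
 have "degree (interpolant m a) < m"
  unfolding interpolant_def
  by (rule degree_sum_less) (use False in \<open>auto simp: degree_lagrange_poly\<close>)
 then show ?thesis ..
qed (simp add: interpolant_def)

text \<open>The last coefficient of the recurrence is 1 or -1, so each term is determined by the m
  terms before it.\<close>

lemma difference_recurrence_unique:
 fixes b :: "nat => real"
 assumes rec: "\<And>i. (\<Sum>j\<le>m. (-1)^j * real (m choose j) * b (i + j)) = 0"
  and init: "\<And>i. i < m ==> b i = 0"
 shows "b i = 0"
proof (induction i rule: less_induct)
 case (less i)
 show ?case
 proof (cases "i < m")
  case False
  have "(\<Sum>j\<le>m. (-1)^j * real (m choose j) * b (i - m + j)) =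
     (\<Sum>j<m. (-1)^j * real (m choose j) * b (i - m + j)) + (-1)^m * b i"
   using False by (simp add: lessThan_Suc_atMost [symmetric])
  moreover have "(\<Sum>j<m. (-1)^j * real (m choose j) * b (i - m + j)) = 0"
   using False less.IH by (intro sum.neutral) auto
  ultimately show ?thesis using rec [of "i - m"] by simp
 qed (use init in simp)
qed

lemma difference_recurrence_interpolant:
 fixes a :: "nat => real"
 assumes rec: "\<And>i. (\<Sum>j\<le>m. (-1)^j * real (m choose j) * a (i + j)) = 0"
 shows "a i = poly (interpolant m a) (real i)"
proof -
 define b where "b i = a i - poly (interpolant m a) (real i)" for i
 have "b i = 0"
 proof (rule difference_recurrence_unique [where m = m])
  fix i
  have "(\<Sum>j\<le>m. (-1)^j * real (m choose j) * poly (interpolant m a) (real i + real j * 1)) = 0"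
   by (rule alternating_binomial_poly) (rule degree_interpolant)
  then show "(\<Sum>j\<le>m. (-1)^j * real (m choose j) * b (i + j)) = 0"
   using rec [of i] by (simp add: b_def right_diff_distrib sum_subtractf)
 qed (simp add: b_def poly_interpolant_node)
 then show ?thesis by (simp add: b_def)
qed

text \<open>On a grid of mesh 1/q the values of g form a sequence annihilated by the m-th
  difference, hence a polynomial in the index of degree less than m. The m integer nodes lie on the
  grid, so this polynomial has m roots and vanishes. This settles the rationals, and continuity does
  the rest.\<close>

lemma continuous_differences_vanish_eq_0:
 fixes g :: "real => real"
 assumes cont: "continuous_on UNIV g"
  and diff: "\<And>x h. fdiff m h g x = 0"
  and nodes: "\<And>j. j < m ==> g (real j) = 0"
 shows "g t = 0"
proof -
 have rational: "g (real i / real q - real N) = 0" if q: "q > 0" for i q N :: nat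
 proof -
  \<comment> \<open>A natural index reaches only points from - N on; as N is arbitrary, all
    rationals are reached.\<close>
  define a where "a i = g (real i / real q - real N)" for i :: nat
  have rec: "(\<Sum>j\<le>m. (-1)^j * real (m choose j) * a (i + j)) = 0" for i
   using diff [of "1 / real q" "real i / real q - real N"]
   by (simp add: fdiff_def a_def add_divide_distrib algebra_simps)
  have a_eq: "a i = poly (interpolant m a) (real i)" for i
   using difference_recurrence_interpolant [OF rec] .
  \<comment> \<open>The index q (N + j) belongs to the grid point j.\<close>
  have roots: "poly (interpolant m a) (real (q * (N + j))) = 0" if "j < m" for j
   using a_eq [of "q * (N + j)"] nodes [OF that] q by (simp add: a_def)
  have "interpolant m a = 0"
  proof (rule ccontr)
   assume nz: "interpolant m a \<noteq> 0"
   have "inj_on (\<lambda>j. real (q * (N + j))) {..<m}"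
    using q by (auto simp: inj_on_def)
   then have "m = card ((\<lambda>j. real (q * (N + j))) ` {..<m})"
    by (simp add: card_image)
   also have "... \<le> card {x. poly (interpolant m a) x = 0}"
    using roots nz by (intro card_mono poly_roots_finite) auto
   also have "... \<le> degree (interpolant m a)"
    using nz by (rule card_poly_roots_bound)
   finally show False using degree_interpolant [of m a] nz by simp
  qed
  then show ?thesis using a_eq [of i] by (simp add: a_def)
 qed
 have "closed {x. g x = 0}"
  using cont by (intro closed_Collect_eq) auto
 moreover have "\<rat> \<subseteq> {x. g x = 0}"
 proof
  fix r :: real assume "r \<in> \<rat>"
  then obtain p b :: int where b: "b > 0" "r = real_of_int p / real_of_int b"
   by (rule Rats_cases')
  define q where "q = nat b"
  have q: "q > 0" and r: "r = real_of_int p / real q"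
   using b by (simp_all add: q_def)
  define N where "N = nat \<bar>p\<bar>"
  define i where "i = nat (p + int q * \<bar>p\<bar>)"
  have "p + int q * \<bar>p\<bar> \<ge> 0"
  proof -
   have "1 * \<bar>p\<bar> \<le> int q * \<bar>p\<bar>" using q by (intro mult_right_mono) auto
   then show ?thesis by linarith
  qed
  then have "real i = real_of_int (p + int q * \<bar>p\<bar>)" unfolding i_def by simp
  then have "r = real i / real q - real N"
   using q unfolding r N_def by (simp add: field_simps)
  then show "r \<in> {x. g x = 0}" using rational [OF q] by simp
 qed
 ultimately have "closure \<rat> \<subseteq> {x. g x = 0}" by (rule closure_minimal [rotated])
 then show ?thesis by (auto simp: Rats_closure_real)
qed

lemma frechet_line:
 fixes g :: "real => real"
 assumes cont: "continuous_on UNIV g" and diff: "\<And>x h. fdiff m h g x = 0"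
 shows "g t = poly (interpolant m (\<lambda>j. g (real j))) t"
proof -
 define p where "p = interpolant m (\<lambda>j. g (real j))"
 have "g t - poly p t = 0"
 proof (rule continuous_differences_vanish_eq_0 [where m = m and g = "\<lambda>t. g t - poly p t"])
  show "continuous_on UNIV (\<lambda>t. g t - poly p t)"
   using cont by (intro continuous_intros)
  have "fdiff m h (poly p) x = 0" for x h
   unfolding fdiff_def using alternating_binomial_poly [OF degree_interpolant, of m _ x h] by (simp add: p_def)
  then show "fdiff m h (\<lambda>t. g t - poly p t) x = 0" for x h
   using diff [of h x] by (simp add: fdiff_def right_diff_distrib sum_subtractf)
 qed (simp add: p_def poly_interpolant_node)
 then show ?thesis by (simp add: p_def)
qed

text \<open>On every line u agrees with a polynomial interpolated at m equidistant points. Freeing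
  the coordinates one after another shows that u is a polynomial of some degree; the sharp degree is
  then read off on the lines through the origin.\<close>

theorem frechet_polynomial:
 fixes u :: "real ^ 'n => real"
 assumes cont: "continuous_on UNIV u" and diff: "\<And>x h. fdiff m h u x = 0"
 shows "polynomial_deg_le (int m - 1) u"
proof -
 have line: "u (x + t *\<^sub>R v) = poly (interpolant m (\<lambda>j. u (x + real j *\<^sub>R v))) t" for x v t
 proof (rule frechet_line [where g = "\<lambda>t. u (x + t *\<^sub>R v)"])
  show "continuous_on UNIV (\<lambda>t. u (x + t *\<^sub>R v))"
   by (rule continuous_on_compose2 [OF cont _ subset_UNIV]) (intro continuous_intros)
  show "fdiff m h (\<lambda>t. u (x + t *\<^sub>R v)) a = 0" for a h :: real
   using diff [of "h *\<^sub>R v" "x + a *\<^sub>R v"] by (simp add: fdiff_def algebra_simps)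
 qed
 have poly_coord: "\<exists>e. polynomial_deg_le e (\<lambda>x :: real ^ 'n. poly q (x $ k))" for q :: "real poly" and k
 proof -
  have pow: "polynomial_deg_le (int i) (\<lambda>x :: real ^ 'n. (x $ k) ^ i)" for i
  proof (induction i)
   case (Suc i)
   then show ?case using polynomial_deg_le_mult [OF polynomial_deg_le_coord Suc] by simp
  qed (simp add: polynomial_deg_le_const)
  have "polynomial_deg_le (int (degree q)) (\<lambda>x :: real ^ 'n. poly q (x $ k))"
   unfolding poly_altdef
   by (intro polynomial_deg_le_sum polynomial_deg_le_cmult polynomial_deg_le_mono [OF pow]) auto
  then show ?thesis ..
 qed
 \<comment> \<open>The coordinates in S are variable, the others are frozen at v. Freeing one more
   coordinate k is interpolation along the axis k, whose coefficients are values of u with k frozen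
   at 0, ..., m - 1.\<close>
 define mix :: "'n set => real ^ 'n => real ^ 'n => real ^ 'n" where
  "mix S x v = (\<chi> i. if i \<in> S then x $ i else v $ i)" for S x v
 have "\<forall>v. \<exists>e. polynomial_deg_le e (\<lambda>x. u (mix S x v))" for S
  using finite [of S]
 proof (induction S rule: finite_induct)
  case empty
  show ?case by (auto simp: mix_def intro: polynomial_deg_le_const)
 next
  case (insert k S)
  show ?case
  proof
   fix v
   define w where "w j = (\<chi> i. if i = k then real j else v $ i)" for j :: nat
   have eq: "u (mix (insert k S) x v) = (\<Sum>j<m. u (mix S x (w j)) * poly (lagrange_poly m j) (x $ k))" for x
   proof -
    define b where "b = mix S x (w 0)"
    have "mix (insert k S) x v = b + (x $ k) *\<^sub>R axis k 1"
     using insert by (auto simp: b_def mix_def w_def vec_eq_iff axis_def)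
    moreover have "mix S x (w j) = b + real j *\<^sub>R axis k 1" for j
     using insert by (auto simp: b_def mix_def w_def vec_eq_iff axis_def)
    ultimately show ?thesis using line [of b "x $ k" "axis k 1"] by (simp add: poly_interpolant)
   qed
   have "\<forall>j. \<exists>e. polynomial_deg_le e (\<lambda>x. u (mix S x (w j)) * poly (lagrange_poly m j) (x $ k))"
   proof
    fix j
    obtain e e' where "polynomial_deg_le e (\<lambda>x. u (mix S x (w j)))"
      "polynomial_deg_le e' (\<lambda>x :: real ^ 'n. poly (lagrange_poly m j) (x $ k))"
     using insert.IH poly_coord by blast
    from polynomial_deg_le_mult [OF this]
    show "\<exists>e. polynomial_deg_le e (\<lambda>x. u (mix S x (w j)) * poly (lagrange_poly m j) (x $ k))" ..
   qed
   from choice [OF this] obtain e where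
    e: "\<And>j. polynomial_deg_le (e j) (\<lambda>x. u (mix S x (w j)) * poly (lagrange_poly m j) (x $ k))"
    by blast
   \<comment> \<open>The bounds e j may be negative; with absolute values the sum dominates each of
     them.\<close>
   have "polynomial_deg_le (\<Sum>j<m. \<bar>e j\<bar>) (\<lambda>x. u (mix (insert k S) x v))"
    unfolding eq
   proof (rule polynomial_deg_le_sum)
    fix j assume j: "j \<in> {..<m}"
    have "e j \<le> \<bar>e j\<bar>" by simp
    also have "... \<le> (\<Sum>j<m. \<bar>e j\<bar>)"
     using j by (intro member_le_sum) auto
    finally show "polynomial_deg_le (\<Sum>j<m. \<bar>e j\<bar>) (\<lambda>x. u (mix S x (w j)) * poly (lagrange_poly m j) (x $ k))"
     by (rule polynomial_deg_le_mono [OF e])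
   qed
   then show "\<exists>e. polynomial_deg_le e (\<lambda>x. u (mix (insert k S) x v))" ..
  qed
 qed
 from this [of UNIV] obtain e where "polynomial_deg_le e (\<lambda>x. u (mix UNIV x 0))" by blast
 moreover have "mix UNIV x 0 = x" for x by (simp add: mix_def vec_eq_iff)
 ultimately have "polynomial_deg_le e u" by simp
 then obtain c where
  u: "u = (\<lambda>x. \<Sum>\<alpha> \<in> {\<alpha>. int (\<Sum>i\<in>UNIV. \<alpha> i) \<le> e}. c \<alpha> * (\<Prod>i\<in>UNIV. (x $ i) ^ \<alpha> i))"
  by (rule polynomial_deg_leE)
 define A where "A = {\<alpha> :: 'n => nat. int (\<Sum>i\<in>UNIV. \<alpha> i) \<le> e}"
 define mono where "mono \<alpha> x = (\<Prod>i\<in>UNIV. (x $ i) ^ \<alpha> i)" for \<alpha> :: "'n => nat" and x :: "real ^ 'n"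
 have finA: "finite A" unfolding A_def by (rule finite_multi_indices)
 have u': "u x = (\<Sum>\<alpha>\<in>A. c \<alpha> * mono \<alpha> x)" for x unfolding u A_def mono_def by simp
 \<comment> \<open>The bound e so far grows with the dimension. For fixed x the function t -> u (t
   x) is the polynomial p, whose coefficients are the homogeneous parts of u at x, and also the
   interpolant q, of degree less than m. So all homogeneous parts of order at least m vanish at
   x.\<close>
 have u_eq: "u x = (\<Sum>\<alpha>\<in>{\<alpha>\<in>A. sum \<alpha> UNIV < m}. c \<alpha> * mono \<alpha> x)" for x
 proof -
  define p where "p = (\<Sum>\<alpha>\<in>A. monom (c \<alpha> * mono \<alpha> x) (sum \<alpha> UNIV))"
  define q where "q = interpolant m (\<lambda>j. u (0 + real j *\<^sub>R x))"
  have "mono \<alpha> (t *\<^sub>R x) = t ^ sum \<alpha> UNIV * mono \<alpha> x" for \<alpha> t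
   by (simp add: mono_def power_mult_distrib prod.distrib power_sum)
  then have "poly p t = u (0 + t *\<^sub>R x)" for t
   by (simp add: p_def poly_sum poly_monom u' algebra_simps)
  then have "poly p t = poly q t" for t using line [of 0 t x] by (simp add: q_def)
  then have "p = q" by (simp add: poly_eq_poly_eq_iff [symmetric] fun_eq_iff)
  then have high: "coeff p d = 0" if "d \<ge> m" for d
   using degree_interpolant [of m "\<lambda>j. u (0 + real j *\<^sub>R x)"] that by (auto simp: q_def intro: coeff_eq_0)
  have cf: "coeff p d = (\<Sum>\<alpha>\<in>{\<alpha>\<in>A. sum \<alpha> UNIV = d}. c \<alpha> * mono \<alpha> x)" for d
   using finA by (simp add: p_def coeff_sum sum.inter_filter)
  have "(\<Sum>\<alpha>\<in>{\<alpha>\<in>A. \<not> sum \<alpha> UNIV < m}. c \<alpha> * mono \<alpha> x) =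
    (\<Sum>d\<in>(\<lambda>\<alpha>. sum \<alpha> UNIV) ` {\<alpha>\<in>A. \<not> sum \<alpha> UNIV < m}.
     \<Sum>\<alpha>\<in>{\<alpha>\<in>{\<alpha>\<in>A. \<not> sum \<alpha> UNIV < m}. sum \<alpha> UNIV = d}. c \<alpha> * mono \<alpha> x)"
   using finA by (subst sum.group) auto
  also have "... = 0"
  proof (rule sum.neutral, safe)
   fix \<beta> assume b: "\<beta> \<in> A" "\<not> sum \<beta> UNIV < m"
   then have "{\<alpha>\<in>{\<alpha>\<in>A. \<not> sum \<alpha> UNIV < m}. sum \<alpha> UNIV = sum \<beta> UNIV} = {\<alpha>\<in>A. sum \<alpha> UNIV = sum \<beta> UNIV}"
    by auto
   then show "(\<Sum>\<alpha>\<in>{\<alpha>\<in>{\<alpha>\<in>A. \<not> sum \<alpha> UNIV < m}. sum \<alpha> UNIV = sum \<beta> UNIV}. c \<alpha> * mono \<alpha> x) = 0"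
    using cf [of "sum \<beta> UNIV"] high [of "sum \<beta> UNIV"] b by simp
  qed
  finally have "(\<Sum>\<alpha>\<in>{\<alpha>\<in>A. \<not> sum \<alpha> UNIV < m}. c \<alpha> * mono \<alpha> x) = 0" .
  moreover have "u x = (\<Sum>\<alpha>\<in>{\<alpha>\<in>A. sum \<alpha> UNIV < m}. c \<alpha> * mono \<alpha> x) + (\<Sum>\<alpha>\<in>{\<alpha>\<in>A. \<not> sum \<alpha> UNIV < m}. c \<alpha> * mono \<alpha> x)"
   unfolding u' using finA by (subst sum.union_disjoint [symmetric]) (auto intro!: sum.cong)
  ultimately show ?thesis by simp
 qed
 have "polynomial_deg_le (int m - 1) (\<lambda>x. \<Sum>\<alpha>\<in>{\<alpha>\<in>A. sum \<alpha> UNIV < m}. c \<alpha> * mono \<alpha> x)"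
  unfolding mono_def
  by (intro polynomial_deg_le_sum polynomial_deg_le_cmult polynomial_deg_le_monomial) (auto simp del: of_nat_sum)
 moreover have "u = (\<lambda>x. \<Sum>\<alpha>\<in>{\<alpha>\<in>A. sum \<alpha> UNIV < m}. c \<alpha> * mono \<alpha> x)"
  using u_eq by (rule ext)
 ultimately show ?thesis by metis
qed

section \<open>Iterated differences of inverse powers\<close>

text \<open>The factor |z|^m is taken out of the tail, and what remains is dominated by its absolute
  value at a radius r between \<rho>' and \<rho>.\<close>

lemma power_series_tail_bound:
 fixes c :: "nat => real"
 assumes sums: "\<And>z. \<bar>z\<bar> < \<rho> ==> (\<lambda>i. c i * z ^ i) sums f z" and \<rho>: "0 \<le> \<rho>'" "\<rho>' < \<rho>"
 obtains C where "C \<ge> 0" "\<And>z. \<bar>z\<bar> \<le> \<rho>' ==> \<bar>f z - (\<Sum>i<m. c i * z ^ i)\<bar> \<le> C * \<bar>z\<bar> ^ m"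
proof -
 define r where "r = (\<rho>' + \<rho>) / 2"
 have r: "0 < r" "\<rho>' < r" "r < \<rho>" using \<rho> by (auto simp: r_def)
 \<comment> \<open>Convergence at the larger radius r2 yields absolute convergence at r.\<close>
 define r2 where "r2 = (r + \<rho>) / 2"
 have r2: "r < r2" "r2 < \<rho>" using r by (auto simp: r2_def)
 have "summable (\<lambda>i. c i * r2 ^ i)"
  using sums [of r2] r r2 by (auto simp: sums_iff)
 then have "summable (\<lambda>i. norm (c i * r ^ i))"
  by (rule powser_insidea) (use r r2 in auto)
 then have "summable (\<lambda>i. norm (c (i + m) * r ^ (i + m)))"
  by (subst summable_iff_shift [of "\<lambda>i. norm (c i * r ^ i)"])
 then have "summable (\<lambda>i. norm (c (i + m) * r ^ (i + m)) * (1 / r ^ m))"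
  by (rule summable_mult2)
 then have sm: "summable (\<lambda>i. \<bar>c (i + m)\<bar> * r ^ i)"
  using r by (simp add: abs_mult power_add field_simps)
 define C where "C = (\<Sum>i. \<bar>c (i + m)\<bar> * r ^ i)"
 show thesis
 proof
  show "C \<ge> 0" unfolding C_def using r by (intro suminf_nonneg sm) auto
  fix z :: real assume z: "\<bar>z\<bar> \<le> \<rho>'"
  then have s: "(\<lambda>i. c i * z ^ i) sums f z" using sums r by auto
  then have "f z = (\<Sum>i. c (i + m) * z ^ (i + m)) + (\<Sum>i<m. c i * z ^ i)"
   using suminf_split_initial_segment [of "\<lambda>i. c i * z ^ i" m] by (auto simp: sums_iff)
  then have "f z - (\<Sum>i<m. c i * z ^ i) = (\<Sum>i. c (i + m) * z ^ (i + m))" by simp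
  also have "\<bar>...\<bar> \<le> (\<Sum>i. (\<bar>c (i + m)\<bar> * r ^ i) * \<bar>z\<bar> ^ m)"
  proof -
   have "norm (c (i + m) * z ^ (i + m)) \<le> (\<bar>c (i + m)\<bar> * r ^ i) * \<bar>z\<bar> ^ m" for i
    using z r by (auto simp: abs_mult power_add power_abs mult.assoc intro!: mult_left_mono mult_right_mono power_mono)
   from norm_suminf_le [OF this summable_mult2 [OF sm]] show ?thesis by simp
  qed
  also have "... = C * \<bar>z\<bar> ^ m"
   unfolding C_def by (rule suminf_mult2 [OF sm, symmetric])
  finally show "\<bar>f z - (\<Sum>i<m. c i * z ^ i)\<bar> \<le> C * \<bar>z\<bar> ^ m" .
 qed
qed

text \<open>The argument \<open>a + b\<close> of the power series is meant with \<open>a\<close> of first and \<open>b\<close> of second order;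
 \<open>taylor_part c m a b\<close> collects the terms of total order less than \<open>m\<close>.\<close>

definition taylor_part :: "(nat => real) => nat => real => real => real" where
 "taylor_part c m a b =
  (\<Sum>i<m. \<Sum>l\<le>i. if i + l < m then c i * real (i choose l) * a ^ (i - l) * b ^ l else 0)"

text \<open>The number \<kappa> is the unit of order: a counts as \<kappa>, b as \<kappa>^2, and
  a^(i-l) b^l as \<kappa>^(i+l). What is discarded is the tail of the series, and the terms with i <
  m \<le> i + l, whose surplus powers of \<kappa> are absorbed in (1 + K)^(i+l-m).\<close>

lemma taylor_part_bound:
 assumes sums: "\<And>z. \<bar>z\<bar> < \<rho> ==> (\<lambda>i. c i * z ^ i) sums f z" and K: "0 \<le> K" "K + K^2 < \<rho>"
 obtains C where "C \<ge> 0" "\<And>a b \<kappa>. \<bar>a\<bar> \<le> \<kappa> ==> \<bar>b\<bar> \<le> \<kappa>^2 ==> \<kappa> \<le> K ==> \<bar>f (a + b) - taylor_part c m a b\<bar> \<le> C * \<kappa> ^ m"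
proof -
 obtain C1 where C1: "C1 \<ge> 0"
  "\<And>z. \<bar>z\<bar> \<le> K + K^2 ==> \<bar>f z - (\<Sum>i<m. c i * z ^ i)\<bar> \<le> C1 * \<bar>z\<bar> ^ m"
  using power_series_tail_bound [of \<rho> c f "K + K^2" m] sums K by auto
 define C2 where "C2 = (\<Sum>i<m. \<Sum>l\<le>i. \<bar>c i\<bar> * real (i choose l) * (1 + K) ^ (i + l - m))"
 show thesis
 proof
  show "C1 * (1 + K) ^ m + C2 \<ge> 0" unfolding C2_def using C1 K by (auto intro!: add_nonneg_nonneg sum_nonneg)
  fix a b \<kappa> :: real assume ab: "\<bar>a\<bar> \<le> \<kappa>" "\<bar>b\<bar> \<le> \<kappa>^2" "\<kappa> \<le> K"
  then have \<kappa>: "0 \<le> \<kappa>" by linarith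
  have "\<kappa>^2 \<le> \<kappa> * K" using ab \<kappa> by (auto simp: power2_eq_square intro: mult_left_mono)
  then have z1: "\<bar>a + b\<bar> \<le> \<kappa> * (1 + K)" using ab by (simp add: algebra_simps)
  also have "... \<le> K + K^2" using ab \<kappa> K mult_right_mono [of \<kappa> K "1 + K"] by (simp add: algebra_simps power2_eq_square)
  finally have z2: "\<bar>a + b\<bar> \<le> K + K^2" .
  have "\<bar>f (a + b) - (\<Sum>i<m. c i * (a + b) ^ i)\<bar> \<le> C1 * \<bar>a + b\<bar> ^ m" by (rule C1(2) [OF z2])
  also have "... \<le> C1 * (\<kappa> * (1 + K)) ^ m" by (intro mult_left_mono power_mono z1 C1(1)) auto
  finally have 1: "\<bar>f (a + b) - (\<Sum>i<m. c i * (a + b) ^ i)\<bar> \<le> C1 * (1 + K) ^ m * \<kappa> ^ m"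
   by (simp add: power_mult_distrib mult_ac)
  have "(\<Sum>i<m. c i * (a + b) ^ i) = (\<Sum>i<m. \<Sum>l\<le>i. c i * real (i choose l) * a ^ (i - l) * b ^ l)"
   by (subst add.commute) (simp add: binomial_ring sum_distrib_left mult_ac)
  then have "(\<Sum>i<m. c i * (a + b) ^ i) - taylor_part c m a b =
   (\<Sum>i<m. \<Sum>l\<le>i. if i + l < m then 0 else c i * real (i choose l) * a ^ (i - l) * b ^ l)"
   unfolding taylor_part_def by (auto simp: sum_subtractf [symmetric] intro!: sum.cong)
  also have "\<bar>...\<bar> \<le> (\<Sum>i<m. \<Sum>l\<le>i. \<bar>c i\<bar> * real (i choose l) * (1 + K) ^ (i + l - m) * \<kappa> ^ m)"
  proof (intro order.trans [OF sum_abs] sum_mono)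
   fix i l assume il: "i \<in> {..<m}" "l \<in> {..i}"
   show "\<bar>if i + l < m then 0 else c i * real (i choose l) * a ^ (i - l) * b ^ l\<bar>
     \<le> \<bar>c i\<bar> * real (i choose l) * (1 + K) ^ (i + l - m) * \<kappa> ^ m"
   proof (cases "i + l < m")
    case False
    have "\<bar>a\<bar> ^ (i - l) * \<bar>b\<bar> ^ l \<le> \<kappa> ^ (i - l) * (\<kappa>^2) ^ l"
     by (intro mult_mono power_mono ab) (use \<kappa> in auto)
    also have "... = \<kappa> ^ (i + l - m) * \<kappa> ^ m"
     using il False by (simp add: power_mult [symmetric] power_add [symmetric] add.commute)
    also have "... \<le> (1 + K) ^ (i + l - m) * \<kappa> ^ m"
     using ab \<kappa> by (intro mult_right_mono power_mono) auto
    finally have "\<bar>c i\<bar> * real (i choose l) * (\<bar>a\<bar> ^ (i - l) * \<bar>b\<bar> ^ l)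
      \<le> \<bar>c i\<bar> * real (i choose l) * ((1 + K) ^ (i + l - m) * \<kappa> ^ m)"
     by (intro mult_left_mono) auto
    then show ?thesis using False by (simp add: abs_mult power_abs mult_ac)
   qed (use K \<kappa> in simp)
  qed
  also have "... = C2 * \<kappa> ^ m" by (simp only: C2_def sum_distrib_right)
  finally have "\<bar>(\<Sum>i<m. c i * (a + b) ^ i) - taylor_part c m a b\<bar> \<le> C2 * \<kappa> ^ m" .
  with 1 show "\<bar>f (a + b) - taylor_part c m a b\<bar> \<le> (C1 * (1 + K) ^ m + C2) * \<kappa> ^ m"
   by (simp add: distrib_right)
 qed
qed

text \<open>With the arguments j a and j^2 b the term of order i + l is a constant times j^(i+l), a
  power below m, which the m-th difference kills.\<close>

lemma alternating_binomial_taylor_part: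
 "(\<Sum>j\<le>m. (-1)^j * real (m choose j) * taylor_part c m (real j * a) ((real j)^2 * b)) = 0"
proof -
 have pw: "(real j * a) ^ (i - l) * ((real j)^2 * b) ^ l = (real j + 0) ^ (i + l) * (a ^ (i - l) * b ^ l)"
  if "l \<le> i" for i j l
 proof -
  have "real j ^ (i - l) * (real j ^ 2) ^ l = real j ^ (i + l)"
   using that by (simp add: power_mult [symmetric] power_add [symmetric] add.commute)
  then show ?thesis by (simp add: power_mult_distrib)
 qed
 have "(\<Sum>j\<le>m. (-1)^j * real (m choose j) * taylor_part c m (real j * a) ((real j)^2 * b)) =
  (\<Sum>j\<le>m. \<Sum>i<m. \<Sum>l\<le>i. if i + l < m then c i * real (i choose l) * a ^ (i - l) * b ^ l *
    ((-1)^j * real (m choose j) * (real j + 0) ^ (i + l)) else 0)"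
  unfolding taylor_part_def sum_distrib_left
 proof (intro sum.cong refl)
  fix j i l assume "j \<in> {..m}" "i \<in> {..<m}" "l \<in> {..i}"
  then show "(-1)^j * real (m choose j) * (if i + l < m then c i * real (i choose l) * (real j * a) ^ (i - l) * ((real j)^2 * b) ^ l else 0)
   = (if i + l < m then c i * real (i choose l) * a ^ (i - l) * b ^ l *
    ((-1)^j * real (m choose j) * (real j + 0) ^ (i + l)) else 0)"
   using pw [of l i j] by (simp add: mult.assoc)
 qed
 also have "... = (\<Sum>i<m. \<Sum>l\<le>i. \<Sum>j\<le>m. if i + l < m then c i * real (i choose l) * a ^ (i - l) * b ^ l *
    ((-1)^j * real (m choose j) * (real j + 0) ^ (i + l)) else 0)"
  by (subst sum.swap, rule sum.cong [OF refl], rule sum.swap)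
 also have "... = 0"
 proof (rule sum.neutral, rule ballI, rule sum.neutral, rule ballI)
  fix i l
  have "(\<Sum>j\<le>m. if i + l < m then c i * real (i choose l) * a ^ (i - l) * b ^ l *
    ((-1)^j * real (m choose j) * (real j + 0) ^ (i + l)) else 0) =
    (if i + l < m then c i * real (i choose l) * a ^ (i - l) * b ^ l *
     (\<Sum>j\<le>m. (-1)^j * real (m choose j) * (real j + 0) ^ (i + l)) else 0)"
   unfolding sum_distrib_left by simp
  also have "... = 0"
   using alternating_binomial_shifted_power [of "i + l" m 0] by auto
  finally show "(\<Sum>j\<le>m. if i + l < m then c i * real (i choose l) * a ^ (i - l) * b ^ l *
    ((-1)^j * real (m choose j) * (real j + 0) ^ (i + l)) else 0) = 0" .
 qed
 finally show ?thesis .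
qed

text \<open>The squared norm of y + j h is quadratic in j, hence the argument j a + j^2 b. The
  difference annihilates the Taylor part, so only its remainder counts. It is applied to exp for the
  heat kernel and to the binomial series for inverse powers.\<close>

lemma fdiff_power_series_bound:
 assumes sums: "\<And>z. \<bar>z\<bar> < \<rho> ==> (\<lambda>i. c i * z ^ i) sums f z"
  and K: "0 \<le> K" "real m * K + (real m * K)^2 < \<rho>"
 obtains C where "C \<ge> 0" "\<And>a b \<kappa>. \<bar>a\<bar> \<le> \<kappa> ==> \<bar>b\<bar> \<le> \<kappa>^2 ==> \<kappa> \<le> K ==>
  \<bar>\<Sum>j\<le>m. (-1)^j * real (m choose j) * f (real j * a + (real j)^2 * b)\<bar> \<le> C * \<kappa> ^ m"
proof -
 obtain C where C: "C \<ge> 0" "\<And>a b \<kappa>. \<bar>a\<bar> \<le> \<kappa> ==> \<bar>b\<bar> \<le> \<kappa>^2 ==> \<kappa> \<le> real m * K ==>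
   \<bar>f (a + b) - taylor_part c m a b\<bar> \<le> C * \<kappa> ^ m"
  using taylor_part_bound [of \<rho> c f "real m * K" m] sums K by auto
 define B where "B = (\<Sum>j\<le>m. real (m choose j) * (C * real m ^ m))"
 show thesis
 proof
  show "B \<ge> 0" unfolding B_def using C by (auto intro!: sum_nonneg)
  fix a b \<kappa> :: real assume ab: "\<bar>a\<bar> \<le> \<kappa>" "\<bar>b\<bar> \<le> \<kappa>^2" "\<kappa> \<le> K"
  then have \<kappa>: "0 \<le> \<kappa>" by linarith
  have "(\<Sum>j\<le>m. (-1)^j * real (m choose j) * f (real j * a + (real j)^2 * b)) =
    (\<Sum>j\<le>m. (-1)^j * real (m choose j) * (f (real j * a + (real j)^2 * b) - taylor_part c m (real j * a) ((real j)^2 * b)))"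
   using alternating_binomial_taylor_part [of m c a b] by (simp add: right_diff_distrib sum_subtractf)
  also have "\<bar>...\<bar> \<le> (\<Sum>j\<le>m. real (m choose j) * (C * real m ^ m) * \<kappa> ^ m)"
  proof (intro order.trans [OF sum_abs] sum_mono)
   fix j assume j: "j \<in> {..m}"
   have "\<bar>f (real j * a + (real j)^2 * b) - taylor_part c m (real j * a) ((real j)^2 * b)\<bar> \<le> C * (real m * \<kappa>) ^ m"
   proof (rule C(2))
    show "\<bar>real j * a\<bar> \<le> real m * \<kappa>" using j ab by (auto simp: abs_mult intro!: mult_mono)
    show "\<bar>(real j)^2 * b\<bar> \<le> (real m * \<kappa>)^2" using j ab by (auto simp: abs_mult power_mult_distrib intro!: mult_mono power_mono)
    show "real m * \<kappa> \<le> real m * K" using ab by (intro mult_left_mono) auto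
   qed
   then show "\<bar>(-1)^j * real (m choose j) * (f (real j * a + (real j)^2 * b) - taylor_part c m (real j * a) ((real j)^2 * b))\<bar>
     \<le> real (m choose j) * (C * real m ^ m) * \<kappa> ^ m"
    by (simp add: abs_mult power_mult_distrib mult.assoc mult_left_mono)
  qed
  also have "... = B * \<kappa> ^ m" by (simp only: B_def sum_distrib_right)
  finally show "\<bar>\<Sum>j\<le>m. (-1)^j * real (m choose j) * f (real j * a + (real j)^2 * b)\<bar> \<le> B * \<kappa> ^ m" .
 qed
qed

lemma exp_sums: "(\<lambda>i. (1 / fact i) * z ^ i) sums exp (z::real)"
 using exp_converges [of z] by (simp add: divide_inverse)

lemma binomial_sums: "\<bar>z\<bar> < 1 ==> (\<lambda>i. ((- b) gchoose i) * z ^ i) sums ((1 + z) powr (- b :: real))"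
 by (rule gen_binomial_real) simp

text \<open>With A = \<epsilon> + |y|^2 taken out, the values at y + j h are A^(-b) (1 + j \<alpha>
  + j^2 \<beta>)^(-b). The choice \<epsilon> = 0 gives the kernel of the fractional Laplacian,
  \<epsilon> = R^2 its smoothed version.\<close>

lemma fdiff_inverse_power_bound:
 fixes b :: real
 assumes "b > 0"
 obtains C where "C \<ge> 0"
  "\<And>(y::'a::real_inner) h \<epsilon>. 0 \<le> \<epsilon> ==> 0 < \<epsilon> + (norm y)^2 ==> 8 * (real m + 1) * norm h \<le> sqrt (\<epsilon> + (norm y)^2) ==>
   \<bar>fdiff m h (\<lambda>z. (\<epsilon> + (norm z)^2) powr (- b)) y\<bar>
    \<le> C * (\<epsilon> + (norm y)^2) powr (- b) * (norm h / sqrt (\<epsilon> + (norm y)^2)) ^ m"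
proof -
 \<comment> \<open>Then m K \<le> 1/4, so m K + (m K)^2 stays below the radius of convergence 1, and
   \<kappa> = 2 |h| / sqrt A is at most K under the hypothesis with the factor 8 (m + 1).\<close>
 define K where "K = 1 / (4 * (real m + 1))"
 define x where "x = real m * K"
 have x: "0 \<le> x" "x \<le> 1/4" unfolding x_def K_def by (simp_all add: field_simps)
 have "x^2 \<le> (1/4)^2" using x by (intro power_mono)
 then have "x^2 \<le> 1/16" by (simp add: power2_eq_square)
 then have "x + x^2 < 1" using x by linarith
 then have K: "0 \<le> K" "real m * K + (real m * K)^2 < 1"
  unfolding x_def by (simp_all add: K_def)
 obtain C where C: "C \<ge> 0" "\<And>\<alpha> \<beta> \<kappa>. \<bar>\<alpha>\<bar> \<le> \<kappa> ==> \<bar>\<beta>\<bar> \<le> \<kappa>^2 ==> \<kappa> \<le> K ==>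
  \<bar>\<Sum>j\<le>m. (-1)^j * real (m choose j) * (1 + (real j * \<alpha> + (real j)^2 * \<beta>)) powr (- b)\<bar> \<le> C * \<kappa> ^ m"
  using fdiff_power_series_bound [of 1 "\<lambda>i. (- b) gchoose i" "\<lambda>z. (1 + z) powr (- b)" K m] binomial_sums K by auto
 show thesis
 proof
  show "C * 2 ^ m \<ge> 0" using C by simp
  fix y h :: 'a and \<epsilon> :: real
  assume \<epsilon>: "0 \<le> \<epsilon>" "0 < \<epsilon> + (norm y)^2" and h: "8 * (real m + 1) * norm h \<le> sqrt (\<epsilon> + (norm y)^2)"
  define A where "A = \<epsilon> + (norm y)^2"
  have A: "A > 0" "sqrt A > 0" "sqrt A * sqrt A = A" "norm y \<le> sqrt A"
   using \<epsilon> by (auto simp: A_def intro: real_le_rsqrt)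
  define \<kappa> where "\<kappa> = 2 * norm h / sqrt A"
  define \<alpha> where "\<alpha> = 2 * (y \<bullet> h) / A"
  define \<beta> where "\<beta> = (norm h)^2 / A"
  have "\<bar>y \<bullet> h\<bar> \<le> sqrt A * norm h"
   using Cauchy_Schwarz_ineq2 [of y h] A(4) mult_right_mono [of "norm y" "sqrt A" "norm h"] by simp
  then have "\<bar>\<alpha>\<bar> \<le> 2 * (sqrt A * norm h) / A"
   using A by (simp add: \<alpha>_def divide_right_mono)
  also have "... = \<kappa>" using A by (simp add: \<kappa>_def field_simps)
  finally have 1: "\<bar>\<alpha>\<bar> \<le> \<kappa>" .
  have 2: "\<bar>\<beta>\<bar> \<le> \<kappa>^2" using A by (simp add: \<beta>_def \<kappa>_def power_divide power_mult_distrib divide_right_mono)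
  have 3: "\<kappa> \<le> K" using h A unfolding \<kappa>_def K_def by (simp add: A_def [symmetric] field_simps)
  have expand: "(\<epsilon> + (norm (y + real j *\<^sub>R h))^2) powr (- b) = A powr (- b) * (1 + (real j * \<alpha> + (real j)^2 * \<beta>)) powr (- b)" for j
  proof -
   have "\<epsilon> + (norm (y + real j *\<^sub>R h))^2 = A + 2 * real j * (y \<bullet> h) + (real j)^2 * (norm h)^2"
   proof -
    have "(norm (y + real j *\<^sub>R h))^2 = (norm y)^2 + 2 * real j * (y \<bullet> h) + (real j)^2 * (norm h)^2"
     unfolding power2_norm_eq_inner
     by (simp add: inner_simps inner_commute) (simp add: power2_eq_square algebra_simps)
    then show ?thesis by (simp add: A_def)
   qed
   also have "... = A * (1 + (real j * \<alpha> + (real j)^2 * \<beta>))"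
    using A by (simp add: \<alpha>_def \<beta>_def field_simps)
   finally have eq: "\<epsilon> + (norm (y + real j *\<^sub>R h))^2 = A * (1 + (real j * \<alpha> + (real j)^2 * \<beta>))" .
   have "0 \<le> \<epsilon> + (norm (y + real j *\<^sub>R h))^2" using \<epsilon> by simp
   with eq A have "0 \<le> 1 + (real j * \<alpha> + (real j)^2 * \<beta>)" by (simp add: zero_le_mult_iff)
   then show ?thesis unfolding eq by (simp add: powr_mult)
  qed
  have "fdiff m h (\<lambda>z. (\<epsilon> + (norm z)^2) powr (- b)) y =
   A powr (- b) * (\<Sum>j\<le>m. (-1)^j * real (m choose j) * (1 + (real j * \<alpha> + (real j)^2 * \<beta>)) powr (- b))"
   unfolding fdiff_def expand sum_distrib_left by (intro sum.cong) auto
  then have "\<bar>fdiff m h (\<lambda>z. (\<epsilon> + (norm z)^2) powr (- b)) y\<bar> \<le> A powr (- b) * (C * \<kappa> ^ m)"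
   using C(2) [OF 1 2 3] by (simp add: abs_mult mult_left_mono)
  then show "\<bar>fdiff m h (\<lambda>z. (\<epsilon> + (norm z)^2) powr (- b)) y\<bar>
    \<le> C * 2 ^ m * (\<epsilon> + (norm y)^2) powr (- b) * (norm h / sqrt (\<epsilon> + (norm y)^2)) ^ m"
   by (simp add: A_def [symmetric] \<kappa>_def power_mult_distrib power_divide mult_ac)
 qed
qed

section \<open>Gaussian kernels and subordination\<close>

lemma nn_integral_lborel_affine:
 fixes f :: "'a::euclidean_space => ennreal"
 assumes [measurable]: "f \<in> borel_measurable borel" and c: "c \<noteq> 0"
 shows "(\<integral>\<^sup>+x. f x \<partial>lborel) = ennreal (\<bar>c\<bar> ^ DIM('a)) * (\<integral>\<^sup>+x. f (t + c *\<^sub>R x) \<partial>lborel)"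
 by (subst lborel_affine [OF c, of t])
   (simp add: nn_integral_density nn_integral_distr nn_integral_cmult ennreal_power)

lemma integrable_lborel_affine:
 fixes f :: "'a::euclidean_space => real"
 assumes f: "integrable lborel f" and c: "c \<noteq> 0"
 shows "integrable lborel (\<lambda>x. f (t + c *\<^sub>R x))"
 using f f [THEN borel_measurable_integrable] unfolding integrable_iff_bounded
 by (subst (asm) nn_integral_lborel_affine [where c = c and t = t])
   (use c in \<open>auto simp: ennreal_mult_less_top ennreal_power [symmetric]\<close>)

lemma integrable_lborel_affine_iff:
 fixes f :: "'a::euclidean_space => real"
 assumes c: "c \<noteq> 0"
 shows "integrable lborel (\<lambda>x. f (t + c *\<^sub>R x)) \<longleftrightarrow> integrable lborel f"
 using integrable_lborel_affine [of f c t]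
  integrable_lborel_affine [of "\<lambda>x. f (t + c *\<^sub>R x)" "1 / c" "- (1 / c) *\<^sub>R t"] c
 by (auto simp: scaleR_diff_right)

lemma integral_lborel_affine:
 fixes f :: "'a::euclidean_space => real"
 assumes c: "c \<noteq> 0"
 shows "(LBINT x. f x) = \<bar>c\<bar> ^ DIM('a) * (LBINT x. f (t + c *\<^sub>R x))"
proof (cases "integrable lborel f")
 case True
 then have [measurable]: "f \<in> borel_measurable borel" by auto
 from c True show ?thesis
  by (subst lborel_affine [OF c, of t]) (simp add: integral_density integral_distr ennreal_power)
next
 case False
 with c show ?thesis by (simp add: integrable_lborel_affine_iff not_integrable_integral_eq)
qed

lemma integral_lborel_shift:
 "(LBINT x. f (t + x)) = (LBINT x. (f :: 'a::euclidean_space => real) x)"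
 using integral_lborel_affine [of 1 f t] by simp

lemma integral_lborel_reflect:
 "(LBINT x. f (t - x)) = (LBINT x. (f :: 'a::euclidean_space => real) x)"
 using integral_lborel_affine [of "-1" f t] by simp

lemma integrable_lborel_shift_iff:
 "integrable lborel (\<lambda>x. f (t + x)) \<longleftrightarrow> integrable lborel (f :: 'a::euclidean_space => real)"
 using integrable_lborel_affine_iff [of 1 f t] by simp

lemma integrable_lborel_reflect_iff:
 "integrable lborel (\<lambda>x. f (t - x)) \<longleftrightarrow> integrable lborel (f :: 'a::euclidean_space => real)"
 using integrable_lborel_affine_iff [of "-1" f t] by simp

text \<open>Layer cake: the weight at x is the integral over r \<ge> |x| of (n + 1) / (1 + r)^(n+2).
  After the integrals are exchanged, the ball of radius r has volume V r^n, and the integrand is at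
  most (n + 1) V / (1 + r)^2.\<close>

lemma integrable_inverse_power:
 "integrable lborel (\<lambda>x::'a::euclidean_space. 1 / (1 + norm x) ^ (DIM('a) + 1))"
proof -
 define n where "n = DIM('a)"
 define V where "V = unit_ball_vol (real n)"
 have V: "V \<ge> 0" by (simp add: V_def)
 have layer: "ennreal (1 / (1 + norm x) ^ (n + 1)) =
   (\<integral>\<^sup>+r. ennreal (real (n + 1) / (1 + r) ^ (n + 2)) * indicator {norm x..} r \<partial>lborel)" for x :: 'a
 proof -
  define f where "f r = (if r \<ge> 0 then real (n + 1) / (1 + r) ^ (n + 2) else 0)" for r :: real
  have [measurable]: "f \<in> borel_measurable borel" unfolding f_def by measurable
  have "(\<integral>\<^sup>+r. ennreal (f r) * indicator {norm x..} r \<partial>lborel) = ennreal (0 - (- 1 / (1 + norm x) ^ (n + 1)))"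
  proof (rule nn_integral_FTC_atLeast)
   fix r assume "norm x \<le> r"
   then have r: "r \<ge> 0" using norm_ge_zero order_trans by blast
   have d: "((\<lambda>r. (1 + r) ^ Suc n) has_real_derivative (1 + real n) * (1 * (1 + r) ^ n)) (at r)"
    by (intro DERIV_power_Suc) (auto intro!: derivative_eq_intros)
   have a: "(1 + r) ^ Suc n \<noteq> 0" using r by simp
   have "((\<lambda>r. - 1 / (1 + r) ^ Suc n) has_real_derivative
     (0 * (1 + r) ^ Suc n - (- 1) * ((1 + real n) * (1 * (1 + r) ^ n))) / ((1 + r) ^ Suc n * (1 + r) ^ Suc n)) (at r)"
    by (rule DERIV_divide [OF DERIV_const d a])
   moreover have "(1 + r) ^ Suc n * (1 + r) ^ Suc n = (1 + r) ^ n * (1 + r) ^ (n + 2)"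
    by (simp only: power_add [symmetric]) simp
   ultimately have "((\<lambda>r. - 1 / (1 + r) ^ (n + 1)) has_real_derivative
     ((1 + real n) * (1 + r) ^ n) / ((1 + r) ^ n * (1 + r) ^ (n + 2))) (at r)"
    by simp
   also have "((1 + real n) * (1 + r) ^ n) / ((1 + r) ^ n * (1 + r) ^ (n + 2)) = f r"
    using r by (simp add: f_def)
   finally show "((\<lambda>r. - 1 / (1 + r) ^ (n + 1)) has_real_derivative f r) (at r)" .
   show "0 \<le> f r" by (simp add: f_def)
  next
   have "filterlim (\<lambda>r::real. (1 + r) ^ (n + 1)) at_top at_top"
    by (intro filterlim_pow_at_top filterlim_tendsto_add_at_top [OF tendsto_const] filterlim_ident) auto
   then show "((\<lambda>r::real. - 1 / (1 + r) ^ (n + 1)) \<longlongrightarrow> 0) at_top"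
    by (intro real_tendsto_divide_at_top [OF tendsto_const])
  qed measurable
  moreover have "ennreal (f r) * indicator {norm x..} r = ennreal (real (n + 1) / (1 + r) ^ (n + 2)) * indicator {norm x..} r" for r
   by (auto simp: f_def indicator_def dest: order_trans [OF norm_ge_zero])
  ultimately show ?thesis by simp
 qed
 have meas: "{x \<in> space (lborel \<Otimes>\<^sub>M lborel). norm (fst x) \<le> snd x} \<in> sets (lborel \<Otimes>\<^sub>M (lborel :: real measure))" (is "?S \<in> _")
  by measurable
 have ind: "(\<lambda>(x::'a, r). indicator {norm x..} r :: ennreal) = indicator {x. norm (fst x) \<le> snd x}"
  by (auto simp: indicator_def fun_eq_iff)
 have [measurable]: "(\<lambda>(x::'a, r). indicator {norm x..} r :: ennreal) \<in> borel_measurable (lborel \<Otimes>\<^sub>M lborel)"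
  unfolding ind using meas by (simp add: space_pair_measure)
 have "(\<integral>\<^sup>+x. ennreal (1 / (1 + norm (x::'a)) ^ (n + 1)) \<partial>lborel) =
  (\<integral>\<^sup>+x. \<integral>\<^sup>+r. ennreal (real (n + 1) / (1 + r) ^ (n + 2)) * indicator {norm (x::'a)..} r \<partial>lborel \<partial>lborel)"
  by (simp only: layer)
 also have "... = (\<integral>\<^sup>+r. \<integral>\<^sup>+x. ennreal (real (n + 1) / (1 + r) ^ (n + 2)) * indicator {norm (x::'a)..} r \<partial>lborel \<partial>lborel)"
  by (rule lborel_pair.Fubini'[symmetric]) measurable
 also have "... \<le> (\<integral>\<^sup>+r. ennreal (real (n + 1) * V / (1 + r)^2) * indicator {0..} r \<partial>lborel)"
 proof (rule nn_integral_mono)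
  fix r :: real
  show "(\<integral>\<^sup>+x. ennreal (real (n + 1) / (1 + r) ^ (n + 2)) * indicator {norm (x::'a)..} r \<partial>lborel)
    \<le> ennreal (real (n + 1) * V / (1 + r)^2) * indicator {0..} r"
  proof (cases "r \<ge> 0")
   case True
   have eq: "(indicator {norm x..} r :: ennreal) = indicator (cball 0 r) x" for x :: 'a
    by (auto simp: indicator_def)
   have "(\<integral>\<^sup>+x. ennreal (real (n + 1) / (1 + r) ^ (n + 2)) * indicator {norm (x::'a)..} r \<partial>lborel)
    = ennreal (real (n + 1) / (1 + r) ^ (n + 2)) * emeasure lborel (cball (0::'a) r)"
    by (simp add: eq nn_integral_cmult_indicator)
   also have "... = ennreal (real (n + 1) / (1 + r) ^ (n + 2) * (V * r ^ n))"
    using True by (simp add: emeasure_cball V_def n_def ennreal_mult' [symmetric])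
   also have "... \<le> ennreal (real (n + 1) / (1 + r) ^ (n + 2) * (V * (1 + r) ^ n))"
    using True V by (intro ennreal_leI mult_left_mono power_mono) auto
   also have "real (n + 1) / (1 + r) ^ (n + 2) * (V * (1 + r) ^ n) = real (n + 1) * V / (1 + r)^2"
   proof -
    have "(1 + r) ^ (n + 2) = (1 + r)^2 * (1 + r) ^ n" by (simp only: power_add mult.commute)
    then show ?thesis using True by simp
   qed
   finally show ?thesis using True by simp
  next
   case False
   then have "(indicator {norm (x::'a)..} r :: ennreal) = 0" for x
    by (auto simp: indicator_def dest: order_trans [OF norm_ge_zero])
   then show ?thesis using False by simp
  qed
 qed
 also have "... = (\<integral>\<^sup>+r. ennreal (if r \<ge> 0 then real (n + 1) * V / (1 + r)^2 else 0) * indicator {0..} r \<partial>lborel)"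
  by (intro nn_integral_cong) (auto simp: indicator_def)
 also have "... = ennreal (0 - (- real (n + 1) * V / (1 + 0)))"
 proof (rule nn_integral_FTC_atLeast)
  fix r :: real assume r: "0 \<le> r"
  then show "((\<lambda>r. - real (n + 1) * V / (1 + r)) has_real_derivative
    (if r \<ge> 0 then real (n + 1) * V / (1 + r)^2 else 0)) (at r)"
   by (auto intro!: derivative_eq_intros simp: power2_eq_square field_simps)
  show "0 \<le> (if r \<ge> 0 then real (n + 1) * V / (1 + r)^2 else 0)" using V by simp
 next
  show "((\<lambda>r::real. - real (n + 1) * V / (1 + r)) \<longlongrightarrow> 0) at_top"
   by (intro real_tendsto_divide_at_top [OF tendsto_const] filterlim_tendsto_add_at_top [OF tendsto_const] filterlim_ident)
 qed measurable
 also have "... < \<infinity>" by simp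
 finally have "(\<integral>\<^sup>+x. ennreal (1 / (1 + norm (x::'a)) ^ (n + 1)) \<partial>lborel) < \<infinity>" .
 then show ?thesis unfolding n_def by (intro integrableI_nonneg) auto
qed

section \<open>Gaussian moments and the heat kernel\<close>

lemma power_le_fact_exp: "0 \<le> t ==> t ^ p \<le> fact p * exp (t::real)"
proof -
 assume t: "0 \<le> t"
 have "(\<Sum>i\<in>{p}. (1 / fact i) * t ^ i) \<le> (\<Sum>i. (1 / fact i) * t ^ i)"
  using exp_sums [of t] t by (intro sum_le_suminf) (auto simp: sums_iff)
 then show ?thesis using exp_sums [of t] by (simp add: sums_iff field_simps)
qed

text \<open>The power is absorbed by exp (1 + r), and 1 + r - r^2/4 \<le> 2 because (r/2 - 1)^2
  \<ge> 0; this is the origin of exp 2.\<close>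

lemma polynomial_gaussian_bound:
 assumes "0 \<le> (r::real)"
 shows "(1 + r) ^ p * exp (- (r^2 / 4)) \<le> fact p * exp 2"
proof -
 have "0 \<le> (r / 2 - 1)^2" by simp
 then have e: "(1 + r) - r^2 / 4 \<le> 2" by (simp add: power2_eq_square field_simps)
 have "(1 + r) ^ p * exp (- (r^2 / 4)) \<le> (fact p * exp (1 + r)) * exp (- (r^2 / 4))"
  using assms by (intro mult_right_mono power_le_fact_exp) auto
 also have "... = fact p * exp ((1 + r) - r^2 / 4)" by (simp add: exp_add [symmetric])
 also have "... \<le> fact p * exp 2" using e by (intro mult_left_mono) auto
 finally show ?thesis .
qed

lemma integrable_polynomial_gaussian:
 "integrable lborel (\<lambda>x::'a::euclidean_space. (1 + norm x) ^ p * exp (- ((norm x)^2 / 4)))"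
proof (rule integrable_bound)
 show "integrable lborel (\<lambda>x::'a. (fact (p + (DIM('a) + 1)) * exp 2) * (1 / (1 + norm x) ^ (DIM('a) + 1)))"
  by (intro integrable_mult_right integrable_inverse_power)
 show "AE x::'a in lborel. norm ((1 + norm x) ^ p * exp (- ((norm x)^2 / 4)))
   \<le> norm ((fact (p + (DIM('a) + 1)) * exp 2) * (1 / (1 + norm x) ^ (DIM('a) + 1)))"
 proof (intro AE_I2)
  fix x :: 'a
  have "0 < 1 + norm x" by (simp add: add_pos_nonneg)
  then show "norm ((1 + norm x) ^ p * exp (- ((norm x)^2 / 4)))
   \<le> norm ((fact (p + (DIM('a) + 1)) * exp 2) * (1 / (1 + norm x) ^ (DIM('a) + 1)))"
   using polynomial_gaussian_bound [of "norm x" "p + (DIM('a) + 1)"]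
   by (simp add: pos_le_divide_eq power_add mult_ac)
 qed
qed measurable

text \<open>The number (4 pi)^(n/2), encoded as the integral itself, so that \<open>gker t\<close>
  has mass one by a mere substitution.\<close>

definition gauss_mass :: "'a::euclidean_space itself => real" where
 "gauss_mass T = (LBINT (x::'a). exp (- ((norm x)^2 / 4)))"

text \<open>The heat kernel (4 pi t)^(-n/2) exp (- |z|^2 / (4 t)).\<close>

definition gker :: "real => 'a::euclidean_space => real" where
 "gker t z = exp (- ((norm z)^2 / (4 * t))) / (gauss_mass TYPE('a) * sqrt t ^ DIM('a))"

lemma gauss_mass_pos: "gauss_mass TYPE('a::euclidean_space) > 0"
proof -
 have int: "integrable lborel (\<lambda>x::'a. exp (- ((norm x)^2 / 4)))"
  using integrable_polynomial_gaussian [of 0] by simp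
 have "gauss_mass TYPE('a) \<noteq> 0"
 proof
  assume "gauss_mass TYPE('a) = 0"
  then have "AE x::'a in lborel. exp (- ((norm x)^2 / 4)) = 0"
   unfolding gauss_mass_def by (subst (asm) integral_nonneg_eq_0_iff_AE [OF int]) auto
  then have "AE x::'a in lborel. False" by simp
  then show False by (simp add: AE_iff_null null_sets_def)
 qed
 moreover have "gauss_mass TYPE('a) \<ge> 0" unfolding gauss_mass_def by simp
 ultimately show ?thesis by simp
qed

lemma gker_measurable [measurable]: "gker t \<in> borel_measurable borel"
 unfolding gker_def by measurable

lemma gker_measurable2 [measurable]: "(\<lambda>(t, z). gker t z) \<in> borel_measurable (borel \<Otimes>\<^sub>M borel)"
 unfolding gker_def by measurable

lemma gker_nonneg: "gker t (z::'a::euclidean_space) \<ge> 0" if "t \<ge> 0"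
 using gauss_mass_pos [where 'a = 'a] that by (simp add: gker_def)

lemma gker_minus: "gker t (- z) = gker t z" by (simp add: gker_def)

lemma gker_scale:
 assumes "t > 0" shows "gker t (sqrt t *\<^sub>R z) = gker 1 (z::'a::euclidean_space) / sqrt t ^ DIM('a)"
 using assms by (simp add: gker_def power_mult_distrib)

lemma integral_gker_scale:
 fixes f :: "'a::euclidean_space => real"
 assumes t: "t > 0"
 shows "(LBINT z. f z * gker t z) = (LBINT z. f (sqrt t *\<^sub>R z) * gker 1 z)"
 using t by (subst integral_lborel_affine [of "sqrt t" _ 0]) (auto simp: gker_scale)

lemma integrable_gker_scale:
 fixes f :: "'a::euclidean_space => real"
 assumes t: "t > 0" and "integrable lborel (\<lambda>z. f (sqrt t *\<^sub>R z) * gker 1 z)"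
 shows "integrable lborel (\<lambda>z. f z * gker t z)"
proof -
 have "integrable lborel (\<lambda>z. (1 / sqrt t ^ DIM('a)) * (f (sqrt t *\<^sub>R z) * gker 1 z))"
  by (intro integrable_mult_right assms)
 then have "integrable lborel (\<lambda>z. f (0 + sqrt t *\<^sub>R z) * gker t (0 + sqrt t *\<^sub>R z))"
  using t by (simp add: gker_scale mult_ac)
 then show ?thesis using t integrable_lborel_affine_iff [of "sqrt t" "\<lambda>z. f z * gker t z" 0] by simp
qed

lemma integrable_power_gker1: "integrable lborel (\<lambda>z::'a::euclidean_space. (1 + norm z) ^ p * gker 1 z)"
 using integrable_mult_right [OF integrable_polynomial_gaussian [of p, where 'a = 'a], of "1 / gauss_mass TYPE('a)"]
 by (simp add: gker_def mult_ac)

lemma integrable_power_gker: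
 assumes t: "t > 0"
 shows "integrable lborel (\<lambda>z::'a::euclidean_space. (1 + norm z) ^ p * gker t z)"
proof (rule integrable_gker_scale [OF t], rule integrable_bound)
 show "integrable lborel (\<lambda>z::'a. (1 + sqrt t) ^ p * ((1 + norm z) ^ p * gker 1 z))"
  by (intro integrable_mult_right integrable_power_gker1)
 show "AE z::'a in lborel. norm ((1 + norm (sqrt t *\<^sub>R z)) ^ p * gker 1 z) \<le> norm ((1 + sqrt t) ^ p * ((1 + norm z) ^ p * gker 1 z))"
 proof (intro AE_I2)
  fix z :: 'a
  have "1 + sqrt t * norm z \<le> (1 + sqrt t) * (1 + norm z)" using t by (simp add: algebra_simps)
  then have "(1 + sqrt t * norm z) ^ p \<le> (1 + sqrt t) ^ p * (1 + norm z) ^ p"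
   using t by (simp add: power_mult_distrib [symmetric] power_mono)
  then show "norm ((1 + norm (sqrt t *\<^sub>R z)) ^ p * gker 1 z) \<le> norm ((1 + sqrt t) ^ p * ((1 + norm z) ^ p * gker 1 z))"
   using t gker_nonneg [of 1 z] by (simp add: abs_mult mult.assoc [symmetric] mult_right_mono)
 qed
qed measurable

lemma integrable_gker: "t > 0 ==> integrable lborel (gker t :: 'a::euclidean_space => real)"
 using integrable_power_gker [of t 0] by simp

lemma integral_gker: "t > 0 ==> (LBINT z. gker t (z::'a::euclidean_space)) = 1"
proof -
 assume t: "t > 0"
 have m: "(LBINT (x::'a). exp (- ((norm x)^2 / 4))) = gauss_mass TYPE('a)"
  by (simp add: gauss_mass_def)
 show ?thesis
  using t integral_gker_scale [of t "\<lambda>_::'a. 1"] gauss_mass_pos [where 'a = 'a]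
  by (simp add: gker_def [of 1] m)
qed

text \<open>After rescaling to time 1 the time enters only through 1 + sqrt t |z|, which increases
  with t.\<close>

lemma integral_power_gker_le:
 assumes t: "0 < t" "t \<le> T"
 shows "(LBINT (z::'a::euclidean_space). (1 + norm z) ^ p * gker t z) \<le>
   (LBINT (z::'a). (1 + norm z) ^ p * gker T z)"
proof -
 have "(LBINT (z::'a). (1 + norm (sqrt t *\<^sub>R z)) ^ p * gker 1 z) \<le> (LBINT (z::'a). (1 + norm (sqrt T *\<^sub>R z)) ^ p * gker 1 z)"
 proof (rule integral_mono')
  have "integrable lborel (\<lambda>z::'a. (1 / sqrt T ^ DIM('a)) * ((1 + norm (sqrt T *\<^sub>R z)) ^ p * gker 1 z))"
   using t integrable_lborel_affine_iff [of "sqrt T" "\<lambda>z::'a. (1 + norm z) ^ p * gker T z" 0]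
    integrable_power_gker [of T p, where 'a = 'a]
   by (simp add: gker_scale mult_ac)
  then have "integrable lborel (\<lambda>z::'a. (sqrt T ^ DIM('a)) * ((1 / sqrt T ^ DIM('a)) * ((1 + norm (sqrt T *\<^sub>R z)) ^ p * gker 1 z)))"
   by (rule integrable_mult_right)
  then show "integrable lborel (\<lambda>z::'a. (1 + norm (sqrt T *\<^sub>R z)) ^ p * gker 1 z)"
   using t by simp
 next
  fix z :: 'a
  show "(1 + norm (sqrt t *\<^sub>R z)) ^ p * gker 1 z \<le> (1 + norm (sqrt T *\<^sub>R z)) ^ p * gker 1 z"
   using t gker_nonneg [of 1 z] by (intro mult_right_mono power_mono) (auto intro: mult_right_mono)
  show "0 \<le> (1 + norm (sqrt T *\<^sub>R z)) ^ p * gker 1 z"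
   using t gker_nonneg [of 1 z] by simp
 qed
 moreover have "T > 0" using t by simp
 ultimately show ?thesis
  using integral_gker_scale [OF t(1), of "\<lambda>z::'a. (1 + norm z) ^ p"]
   integral_gker_scale [of T "\<lambda>z::'a. (1 + norm z) ^ p"] by simp
qed

text \<open>Scaling z by sqrt t takes a factor t out of |z|^2. This linear rate at small times
  compensates one power of the weight t^(-1-s).\<close>

lemma gker_second_moment:
 obtains C where "C \<ge> 0" "\<And>t. 0 < t ==> t \<le> 1 ==>
  (LBINT (z::'a::euclidean_space). (norm z)^2 * (1 + norm z) ^ p * gker t z) \<le> C * t"
proof -
 define C where "C = (LBINT (z::'a). (1 + norm z) ^ (p + 2) * gker 1 z)"
 have C: "C \<ge> 0" unfolding C_def
  by (intro integral_nonneg mult_nonneg_nonneg zero_le_power gker_nonneg) auto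
 have le: "(LBINT (z::'a). (norm z)^2 * (1 + norm z) ^ p * gker t z) \<le> C * t"
  if t: "0 < t" "t \<le> 1" for t
 proof -
 have "(LBINT (z::'a). (norm z)^2 * (1 + norm z) ^ p * gker t z) =
   (LBINT (z::'a). (norm (sqrt t *\<^sub>R z))^2 * (1 + norm (sqrt t *\<^sub>R z)) ^ p * gker 1 z)"
  using t by (intro integral_gker_scale)
 also have "... \<le> (LBINT (z::'a). t * ((1 + norm z) ^ (p + 2) * gker 1 z))"
 proof (rule integral_mono')
  show "integrable lborel (\<lambda>z::'a. t * ((1 + norm z) ^ (p + 2) * gker 1 z))"
   by (intro integrable_mult_right integrable_power_gker1)
  fix z :: 'a
  have "sqrt t \<le> 1" using t by simp
  then have "1 + sqrt t * norm z \<le> 1 + norm z" using t by (simp add: mult_left_le_one_le)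
  then have "(norm z)^2 * (1 + sqrt t * norm z) ^ p \<le> (1 + norm z)^2 * (1 + norm z) ^ p"
   using t by (intro mult_mono power_mono) auto
  then have *: "t * ((norm z)^2 * (1 + sqrt t * norm z) ^ p) * gker 1 z \<le> t * ((1 + norm z)^2 * (1 + norm z) ^ p) * gker 1 z"
   using t gker_nonneg [of 1 z] by (intro mult_left_mono mult_right_mono) auto
  show "(norm (sqrt t *\<^sub>R z))^2 * (1 + norm (sqrt t *\<^sub>R z)) ^ p * gker 1 z \<le> t * ((1 + norm z) ^ (p + 2) * gker 1 z)"
  proof -
   have "(1 + norm z) ^ (p + 2) = (1 + norm z)^2 * (1 + norm z) ^ p"
    by (subst power_add) (rule mult.commute)
   moreover have "norm (sqrt t *\<^sub>R z) = sqrt t * norm z" "(sqrt t * norm z)^2 = t * (norm z)^2"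
    using t by (simp_all add: power_mult_distrib)
   ultimately show ?thesis using * by (simp only: mult.assoc)
  qed
  show "0 \<le> t * ((1 + norm z) ^ (p + 2) * gker 1 z)"
   using t gker_nonneg [of 1 z] by simp
 qed
 also have "... = C * t" unfolding C_def by simp
 finally show ?thesis .
 qed
 show thesis by (rule that [OF C le])
qed

text \<open>Completing the square gives the semigroup property.\<close>

lemma gker_product:
 assumes "0 < a" "0 < b"
 shows "gker a z * gker b (w - z) = gker (a + b) w * gker (a * b / (a + b)) (z - (a / (a + b)) *\<^sub>R (w::'a::euclidean_space))"
proof -
 have ab: "a + b > 0" using assms by simp
 have "(norm z)^2 / (4 * a) + (norm (w - z))^2 / (4 * b) =
   (norm w)^2 / (4 * (a + b)) + (norm (z - (a / (a + b)) *\<^sub>R w))^2 / (4 * (a * b / (a + b)))"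
 proof -
  define x y v where "x = z \<bullet> z" and "y = w \<bullet> w" and "v = z \<bullet> w"
  have 1: "(norm (w - z))^2 = y - 2 * v + x"
   by (simp add: power2_norm_eq_inner inner_simps inner_commute x_def y_def v_def)
  have 2: "(norm (z - (a / (a + b)) *\<^sub>R w))^2 = x - 2 * (a / (a + b)) * v + (a / (a + b))^2 * y"
   by (simp add: power2_norm_eq_inner inner_simps inner_commute x_def y_def v_def) (simp add: power2_eq_square)
  have 3: "(norm z)^2 = x" "(norm w)^2 = y" by (simp_all add: power2_norm_eq_inner x_def y_def)
  show ?thesis unfolding 1 2 3 using assms ab
   by (simp add: divide_simps) (simp add: power2_eq_square algebra_simps)
 qed
 then have e: "exp (- ((norm z)^2 / (4 * a))) * exp (- ((norm (w - z))^2 / (4 * b))) =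
   exp (- ((norm w)^2 / (4 * (a + b)))) * exp (- ((norm (z - (a / (a + b)) *\<^sub>R w))^2 / (4 * (a * b / (a + b)))))"
  by (simp only: exp_add [symmetric] minus_add_distrib [symmetric])
 have s: "sqrt (a + b) ^ DIM('a) * sqrt (a * b / (a + b)) ^ DIM('a) = sqrt a ^ DIM('a) * sqrt b ^ DIM('a)"
  using ab by (simp add: power_mult_distrib [symmetric] real_sqrt_mult [symmetric])
 have "gker a z * gker b (w - z) = exp (- ((norm z)^2 / (4 * a))) * exp (- ((norm (w - z))^2 / (4 * b))) /
   (gauss_mass TYPE('a) * gauss_mass TYPE('a) * (sqrt a ^ DIM('a) * sqrt b ^ DIM('a)))"
  by (simp add: gker_def mult_ac)
 also have "... = gker (a + b) w * gker (a * b / (a + b)) (z - (a / (a + b)) *\<^sub>R w)"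
  unfolding e s [symmetric] by (simp add: gker_def mult_ac)
 finally show ?thesis .
qed

lemma gker_convolution:
 assumes "0 < a" "0 < b"
 shows "(LBINT z. gker a z * gker b (w - z)) = gker (a + b) (w::'a::euclidean_space)"
proof -
 have "(LBINT z. gker (a * b / (a + b)) (- (a / (a + b)) *\<^sub>R w + z)) = 1"
  using assms by (subst integral_lborel_shift) (simp add: integral_gker)
 then show ?thesis unfolding gker_product [OF assms] by simp
qed

section \<open>Subordination: the kernel |h|^(-n-2s) as a mixture of heat kernels\<close>

definition rker :: "real => 'a::euclidean_space => real" where
 "rker s h = 1 / norm h powr (real DIM('a) + 2 * s)"

text \<open>The density in Bochner's formula, by which \<lambda>^s is a constant times the integral
  of (1 - exp (- t \<lambda>)) t^(-1-s). The value 0 for t \<le> 0 allows integration over the whole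
  line.\<close>

definition lweight :: "real => real => real" where
 "lweight s t = (if t > 0 then t powr (- 1 - s) else 0)"

text \<open>The mixture of the heat kernels evaluated at |h| = 1, which is the factor of
  proportionality to \<open>rker\<close>.\<close>

definition mix_const :: "'a::euclidean_space itself => real => real" where
 "mix_const T s = (LBINT t. lweight s t * (exp (- (1 / (4 * t))) / (gauss_mass TYPE('a) * sqrt t ^ DIM('a))))"

lemma rker_measurable [measurable]: "rker s \<in> borel_measurable borel"
 unfolding rker_def by measurable

lemma lweight_measurable [measurable]: "lweight s \<in> borel_measurable borel"
 unfolding lweight_def by measurable

lemma rker_nonneg: "rker s h \<ge> 0" by (simp add: rker_def)
lemma rker_0: "rker s 0 = 0" by (simp add: rker_def)
lemma rker_minus: "rker s (- h) = rker s h" by (simp add: rker_def)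
lemma lweight_nonneg: "lweight s t \<ge> 0" by (simp add: lweight_def)

text \<open>Near 0 the integrand is t^(-s), integrable since s < 1; at infinity it is t^(-1-s),
  integrable since s > 0.\<close>

lemma integrable_lweight:
 assumes s: "0 < s" "s < 1"
 shows "integrable lborel (\<lambda>t. lweight s t * min 1 t)"
proof (rule integrableI_nonneg)
 show "AE t in lborel. 0 \<le> lweight s t * min 1 t"
  by (intro AE_I2) (auto simp: lweight_def)
 have small: "(\<integral>\<^sup>+t. ennreal (indicator {0<..1} t * t powr (- s)) \<partial>lborel) < \<infinity>"
 proof -
  have "(\<lambda>t. t powr (- s)) integrable_on {0<..1}"
   by (rule integrable_on_powr_from_0') (use s in auto)
  then have "(\<lambda>t. t powr (- s)) absolutely_integrable_on {0<..1}"
   by (intro nonnegative_absolutely_integrable_1) auto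
  then have "integrable lebesgue (\<lambda>t. indicator {0<..1} t * t powr (- s))"
   by (simp add: set_integrable_def)
  then have "integrable lborel (\<lambda>t. indicator {0<..1} t * t powr (- s))"
   by (subst (asm) integrable_completion) auto
  then show ?thesis
   by (subst (asm) integrable_iff_bounded) (simp add: abs_mult)
 qed
 have large: "(\<integral>\<^sup>+t. ennreal (t powr (- 1 - s)) * indicator {1..} t \<partial>lborel) = ennreal (0 - (- (1 powr (- s) / s)))"
 proof (rule nn_integral_FTC_atLeast)
  fix t :: real assume "1 \<le> t"
  then show "((\<lambda>t. - (t powr (- s) / s)) has_real_derivative t powr (- 1 - s)) (at t)"
   using s by (auto intro!: derivative_eq_intros simp: powr_diff powr_minus field_simps)
 next
  show "((\<lambda>t. - (t powr (- s) / s)) \<longlongrightarrow> 0) at_top"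
   using s by real_asymp
 qed auto
 have "(\<integral>\<^sup>+t. ennreal (lweight s t * min 1 t) \<partial>lborel) \<le>
   (\<integral>\<^sup>+t. ennreal (indicator {0<..1} t * t powr (- s)) + ennreal (t powr (- 1 - s)) * indicator {1..} t \<partial>lborel)"
 proof (rule nn_integral_mono)
  fix t :: real
  have "t powr (- 1 - s) * t = t powr (- s)" if "t > 0"
   using that by (simp add: powr_diff powr_minus field_simps)
  then show "ennreal (lweight s t * min 1 t) \<le> ennreal (indicator {0<..1} t * t powr (- s)) + ennreal (t powr (- 1 - s)) * indicator {1..} t"
   by (auto simp: lweight_def indicator_def min_def)
 qed
 also have "... < \<infinity>"
  using small by (subst nn_integral_add) (auto simp: large)
 finally show "(\<integral>\<^sup>+t. ennreal (lweight s t * min 1 t) \<partial>lborel) < \<infinity>" .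
qed measurable

text \<open>Comparison with \<open>lweight s t * min 1 t\<close>. For small t the exponential is
  below C t^(n+1), by \<open>power_le_fact_exp\<close> at 1 / (4 t); this pays for the n factors
  sqrt t in the denominator and leaves a factor t.\<close>

lemma integrable_mix:
 assumes s: "0 < s" "s < 1"
 shows "integrable lborel (\<lambda>t. lweight s t * (exp (- (1 / (4 * t))) / (gauss_mass TYPE('a::euclidean_space) * sqrt t ^ DIM('a))))"
proof -
 define n where "n = DIM('a)"
 define m where "m = gauss_mass TYPE('a)"
 have m: "m > 0" unfolding m_def by (rule gauss_mass_pos)
 define C :: real where "C = fact (n + 1) * 4 ^ (n + 1)"
 have C: "C \<ge> 1" unfolding C_def by (simp add: mult_ge1_I one_le_power fact_ge_1)
 have bound: "exp (- (1 / (4 * t))) / sqrt t ^ n \<le> C * min 1 t" if t: "t > 0" for t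
 proof (cases "t \<ge> 1")
  case True
  then have "exp (- (1 / (4 * t))) / sqrt t ^ n \<le> 1 / 1"
   by (intro frac_le) (auto simp: one_le_power)
  also have "1 / 1 \<le> C * min 1 t" using True C by simp
  finally show ?thesis .
 next
  case False
  have "(1 / (4 * t)) ^ (n + 1) \<le> fact (n + 1) * exp (1 / (4 * t))"
   using t by (intro power_le_fact_exp) auto
  then have "exp (- (1 / (4 * t))) \<le> fact (n + 1) * (4 * t) ^ (n + 1)"
   using t by (simp add: exp_minus power_divide divide_simps del: fact_Suc power_Suc) (simp add: mult_ac)
  also have "... = C * (t * t ^ n)" by (simp add: C_def power_mult_distrib)
  finally have "exp (- (1 / (4 * t))) / sqrt t ^ n \<le> C * (t * t ^ n) / sqrt t ^ n"
   using t by (intro divide_right_mono) auto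
  also have "t ^ n = sqrt t ^ n * sqrt t ^ n" using t by (simp add: power_mult_distrib [symmetric])
  also have "C * (t * (sqrt t ^ n * sqrt t ^ n)) / sqrt t ^ n = C * t * sqrt t ^ n" using t by simp
  also have "... \<le> C * t * 1"
   using t False C by (intro mult_left_mono power_le_one) auto
  finally show ?thesis using False by simp
 qed
 have "integrable lborel (\<lambda>t. lweight s t * (exp (- (1 / (4 * t))) / (m * sqrt t ^ n)))"
 proof (rule integrable_bound)
  show "integrable lborel (\<lambda>t. (C / m) * (lweight s t * min 1 t))"
   by (intro integrable_mult_right integrable_lweight s)
  show "AE t in lborel. norm (lweight s t * (exp (- (1 / (4 * t))) / (m * sqrt t ^ n))) \<le> norm ((C / m) * (lweight s t * min 1 t))" (is "AE t in _. ?P t")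
  proof (intro AE_I2)
   fix t :: real
   show "?P t"
   proof (cases "t > 0")
    case True
    have "lweight s t * (exp (- (1 / (4 * t))) / sqrt t ^ n) / m \<le> lweight s t * (C * min 1 t) / m"
     using m bound [OF True] by (intro divide_right_mono mult_left_mono lweight_nonneg) auto
    then show ?thesis using True m C lweight_nonneg [of s t] by (simp add: abs_mult mult_ac)
   qed (simp add: lweight_def)
  qed
 qed measurable
 then show ?thesis unfolding m_def n_def .
qed

lemma mix_const_pos:
 assumes s: "0 < s" "s < 1"
 shows "mix_const TYPE('a::euclidean_space) s > 0"
proof -
 let ?k = "\<lambda>t. lweight s t * (exp (- (1 / (4 * t))) / (gauss_mass TYPE('a) * sqrt t ^ DIM('a)))"
 have nonneg: "0 \<le> ?k t" for t
 proof (cases "t > 0")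
  case True
  then show ?thesis
   using lweight_nonneg [of s t] gauss_mass_pos [where 'a = 'a] by simp
 qed (simp add: lweight_def)
 have "mix_const TYPE('a) s \<noteq> 0"
 proof
  assume "mix_const TYPE('a) s = 0"
  then have "AE t in lborel. ?k t = 0"
   unfolding mix_const_def using nonneg
   by (subst (asm) integral_nonneg_eq_0_iff_AE [OF integrable_mix [OF s]]) auto
  then have "AE t in lborel. t \<notin> {0<..<1::real}"
  proof eventually_elim
   case (elim t)
   then show ?case using gauss_mass_pos [where 'a = 'a] by (auto simp: lweight_def)
  qed
  then have "emeasure lborel {0<..<1::real} = 0"
   by (subst (asm) AE_iff_measurable [where N = "{0<..<1}"]) auto
  then show False by simp
 qed
 moreover have "mix_const TYPE('a) s \<ge> 0"
  unfolding mix_const_def by (rule integral_nonneg) (rule nonneg)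
 ultimately show ?thesis by simp
qed

text \<open>The substitution of |h|^2 t for t moves all dependence on h into the factor |h|^(-2s)
  |h|^(-n), and the remaining integral is \<open>mix_const\<close>.\<close>

lemma nn_integral_lweight_gker:
 fixes h :: "'a::euclidean_space"
 assumes s: "0 < s" "s < 1" and h: "h \<noteq> 0"
 shows "(\<integral>\<^sup>+t. ennreal (lweight s t * gker t h) \<partial>lborel) = ennreal (mix_const TYPE('a) s * rker s h)"
proof -
 let ?k = "\<lambda>t. lweight s t * (exp (- (1 / (4 * t))) / (gauss_mass TYPE('a) * sqrt t ^ DIM('a)))"
 define r where "r = norm h"
 have r: "r > 0" using h by (simp add: r_def)
 have nonneg: "0 \<le> ?k t" for t
 proof (cases "t > 0")
  case True
  then show ?thesis
   using lweight_nonneg [of s t] gauss_mass_pos [where 'a = 'a] by simp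
 qed (simp add: lweight_def)
 have scale: "r^2 * (lweight s (r^2 * t) * gker (r^2 * t) h) = rker s h * ?k t" for t
 proof (cases "t > 0")
  case True
  have lw: "r^2 * lweight s (r^2 * t) = r powr (- 2 * s) * lweight s t"
  proof -
   have "(r^2 * t) powr (- 1 - s) = (r powr 2) powr (- 1 - s) * t powr (- 1 - s)"
    using r True by (simp add: powr_mult)
   also have "... = r powr (- 2 - 2 * s) * t powr (- 1 - s)"
    by (simp only: powr_powr) (simp add: algebra_simps)
   finally have "r^2 * (r^2 * t) powr (- 1 - s) = (r powr 2 * r powr (- 2 - 2 * s)) * t powr (- 1 - s)"
    using r by simp
   also have "r powr 2 * r powr (- 2 - 2 * s) = r powr (- 2 * s)"
    by (simp only: powr_add [symmetric]) simp
   finally show ?thesis using r True by (simp add: lweight_def)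
  qed
  have gk: "gker (r^2 * t) h = exp (- (1 / (4 * t))) / (gauss_mass TYPE('a) * sqrt t ^ DIM('a)) * r powr (- real DIM('a))"
  proof -
   have e1: "r^2 / (4 * (r^2 * t)) = 1 / (4 * t)" using r by simp
   have e2: "sqrt (r^2 * t) ^ DIM('a) = r ^ DIM('a) * sqrt t ^ DIM('a)"
    using r by (simp add: real_sqrt_mult power_mult_distrib)
   have e3: "r powr (- real DIM('a)) = 1 / r ^ DIM('a)"
    using r by (simp add: powr_minus_divide powr_realpow)
   show ?thesis unfolding gker_def r_def [symmetric] e1 e2 e3 by simp
  qed
  have "r powr (- 2 * s) * r powr (- real DIM('a)) = r powr (- (real DIM('a) + 2 * s))"
   by (simp only: powr_add [symmetric]) (simp add: algebra_simps)
  also have "... = rker s h" by (simp only: rker_def r_def [symmetric] powr_minus_divide)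
  finally have rk: "r powr (- 2 * s) * r powr (- real DIM('a)) = rker s h" .
  have "r^2 * (lweight s (r^2 * t) * gker (r^2 * t) h) = (r^2 * lweight s (r^2 * t)) * gker (r^2 * t) h"
   by (rule mult.assoc [symmetric])
  also have "... = (r powr (- 2 * s) * r powr (- real DIM('a))) * ?k t"
   unfolding lw gk by (simp only: mult_ac)
  finally show ?thesis unfolding rk .
 qed (use r in \<open>simp add: lweight_def zero_less_mult_iff\<close>)
 have "(\<integral>\<^sup>+t. ennreal (lweight s t * gker t h) \<partial>lborel) =
   ennreal \<bar>r^2\<bar> * (\<integral>\<^sup>+t. ennreal (lweight s (0 + r^2 * t) * gker (0 + r^2 * t) h) \<partial>lborel)"
  using r by (intro nn_integral_real_affine) auto
 also have "... = (\<integral>\<^sup>+t. ennreal (r^2 * (lweight s (r^2 * t) * gker (r^2 * t) h)) \<partial>lborel)"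
  using r by (subst nn_integral_cmult [symmetric]) (auto simp: ennreal_mult')
 also have "... = (\<integral>\<^sup>+t. ennreal (rker s h) * ennreal (?k t) \<partial>lborel)"
  by (simp only: scale ennreal_mult' [OF rker_nonneg])
 also have "... = ennreal (rker s h) * (\<integral>\<^sup>+t. ennreal (?k t) \<partial>lborel)"
  by (intro nn_integral_cmult) measurable
 also have "(\<integral>\<^sup>+t. ennreal (?k t) \<partial>lborel) = ennreal (mix_const TYPE('a) s)"
  unfolding mix_const_def by (intro nn_integral_eq_integral integrable_mix s AE_I2 nonneg)
 finally show ?thesis
  by (simp only: mult.commute [of "mix_const TYPE('a) s" "rker s h"] ennreal_mult' [OF rker_nonneg])
qed

lemma AE_lborel_neq: "AE h in lborel. h \<noteq> (c::'a::euclidean_space)"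
 by (rule AE_lborel_singleton)

lemma nn_integral_rker:
 fixes f :: "'a::euclidean_space => real"
 assumes s: "0 < s" "s < 1" and [measurable]: "f \<in> borel_measurable borel" and f: "\<And>h. f h \<ge> 0"
 shows "ennreal (mix_const TYPE('a) s) * (\<integral>\<^sup>+h. ennreal (f h * rker s h) \<partial>lborel) =
  (\<integral>\<^sup>+t. \<integral>\<^sup>+h. ennreal (f h * (lweight s t * gker t h)) \<partial>lborel \<partial>lborel)"
proof -
 have "ennreal (mix_const TYPE('a) s) * (\<integral>\<^sup>+h. ennreal (f h * rker s h) \<partial>lborel) =
   (\<integral>\<^sup>+h. ennreal (f h) * ennreal (mix_const TYPE('a) s * rker s h) \<partial>lborel)"
  using mix_const_pos [OF s, where 'a = 'a] f rker_nonneg [of s]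
  by (subst nn_integral_cmult [symmetric]) (auto simp: ennreal_mult' [symmetric] mult_ac)
 also have "... = (\<integral>\<^sup>+h. ennreal (f h) * (\<integral>\<^sup>+t. ennreal (lweight s t * gker t h) \<partial>lborel) \<partial>lborel)"
  using AE_lborel_neq [of "0::'a"] by (intro nn_integral_cong_AE) (auto simp: nn_integral_lweight_gker [OF s])
 also have "... = (\<integral>\<^sup>+h. \<integral>\<^sup>+t. ennreal (f h * (lweight s t * gker t h)) \<partial>lborel \<partial>lborel)"
  using f by (subst nn_integral_cmult [symmetric]) (auto simp: ennreal_mult' )
 also have "... = (\<integral>\<^sup>+t. \<integral>\<^sup>+h. ennreal (f h * (lweight s t * gker t h)) \<partial>lborel \<partial>lborel)"
  by (rule lborel_pair.Fubini'[symmetric]) measurable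
 finally show ?thesis .
qed

text \<open>Fubini, where the nonnegative case \<open>nn_integral_rker\<close> for |f| supplies the
  joint integrability.\<close>

lemma integral_rker_mixture:
 fixes f :: "'a::euclidean_space => real"
 assumes s: "0 < s" "s < 1" and f: "integrable lborel (\<lambda>h. f h * rker s h)"
  and [measurable]: "f \<in> borel_measurable borel"
 shows "integrable lborel (\<lambda>t. lweight s t * (LBINT h. f h * gker t h))"
  and "mix_const TYPE('a) s * (LBINT h. f h * rker s h) =
   (LBINT t. lweight s t * (LBINT h. f h * gker t h))"
proof -
 let ?F = "\<lambda>(h::'a, t). f h * (lweight s t * gker t h)"
 have lg: "0 \<le> lweight s t * gker t h" for t and h :: 'a
  using lweight_nonneg [of s t] gker_nonneg [of t h] by (cases "t \<ge> 0") (auto simp: lweight_def)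
 have joint: "integrable (lborel \<Otimes>\<^sub>M lborel) ?F"
 proof (rule integrableI_bounded)
  have "(\<integral>\<^sup>+z. ennreal (norm (?F z)) \<partial>(lborel \<Otimes>\<^sub>M lborel)) =
    (\<integral>\<^sup>+t. \<integral>\<^sup>+h. ennreal (\<bar>f h\<bar> * (lweight s t * gker t h)) \<partial>lborel \<partial>lborel)"
  proof -
   have "\<bar>f h * (lweight s t * gker t h)\<bar> = \<bar>f h\<bar> * (lweight s t * gker t h)" for h t
    by (simp only: abs_mult [of "f h"] abs_of_nonneg [OF lg])
   then show ?thesis by (subst lborel_pair.nn_integral_snd [symmetric]) auto
  qed
  also have "... = ennreal (mix_const TYPE('a) s) * (\<integral>\<^sup>+h. ennreal (\<bar>f h\<bar> * rker s h) \<partial>lborel)"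
   by (rule nn_integral_rker [OF s, symmetric]) auto
  also have "... < \<infinity>"
   using f by (auto simp: integrable_iff_bounded abs_mult abs_of_nonneg [OF rker_nonneg] ennreal_mult_less_top)
  finally show "(\<integral>\<^sup>+z. ennreal (norm (?F z)) \<partial>(lborel \<Otimes>\<^sub>M lborel)) < \<infinity>" .
 qed measurable
 have eq: "(LBINT h. f h * (lweight s t * gker t h)) = lweight s t * (LBINT h. f h * gker t h)" for t
  by (simp only: mult.left_commute [of _ "lweight s t"] integral_mult_right_zero)
 show "integrable lborel (\<lambda>t. lweight s t * (LBINT h. f h * gker t h))"
  using lborel_pair.integrable_snd [OF joint] by (simp add: eq)
 have "(LBINT t. lweight s t * (LBINT h. f h * gker t h)) = (LBINT h. LBINT t. f h * (lweight s t * gker t h))"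
  using lborel_pair.Fubini_integral [OF joint] by (simp add: eq)
 also have "... = (LBINT h. mix_const TYPE('a) s * (f h * rker s h))"
 proof (rule integral_cong_AE)
  show "AE h in lborel. (LBINT t. f h * (lweight s t * gker t h)) = mix_const TYPE('a) s * (f h * rker s h)"
   using AE_lborel_neq [of "0::'a"]
  proof eventually_elim
   case (elim h)
   have "(LBINT t. lweight s t * gker t h) = mix_const TYPE('a) s * rker s h"
    using nn_integral_lweight_gker [OF s elim] lg mix_const_pos [OF s, where 'a = 'a] rker_nonneg [of s h]
    by (subst integral_eq_nn_integral) auto
   then show ?case by simp
  qed
 qed measurable
 finally show "mix_const TYPE('a) s * (LBINT h. f h * rker s h) =
   (LBINT t. lweight s t * (LBINT h. f h * gker t h))" by simp
qed

text \<open>Subordination replaces polar coordinates: the average of min 1 |h|^2 under the heat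
  kernel is at most (C + 1) min 1 t, by the second moment for t \<le> 1 and by the total mass
  otherwise, and this is integrable against \<open>lweight\<close>.\<close>

lemma integrable_min_rker:
 assumes s: "0 < s" "s < 1"
 shows "integrable lborel (\<lambda>h::'a::euclidean_space. min 1 ((norm h)^2) * rker s h)"
proof (rule integrableI_nonneg)
 obtain C where C: "C \<ge> 0" "\<And>t. 0 < t ==> t \<le> 1 ==> (LBINT (z::'a). (norm z)^2 * (1 + norm z) ^ 0 * gker t z) \<le> C * t"
  using gker_second_moment [where p = 0 and 'a = 'a] by blast
 have inner: "(\<integral>\<^sup>+h. ennreal (min 1 ((norm h)^2) * (lweight s t * gker t (h::'a))) \<partial>lborel) \<le> ennreal ((C + 1) * (lweight s t * min 1 t))" for t
 proof (cases "t > 0")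
  case True
  have int: "integrable lborel (\<lambda>h::'a. min 1 ((norm h)^2) * gker t h)"
   by (rule integrable_bound [OF integrable_gker [OF True]])
     (use gker_nonneg [of t, where 'a = 'a] True in \<open>auto simp: abs_mult intro!: mult_left_le_one_le\<close>)
  have "(LBINT (h::'a). min 1 ((norm h)^2) * gker t h) \<le> (C + 1) * min 1 t"
  proof (cases "t \<le> 1")
   case t1: True
   have "(LBINT (h::'a). min 1 ((norm h)^2) * gker t h) \<le> (LBINT (h::'a). (norm h)^2 * (1 + norm h) ^ 0 * gker t h)"
   proof (rule integral_mono')
    show "integrable lborel (\<lambda>h::'a. (norm h)^2 * (1 + norm h) ^ 0 * gker t h)"
    proof (rule integrable_bound [OF integrable_power_gker [OF True, of 2]])
     show "AE h::'a in lborel. norm ((norm h)^2 * (1 + norm h) ^ 0 * gker t h) \<le> norm ((1 + norm h)^2 * gker t h)"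
      using gker_nonneg [of t, where 'a = 'a] True
      by (intro AE_I2) (auto simp: abs_mult intro!: mult_right_mono power_mono)
    qed measurable
   qed (use gker_nonneg [of t, where 'a = 'a] True in \<open>auto intro!: mult_right_mono\<close>)
   also have "... \<le> C * t" using C(2) [OF True t1] .
   finally show ?thesis using t1 True by (simp add: algebra_simps)
  next
   case False
   have "(LBINT (h::'a). min 1 ((norm h)^2) * gker t h) \<le> (LBINT (h::'a). gker t h)"
    by (intro integral_mono' integrable_gker True)
      (use gker_nonneg [of t, where 'a = 'a] True in \<open>auto intro!: mult_left_le_one_le\<close>)
   then show ?thesis using False C True by (simp add: integral_gker)
  qed
  then have "lweight s t * (LBINT (h::'a). min 1 ((norm h)^2) * gker t h) \<le> lweight s t * ((C + 1) * min 1 t)"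
   by (rule mult_left_mono [OF _ lweight_nonneg])
  also have "... = (C + 1) * (lweight s t * min 1 t)" by simp
  finally have "lweight s t * (LBINT (h::'a). min 1 ((norm h)^2) * gker t h) \<le> (C + 1) * (lweight s t * min 1 t)" .
  moreover have "(\<integral>\<^sup>+h. ennreal (min 1 ((norm h)^2) * (lweight s t * gker t (h::'a))) \<partial>lborel) =
    ennreal (LBINT (h::'a). lweight s t * (min 1 ((norm h)^2) * gker t h))"
   using gker_nonneg [of t, where 'a = 'a] True
   unfolding mult.left_commute [of _ "lweight s t"]
   by (intro nn_integral_eq_integral integrable_mult_right int AE_I2 mult_nonneg_nonneg lweight_nonneg) auto
  ultimately show ?thesis by (simp add: ennreal_leI)
 qed (simp add: lweight_def)
 have "ennreal (mix_const TYPE('a) s) * (\<integral>\<^sup>+h. ennreal (min 1 ((norm h)^2) * rker s (h::'a)) \<partial>lborel) =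
  (\<integral>\<^sup>+t. \<integral>\<^sup>+h. ennreal (min 1 ((norm h)^2) * (lweight s t * gker t (h::'a))) \<partial>lborel \<partial>lborel)"
  by (rule nn_integral_rker [OF s]) auto
 also have "... \<le> (\<integral>\<^sup>+t. ennreal ((C + 1) * (lweight s t * min 1 t)) \<partial>lborel)"
  by (intro nn_integral_mono inner)
 also have "... < \<infinity>"
 proof -
  have "integrable lborel (\<lambda>t. (C + 1) * (lweight s t * min 1 t))"
   by (intro integrable_mult_right integrable_lweight s)
  moreover have "AE t in lborel. 0 \<le> (C + 1) * (lweight s t * min 1 t)"
   using C by (intro AE_I2) (auto simp: lweight_def)
  ultimately show ?thesis by (simp add: nn_integral_eq_integral)
 qed
 finally show "(\<integral>\<^sup>+h. ennreal (min 1 ((norm h)^2) * rker s (h::'a)) \<partial>lborel) < \<infinity>"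
  using mix_const_pos [OF s, where 'a = 'a] by (auto simp: ennreal_mult_less_top)
qed (auto simp: rker_nonneg)

section \<open>The fractional Laplacian and mollification\<close>

text \<open>The fractional Laplacian without principal value: pairing h with - h cancels the
  first-order term, so the integral converges absolutely as soon as second differences are of order
  |h|^2. Its truncation \<open>tflap\<close> makes sense for every bounded measurable
  function.\<close>

definition flap :: "real => ('a::euclidean_space => real) => 'a => real" where
 "flap s f x = (LBINT h. sdiff f x h * rker s h) / 2"

definition tflap :: "real => real => ('a::euclidean_space => real) => 'a => real" where
 "tflap s e f x = (LBINT h. indicator (- ball 0 e) h * ((f x - f (x + h)) * rker s h))"

lemma sdiff_measurable [measurable]:
 fixes f :: "'a::euclidean_space => real"
 assumes [measurable]: "f \<in> borel_measurable borel"
 shows "sdiff f x \<in> borel_measurable borel"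
 unfolding sdiff_def [abs_def] by measurable

lemma tflap_eq_sdiff:
 fixes f :: "'a::euclidean_space => real"
 assumes "integrable lborel (\<lambda>h. indicator (- ball 0 e) h * ((f x - f (x + h)) * rker s h))"
 shows "tflap s e f x = (LBINT h. indicator (- ball 0 e) h * (sdiff f x h * rker s h)) / 2"
proof -
 let ?I = "\<lambda>h::'a. indicator (- ball 0 e) h * ((f x - f (x + h)) * rker s h)"
 have ind: "indicator (- ball 0 e) (0 - h) = (indicator (- ball 0 e) h :: real)" for h :: 'a
  by (simp add: indicator_def)
 have "tflap s e f x + tflap s e f x = (LBINT h. ?I h) + (LBINT h. ?I (0 - h))"
  unfolding tflap_def by (subst integral_lborel_reflect) simp
 also have "... = (LBINT h. ?I h + ?I (0 - h))"
  by (rule integral_add [symmetric])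
    (use assms in \<open>auto simp: integrable_lborel_reflect_iff [of ?I 0, simplified]\<close>)
 also have "... = (LBINT h. indicator (- ball 0 e) h * (sdiff f x h * rker s h))"
  unfolding ind by (intro integral_cong) (auto simp: sdiff_def rker_minus algebra_simps)
 finally show ?thesis by simp
qed

lemma tflap_tendsto_flap:
 fixes f :: "'a::euclidean_space => real"
 assumes I: "\<And>e. e > 0 ==> integrable lborel (\<lambda>h. indicator (- ball 0 e) h * ((f x - f (x + h)) * rker s h))"
  and S: "integrable lborel (\<lambda>h. sdiff f x h * rker s h)"
 shows "((\<lambda>e. tflap s e f x) \<longlongrightarrow> flap s f x) (at_right 0)"
 unfolding tendsto_at_iff_sequentially
proof (intro allI impI)
 fix X :: "nat => real"
 assume pos: "\<forall>i. X i \<in> {0<..} - {0}" and X: "X \<longlonglongrightarrow> 0"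
 have [measurable]: "(\<lambda>h. sdiff f x h * rker s h) \<in> borel_measurable lborel" using S by auto
 have "(\<lambda>i. LBINT h. indicator (- ball 0 (X i)) h * (sdiff f x h * rker s h))
   \<longlonglongrightarrow> (LBINT h. sdiff f x h * rker s h)"
 proof (rule integral_dominated_convergence [where w = "\<lambda>h. \<bar>sdiff f x h * rker s h\<bar>"])
  show "integrable lborel (\<lambda>h. \<bar>sdiff f x h * rker s h\<bar>)" using S by simp
  show "AE h in lborel. (\<lambda>i. indicator (- ball 0 (X i)) h * (sdiff f x h * rker s h)) \<longlonglongrightarrow> sdiff f x h * rker s h"
   using AE_lborel_neq [of "0::'a"]
  proof eventually_elim
   case (elim h)
   have "\<forall>\<^sub>F i in sequentially. X i < norm h"
    using X elim by (intro order_tendstoD) auto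
   then have "\<forall>\<^sub>F i in sequentially. indicator (- ball 0 (X i)) h * (sdiff f x h * rker s h) = sdiff f x h * rker s h"
    by eventually_elim (simp add: indicator_def)
   then show ?case by (rule tendsto_eventually)
  qed
  show "\<And>i. AE h in lborel. norm (indicator (- ball 0 (X i)) h * (sdiff f x h * rker s h)) \<le> \<bar>sdiff f x h * rker s h\<bar>"
   by (intro AE_I2) (simp add: indicator_def)
 qed measurable
 then have "(\<lambda>i. (LBINT h. indicator (- ball 0 (X i)) h * (sdiff f x h * rker s h)) / 2) \<longlonglongrightarrow> flap s f x"
  unfolding flap_def by (intro tendsto_divide tendsto_const) auto
 moreover have "(\<lambda>i. (LBINT h. indicator (- ball 0 (X i)) h * (sdiff f x h * rker s h)) / 2) = (\<lambda>e. tflap s e f x) \<circ> X"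
  by (rule ext) (use pos in \<open>simp add: tflap_eq_sdiff [OF I]\<close>)
 ultimately show "((\<lambda>e. tflap s e f x) \<circ> X) \<longlonglongrightarrow> flap s f x" by (simp only:)
qed

text \<open>The values c = 1 and c = - 1 give the positive and the negative part, rewritten as Borel
  integrals over the increment h.\<close>

lemma frac_part_eq_aux:
 fixes v :: "real ^ 'n => real" and c :: real
 assumes [measurable]: "v \<in> borel_measurable borel"
 shows "(\<integral>\<^sup>+ y \<in> - ball x e. ennreal (c * ((v x - v y) / norm (x - y) powr (real CARD('n) + 2 * s))) \<partial>lebesgue)
  = (\<integral>\<^sup>+h. ennreal (indicator (- ball 0 e) h * (c * ((v x - v (x + h)) * rker s h))) \<partial>lborel)"
proof -
 have "(\<integral>\<^sup>+ y \<in> - ball x e. ennreal (c * ((v x - v y) / norm (x - y) powr (real CARD('n) + 2 * s))) \<partial>lebesgue)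
  = (\<integral>\<^sup>+ y. ennreal (c * ((v x - v y) / norm (x - y) powr (real CARD('n) + 2 * s))) * indicator (- ball x e) y \<partial>lborel)"
  by (rule nn_integral_completion)
 also have "... = ennreal (\<bar>1\<bar> ^ DIM(real ^ 'n)) *
   (\<integral>\<^sup>+ h. ennreal (c * ((v x - v (x + 1 *\<^sub>R h)) / norm (x - (x + 1 *\<^sub>R h)) powr (real CARD('n) + 2 * s))) * indicator (- ball x e) (x + 1 *\<^sub>R h) \<partial>lborel)"
  by (rule nn_integral_lborel_affine) (auto intro!: borel_measurable_times)
 also have "... = (\<integral>\<^sup>+h. ennreal (indicator (- ball 0 e) h * (c * ((v x - v (x + h)) * rker s h))) \<partial>lborel)"
 proof (simp, intro nn_integral_cong)
  fix h
  have "indicator (- ball x e) (x + h) = (indicator (- ball 0 e) h :: ennreal)"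
   by (simp add: indicator_def dist_norm)
  then show "ennreal (c * (v x - v (x + h)) / norm h powr (real CARD('n) + 2 * s)) * indicator (- ball x e) (x + h) =
    ennreal (indicator (- ball 0 e) h * (c * ((v x - v (x + h)) * rker s h)))"
   by (auto simp: rker_def indicator_def)
 qed
 finally show ?thesis .
qed

lemma frac_pos_part_eq:
 fixes v :: "real ^ 'n => real"
 assumes "v \<in> borel_measurable borel"
 shows "frac_pos_part s v x e = (\<integral>\<^sup>+h. ennreal (indicator (- ball 0 e) h * ((v x - v (x + h)) * rker s h)) \<partial>lborel)"
 using frac_part_eq_aux [OF assms, where c = 1] by (simp add: frac_pos_part_def)

lemma frac_neg_part_eq:
 fixes v :: "real ^ 'n => real"
 assumes "v \<in> borel_measurable borel"
 shows "frac_neg_part s v x e = (\<integral>\<^sup>+h. ennreal (- (indicator (- ball 0 e) h * ((v x - v (x + h)) * rker s h))) \<partial>lborel)"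
 using frac_part_eq_aux [OF assms, where c = "- 1", of x s e]
 unfolding frac_neg_part_def by (simp only: mult_minus1 mult_minus_right)

lemma frac_parts_eq_tflap:
 fixes v :: "real ^ 'n => real"
 assumes "v \<in> borel_measurable borel"
  and I: "integrable lborel (\<lambda>h. indicator (- ball 0 e) h * ((v x - v (x + h)) * rker s h))"
 shows "frac_pos_part s v x e < \<infinity>" "frac_neg_part s v x e < \<infinity>"
  "enn2ereal (frac_pos_part s v x e) - enn2ereal (frac_neg_part s v x e) = ereal (tflap s e v x)"
proof -
 let ?I = "\<lambda>h. indicator (- ball 0 e) h * ((v x - v (x + h)) * rker s h)"
 have "(\<integral>\<^sup>+h. ennreal (?I h) \<partial>lborel) \<le> (\<integral>\<^sup>+h. ennreal (norm (?I h)) \<partial>lborel)"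
  by (intro nn_integral_mono ennreal_leI) simp
 also have "... < \<infinity>" using I unfolding integrable_iff_bounded by blast
 finally show p: "frac_pos_part s v x e < \<infinity>" by (simp add: frac_pos_part_eq assms)
 have "(\<integral>\<^sup>+h. ennreal (- ?I h) \<partial>lborel) \<le> (\<integral>\<^sup>+h. ennreal (norm (?I h)) \<partial>lborel)"
  by (intro nn_integral_mono ennreal_leI) simp
 also have "... < \<infinity>" using I unfolding integrable_iff_bounded by blast
 finally show n: "frac_neg_part s v x e < \<infinity>" by (simp add: frac_neg_part_eq assms)
 have "tflap s e v x = enn2real (frac_pos_part s v x e) - enn2real (frac_neg_part s v x e)"
  unfolding tflap_def using real_lebesgue_integral_def [OF I]
  by (simp add: frac_pos_part_eq frac_neg_part_eq assms)
 moreover obtain a where "frac_pos_part s v x e = ennreal a" "a \<ge> 0"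
  using p by (cases "frac_pos_part s v x e") auto
 moreover obtain b where "frac_neg_part s v x e = ennreal b" "b \<ge> 0"
  using n by (cases "frac_neg_part s v x e") auto
 ultimately show "enn2ereal (frac_pos_part s v x e) - enn2ereal (frac_neg_part s v x e) = ereal (tflap s e v x)"
  by (simp add: enn2ereal_ennreal)
qed

lemma has_frac_laplacian_flap:
 fixes v :: "real ^ 'n => real"
 assumes v: "v \<in> borel_measurable borel"
  and I: "\<And>e. e > 0 ==> integrable lborel (\<lambda>h. indicator (- ball 0 e) h * ((v x - v (x + h)) * rker s h))"
  and S: "integrable lborel (\<lambda>h. sdiff v x h * rker s h)"
 shows "has_frac_laplacian s v x (ereal (flap s v x))"
 unfolding has_frac_laplacian_def
proof (intro conjI allI impI)
 fix e :: real assume "e > 0"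
 then show "frac_pos_part s v x e < \<infinity> \<or> frac_neg_part s v x e < \<infinity>"
  using frac_parts_eq_tflap(1) [OF v I] by simp
next
 have "((\<lambda>e. ereal (tflap s e v x)) \<longlongrightarrow> ereal (flap s v x)) (at_right 0)"
  using tflap_tendsto_flap [OF I S] by (rule tendsto_ereal)
 moreover have "\<forall>\<^sub>F e in at_right 0. ereal (tflap s e v x) = enn2ereal (frac_pos_part s v x e) - enn2ereal (frac_neg_part s v x e)"
  unfolding eventually_at_filter using frac_parts_eq_tflap(3) [OF v I] by (auto intro!: always_eventually)
 ultimately show "((\<lambda>e. enn2ereal (frac_pos_part s v x e) - enn2ereal (frac_neg_part s v x e)) \<longlongrightarrow> ereal (flap s v x)) (at_right 0)"
  by (rule Lim_transform_eventually)
qed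

text \<open>Off the ball (1 + 1/e^2) min 1 |h|^2 is at least 1, so a bounded function is dominated
  by a multiple of min 1 |h|^2.\<close>

lemma integrable_off_ball:
 fixes f :: "'a::euclidean_space => real"
 assumes s: "0 < s" "s < 1" and e: "e > 0"
  and [measurable]: "f \<in> borel_measurable borel" and B: "\<And>h. \<bar>f h\<bar> \<le> B"
 shows "integrable lborel (\<lambda>h. indicator (- ball 0 e) h * (f h * rker s h))"
proof (rule integrable_bound)
 show "integrable lborel (\<lambda>h::'a. (B * (1 + 1 / e^2)) * (min 1 ((norm h)^2) * rker s h))"
  by (intro integrable_mult_right integrable_min_rker s)
 show "AE h in lborel. norm (indicator (- ball 0 e) h * (f h * rker s h)) \<le> norm ((B * (1 + 1 / e^2)) * (min 1 ((norm h)^2) * rker s h))" (is "AE h in _. ?P h")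
 proof (intro AE_I2)
  fix h :: 'a
  have B0: "0 \<le> B" using B [of h] by linarith
  show "?P h"
  proof (cases "norm h < e")
   case False
   have "1 \<le> (1 + 1 / e^2) * min 1 ((norm h)^2)"
   proof (cases "(norm h)^2 \<le> 1")
    case True
    have "e^2 \<le> (norm h)^2" using False e by (intro power_mono) auto
    then have "1 \<le> (1 / e^2) * (norm h)^2" using e by (simp add: field_simps)
    moreover have "(1 + 1 / e^2) * min 1 ((norm h)^2) = (norm h)^2 + (1 / e^2) * (norm h)^2"
     using True by (simp add: distrib_right)
    ultimately show ?thesis using zero_le_power2 [of "norm h"] by linarith
   qed (use e in auto)
   from mult_left_mono [OF this B0]
   have "\<bar>f h\<bar> \<le> B * ((1 + 1 / e^2) * min 1 ((norm h)^2))"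
    using B [of h] by linarith
   then have "\<bar>f h\<bar> * rker s h \<le> B * ((1 + 1 / e^2) * min 1 ((norm h)^2)) * rker s h"
    by (rule mult_right_mono [OF _ rker_nonneg])
   also have "... = (B * (1 + 1 / e^2)) * (min 1 ((norm h)^2) * rker s h)" by (simp only: mult.assoc)
   also have "... \<le> norm ..." by simp
   finally show ?thesis using False by (simp add: abs_mult abs_of_nonneg [OF rker_nonneg])
  qed simp
 qed
qed measurable

lemma integrable_near_0:
 fixes f :: "'a::euclidean_space => real"
 assumes s: "0 < s" "s < 1"
  and [measurable]: "f \<in> borel_measurable borel" and B: "\<And>h. \<bar>f h\<bar> \<le> C * min 1 ((norm h)^2)"
 shows "integrable lborel (\<lambda>h. f h * rker s h)"
proof (rule integrable_bound)
 show "integrable lborel (\<lambda>h::'a. C * (min 1 ((norm h)^2) * rker s h))"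
  by (intro integrable_mult_right integrable_min_rker s)
 show "AE h in lborel. norm (f h * rker s h) \<le> norm (C * (min 1 ((norm h)^2) * rker s h))" (is "AE h in _. ?P h")
 proof (intro AE_I2)
  fix h :: 'a
  have "norm (f h * rker s h) = \<bar>f h\<bar> * rker s h" by (simp add: abs_mult abs_of_nonneg [OF rker_nonneg])
  also have "... \<le> (C * min 1 ((norm h)^2)) * rker s h" by (intro mult_right_mono B rker_nonneg)
  also have "... \<le> norm (C * (min 1 ((norm h)^2) * rker s h))" by (simp add: mult.assoc)
  finally show "?P h" .
 qed
qed measurable

lemma integral_sdiff_gker:
 fixes v :: "'a::euclidean_space => real"
 assumes t: "t > 0" and [measurable]: "v \<in> borel_measurable borel" and B: "\<And>y. \<bar>v y\<bar> \<le> B"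
 shows "(LBINT h. sdiff v x h * gker t h) = 2 * (v x - (LBINT z. v (x + z) * gker t z))"
proof -
 have i: "integrable lborel (\<lambda>z. v (x + c *\<^sub>R z) * gker t z)" for c
 proof (rule integrable_bound)
  show "integrable lborel (\<lambda>z::'a. B * gker t z)" by (intro integrable_mult_right integrable_gker t)
  show "AE z in lborel. norm (v (x + c *\<^sub>R z) * gker t z) \<le> norm (B * gker t z)"
   using B gker_nonneg [of t, where 'a = 'a] t
   by (intro AE_I2) (auto simp: abs_mult intro!: mult_right_mono intro: order.trans [OF B])
 qed measurable
 have r: "(LBINT z. v (x - z) * gker t z) = (LBINT z. v (x + z) * gker t z)"
  using integral_lborel_reflect [of "\<lambda>z. v (x + z) * gker t z" 0] by (simp add: gker_minus)
 have "(LBINT h. sdiff v x h * gker t h) = (LBINT h. 2 * v x * gker t h - v (x + h) * gker t h - v (x - h) * gker t h)"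
  by (intro integral_cong) (auto simp: sdiff_def algebra_simps)
 also have "... = 2 * v x * (LBINT h. gker t (h::'a)) - (LBINT z. v (x + z) * gker t z) - (LBINT z. v (x - z) * gker t z)"
  using i [of 1] i [of "-1"] integrable_gker [OF t, where 'a = 'a] by simp
 also have "... = 2 * (v x - (LBINT z. v (x + z) * gker t z))"
  using t by (simp add: r integral_gker)
 finally show ?thesis .
qed

text \<open>Bochner's formula for the operator: a multiple of the fractional Laplacian is the
  integral over t of v minus its heat evolution, with weight t^(-1-s). It follows from subordination
  applied to the second difference, which is twice v x minus its heat average after the even kernel
  identifies h with - h.\<close>

lemma flap_mixture:
 fixes v :: "'a::euclidean_space => real"
 assumes s: "0 < s" "s < 1" and [measurable]: "v \<in> borel_measurable borel" and B: "\<And>y. \<bar>v y\<bar> \<le> B"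
  and C: "\<And>h. \<bar>sdiff v x h\<bar> \<le> C * min 1 ((norm h)^2)"
 shows "integrable lborel (\<lambda>t. lweight s t * (v x - (LBINT z. v (x + z) * gker t z)))"
  and "mix_const TYPE('a) s * flap s v x = (LBINT t. lweight s t * (v x - (LBINT z. v (x + z) * gker t z)))"
proof -
 have S: "integrable lborel (\<lambda>h. sdiff v x h * rker s h)"
  by (rule integrable_near_0 [OF s _ C]) measurable
 have eq: "lweight s t * (LBINT h. sdiff v x h * gker t h) = 2 * (lweight s t * (v x - (LBINT z. v (x + z) * gker t z)))" for t
  using integral_sdiff_gker [of t v B x] B by (cases "t > 0") (simp_all add: lweight_def)
 note mix = integral_rker_mixture [OF s S sdiff_measurable]
 have "integrable lborel (\<lambda>t. (1/2) * (2 * (lweight s t * (v x - (LBINT z. v (x + z) * gker t z)))))"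
  using mix(1) by (intro integrable_mult_right) (simp add: eq)
 then show "integrable lborel (\<lambda>t. lweight s t * (v x - (LBINT z. v (x + z) * gker t z)))" by simp
 have "2 * (mix_const TYPE('a) s * flap s v x) = mix_const TYPE('a) s * (LBINT h. sdiff v x h * rker s h)"
  by (simp add: flap_def)
 also have "... = 2 * (LBINT t. lweight s t * (v x - (LBINT z. v (x + z) * gker t z)))"
  using mix(2) by (simp add: eq)
 finally show "mix_const TYPE('a) s * flap s v x = (LBINT t. lweight s t * (v x - (LBINT z. v (x + z) * gker t z)))"
  by simp
qed

section \<open>A compactly supported mollifier\<close>

text \<open>The cube of a positive part is already twice continuously differentiable, and its second
  differences have elementary bounds. The mass is not normalised, so the estimates carry the
  integral of \<open>bump r\<close> along.\<close>

definition bump :: "real => 'a::euclidean_space => real" where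
 "bump r z = (max 0 (1 - (norm z / r)^2)) ^ 3"

lemma bump_nonneg: "bump r z \<ge> 0" by (simp add: bump_def)

lemma bump_le_1: "bump r z \<le> 1"
 unfolding bump_def by (rule power_le_one) auto

lemma bump_eq_0: "0 < r ==> r \<le> norm z ==> bump r z = 0"
proof -
 assume "0 < r" "r \<le> norm z"
 then have "1 \<le> (norm z / r)^2" by (intro one_le_power) simp
 then show ?thesis by (simp add: bump_def max_absorb1)
qed

lemma bump_measurable [measurable]: "bump r \<in> borel_measurable borel"
 unfolding bump_def by measurable

lemma integrable_bump: "0 < r ==> integrable lborel (bump r :: 'a::euclidean_space => real)"
proof (rule integrable_bound)
 show "integrable lborel (indicator (ball (0::'a) r) :: 'a => real)"
  using emeasure_lborel_ball_finite [of "0::'a" r] by simp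
 show "0 < r ==> AE z::'a in lborel. norm (bump r z) \<le> norm (indicator (ball (0::'a) r) z :: real)"
  by (intro AE_I2) (auto simp: indicator_def bump_le_1 bump_nonneg bump_eq_0 abs_of_nonneg)
qed measurable

lemma integral_bump_pos: "0 < r ==> (LBINT z. bump r (z::'a::euclidean_space)) > 0"
proof -
 assume r: "0 < r"
 have "(LBINT z. bump r (z::'a)) \<noteq> 0"
 proof
  assume "(LBINT z. bump r (z::'a)) = 0"
  then have "AE z::'a in lborel. bump r z = 0"
   using integral_nonneg_eq_0_iff_AE [OF integrable_bump [OF r, where 'a = 'a]] by (simp add: bump_nonneg)
  then have "AE z::'a in lborel. z \<notin> ball 0 r"
  proof eventually_elim
   case (elim z)
   then have "\<not> (norm z / r)^2 < 1" by (auto simp: bump_def max_def split: if_splits)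
   then show ?case using r by (auto simp: power_less_one_iff abs_square_less_1)
  qed
  then have "emeasure lborel (ball (0::'a) r) = 0"
   by (subst (asm) AE_iff_measurable [where N = "ball 0 r"]) auto
  then have "measure lebesgue (ball (0::'a) r) = 0" by (simp add: measure_def)
  then show False using content_ball_pos [OF r, of "0::'a"] by simp
 qed
 moreover have "(LBINT z. bump r (z::'a)) \<ge> 0" by (simp add: bump_nonneg)
 ultimately show ?thesis by simp
qed

text \<open>First-order Taylor expansion of the cubed positive part. Below 1 its second derivative
  is at most 6, and half of this is the constant 3.\<close>

lemma cube_positive_part_taylor:
 fixes a b :: real
 assumes "a \<le> 1" "b \<le> 1"
 shows "\<bar>(max 0 b) ^ 3 - (max 0 a) ^ 3 - 3 * (max 0 a)^2 * (b - a)\<bar> \<le> 3 * (b - a)^2"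
proof -
 consider "a \<ge> 0" "b \<ge> 0" | "a \<ge> 0" "b < 0" | "a < 0" "b \<ge> 0" | "a < 0" "b < 0" by linarith
 then show ?thesis
 proof cases
  case 1
  have "b ^ 3 - a ^ 3 - 3 * a^2 * (b - a) = (b - a)^2 * (b + 2 * a)"
   by (simp add: power2_eq_square power3_eq_cube algebra_simps)
  moreover have "(b - a)^2 * (b + 2 * a) \<le> (b - a)^2 * 3"
   using assms by (intro mult_left_mono) auto
  moreover have "0 \<le> (b - a)^2 * (b + 2 * a)" using 1 by simp
  ultimately show ?thesis using 1 by (simp add: max_def)
 next
  case 2
  have e: "- (a ^ 3) - 3 * a^2 * (b - a) = a * (a * (2 * a - 3 * b))"
   by (simp add: power2_eq_square power3_eq_cube algebra_simps)
  have "a * (a * (2 * a - 3 * b)) \<le> 1 * (a * (2 * a - 3 * b))"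
   using assms 2 by (intro mult_right_mono) auto
  also have "... \<le> (a - b) * (3 * (a - b))"
   using 2 by (simp only: mult_1) (intro mult_mono, auto)
  also have "... = 3 * (b - a)^2" by (simp add: power2_eq_square algebra_simps)
  finally have "a * (a * (2 * a - 3 * b)) \<le> 3 * (b - a)^2" .
  moreover have "0 \<le> a * (a * (2 * a - 3 * b))" using 2 by simp
  ultimately show ?thesis using 2 e by (simp add: max_def)
 next
  case 3
  have "b ^ 3 \<le> b ^ 2" using assms 3 by (intro power_decreasing) auto
  also have "... \<le> (b - a)^2" using 3 by (intro power_mono) auto
  finally have "b ^ 3 \<le> 3 * (b - a)^2" by (smt (verit) zero_le_power2)
  then show ?thesis using 3 by (simp add: max_def)
 qed (simp add: max_def)
qed

text \<open>Put q = |z| / r. For q > 1 the trivial bound 2 suffices, and far from the origin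
  everything vanishes. Otherwise the arguments of the positive part move by at most 5 q, so the two
  Taylor errors are at most 3 * 25 q^2 each, and the term of second order adds 6 q^2: together 156
  q^2.\<close>

lemma sdiff_bump_bound:
 fixes y z :: "'a::euclidean_space"
 assumes r: "0 < r"
 shows "\<bar>sdiff (bump r) y z\<bar> \<le> 156 * (norm z / r)^2"
proof -
 define q where "q = norm z / r"
 have q: "q \<ge> 0" using r by (simp add: q_def)
 consider "q > 1" | "q \<le> 1" "norm y > 2 * r" | "q \<le> 1" "norm y \<le> 2 * r" by linarith
 then have "\<bar>sdiff (bump r) y z\<bar> \<le> 156 * q^2"
 proof cases
  case 1
  have "\<bar>sdiff (bump r) y z\<bar> \<le> 2"
   unfolding sdiff_def using bump_nonneg [of r y] bump_nonneg [of r "y + z"] bump_nonneg [of r "y - z"]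
    bump_le_1 [of r y] bump_le_1 [of r "y + z"] bump_le_1 [of r "y - z"] by linarith
  moreover have "1 \<le> q^2" using 1 by (simp add: one_le_power)
  ultimately show ?thesis by linarith
 next
  case 2
  then have "norm z \<le> r" using r by (simp add: q_def)
  then have "norm (y + z) \<ge> r" "norm (y - z) \<ge> r" "norm y \<ge> r"
   using 2 r norm_diff_ineq [of y z] norm_triangle_ineq2 [of y z] by linarith+
  then show ?thesis using r q by (simp add: sdiff_def bump_eq_0)
 next
  case 3
  define A where "A = 1 - (norm y / r)^2"
  define \<beta> where "\<beta> = (y \<bullet> z) / r^2"
  define \<gamma> where "\<gamma> = q^2"
  define P where "P w = (max 0 w) ^ 3" for w :: real
  have b0: "bump r y = P A" by (simp add: bump_def P_def A_def)
  have e1: "1 - (norm (y + z) / r)^2 = A - 2 * \<beta> - \<gamma>"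
  proof -
   have "(norm (y + z))^2 = (norm y)^2 + 2 * (y \<bullet> z) + (norm z)^2"
    by (simp add: power2_norm_eq_inner inner_simps inner_commute)
   then show ?thesis by (simp add: A_def \<beta>_def \<gamma>_def q_def power_divide add_divide_distrib)
  qed
  have e2: "1 - (norm (y - z) / r)^2 = A + 2 * \<beta> - \<gamma>"
  proof -
   have "(norm (y - z))^2 = (norm y)^2 - 2 * (y \<bullet> z) + (norm z)^2"
    by (simp add: power2_norm_eq_inner inner_simps inner_commute)
   then show ?thesis by (simp add: A_def \<beta>_def \<gamma>_def q_def power_divide add_divide_distrib diff_divide_distrib)
  qed
  have le1: "A \<le> 1" "A - 2 * \<beta> - \<gamma> \<le> 1" "A + 2 * \<beta> - \<gamma> \<le> 1"
   unfolding e1 [symmetric] e2 [symmetric] by (simp_all add: A_def)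
  have "\<bar>y \<bullet> z\<bar> \<le> (2 * r) * norm z"
   using Cauchy_Schwarz_ineq2 [of y z] mult_right_mono [OF 3(2), of "norm z"] by simp
  then have "\<bar>\<beta>\<bar> \<le> (2 * r) * norm z / r^2"
   unfolding \<beta>_def abs_divide using r by (simp add: divide_right_mono)
  also have "... = 2 * q" using r by (simp add: q_def power2_eq_square)
  finally have \<beta>: "\<bar>\<beta>\<bar> \<le> 2 * q" .
  have \<gamma>: "0 \<le> \<gamma>" "\<gamma> \<le> q" using 3(1) q by (auto simp: \<gamma>_def power2_eq_square intro: mult_left_le)
  have sq: "(A - 2 * \<beta> - \<gamma> - A)^2 \<le> (5 * q)^2" "(A + 2 * \<beta> - \<gamma> - A)^2 \<le> (5 * q)^2"
   by (subst power2_le_iff_abs_le; use \<beta> \<gamma> q in linarith)+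
  have "\<bar>P (A - 2 * \<beta> - \<gamma>) - P A - 3 * (max 0 A)^2 * (A - 2 * \<beta> - \<gamma> - A)\<bar> \<le> 3 * (5 * q)^2"
   unfolding P_def using sq(1) by (intro order.trans [OF cube_positive_part_taylor [OF le1(1,2)]]) simp
  moreover have "\<bar>P (A + 2 * \<beta> - \<gamma>) - P A - 3 * (max 0 A)^2 * (A + 2 * \<beta> - \<gamma> - A)\<bar> \<le> 3 * (5 * q)^2"
   unfolding P_def using sq(2) by (intro order.trans [OF cube_positive_part_taylor [OF le1(1,3)]]) simp
  moreover have "sdiff (bump r) y z = - (P (A - 2 * \<beta> - \<gamma>) - P A - 3 * (max 0 A)^2 * (A - 2 * \<beta> - \<gamma> - A))
    - (P (A + 2 * \<beta> - \<gamma>) - P A - 3 * (max 0 A)^2 * (A + 2 * \<beta> - \<gamma> - A)) + 6 * ((max 0 A)^2 * \<gamma>)"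
   unfolding sdiff_def b0 by (simp add: bump_def e1 e2 P_def) (simp add: algebra_simps)
  moreover have "(max 0 A)^2 * \<gamma> \<le> 1 * \<gamma>"
   using le1(1) \<gamma> by (intro mult_right_mono power_le_one) auto
  moreover have "0 \<le> (max 0 A)^2 * \<gamma>" using \<gamma> by simp
  moreover have "(5 * q)^2 = 25 * \<gamma>" by (simp add: \<gamma>_def power_mult_distrib)
  ultimately have "\<bar>sdiff (bump r) y z\<bar> \<le> 156 * \<gamma>" by linarith
  then show ?thesis by (simp add: \<gamma>_def)
 qed
 then show ?thesis by (simp add: q_def)
qed

text \<open>The second difference vanishes unless |y| \<le> r + |z|, and there 1 + |y| \<le> (1 + r)
  (1 + |z|). So decay in y of any order L can be bought with growth in z.\<close>

lemma sdiff_bump_weighted: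
 fixes y z :: "'a::euclidean_space"
 assumes r: "0 < r"
 shows "\<bar>sdiff (bump r) y z\<bar> \<le> (156 / r^2 * (1 + r) ^ L) * (norm z)^2 * (1 + norm z) ^ L / (1 + norm y) ^ L"
proof (cases "norm y \<le> r + norm z")
 case True
 have p: "0 < 1 + norm y" by (simp add: add_pos_nonneg)
 have "1 + norm y \<le> (1 + r) * (1 + norm z)"
 proof -
  have "(1 + r) * (1 + norm z) = 1 + r + norm z + r * norm z" by (simp add: algebra_simps)
  moreover have "0 \<le> r * norm z" using r by simp
  ultimately show ?thesis using True by linarith
 qed
 then have "(1 + norm y) ^ L \<le> ((1 + r) * (1 + norm z)) ^ L" by (intro power_mono) auto
 then have "1 \<le> ((1 + r) ^ L * (1 + norm z) ^ L) / (1 + norm y) ^ L"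
  using p by (simp add: power_mult_distrib)
 then have "156 * (norm z / r)^2 * 1 \<le> 156 * (norm z / r)^2 * (((1 + r) ^ L * (1 + norm z) ^ L) / (1 + norm y) ^ L)"
  by (intro mult_left_mono) auto
 then show ?thesis using sdiff_bump_bound [OF r, of y z] by (simp add: power_divide mult_ac)
next
 case False
 then have "norm (y + z) \<ge> r" "norm (y - z) \<ge> r" "norm y \<ge> r"
  using r norm_diff_ineq [of y z] norm_triangle_ineq2 [of y z] norm_ge_zero [of z] by linarith+
 then show ?thesis using r by (simp add: sdiff_def bump_eq_0)
qed

text \<open>For |h| \<le> 1 the weighted bound with the integrable weight of order n + 1 applies;
  for larger h the four translated bumps are integrated separately.\<close>

lemma integral_sdiff_bump:
 assumes r: "0 < r"
 obtains C where "C \<ge> 0" "\<And>h::'a::euclidean_space. integrable lborel (\<lambda>y. sdiff (bump r) y h)"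
  "\<And>h::'a. (LBINT y. \<bar>sdiff (bump r) y h\<bar>) \<le> C * min 1 ((norm h)^2)"
proof -
 define L where "L = DIM('a) + 1"
 define W where "W = (LBINT y. 1 / (1 + norm (y::'a)) ^ L)"
 define I where "I = (LBINT z. bump r (z::'a))"
 define C1 where "C1 = 156 / r^2 * (1 + r) ^ L * 2 ^ L * W"
 have W: "W \<ge> 0" unfolding W_def by simp
 have I: "I > 0" unfolding I_def by (rule integral_bump_pos [OF r])
 have C1: "C1 \<ge> 0" unfolding C1_def using r W by simp
 have b: "integrable lborel (\<lambda>y::'a. bump r (y + h))" for h
  using integrable_lborel_shift_iff [of "bump r" h] integrable_bump [OF r, where 'a = 'a] by (simp add: add.commute)
 have Ib: "(LBINT y. bump r (y + h)) = I" for h :: 'a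
  using integral_lborel_shift [of "bump r" h] by (simp add: add.commute I_def)
 have int: "integrable lborel (\<lambda>y::'a. sdiff (bump r) y h)" for h
  unfolding sdiff_def using b [of h] b [of "- h"] integrable_bump [OF r, where 'a = 'a] by simp
 have le: "(LBINT y. \<bar>sdiff (bump r) y h\<bar>) \<le> (C1 + 4 * I) * min 1 ((norm h)^2)" for h :: 'a
 proof (cases "norm h \<le> 1")
  case True
  have wi: "integrable lborel (\<lambda>y::'a. 1 / (1 + norm y) ^ L)" unfolding L_def by (rule integrable_inverse_power)
  have "(LBINT y. \<bar>sdiff (bump r) y h\<bar>) \<le> (LBINT y. (156 / r^2 * (1 + r) ^ L * 2 ^ L * (norm h)^2) * (1 / (1 + norm (y::'a)) ^ L))"
  proof (rule integral_mono')
   show "integrable lborel (\<lambda>y::'a. (156 / r^2 * (1 + r) ^ L * 2 ^ L * (norm h)^2) * (1 / (1 + norm y) ^ L))"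
    by (intro integrable_mult_right wi)
   fix y :: 'a
   have "(156 / r^2 * (1 + r) ^ L) * (norm h)^2 * (1 + norm h) ^ L / (1 + norm y) ^ L
     \<le> (156 / r^2 * (1 + r) ^ L) * (norm h)^2 * 2 ^ L / (1 + norm y) ^ L"
    using True r by (intro divide_right_mono mult_left_mono power_mono) auto
   then show "\<bar>sdiff (bump r) y h\<bar> \<le> (156 / r^2 * (1 + r) ^ L * 2 ^ L * (norm h)^2) * (1 / (1 + norm y) ^ L)"
    using sdiff_bump_weighted [OF r, of y h L] by (simp add: mult_ac)
   show "0 \<le> (156 / r^2 * (1 + r) ^ L * 2 ^ L * (norm h)^2) * (1 / (1 + norm y) ^ L)" using r by simp
  qed
  also have "... = (156 / r^2 * (1 + r) ^ L * 2 ^ L * (norm h)^2) * W"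
   unfolding W_def by (rule integral_mult_right_zero)
  also have "... = C1 * (norm h)^2" by (simp add: C1_def)
  also have "... \<le> (C1 + 4 * I) * (norm h)^2" using I by (intro mult_right_mono) auto
  also have "(norm h)^2 = min 1 ((norm h)^2)" using True by (simp add: min_absorb2 power_le_one)
  finally show ?thesis .
 next
  case False
  have "(LBINT y. \<bar>sdiff (bump r) y h\<bar>) \<le> (LBINT y. 2 * bump r y + bump r (y + h) + bump r (y + - h))"
  proof (rule integral_mono')
   show "integrable lborel (\<lambda>y. 2 * bump r y + bump r (y + h) + bump r (y + - h))"
    using b [of h] b [of "- h"] integrable_bump [OF r, where 'a = 'a] by simp
   fix y :: 'a
   show "\<bar>sdiff (bump r) y h\<bar> \<le> 2 * bump r y + bump r (y + h) + bump r (y + - h)"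
    using bump_nonneg [of r y] bump_nonneg [of r "y + h"] bump_nonneg [of r "y - h"] by (simp add: sdiff_def)
   show "0 \<le> 2 * bump r y + bump r (y + h) + bump r (y + - h)" by (simp add: bump_nonneg)
  qed
  also have "... = 4 * I"
  proof -
   have "(LBINT y. 2 * bump r y + bump r (y + h) + bump r (y + - h)) = 2 * I + I + I"
    using b [of h] b [of "- h"] integrable_bump [OF r, where 'a = 'a] Ib [of h] Ib [of "-h"] by (simp add: I_def)
   then show ?thesis by simp
  qed
  also have "... \<le> (C1 + 4 * I) * 1" using C1 by simp
  also have "1 = min 1 ((norm h)^2)" using False by (simp add: min_def one_le_power)
  finally show ?thesis .
 qed
 have "C1 + 4 * I \<ge> 0" using C1 I by simp
 from that [OF this int le] show thesis .
qed

section \<open>Mollification and the fractional Laplacian\<close>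

lemma integrable_lborel_product:
 fixes f :: "'a::euclidean_space => real" and g :: "'b::euclidean_space => real"
 assumes f: "integrable lborel f" and g: "integrable lborel g"
 shows "integrable (lborel \<Otimes>\<^sub>M lborel) (\<lambda>(x, y). f x * g y)"
proof (rule lborel_pair.Fubini_integrable)
 have [measurable]: "f \<in> borel_measurable borel" "g \<in> borel_measurable borel"
  using f g by auto
 show "(\<lambda>(x, y). f x * g y) \<in> borel_measurable (lborel \<Otimes>\<^sub>M lborel)" by measurable
 show "integrable lborel (\<lambda>x. LBINT y. norm (case (x, y) of (x, y) => f x * g y))"
  using f by (simp add: abs_mult)
 show "AE x in lborel. integrable lborel (\<lambda>y. case (x, y) of (x, y) => f x * g y)"
  using g by simp
qed

definition moll :: "real => ('a::euclidean_space => real) => 'a => real" where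
 "moll r f x = (LBINT y. f y * bump r (x - y))"

lemma moll_shift: "moll r f (x + h) = (LBINT y. f (y + h) * bump r (x - y))"
 unfolding moll_def
 using integral_lborel_shift [of "\<lambda>y. f y * bump r (x + h - y)" h] by (simp add: algebra_simps)

lemma moll_measurable [measurable]:
 fixes f :: "'a::euclidean_space => real"
 assumes [measurable]: "f \<in> borel_measurable borel"
 shows "moll r f \<in> borel_measurable borel"
 unfolding moll_def [abs_def] by measurable

lemma integrable_bump_shift: "0 < r ==> integrable lborel (\<lambda>y::'a::euclidean_space. bump r (x - y))"
 using integrable_lborel_reflect_iff [of "bump r" x] integrable_bump [of r, where 'a = 'a] by simp

lemma integral_bump_shift:
 fixes x :: "'a::euclidean_space"
 shows "(LBINT y. bump r (x - y)) = (LBINT (y::'a). bump r y)"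
 by (rule integral_lborel_reflect)

lemma integrable_mult_bump:
 fixes f :: "'a::euclidean_space => real"
 assumes r: "0 < r" and [measurable]: "f \<in> borel_measurable borel"
  and B: "\<And>y. norm (x - y) < r ==> \<bar>f y\<bar> \<le> B"
 shows "integrable lborel (\<lambda>y. f y * bump r (x - y))"
proof (rule integrable_bound)
 show "integrable lborel (\<lambda>y::'a. B * bump r (x - y))"
  by (intro integrable_mult_right integrable_bump_shift r)
 show "AE y in lborel. norm (f y * bump r (x - y)) \<le> norm (B * bump r (x - y))" (is "AE y in _. ?P y")
 proof (intro AE_I2)
  fix y
  show "?P y"
  proof (cases "norm (x - y) < r")
   case True
   then have "\<bar>f y\<bar> * bump r (x - y) \<le> \<bar>B\<bar> * bump r (x - y)"
    using B [of y] bump_nonneg by (intro mult_right_mono) (auto intro: order.trans)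
   then show ?thesis by (simp add: abs_mult abs_of_nonneg [OF bump_nonneg])
  qed (simp add: bump_eq_0 r)
 qed
qed measurable

lemma moll_bound:
 fixes f :: "'a::euclidean_space => real"
 assumes r: "0 < r" and [measurable]: "f \<in> borel_measurable borel" and B: "\<And>y. \<bar>f y\<bar> \<le> B"
 shows "\<bar>moll r f x\<bar> \<le> B * (LBINT z. bump r (z::'a))"
proof -
 have "\<bar>moll r f x\<bar> \<le> (LBINT y. \<bar>f y * bump r (x - y)\<bar>)"
  unfolding moll_def by (rule integral_abs_bound)
 also have "... \<le> (LBINT y. B * bump r (x - y))"
  using B bump_nonneg
  by (intro integral_mono' integrable_mult_right integrable_bump_shift r)
    (auto simp: abs_mult abs_of_nonneg [OF bump_nonneg] intro!: mult_right_mono mult_nonneg_nonneg order.trans [OF abs_ge_zero B])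
 also have "... = B * (LBINT z. bump r (z::'a))"
  by (simp add: integral_bump_shift)
 finally show ?thesis .
qed

lemma sdiff_moll:
 fixes f :: "'a::euclidean_space => real"
 assumes r: "0 < r" and [measurable]: "f \<in> borel_measurable borel"
  and B: "\<And>y. \<bar>f y\<bar> \<le> B"
 shows "sdiff (moll r f) x h = (LBINT y. f y * sdiff (bump r) (x - y) h)"
proof -
 have i: "integrable lborel (\<lambda>y. f y * bump r (c - y))" for c
  by (rule integrable_mult_bump [OF r]) (use B in auto)
 have "sdiff (moll r f) x h = (LBINT y. 2 * (f y * bump r (x - y)) - f y * bump r (x + h - y) - f y * bump r (x - h - y))"
  unfolding sdiff_def moll_def using i [of x] i [of "x + h"] i [of "x - h"] by simp
 also have "... = (LBINT y. f y * sdiff (bump r) (x - y) h)"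
  by (intro integral_cong) (auto simp: sdiff_def algebra_simps)
 finally show ?thesis .
qed

text \<open>Second differences fall on the bump, so f need only be bounded. The constant depends on
  r alone and thus serves whole sequences with a common bound B.\<close>

lemma sdiff_moll_bound:
 assumes r: "0 < r"
 obtains C where "C \<ge> 0" "\<And>(f :: 'a::euclidean_space => real) B x h. f \<in> borel_measurable borel ==>
   (\<And>y. \<bar>f y\<bar> \<le> B) ==> \<bar>sdiff (moll r f) x h\<bar> \<le> B * C * min 1 ((norm h)^2)"
proof -
 obtain C where C: "C \<ge> 0" and int: "\<And>h::'a. integrable lborel (\<lambda>y. sdiff (bump r) y h)"
  and le: "\<And>h::'a. (LBINT y. \<bar>sdiff (bump r) y h\<bar>) \<le> C * min 1 ((norm h)^2)"
  using integral_sdiff_bump [OF r, where 'a = 'a] by blast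
 have "\<bar>sdiff (moll r f) x h\<bar> \<le> B * C * min 1 ((norm h)^2)"
  if [measurable]: "f \<in> borel_measurable borel" and B: "\<And>y. \<bar>f y\<bar> \<le> B" for f :: "'a => real" and B x h
 proof -
  have B0: "0 \<le> B" using B [of 0] by linarith
  have int': "integrable lborel (\<lambda>y. \<bar>sdiff (bump r) (x - y) h\<bar>)"
   using integrable_lborel_reflect_iff [of "\<lambda>y. sdiff (bump r) y h" x] int [of h] by simp
  have "\<bar>sdiff (moll r f) x h\<bar> \<le> (LBINT y. \<bar>f y * sdiff (bump r) (x - y) h\<bar>)"
   unfolding sdiff_moll [OF r that] by (rule integral_abs_bound)
  also have "... \<le> (LBINT y. B * \<bar>sdiff (bump r) (x - y) h\<bar>)"
   using B B0 by (intro integral_mono' integrable_mult_right int') (auto simp: abs_mult intro!: mult_right_mono)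
  also have "... = B * (LBINT y. \<bar>sdiff (bump r) y h\<bar>)"
   using integral_lborel_reflect [of "\<lambda>y. \<bar>sdiff (bump r) y h\<bar>" x] by simp
  also have "... \<le> B * (C * min 1 ((norm h)^2))" by (intro mult_left_mono le B0)
  finally show ?thesis by simp
 qed
 with C show thesis by (rule that)
qed

text \<open>Bounded almost everywhere convergence makes the mollifications converge pointwise, and
  \<open>sdiff_moll_bound\<close> provides one integrable majorant for all of their second
  differences.\<close>

lemma flap_moll_tendsto:
 fixes f :: "nat => 'a::euclidean_space => real"
 assumes s: "0 < s" "s < 1" and r: "0 < r"
  and [measurable]: "\<And>i. f i \<in> borel_measurable borel" "f0 \<in> borel_measurable borel"
  and B: "\<And>i y. \<bar>f i y\<bar> \<le> B"  "\<And>y. \<bar>f0 y\<bar> \<le> B"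
  and lim: "AE y in lborel. (\<lambda>i. f i y) \<longlonglongrightarrow> f0 y"
 shows "(\<lambda>i. flap s (moll r (f i)) x) \<longlonglongrightarrow> flap s (moll r f0) x"
proof -
 obtain C where C: "C \<ge> 0" "\<And>(f :: 'a => real) B x h. f \<in> borel_measurable borel ==>
   (\<And>y. \<bar>f y\<bar> \<le> B) ==> \<bar>sdiff (moll r f) x h\<bar> \<le> B * C * min 1 ((norm h)^2)"
  using sdiff_moll_bound [OF r, where 'a = 'a] by blast
 have m: "(\<lambda>i. moll r (f i) z) \<longlonglongrightarrow> moll r f0 z" for z
  unfolding moll_def
 proof (rule integral_dominated_convergence [where w = "\<lambda>y. B * bump r (z - y)"])
  show "integrable lborel (\<lambda>y. B * bump r (z - y))"
   by (intro integrable_mult_right integrable_bump_shift r)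
  show "AE y in lborel. (\<lambda>i. f i y * bump r (z - y)) \<longlonglongrightarrow> f0 y * bump r (z - y)"
   using lim by eventually_elim (intro tendsto_intros)
  show "\<And>i. AE y in lborel. norm (f i y * bump r (z - y)) \<le> B * bump r (z - y)"
   using B bump_nonneg by (intro AE_I2) (auto simp: abs_mult abs_of_nonneg [OF bump_nonneg] intro!: mult_right_mono)
 qed measurable
 have "(\<lambda>i. LBINT h. sdiff (moll r (f i)) x h * rker s h) \<longlonglongrightarrow> (LBINT h. sdiff (moll r f0) x h * rker s h)"
 proof (rule integral_dominated_convergence [where w = "\<lambda>h. B * C * (min 1 ((norm h)^2) * rker s h)"])
  show "integrable lborel (\<lambda>h::'a. B * C * (min 1 ((norm h)^2) * rker s h))"
   by (intro integrable_mult_right integrable_min_rker s)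
  show "AE h in lborel. (\<lambda>i. sdiff (moll r (f i)) x h * rker s h) \<longlonglongrightarrow> sdiff (moll r f0) x h * rker s h"
   unfolding sdiff_def by (intro AE_I2 tendsto_intros m)
  fix i
  show "AE h in lborel. norm (sdiff (moll r (f i)) x h * rker s h) \<le> B * C * (min 1 ((norm h)^2) * rker s h)" (is "AE h in _. ?P h")
  proof (intro AE_I2)
   fix h
   have "\<bar>sdiff (moll r (f i)) x h\<bar> \<le> B * C * min 1 ((norm h)^2)" by (rule C(2)) (use B in auto)
   from mult_right_mono [OF this rker_nonneg [of s h]]
   show "?P h"
    by (simp add: abs_mult abs_of_nonneg [OF rker_nonneg] mult.assoc)
  qed
 qed measurable
 then show ?thesis unfolding flap_def by (intro tendsto_divide tendsto_const) auto
qed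

text \<open>Off a ball the kernel is integrable, so Fubini applies to a merely bounded f, for which
  the full operator need not exist at a point.\<close>

lemma tflap_moll:
 fixes f :: "'a::euclidean_space => real"
 assumes s: "0 < s" "s < 1" and r: "0 < r" and \<delta>: "0 < \<delta>"
  and [measurable]: "f \<in> borel_measurable borel" and B: "\<And>y. \<bar>f y\<bar> \<le> B"
 shows "integrable lborel (\<lambda>z. tflap s \<delta> f z * bump r (x - z))"
  "tflap s \<delta> (moll r f) x = (LBINT z. tflap s \<delta> f z * bump r (x - z))"
proof -
 let ?K = "\<lambda>h::'a. indicator (- ball 0 \<delta>) h * rker s h :: real"
 let ?F = "\<lambda>(h::'a, z). ?K h * ((f z - f (z + h)) * bump r (x - z))"
 have B0: "0 \<le> B" using B [of 0] by linarith
 have K: "integrable lborel ?K"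
  using integrable_off_ball [OF s \<delta>, of "\<lambda>_::'a. 1" 1] by simp
 have K0: "0 \<le> ?K h" for h by (simp add: rker_nonneg)
 have joint: "integrable (lborel \<Otimes>\<^sub>M lborel) ?F"
 proof (rule integrable_bound)
  have "integrable (lborel \<Otimes>\<^sub>M lborel) (\<lambda>(h, z). ?K h * (2 * B * bump r (x - z)))"
   using integrable_lborel_product [OF K, of "\<lambda>z. 2 * B * bump r (x - z)"] integrable_bump_shift [OF r, of x] by simp
  then show "integrable (lborel \<Otimes>\<^sub>M lborel) (\<lambda>p. ?K (fst p) * (2 * B * bump r (x - snd p)))"
   by (simp only: case_prod_unfold)
  show "AE p in lborel \<Otimes>\<^sub>M lborel. norm (?F p) \<le> norm (?K (fst p) * (2 * B * bump r (x - snd p)))"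
  proof (intro AE_I2)
   fix p :: "'a \<times> 'a"
   have "\<bar>f (snd p) - f (snd p + fst p)\<bar> \<le> 2 * B" using B [of "snd p"] B [of "snd p + fst p"] by linarith
   then have "?K (fst p) * (\<bar>f (snd p) - f (snd p + fst p)\<bar> * bump r (x - snd p)) \<le> ?K (fst p) * (2 * B * bump r (x - snd p))"
    by (intro mult_left_mono mult_right_mono K0 bump_nonneg)
   then show "norm (?F p) \<le> norm (?K (fst p) * (2 * B * bump r (x - snd p)))"
    using B0 by (simp add: case_prod_beta abs_mult abs_of_nonneg [OF bump_nonneg] abs_of_nonneg [OF rker_nonneg])
  qed
 qed measurable
 have eq: "(LBINT h. ?F (h, z)) = tflap s \<delta> f z * bump r (x - z)" for z
 proof -
  have "(LBINT h. ?F (h, z)) = (LBINT h. (indicator (- ball 0 \<delta>) h * ((f z - f (z + h)) * rker s h)) * bump r (x - z))"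
   by (intro integral_cong) auto
  then show ?thesis unfolding tflap_def by simp
 qed
 show "integrable lborel (\<lambda>z. tflap s \<delta> f z * bump r (x - z))"
  using lborel_pair.integrable_snd [OF joint] eq by simp
 have i: "integrable lborel (\<lambda>y. f (y + h) * bump r (x - y))" for h
  by (rule integrable_mult_bump [OF r]) (use B in auto)
 have "tflap s \<delta> (moll r f) x = (LBINT h. LBINT z. ?F (h, z))"
  unfolding tflap_def
 proof (intro integral_cong refl)
  fix h
  have "moll r f x - moll r f (x + h) = (LBINT z. (f z - f (z + h)) * bump r (x - z))"
   unfolding moll_shift using i [of 0] i [of h] by (simp add: moll_def left_diff_distrib)
  then show "indicator (- ball 0 \<delta>) h * ((moll r f x - moll r f (x + h)) * rker s h) = (LBINT z. ?F (h, z))"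
   by simp
 qed
 also have "... = (LBINT z. LBINT h. ?F (h, z))"
  using lborel_pair.Fubini_integral [OF joint] by simp
 finally show "tflap s \<delta> (moll r f) x = (LBINT z. tflap s \<delta> f z * bump r (x - z))"
  by (simp only: eq)
qed

section \<open>Paraboloids as viscosity test functions\<close>

text \<open>A paraboloid of opening A on the ball of radius \<delta> contributes - A times this
  number to the fractional Laplacian at its centre.\<close>

definition ball_moment :: "'a::euclidean_space itself => real => real => real" where
 "ball_moment T s \<delta> = (LBINT h. indicator (ball (0::'a) \<delta>) h * ((norm h)^2 * rker s h))"

lemma integrable_ball_moment:
 assumes s: "0 < s" "s < 1"
 shows "integrable lborel (\<lambda>h. indicator (ball (0::'a::euclidean_space) \<delta>) h * ((norm h)^2 * rker s h))"
proof -
 have "integrable lborel (\<lambda>h::'a. (indicator (ball (0::'a) \<delta>) h * (norm h)^2) * rker s h)"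
 proof (rule integrable_near_0 [OF s, where C = "1 + \<delta>^2"])
  fix h :: 'a
  show "\<bar>indicator (ball (0::'a) \<delta>) h * (norm h)^2\<bar> \<le> (1 + \<delta>^2) * min 1 ((norm h)^2)"
  proof (cases "norm h < \<delta>")
   case True
   then have "(norm h)^2 \<le> \<delta>^2" by (intro power_mono) auto
   moreover have "(norm h)^2 \<le> (1 + \<delta>^2) * (norm h)^2" by (simp add: distrib_right)
   ultimately show ?thesis using True by (auto simp: min_def)
  qed simp
 qed (intro borel_measurable_times borel_measurable_indicator borel_measurable_power borel_measurable_norm; simp)
 then show ?thesis by (simp add: mult.assoc)
qed

lemma ball_moment_tendsto:
 assumes s: "0 < s" "s < 1"
 shows "(ball_moment TYPE('a::euclidean_space) s \<longlongrightarrow> 0) (at_right 0)"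
 unfolding tendsto_at_iff_sequentially
proof (intro allI impI)
 fix X :: "nat => real"
 assume pos: "\<forall>i. X i \<in> {0<..} - {0}" and X: "X \<longlonglongrightarrow> 0"
 obtain K where K: "\<And>i. X i \<le> K"
  using convergent_imp_Bseq [OF convergentI [OF X]] unfolding Bseq_def by (metis abs_le_D1 real_norm_def)
 have "(\<lambda>i. LBINT h. indicator (ball (0::'a) (X i)) h * ((norm h)^2 * rker s h)) \<longlonglongrightarrow> (LBINT (h::'a). 0)"
 proof (rule integral_dominated_convergence [where w = "\<lambda>h. indicator (ball (0::'a) K) h * ((norm h)^2 * rker s h)"])
  show "AE h in lborel. (\<lambda>i. indicator (ball (0::'a) (X i)) h * ((norm h)^2 * rker s h)) \<longlonglongrightarrow> 0"
   using AE_lborel_neq [of "0::'a"]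
  proof eventually_elim
   case (elim h)
   have "\<forall>\<^sub>F i in sequentially. X i < norm h"
    using X elim by (intro order_tendstoD) auto
   then have "\<forall>\<^sub>F i in sequentially. indicator (ball (0::'a) (X i)) h * ((norm h)^2 * rker s h) = 0"
    by eventually_elim (simp add: indicator_def)
   then show ?case by (rule tendsto_eventually)
  qed
  fix i
  have "indicator (ball (0::'a) (X i)) h \<le> (indicator (ball (0::'a) K) h :: real)" for h
   using K [of i] by (auto simp: indicator_def)
  then show "AE h in lborel. norm (indicator (ball (0::'a) (X i)) h * ((norm h)^2 * rker s h)) \<le> indicator (ball (0::'a) K) h * ((norm h)^2 * rker s h)"
   by (intro AE_I2) (auto simp: abs_mult abs_of_nonneg [OF rker_nonneg] rker_nonneg intro!: mult_right_mono)
 qed (auto intro!: integrable_ball_moment s borel_measurable_integrable [OF integrable_ball_moment [OF s], simplified])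
 then show "(ball_moment TYPE('a) s \<circ> X) \<longlonglongrightarrow> 0" by (simp add: o_def ball_moment_def)
qed

text \<open>The part of the subsolution property that is seen by paraboloids touching from above.
  The contribution of the paraboloid inside the ball has been moved to the right-hand side, so that
  only the truncated operator on w remains.\<close>

definition touch_sub :: "real => 'a::euclidean_space set => ('a => real) => ('a => real) => bool" where
 "touch_sub s \<Omega> w g \<longleftrightarrow> (\<forall>x\<in>\<Omega>. \<forall>\<delta>>0. \<forall>p. \<forall>A\<ge>0. ball x \<delta> \<subseteq> \<Omega> \<longrightarrow>
   (\<forall>y. w y \<le> w x + p \<bullet> (y - x) + A * (norm (y - x))^2) \<longrightarrow> tflap s \<delta> w x \<le> g x + A * ball_moment TYPE('a) s \<delta>)"

lemma C2_on_quadratic: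
 "C2_on N (\<lambda>y. a + p \<bullet> (y - x) + A * (norm (y - x))^2)"
 unfolding C2_on_def
proof (intro exI conjI ballI)
 let ?D1 = "\<lambda>y. blinfun_inner_right (p + (2 * A) *\<^sub>R (y - x))"
 let ?D2 = "\<lambda>y::real ^ 'a. Blinfun (\<lambda>h. blinfun_inner_right ((2 * A) *\<^sub>R (h::real ^ 'a)))"
 have bl: "bounded_linear (\<lambda>h. blinfun_inner_right ((2 * A) *\<^sub>R (h::real ^ 'a)))"
  by (intro bounded_linear_compose [OF bounded_linear_blinfun_inner_right] bounded_linear_scaleR_right)
 fix y
 show "((\<lambda>y. a + p \<bullet> (y - x) + A * (norm (y - x))^2) has_derivative blinfun_apply (?D1 y)) (at y)"
  unfolding power2_norm_eq_inner
  by (auto intro!: derivative_eq_intros simp: inner_simps inner_commute algebra_simps fun_eq_iff)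
 show "(?D1 has_derivative blinfun_apply (?D2 y)) (at y)"
  unfolding bounded_linear_Blinfun_apply [OF bl]
  by (auto intro!: derivative_eq_intros bounded_linear.has_derivative [OF bounded_linear_blinfun_inner_right])
next
 show "continuous_on N (\<lambda>y::real ^ 'a. Blinfun (\<lambda>h. blinfun_inner_right ((2 * A) *\<^sub>R (h::real ^ 'a))))"
  by (rule continuous_on_const)
qed

text \<open>The linear part cancels in the second difference, the quadratic part leaves the ball
  moment, and outside the ball the function is w.\<close>

lemma has_frac_laplacian_quadratic:
 fixes w :: "real ^ 'n => real"
 assumes s: "0 < s" "s < 1" and \<delta>: "0 < \<delta>"
  and [measurable]: "w \<in> borel_measurable borel" and B: "\<And>y. \<bar>w y\<bar> \<le> B"
 shows "has_frac_laplacian s (\<lambda>y. if y \<in> ball x \<delta> then w x + p \<bullet> (y - x) + A * (norm (y - x))^2 else w y) x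
  (ereal (tflap s \<delta> w x - A * ball_moment TYPE(real ^ 'n) s \<delta>))"
proof -
 let ?v = "\<lambda>y. if y \<in> ball x \<delta> then w x + p \<bullet> (y - x) + A * (norm (y - x))^2 else w y"
 define C where "C = \<bar>w x\<bar> + norm p * \<delta> + \<bar>A\<bar> * \<delta>^2 + B"
 have B0: "0 \<le> B" using B [of 0] by linarith
 have [measurable]: "ball x \<delta> \<in> sets borel" by simp
 have vm [measurable]: "?v \<in> borel_measurable borel" by measurable
 have vb: "\<bar>?v y\<bar> \<le> C" for y
 proof (cases "y \<in> ball x \<delta>")
  case True
  then have n: "norm (y - x) \<le> \<delta>" by (simp add: dist_norm norm_minus_commute)
  have "\<bar>p \<bullet> (y - x)\<bar> \<le> norm p * norm (y - x)" by (rule Cauchy_Schwarz_ineq2)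
  also have "... \<le> norm p * \<delta>" using n by (intro mult_left_mono) auto
  finally have 1: "\<bar>p \<bullet> (y - x)\<bar> \<le> norm p * \<delta>" .
  have "\<bar>A * (norm (y - x))^2\<bar> = \<bar>A\<bar> * (norm (y - x))^2" by (simp add: abs_mult)
  also have "... \<le> \<bar>A\<bar> * \<delta>^2" using n by (intro mult_left_mono power_mono) auto
  finally have 2: "\<bar>A * (norm (y - x))^2\<bar> \<le> \<bar>A\<bar> * \<delta>^2" .
  show ?thesis using 1 2 B0 True unfolding C_def by simp
 next
  case False
  have "0 \<le> norm p * \<delta>" "0 \<le> \<bar>A\<bar> * \<delta>^2" using \<delta> by simp_all
  then have "\<bar>w y\<bar> \<le> C" unfolding C_def using B [of y] abs_ge_zero [of "w x"] by linarith
  then show ?thesis using False by simp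
 qed
 have vx: "?v x = w x" using \<delta> by simp
 have I: "integrable lborel (\<lambda>h. indicator (- ball 0 e) h * ((?v x - ?v (x + h)) * rker s h))" if "e > 0" for e
 proof (rule integrable_off_ball [OF s that, where B = "2 * C"])
  fix h
  show "\<bar>?v x - ?v (x + h)\<bar> \<le> 2 * C" using vb [of x] vb [of "x + h"] by linarith
 qed measurable
 have Iw: "integrable lborel (\<lambda>h. indicator (- ball 0 \<delta>) h * ((w x - w (x + h)) * rker s h))"
 proof (rule integrable_off_ball [OF s \<delta>, where B = "2 * B"])
  fix h
  show "\<bar>w x - w (x + h)\<bar> \<le> 2 * B" using B [of x] B [of "x + h"] by linarith
 qed measurable
 have Sw: "integrable lborel (\<lambda>h. indicator (- ball 0 \<delta>) h * (sdiff w x h * rker s h))"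
 proof (rule integrable_off_ball [OF s \<delta>, where B = "4 * B"])
  fix h
  show "\<bar>sdiff w x h\<bar> \<le> 4 * B" unfolding sdiff_def using B [of x] B [of "x + h"] B [of "x - h"] by linarith
 qed measurable
 have sd: "sdiff ?v x h * rker s h = indicator (- ball 0 \<delta>) h * (sdiff w x h * rker s h)
   - 2 * A * (indicator (ball 0 \<delta>) h * ((norm h)^2 * rker s h))" for h
  using \<delta> by (auto simp: sdiff_def indicator_def dist_norm algebra_simps)
 have S: "integrable lborel (\<lambda>h. sdiff ?v x h * rker s h)"
  unfolding sd by (intro integrable_diff integrable_mult_right integrable_ball_moment s Sw)
 have "(LBINT h. sdiff ?v x h * rker s h) = 2 * tflap s \<delta> w x - 2 * A * ball_moment TYPE(real ^ 'n) s \<delta>"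
  unfolding sd tflap_eq_sdiff [OF Iw] ball_moment_def
  by (subst integral_diff) (auto intro!: integrable_mult_right integrable_ball_moment s Sw)
 then have "flap s ?v x = tflap s \<delta> w x - A * ball_moment TYPE(real ^ 'n) s \<delta>" by (simp add: flap_def)
 then show ?thesis using has_frac_laplacian_flap [OF vm I S] by simp
qed

lemma has_frac_laplacian_unique:
 "has_frac_laplacian s v x L ==> has_frac_laplacian s v x L' ==> L = L'"
 unfolding has_frac_laplacian_def
 by (elim conjE) (rule tendsto_unique [OF trivial_limit_at_right_real])

lemma tflap_uminus: "tflap s \<delta> (\<lambda>y. - w y) x = - tflap s \<delta> w x"
proof -
 have "tflap s \<delta> (\<lambda>y. - w y) x = (LBINT h. - (indicator (- ball 0 \<delta>) h * ((w x - w (x + h)) * rker s h)))"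
  unfolding tflap_def by (intro integral_cong) (auto simp: algebra_simps)
 then show ?thesis by (simp add: tflap_def)
qed

text \<open>The supersolution property is recorded as the subsolution property of - w, so that the
  regularisation from above has to be carried out only once.\<close>

lemma visc_imp_touch_sub:
 fixes w :: "real ^ 'n => real"
 assumes s: "0 < s" "s < 1" and visc: "visc_frac_laplacian_eq s \<Omega> w g"
  and wm: "w \<in> borel_measurable borel" and B: "\<And>y. \<bar>w y\<bar> \<le> B"
 shows "touch_sub s \<Omega> w g" "touch_sub s \<Omega> (\<lambda>y. - w y) (\<lambda>y. - g y)"
proof -
 have key: "((\<forall>y\<in>ball x \<delta>. w y \<le> w x + p \<bullet> (y - x) + A * (norm (y - x))^2) \<longrightarrow>
    tflap s \<delta> w x - A * ball_moment TYPE(real ^ 'n) s \<delta> \<le> g x) \<and>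
   ((\<forall>y\<in>ball x \<delta>. w x + p \<bullet> (y - x) + A * (norm (y - x))^2 \<le> w y) \<longrightarrow>
    g x \<le> tflap s \<delta> w x - A * ball_moment TYPE(real ^ 'n) s \<delta>)"
  if "x \<in> \<Omega>" "0 < \<delta>" "ball x \<delta> \<subseteq> \<Omega>" for x \<delta> p A
 proof -
  let ?q = "\<lambda>y. w x + p \<bullet> (y - x) + A * (norm (y - x))^2"
  have "open (ball x \<delta>) \<and> x \<in> ball x \<delta> \<and> ball x \<delta> \<subseteq> \<Omega> \<and> C2_on (ball x \<delta>) ?q \<and> ?q x = w x"
   using that by (simp add: C2_on_quadratic)
  with visc that(1) have
   above: "(\<forall>y\<in>ball x \<delta>. w y \<le> ?q y) ==>
      \<exists>L. has_frac_laplacian s (\<lambda>y. if y \<in> ball x \<delta> then ?q y else w y) x L \<and> L \<le> ereal (g x)" and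
   below: "(\<forall>y\<in>ball x \<delta>. ?q y \<le> w y) ==>
      \<exists>L. has_frac_laplacian s (\<lambda>y. if y \<in> ball x \<delta> then ?q y else w y) x L \<and> ereal (g x) \<le> L"
   unfolding visc_frac_laplacian_eq_def by blast+
  have eq: "L = ereal (tflap s \<delta> w x - A * ball_moment TYPE(real ^ 'n) s \<delta>)"
   if "has_frac_laplacian s (\<lambda>y. if y \<in> ball x \<delta> then ?q y else w y) x L" for L
   by (rule has_frac_laplacian_unique [OF that has_frac_laplacian_quadratic [OF s \<open>0 < \<delta>\<close> wm B]])
  show ?thesis
  proof (intro conjI impI)
   assume "\<forall>y\<in>ball x \<delta>. w y \<le> ?q y"
   from above [OF this] obtain L where "has_frac_laplacian s (\<lambda>y. if y \<in> ball x \<delta> then ?q y else w y) x L"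
    and L: "L \<le> ereal (g x)" by (elim exE conjE)
   from L show "tflap s \<delta> w x - A * ball_moment TYPE(real ^ 'n) s \<delta> \<le> g x"
    unfolding eq [OF \<open>has_frac_laplacian s _ x L\<close>] by simp
  next
   assume "\<forall>y\<in>ball x \<delta>. ?q y \<le> w y"
   from below [OF this] obtain L where "has_frac_laplacian s (\<lambda>y. if y \<in> ball x \<delta> then ?q y else w y) x L"
    and L: "ereal (g x) \<le> L" by (elim exE conjE)
   from L show "g x \<le> tflap s \<delta> w x - A * ball_moment TYPE(real ^ 'n) s \<delta>"
    unfolding eq [OF \<open>has_frac_laplacian s _ x L\<close>] by simp
  qed
 qed
 show "touch_sub s \<Omega> w g" unfolding touch_sub_def
 proof (intro ballI allI impI)
  fix x \<delta> p A assume "x \<in> \<Omega>" "(0::real) < \<delta>" "(0::real) \<le> A" "ball x \<delta> \<subseteq> \<Omega>"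
   "\<forall>y. w y \<le> w x + p \<bullet> (y - x) + A * (norm (y - x))^2"
  then have "tflap s \<delta> w x - A * ball_moment TYPE(real ^ 'n) s \<delta> \<le> g x" using key [of x \<delta> p A] by blast
  then show "tflap s \<delta> w x \<le> g x + A * ball_moment TYPE(real ^ 'n) s \<delta>" by linarith
 qed
 show "touch_sub s \<Omega> (\<lambda>y. - w y) (\<lambda>y. - g y)" unfolding touch_sub_def
 proof (intro ballI allI impI)
  fix x \<delta> p A assume *: "x \<in> \<Omega>" "(0::real) < \<delta>" "(0::real) \<le> A" "ball x \<delta> \<subseteq> \<Omega>"
   "\<forall>y. - w y \<le> - w x + p \<bullet> (y - x) + A * (norm (y - x))^2"
  have "\<forall>y\<in>ball x \<delta>. w x + (- p) \<bullet> (y - x) + (- A) * (norm (y - x))^2 \<le> w y"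
  proof
   fix y show "w x + (- p) \<bullet> (y - x) + (- A) * (norm (y - x))^2 \<le> w y"
    using *(5) [rule_format, of y] by simp
  qed
  then have "g x \<le> tflap s \<delta> w x - (- A) * ball_moment TYPE(real ^ 'n) s \<delta>" using key [of x \<delta> "- p" "- A"] * by blast
  then show "tflap s \<delta> (\<lambda>y. - w y) x \<le> - g x + A * ball_moment TYPE(real ^ 'n) s \<delta>"
   unfolding tflap_uminus by simp
 qed
qed

section \<open>From viscosity solutions to mollified equations\<close>

definition supconv :: "nat => ('a::euclidean_space => real) => 'a => real" where
 "supconv i w z = (SUP y. w y - real i * (norm (z - y))^2)"

lemma supconv_bdd:
 assumes "\<And>y. \<bar>w y\<bar> \<le> B"
 shows "bdd_above (range (\<lambda>y. w y - real i * (norm (z - y))^2))"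
proof (rule bdd_aboveI2)
 fix y
 have "0 \<le> real i * (norm (z - y))^2" by simp
 then show "w y - real i * (norm (z - y))^2 \<le> B" using assms [of y] by linarith
qed

lemma supconv_ge:
 assumes "\<And>y. \<bar>w y\<bar> \<le> B"
 shows "w y - real i * (norm (z - y))^2 \<le> supconv i w z"
 unfolding supconv_def by (rule cSUP_upper [OF UNIV_I supconv_bdd]) (rule assms)

lemma supconv_ge_self:
 assumes "\<And>y. \<bar>w y\<bar> \<le> B"
 shows "w z \<le> supconv i w z"
 using supconv_ge [of w B z i z, OF assms] by simp

lemma supconv_le:
 assumes "\<And>y. w y - real i * (norm (z - y))^2 \<le> c"
 shows "supconv i w z \<le> c"
 unfolding supconv_def by (rule cSUP_least) (use assms in auto)

lemma supconv_bound:
 assumes "\<And>y. \<bar>w y\<bar> \<le> B"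
 shows "\<bar>supconv i w z\<bar> \<le> B"
proof -
 have "supconv i w z \<le> B"
 proof (rule supconv_le)
  fix y
  have "0 \<le> real i * (norm (z - y))^2" by simp
  then show "w y - real i * (norm (z - y))^2 \<le> B" using assms [of y] by linarith
 qed
 then show ?thesis using supconv_ge_self [of w B z i, OF assms] assms [of z] by linarith
qed

text \<open>The supremum is over an uncountable set, but for each fixed y the expression is
  continuous in z, so the superlevel sets are open whatever w is.\<close>

lemma supconv_measurable:
 fixes w :: "'a::euclidean_space => real"
 assumes B: "\<And>y. \<bar>w y\<bar> \<le> B"
 shows "supconv i w \<in> borel_measurable borel"
proof (rule borel_measurableI_greater)
 fix c
 have "{z \<in> space borel. c < supconv i w z} = (\<Union>y. {z. c < w y - real i * (norm (z - y))^2})"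
  unfolding supconv_def using less_cSUP_iff [OF _ supconv_bdd [of w B, OF B]] by auto
 also have "open ..."
  by (intro open_UN ballI open_Collect_less continuous_intros)
 then have "(\<Union>y. {z. c < w y - real i * (norm (z - y))^2}) \<in> sets borel" by simp
 finally show "{z \<in> space borel. c < supconv i w z} \<in> sets borel" .
qed

text \<open>Points at distance at least d from z pay a penalty i d^2, which exceeds the oscillation
  2 B for large i; at nearer points w is within e/2 of w z.\<close>

lemma supconv_tendsto:
 fixes w :: "'a::euclidean_space => real"
 assumes B: "\<And>y. \<bar>w y\<bar> \<le> B" and c: "isCont w z"
 shows "(\<lambda>i. supconv i w z) \<longlonglongrightarrow> w z"
proof (rule LIMSEQ_I)
 fix e :: real assume e: "0 < e"
 obtain d where d: "d > 0" "\<And>y. dist y z < d ==> dist (w y) (w z) < e / 2"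
  using c e unfolding continuous_at_eps_delta by (metis half_gt_zero)
 obtain n :: nat where n: "2 * B / d^2 < real n" using reals_Archimedean2 by blast
 have "norm (supconv i w z - w z) < e" if "n \<le> i" for i
 proof -
  have "supconv i w z \<le> w z + e / 2"
  proof (rule supconv_le)
   fix y
   have nn: "0 \<le> real i * (norm (z - y))^2" by simp
   show "w y - real i * (norm (z - y))^2 \<le> w z + e / 2"
   proof (cases "dist y z < d")
    case True
    then show ?thesis using d(2) [OF True] nn unfolding dist_real_def by linarith
   next
    case False
    then have "d^2 \<le> (norm (z - y))^2" using d by (intro power_mono) (auto simp: dist_norm norm_minus_commute)
    then have "real n * d^2 \<le> real i * (norm (z - y))^2" using that by (intro mult_mono) auto
    moreover have "2 * B < real n * d^2" using n d by (simp add: field_simps)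
    ultimately show ?thesis using B [of y] B [of z] e by linarith
   qed
  qed
  then show ?thesis using supconv_ge_self [of w B z i, OF B] e by (simp add: abs_less_iff)
 qed
 then show "\<exists>no. \<forall>i\<ge>no. norm (supconv i w z - w z) < e" by blast
qed

text \<open>A point where the supremum is attained is a point at which \<open>w\<close> is touched from above by a
 paraboloid. Translating the point of evaluation moves the increments of \<open>w\<close> to those of the
 sup-convolution, so the inequality known at the touching point holds at \<^emph>\<open>every\<close> point for
 the sup-convolution.\<close>

lemma tflap_supconv_le:
 fixes w :: "'a::euclidean_space => real"
 assumes s: "0 < s" "s < 1" and T: "touch_sub s (ball 0 M) w g"
  and [measurable]: "w \<in> borel_measurable borel" and B: "\<And>y. \<bar>w y\<bar> \<le> B"
  and cont: "continuous_on (ball 0 M) w"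
  and z: "norm z + \<eta> < M" and \<eta>: "0 < \<eta>" and i: "2 * B < real i * \<eta>^2"
  and \<delta>: "0 < \<delta>" "norm z + \<eta> + \<delta> \<le> M"
 obtains x where "norm (x - z) \<le> \<eta>" "tflap s \<delta> (supconv i w) z \<le> g x + real i * ball_moment TYPE('a) s \<delta>"
proof -
 let ?f = "\<lambda>y. w y - real i * (norm (z - y))^2"
 have sub: "cball z \<eta> \<subseteq> ball 0 M"
 proof
  fix y assume "y \<in> cball z \<eta>"
  then show "y \<in> ball 0 M" using z norm_triangle_ineq [of z "y - z"] by (simp add: dist_norm norm_minus_commute)
 qed
 have "continuous_on (cball z \<eta>) ?f"
  by (intro continuous_intros continuous_on_subset [OF cont sub])
 then obtain x where x: "x \<in> cball z \<eta>" "\<And>y. y \<in> cball z \<eta> ==> ?f y \<le> ?f x"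
  using continuous_attains_sup [of "cball z \<eta>" ?f] \<eta> by fastforce
 \<comment> \<open>Outside \<open>cball z \<eta>\<close> the penalty exceeds 2 B, so the maximum
   over this compact ball is a global one.\<close>
 have all: "?f y \<le> ?f x" for y
 proof (cases "y \<in> cball z \<eta>")
  case False
  then have "\<eta>^2 \<le> (norm (z - y))^2" using \<eta> by (intro power_mono) (auto simp: dist_norm)
  then have "real i * \<eta>^2 \<le> real i * (norm (z - y))^2" by (intro mult_left_mono) auto
  then have "?f y \<le> ?f z" using i B [of y] B [of z] by simp
  also have "... \<le> ?f x" using x(2) [of z] \<eta> by simp
  finally show ?thesis .
 qed (rule x(2))
 have W: "supconv i w z = ?f x"
  by (intro antisym supconv_le all supconv_ge [OF B])
 have xM: "ball x \<delta> \<subseteq> ball 0 M" "x \<in> ball 0 M"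
 proof -
  show "ball x \<delta> \<subseteq> ball 0 M"
  proof
   fix y assume "y \<in> ball x \<delta>"
   then have "norm (y - x) < \<delta>" "norm (x - z) \<le> \<eta>" using x(1) by (auto simp: dist_norm norm_minus_commute)
   moreover have "norm y \<le> norm z + norm (x - z) + norm (y - x)"
    using norm_triangle_ineq [of "z + (x - z)" "y - x"] norm_triangle_ineq [of z "x - z"] by simp
   ultimately show "y \<in> ball 0 M" using \<delta> by simp
  qed
  then show "x \<in> ball 0 M" by (rule subsetD) (use \<delta> in simp)
 qed
 have "\<forall>y. w y \<le> w x + (- (2 * real i) *\<^sub>R (z - x)) \<bullet> (y - x) + real i * (norm (y - x))^2"
 proof
  fix y
  define q where "q = (z - x) \<bullet> (y - x)"
  have E: "(norm (z - y))^2 = (norm (z - x))^2 - 2 * q + (norm (y - x))^2"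
   by (simp add: q_def power2_norm_eq_inner inner_simps inner_commute)
  have "real i * (norm (z - y))^2 = real i * (norm (z - x))^2 - 2 * real i * q + real i * (norm (y - x))^2"
   by (subst E) (simp add: algebra_simps)
  moreover have "(- (2 * real i) *\<^sub>R (z - x)) \<bullet> (y - x) = - 2 * real i * q" by (simp add: q_def)
  ultimately show "w y \<le> w x + (- (2 * real i) *\<^sub>R (z - x)) \<bullet> (y - x) + real i * (norm (y - x))^2"
   using all [of y] by linarith
 qed
 then have touch: "tflap s \<delta> w x \<le> g x + real i * ball_moment TYPE('a) s \<delta>"
  using T \<delta> xM unfolding touch_sub_def by (metis of_nat_0_le_iff)
 have "tflap s \<delta> (supconv i w) z \<le> tflap s \<delta> w x"
  unfolding tflap_def
 proof (rule integral_mono)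
  have [measurable]: "supconv i w \<in> borel_measurable borel" by (rule supconv_measurable [OF B])
  show "integrable lborel (\<lambda>h. indicator (- ball 0 \<delta>) h * ((supconv i w z - supconv i w (z + h)) * rker s h))"
  proof (rule integrable_off_ball [OF s \<delta>(1), where B = "2 * B"])
   fix h show "\<bar>supconv i w z - supconv i w (z + h)\<bar> \<le> 2 * B"
    using supconv_bound [of w B i z, OF B] supconv_bound [of w B i "z + h", OF B] by linarith
  qed measurable
  show "integrable lborel (\<lambda>h. indicator (- ball 0 \<delta>) h * ((w x - w (x + h)) * rker s h))"
  proof (rule integrable_off_ball [OF s \<delta>(1), where B = "2 * B"])
   fix h show "\<bar>w x - w (x + h)\<bar> \<le> 2 * B" using B [of x] B [of "x + h"] by linarith
  qed measurable
  fix h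
  \<comment> \<open>Shifting both points by h leaves the penalty unchanged.\<close>
  have "w (x + h) - real i * (norm (z + h - (x + h)))^2 \<le> supconv i w (z + h)" by (rule supconv_ge) (rule B)
  then have "supconv i w z - supconv i w (z + h) \<le> w x - w (x + h)" using W by simp
  then show "indicator (- ball 0 \<delta>) h * ((supconv i w z - supconv i w (z + h)) * rker s h)
    \<le> indicator (- ball 0 \<delta>) h * ((w x - w (x + h)) * rker s h)"
   by (intro mult_left_mono mult_right_mono rker_nonneg) auto
 qed
 with touch x(1) show thesis by (intro that [of x]) (auto simp: dist_norm norm_minus_commute)
qed

text \<open>The inequality at all points z is integrated against the bump, and only then \<delta>
  tends to 0: the mollified sup-convolution has a fractional Laplacian, and with i fixed the error i
  \<open>ball_moment\<close> disappears. The distance \<eta> from z to the touching point costs the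
  error e, by uniform continuity of g on a smaller closed ball.\<close>

lemma flap_moll_supconv_le:
 fixes w :: "'a::euclidean_space => real"
 assumes s: "0 < s" "s < 1" and r: "0 < r" and T: "touch_sub s (ball 0 M) w g"
  and wm [measurable]: "w \<in> borel_measurable borel" and B: "\<And>y. \<bar>w y\<bar> \<le> B"
  and cont: "continuous_on (ball 0 M) w"
  and gm [measurable]: "g \<in> borel_measurable borel" and gc: "continuous_on (ball 0 M) g"
  and x0: "norm x0 + r < M" and e: "0 < e"
 shows "\<forall>\<^sub>F i in sequentially. flap s (moll r (supconv i w)) x0 \<le> moll r g x0 + e * (LBINT (z::'a). bump r z)"
proof -
 define \<rho> where "\<rho> = norm x0 + r"
 define \<rho>' where "\<rho>' = (\<rho> + M) / 2"
 have \<rho>: "\<rho> < \<rho>'" "\<rho>' < M" "0 < \<rho>" using x0 add_nonneg_pos [OF norm_ge_zero [of x0] r] by (auto simp: \<rho>_def \<rho>'_def)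
 have sub: "cball 0 \<rho>' \<subseteq> ball (0::'a) M" using \<rho> by auto
 have gc': "continuous_on (cball 0 \<rho>') g" by (rule continuous_on_subset [OF gc sub])
 obtain d where d: "d > 0" "\<And>x z. x \<in> cball 0 \<rho>' ==> z \<in> cball 0 \<rho>' ==> dist x z < d ==> dist (g x) (g z) < e"
  using compact_uniformly_continuous [OF gc'] e unfolding uniformly_continuous_on_def by (metis compact_cball)
 obtain G where G: "\<And>z. z \<in> cball 0 \<rho>' ==> \<bar>g z\<bar> \<le> G"
  using compact_continuous_image [OF gc' compact_cball, THEN compact_imp_bounded]
  unfolding bounded_iff by (metis imageI real_norm_def)
 define \<eta> where "\<eta> = min (\<rho>' - \<rho>) (d / 2)"
 have \<eta>: "0 < \<eta>" "\<eta> \<le> \<rho>' - \<rho>" "\<eta> < d" using \<rho> d by (auto simp: \<eta>_def)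
 have pw: "tflap s \<delta> (supconv i w) z \<le> g z + e + real i * ball_moment TYPE('a) s \<delta>"
  if i: "2 * B < real i * \<eta>^2" and \<delta>: "0 < \<delta>" "\<delta> \<le> M - \<rho>'" and z: "norm z \<le> \<rho>" for i \<delta> z
 proof -
  obtain x where x: "norm (x - z) \<le> \<eta>" "tflap s \<delta> (supconv i w) z \<le> g x + real i * ball_moment TYPE('a) s \<delta>"
   by (rule tflap_supconv_le [OF s T wm B cont _ \<eta>(1) i \<delta>(1), of z]) (use z \<eta> \<delta> \<rho> in auto)
  have "norm x \<le> \<rho>'" using norm_triangle_ineq [of z "x - z"] x z \<eta> by simp
  then have "dist (g x) (g z) < e" using x \<eta> z \<rho> by (intro d) (auto simp: dist_norm)
  then show ?thesis using x(2) by (simp add: dist_real_def abs_less_iff)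
 qed
 obtain n :: nat where n: "2 * B / \<eta>^2 < real n" using reals_Archimedean2 by blast
 have "flap s (moll r (supconv i w)) x0 \<le> moll r g x0 + e * (LBINT (z::'a). bump r z)" if "n \<le> i" for i
 proof -
  have i: "2 * B < real i * \<eta>^2"
  proof -
   have "2 * B < real n * \<eta>^2" using n \<eta> by (simp add: field_simps)
   also have "... \<le> real i * \<eta>^2" using that by (intro mult_right_mono) auto
   finally show ?thesis .
  qed
  have Wm [measurable]: "supconv i w \<in> borel_measurable borel" by (rule supconv_measurable [OF B])
  have WB: "\<bar>supconv i w y\<bar> \<le> B" for y by (rule supconv_bound [OF B])
  have gi: "integrable lborel (\<lambda>z. g z * bump r (x0 - z))"
  proof (rule integrable_mult_bump [OF r gm])
   fix z assume "norm (x0 - z) < r"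
   then have "norm z \<le> \<rho>'" using \<rho> norm_triangle_ineq2 [of z x0] by (simp add: \<rho>_def norm_minus_commute)
   then show "\<bar>g z\<bar> \<le> G" by (intro G) simp
  qed
  have bi: "integrable lborel (\<lambda>z. c * bump r (x0 - z))" for c
   by (intro integrable_mult_right integrable_bump_shift r)
  have step: "tflap s \<delta> (moll r (supconv i w)) x0 \<le> moll r g x0 + (e + real i * ball_moment TYPE('a) s \<delta>) * (LBINT (z::'a). bump r z)"
   if \<delta>: "0 < \<delta>" "\<delta> \<le> M - \<rho>'" for \<delta>
  proof -
   have "tflap s \<delta> (moll r (supconv i w)) x0 = (LBINT z. tflap s \<delta> (supconv i w) z * bump r (x0 - z))"
    by (rule tflap_moll(2) [OF s r \<delta>(1) Wm WB])
   also have "... \<le> (LBINT z. g z * bump r (x0 - z) + (e + real i * ball_moment TYPE('a) s \<delta>) * bump r (x0 - z))"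
   proof (rule integral_mono)
    show "integrable lborel (\<lambda>z. tflap s \<delta> (supconv i w) z * bump r (x0 - z))"
     by (rule tflap_moll(1) [OF s r \<delta>(1) Wm WB])
    show "integrable lborel (\<lambda>z. g z * bump r (x0 - z) + (e + real i * ball_moment TYPE('a) s \<delta>) * bump r (x0 - z))"
     by (intro integrable_add gi bi)
    fix z
    show "tflap s \<delta> (supconv i w) z * bump r (x0 - z) \<le> g z * bump r (x0 - z) + (e + real i * ball_moment TYPE('a) s \<delta>) * bump r (x0 - z)"
    proof (cases "norm (x0 - z) < r")
     case True
     then have "norm z \<le> \<rho>" using norm_triangle_ineq2 [of z x0] by (simp add: \<rho>_def norm_minus_commute)
     from mult_right_mono [OF pw [OF i \<delta> this] bump_nonneg [of r "x0 - z"]]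
     show ?thesis by (simp add: algebra_simps)
    qed (simp add: bump_eq_0 r)
   qed
   also have "... = moll r g x0 + (e + real i * ball_moment TYPE('a) s \<delta>) * (LBINT (z::'a). bump r z)"
    using gi bi [of "e + real i * ball_moment TYPE('a) s \<delta>"]
    by (simp add: moll_def integral_bump_shift)
   finally show ?thesis .
  qed
  obtain C where C: "C \<ge> 0" "\<And>(f :: 'a => real) B x h. f \<in> borel_measurable borel ==>
    (\<And>y. \<bar>f y\<bar> \<le> B) ==> \<bar>sdiff (moll r f) x h\<bar> \<le> B * C * min 1 ((norm h)^2)"
   using sdiff_moll_bound [OF r, where 'a = 'a] by blast
  let ?v = "moll r (supconv i w)"
  have vb: "\<bar>?v y\<bar> \<le> B * (LBINT (z::'a). bump r z)" for y by (rule moll_bound [OF r Wm WB])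
  have l1: "((\<lambda>\<delta>. tflap s \<delta> ?v x0) \<longlongrightarrow> flap s ?v x0) (at_right 0)"
  proof (rule tflap_tendsto_flap)
   show "integrable lborel (\<lambda>h. indicator (- ball 0 e) h * ((?v x0 - ?v (x0 + h)) * rker s h))" if "e > 0" for e
   proof (rule integrable_off_ball [OF s that, where B = "2 * (B * (LBINT (z::'a). bump r z))"])
    fix h show "\<bar>?v x0 - ?v (x0 + h)\<bar> \<le> 2 * (B * (LBINT (z::'a). bump r z))"
     using vb [of x0] vb [of "x0 + h"] by linarith
   qed measurable
   show "integrable lborel (\<lambda>h. sdiff ?v x0 h * rker s h)"
    by (rule integrable_near_0 [OF s _ C(2) [OF Wm WB]]) measurable
  qed
  have l2: "((\<lambda>\<delta>. moll r g x0 + (e + real i * ball_moment TYPE('a) s \<delta>) * (LBINT (z::'a). bump r z)) \<longlongrightarrow>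
    moll r g x0 + (e + real i * 0) * (LBINT (z::'a). bump r z)) (at_right 0)"
   by (intro tendsto_intros ball_moment_tendsto s)
  have ev: "\<forall>\<^sub>F \<delta> in at_right 0. tflap s \<delta> ?v x0 \<le> moll r g x0 + (e + real i * ball_moment TYPE('a) s \<delta>) * (LBINT (z::'a). bump r z)"
   unfolding eventually_at_right_field
   using step \<rho> by (intro exI [of _ "M - \<rho>'"]) auto
  have "flap s ?v x0 \<le> moll r g x0 + (e + real i * 0) * (LBINT (z::'a). bump r z)"
   by (rule tendsto_le [OF trivial_limit_at_right_real l2 l1 ev])
  then show ?thesis by simp
 qed
 then show ?thesis by (auto simp: eventually_sequentially)
qed

text \<open>The cut-off functions to which this is applied may jump on a sphere, so convergence of
  the sup-convolutions is available almost everywhere only; under the mollifier this is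
  enough.\<close>

theorem touch_sub_flap_moll_le:
 fixes w :: "'a::euclidean_space => real"
 assumes s: "0 < s" "s < 1" and r: "0 < r" and T: "touch_sub s (ball 0 M) w g"
  and wm: "w \<in> borel_measurable borel" and B: "\<And>y. \<bar>w y\<bar> \<le> B"
  and cont: "continuous_on (ball 0 M) w" and ae: "AE y in lborel. isCont w y"
  and gm: "g \<in> borel_measurable borel" and gc: "continuous_on (ball 0 M) g"
  and x0: "norm x0 + r < M"
 shows "flap s (moll r w) x0 \<le> moll r g x0"
proof (rule field_le_epsilon)
 fix e :: real assume e: "0 < e"
 define I where "I = (LBINT (z::'a). bump r z)"
 have I: "I > 0" unfolding I_def by (rule integral_bump_pos [OF r])
 have "(\<lambda>i. flap s (moll r (supconv i w)) x0) \<longlonglongrightarrow> flap s (moll r w) x0"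
 proof (rule flap_moll_tendsto [OF s r _ wm _ B])
  show "supconv i w \<in> borel_measurable borel" for i by (rule supconv_measurable [OF B])
  show "\<bar>supconv i w y\<bar> \<le> B" for i y by (rule supconv_bound [OF B])
  show "AE y in lborel. (\<lambda>i. supconv i w y) \<longlonglongrightarrow> w y"
   using ae by eventually_elim (rule supconv_tendsto [OF B])
 qed
 moreover have "\<forall>\<^sub>F i in sequentially. flap s (moll r (supconv i w)) x0 \<le> moll r g x0 + e / I * I"
  unfolding I_def
  by (rule flap_moll_supconv_le [OF s r T wm B cont gm gc x0]) (use e I in \<open>simp add: I_def\<close>)
 ultimately have "flap s (moll r w) x0 \<le> moll r g x0 + e / I * I"
  by (rule tendsto_upperbound) simp
 then show "flap s (moll r w) x0 \<le> moll r g x0 + e" using I by simp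
qed

lemma moll_uminus: "moll r (\<lambda>y. - f y) x = - moll r f x"
 by (simp add: moll_def)

lemma flap_uminus: "flap s (\<lambda>y. - f y) x = - flap s f x"
proof -
 have "(LBINT h. sdiff (\<lambda>y. - f y) x h * rker s h) = (LBINT h. - (sdiff f x h * rker s h))"
  by (intro integral_cong) (auto simp: sdiff_def algebra_simps)
 then show ?thesis by (simp add: flap_def)
qed

theorem visc_flap_moll_eq:
 fixes w :: "real ^ 'n => real"
 assumes s: "0 < s" "s < 1" and r: "0 < r" and visc: "visc_frac_laplacian_eq s (ball 0 M) w g"
  and wm: "w \<in> borel_measurable borel" and B: "\<And>y. \<bar>w y\<bar> \<le> B" and ae: "AE y in lborel. isCont w y"
  and gm: "g \<in> borel_measurable borel" and x0: "norm x0 + r < M"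
 shows "flap s (moll r w) x0 = moll r g x0"
proof (rule antisym)
 have wc: "continuous_on (ball 0 M) w" and gc: "continuous_on (ball 0 M) g"
  using visc by (auto simp: visc_frac_laplacian_eq_def)
 note T = visc_imp_touch_sub [OF s visc wm B]
 show "flap s (moll r w) x0 \<le> moll r g x0"
  by (rule touch_sub_flap_moll_le [OF s r T(1) wm B wc ae gm gc x0])
 have "flap s (moll r (\<lambda>y. - w y)) x0 \<le> moll r (\<lambda>y. - g y) x0"
 proof (rule touch_sub_flap_moll_le [OF s r T(2) _ _ _ _ _ _ x0])
  show "AE y in lborel. isCont (\<lambda>y. - w y) y" using ae by eventually_elim (rule continuous_minus)
 qed (use wm gm B wc gc in \<open>auto intro: continuous_on_minus\<close>)
 moreover have "moll r (\<lambda>y. - w y) = (\<lambda>x. - moll r w x)" by (rule ext) (rule moll_uminus)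
 ultimately show "moll r g x0 \<le> flap s (moll r w) x0" by (simp add: moll_uminus flap_uminus)
qed

section \<open>A Liouville property\<close>

lemma one_plus_norm_le: "1 + norm (y::'a::real_normed_vector) \<le> (1 + norm (y + a)) * (1 + norm a)"
proof -
 have "norm y \<le> norm (y + a) + norm a" using norm_triangle_ineq4 [of "y + a" a] by simp
 moreover have "0 \<le> norm (y + a) * norm a" by simp
 moreover have "(1 + norm (y + a)) * (1 + norm a) = 1 + norm (y + a) + norm a + norm (y + a) * norm a"
  by (simp add: algebra_simps)
 ultimately show ?thesis by linarith
qed

text \<open>Peetre's inequality: a translation by a bounded vector changes a power weight by a
  bounded factor.\<close>

lemma inverse_weight_shift:
 fixes y a :: "'a::real_normed_vector"
 assumes "norm a \<le> b"
 shows "1 / (1 + norm (y + a)) ^ L \<le> (1 + b) ^ L / (1 + norm y) ^ L"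
proof -
 have b: "0 \<le> b" using assms norm_ge_zero order_trans by blast
 have "1 + norm y \<le> (1 + norm (y + a)) * (1 + norm a)" by (rule one_plus_norm_le)
 also have "... \<le> (1 + norm (y + a)) * (1 + b)" using assms by (intro mult_left_mono) auto
 finally have "(1 + norm y) ^ L \<le> ((1 + norm (y + a)) * (1 + b)) ^ L" by (intro power_mono) auto
 moreover have "0 < (1 + norm y) ^ L" "0 < (1 + norm (y + a)) ^ L" by (simp_all add: add_pos_nonneg)
 ultimately show ?thesis by (simp add: power_mult_distrib divide_simps mult.commute)
qed

lemma fdiff_abs_le:
 assumes "\<And>j. j \<le> m ==> \<bar>f (x + real j *\<^sub>R h)\<bar> \<le> B"
 shows "\<bar>fdiff m h f x\<bar> \<le> 2 ^ m * B"
proof -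
 have "\<bar>fdiff m h f x\<bar> \<le> (\<Sum>j\<le>m. real (m choose j) * B)"
  unfolding fdiff_def
  by (intro order.trans [OF sum_abs] sum_mono) (auto simp: abs_mult intro!: mult_left_mono assms)
 also have "... = (\<Sum>j\<le>m. real (m choose j)) * B" by (simp add: sum_distrib_right)
 also have "(\<Sum>j\<le>m. real (m choose j)) = 2 ^ m"
  using choose_row_sum [of m] by (metis of_nat_sum of_nat_power of_nat_numeral)
 finally show ?thesis .
qed

lemma fdiff_measurable [measurable]:
 fixes f :: "'a::euclidean_space => real"
 assumes [measurable]: "f \<in> borel_measurable borel"
 shows "fdiff m h f \<in> borel_measurable borel"
 unfolding fdiff_def [abs_def] by measurable

lemma sdiff_fdiff: "sdiff (fdiff m h f) x z = fdiff m h (\<lambda>y. sdiff f y z) x"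
 unfolding sdiff_def fdiff_def
 by (simp add: sum_subtractf [symmetric] sum_distrib_left algebra_simps)

section \<open>Differences of the heat kernel and of its action on a bump\<close>

lemma gker1_decay:
 obtains C where "C > 0" "\<And>y::'a::euclidean_space. gker 1 y \<le> C / (1 + norm y) ^ p"
proof -
 have g: "gauss_mass TYPE('a) > 0" by (rule gauss_mass_pos)
 have "gker 1 y \<le> (fact p * exp 2 / gauss_mass TYPE('a)) / (1 + norm y) ^ p" for y :: 'a
 proof -
  have "0 < (1 + norm y) ^ p" by (simp add: add_pos_nonneg)
  then show ?thesis
   using polynomial_gaussian_bound [of "norm y" p] g by (simp add: gker_def divide_simps mult_ac)
 qed
 moreover have "fact p * exp 2 / gauss_mass TYPE('a) > 0" using g by simp
 ultimately show thesis by (rule that [rotated])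
qed

text \<open>If \<kappa> = |h| (1 + |y|) is at most 1, the Gaussian at y + j h is that at y times the
  exponential of a small quadratic in j, and the power series bound applies. Otherwise 1 \<le>
  \<kappa>^m, and the triangle inequality with a weight of order L + m is good enough.\<close>

lemma fdiff_gker1_bound:
 assumes H: "0 \<le> H"
 obtains C where "C \<ge> 0" "\<And>h y::'a::euclidean_space. norm h \<le> H ==>
  \<bar>fdiff m h (gker 1) y\<bar> \<le> C * norm h ^ m / (1 + norm y) ^ L"
proof -
 define M where "M = gauss_mass TYPE('a)"
 have M: "M > 0" unfolding M_def by (rule gauss_mass_pos)
 obtain C1 where C1: "C1 \<ge> 0" "\<And>a b \<kappa>. \<bar>a\<bar> \<le> \<kappa> ==> \<bar>b\<bar> \<le> \<kappa>^2 ==> \<kappa> \<le> 1 ==>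
  \<bar>\<Sum>j\<le>m. (-1)^j * real (m choose j) * exp (real j * a + (real j)^2 * b)\<bar> \<le> C1 * \<kappa> ^ m"
  using fdiff_power_series_bound [of "real m * 1 + (real m * 1)^2 + 1" "\<lambda>i. 1 / fact i" exp 1 m] exp_sums by auto
 obtain C2 where C2: "C2 > 0" "\<And>y::'a. gker 1 y \<le> C2 / (1 + norm y) ^ (L + m)"
  using gker1_decay [where 'a = 'a and p = "L + m"] by blast
 define C3 where "C3 = C1 / M * (fact (m + L) * exp 2)"
 define C4 where "C4 = 2 ^ m * (C2 * (1 + real m * H) ^ (L + m))"
 have C34: "0 \<le> C3" "0 \<le> C4" using C1 C2 M H by (auto simp: C3_def C4_def)
 show thesis
 proof (rule that [of "C3 + C4"])
  show "0 \<le> C3 + C4" using C34 by simp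
  fix h y :: 'a assume h: "norm h \<le> H"
  have yp: "0 < 1 + norm y" by (simp add: add_pos_nonneg)
  define \<kappa> where "\<kappa> = norm h * (1 + norm y)"
  have \<kappa>0: "0 \<le> \<kappa>" "norm h \<le> \<kappa>" by (simp_all add: \<kappa>_def mult_left_le algebra_simps)
  show "\<bar>fdiff m h (gker 1) y\<bar> \<le> (C3 + C4) * norm h ^ m / (1 + norm y) ^ L"
  proof (cases "\<kappa> \<le> 1")
   case True
   define a where "a = - (y \<bullet> h) / 2"
   define b where "b = - (norm h)\<^sup>2 / 4"
   have "\<bar>y \<bullet> h\<bar> \<le> norm y * norm h" by (rule Cauchy_Schwarz_ineq2)
   also have "... \<le> \<kappa>" by (simp add: \<kappa>_def algebra_simps)
   finally have a: "\<bar>a\<bar> \<le> \<kappa>" using \<kappa>0 by (simp add: a_def)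
   have "(norm h)^2 \<le> \<kappa>^2" using \<kappa>0 by (intro power_mono) auto
   then have b: "\<bar>b\<bar> \<le> \<kappa>^2" using zero_le_power2 [of "norm h"] unfolding b_def by linarith
   have e: "gker 1 (y + real j *\<^sub>R h) = exp (- ((norm y)^2 / 4)) / M * exp (real j * a + (real j)^2 * b)" for j
   proof -
    have "(norm (y + real j *\<^sub>R h))^2 = (norm y)^2 + 2 * real j * (y \<bullet> h) + (real j)^2 * (norm h)^2"
     unfolding power2_norm_eq_inner
     by (simp add: inner_simps inner_commute) (simp add: power2_eq_square algebra_simps)
    then have E: "- ((norm (y + real j *\<^sub>R h))^2 / 4) = - ((norm y)^2 / 4) + (real j * a + (real j)^2 * b)"
     by (simp add: a_def b_def field_simps)
    have "gker 1 v = exp (- ((norm v)^2 / 4)) / M" for v :: 'a by (simp add: gker_def M_def)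
    then show ?thesis unfolding E by (simp only: E exp_add times_divide_eq_left)
   qed
   have "fdiff m h (gker 1) y = exp (- ((norm y)^2 / 4)) / M * (\<Sum>j\<le>m. (-1)^j * real (m choose j) * exp (real j * a + (real j)^2 * b))"
    unfolding fdiff_def e sum_distrib_left by (intro sum.cong) auto
   then have "\<bar>fdiff m h (gker 1) y\<bar> \<le> exp (- ((norm y)^2 / 4)) / M * (C1 * \<kappa> ^ m)"
    using C1(2) [OF a b True] M by (simp add: abs_mult divide_right_mono mult_left_mono)
   also have "... = C1 / M * norm h ^ m * ((1 + norm y) ^ (m + L) * exp (- ((norm y)^2 / 4))) / (1 + norm y) ^ L"
    using yp by (simp add: \<kappa>_def power_mult_distrib power_add)
   also have "... \<le> C1 / M * norm h ^ m * (fact (m + L) * exp 2) / (1 + norm y) ^ L"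
    using C1 M yp polynomial_gaussian_bound [of "norm y" "m + L"]
    by (intro divide_right_mono mult_left_mono) auto
   also have "... = C3 * norm h ^ m / (1 + norm y) ^ L" by (simp add: C3_def)
   also have "... \<le> (C3 + C4) * norm h ^ m / (1 + norm y) ^ L"
    using C34 by (intro divide_right_mono mult_right_mono) auto
   finally show ?thesis .
  next
   case False
   have "\<bar>fdiff m h (gker 1) y\<bar> \<le> 2 ^ m * (C2 * ((1 + real m * H) ^ (L + m) / (1 + norm y) ^ (L + m)))"
   proof (rule fdiff_abs_le)
    fix j assume j: "j \<le> m"
    have nj: "norm (real j *\<^sub>R h) \<le> real m * H" using j h by (auto intro: mult_mono)
    have "gker 1 (y + real j *\<^sub>R h) \<le> C2 * (1 / (1 + norm (y + real j *\<^sub>R h)) ^ (L + m))" using C2(2) by simp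
    also have "... \<le> C2 * ((1 + real m * H) ^ (L + m) / (1 + norm y) ^ (L + m))"
     using C2 by (intro mult_left_mono inverse_weight_shift nj) auto
    finally show "\<bar>gker 1 (y + real j *\<^sub>R h)\<bar> \<le> C2 * ((1 + real m * H) ^ (L + m) / (1 + norm y) ^ (L + m))"
     using gker_nonneg [of 1 "y + real j *\<^sub>R h"] by simp
   qed
   also have "... = C4 * 1 / (1 + norm y) ^ (L + m)" by (simp add: C4_def)
   also have "... \<le> C4 * \<kappa> ^ m / (1 + norm y) ^ (L + m)"
    using False C34 by (intro divide_right_mono mult_left_mono) (auto simp: one_le_power)
   also have "... = C4 * norm h ^ m / (1 + norm y) ^ L"
    using yp by (simp add: \<kappa>_def power_mult_distrib power_add)
   also have "... \<le> (C3 + C4) * norm h ^ m / (1 + norm y) ^ L"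
    using C34 by (intro divide_right_mono mult_right_mono) auto
   finally show ?thesis .
  qed
 qed
qed

text \<open>Scaling turns time t and step h into time 1 and step h / sqrt t, so an m-th difference
  gains t^(-m/2). For t \<ge> 1 the scaled step is at most |h|, which keeps the constant
  uniform.\<close>

lemma fdiff_gker_bound:
 fixes h :: "'a::euclidean_space"
 obtains C where "C \<ge> 0" "\<And>t y. 1 \<le> t ==> \<bar>fdiff m h (gker t) y\<bar> \<le> C / (sqrt t + norm y) ^ (DIM('a) + m)"
proof -
 obtain C where C: "C \<ge> 0" "\<And>h' y::'a. norm h' \<le> norm h ==>
  \<bar>fdiff m h' (gker 1) y\<bar> \<le> C * norm h' ^ m / (1 + norm y) ^ (DIM('a) + m)"
  using fdiff_gker1_bound [OF norm_ge_zero [of h], of m "DIM('a) + m"] by blast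
 show thesis
 proof (rule that [of "C * norm h ^ m"])
  show "0 \<le> C * norm h ^ m" using C by simp
  fix t :: real and y :: 'a assume t: "1 \<le> t"
  define q where "q = sqrt t"
  have q: "q \<ge> 1" using t by (simp add: q_def)
  have g: "gker t z = gker 1 ((1 / q) *\<^sub>R z) / q ^ DIM('a)" for z :: 'a
   using gker_scale [of t "(1 / q) *\<^sub>R z"] t q by (simp add: q_def [symmetric])
  have "fdiff m h (gker t) y = fdiff m ((1 / q) *\<^sub>R h) (gker 1) ((1 / q) *\<^sub>R y) / q ^ DIM('a)"
   unfolding fdiff_def sum_divide_distrib
   by (intro sum.cong) (auto simp: g scaleR_add_right)
  then have "\<bar>fdiff m h (gker t) y\<bar> = \<bar>fdiff m ((1 / q) *\<^sub>R h) (gker 1) ((1 / q) *\<^sub>R y)\<bar> / q ^ DIM('a)"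
   using q by (simp add: abs_divide)
  moreover have "norm ((1 / q) *\<^sub>R h) \<le> norm h" using q by (simp add: divide_le_eq mult_left_le mult_le_cancel_left1)
  from C(2) [OF this, of "(1 / q) *\<^sub>R y"]
  have "\<bar>fdiff m ((1 / q) *\<^sub>R h) (gker 1) ((1 / q) *\<^sub>R y)\<bar> \<le> C * (norm h / q) ^ m / (1 + norm y / q) ^ (DIM('a) + m)"
   using q by simp
  ultimately have "\<bar>fdiff m h (gker t) y\<bar> \<le> C * (norm h / q) ^ m / (1 + norm y / q) ^ (DIM('a) + m) / q ^ DIM('a)"
   using q by (simp only:) (intro divide_right_mono, auto)
  also have "... = C * norm h ^ m / ((1 + norm y / q) ^ (DIM('a) + m) * q ^ (DIM('a) + m))"
   using q by (simp add: power_divide power_add)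
  also have "(1 + norm y / q) ^ (DIM('a) + m) * q ^ (DIM('a) + m) = (q + norm y) ^ (DIM('a) + m)"
   using q by (simp add: power_mult_distrib [symmetric] distrib_right)
  finally show "\<bar>fdiff m h (gker t) y\<bar> \<le> C * norm h ^ m / (sqrt t + norm y) ^ (DIM('a) + m)"
   by (simp add: q_def)
 qed
qed

text \<open>The heat evolution of f. The value f x at t = 0 makes time 0 an ordinary time, without a
  limit.\<close>

definition heat :: "('a::euclidean_space => real) => real => 'a => real" where
 "heat f t x = (if t > 0 then \<integral>z. f (x + z) * gker t z \<partial>lborel else f x)"

lemma heat_measurable [measurable]:
 fixes f :: "'a::euclidean_space => real"
 assumes [measurable]: "f \<in> borel_measurable borel"
 shows "(\<lambda>(t, x). heat f t x) \<in> borel_measurable (borel \<Otimes>\<^sub>M borel)"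
 unfolding heat_def by measurable

text \<open>The difference is moved from the bump to the heat kernel, where it produces decay in
  time and space.\<close>

lemma heat_fdiff_bump:
 fixes h :: "'a::euclidean_space"
 assumes r: "0 < r" and t: "0 < t"
 shows "heat (fdiff m h (bump r)) t x = (LBINT w. bump r w * fdiff m h (gker t) (x - w))"
proof -
 have int: "integrable lborel (\<lambda>z. bump r (c + z) * gker t z)" for c :: 'a
 proof (rule integrable_bound [OF integrable_gker [OF t]])
  show "AE z in lborel. norm (bump r (c + z) * gker t z) \<le> norm (gker t z)"
   using bump_le_1
   by (intro AE_I2) (auto simp: abs_mult abs_of_nonneg [OF bump_nonneg] bump_nonneg intro!: mult_left_le_one_le)
 qed measurable
 have shift: "(LBINT z. bump r (c + z) * gker t z) = (LBINT w. bump r w * gker t (c - w))"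
  "integrable lborel (\<lambda>w. bump r w * gker t (c - w))" for c :: 'a
 proof -
  have eq: "bump r (c + z) * gker t (c - (c + z)) = bump r (c + z) * gker t z" for z
   by (simp add: gker_minus)
  show "(LBINT z. bump r (c + z) * gker t z) = (LBINT w. bump r w * gker t (c - w))"
   using integral_lborel_shift [of "\<lambda>w. bump r w * gker t (c - w)" c] by (simp only: eq)
  show "integrable lborel (\<lambda>w. bump r w * gker t (c - w))"
   using integrable_lborel_shift_iff [of "\<lambda>w. bump r w * gker t (c - w)" c] int [of c] by (simp only: eq)
 qed
 have "heat (fdiff m h (bump r)) t x = (LBINT z. (\<Sum>j\<le>m. (-1)^j * real (m choose j) * (bump r (x + real j *\<^sub>R h + z) * gker t z)))"
  using t unfolding heat_def fdiff_def by (simp add: sum_distrib_left algebra_simps)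
 also have "... = (\<Sum>j\<le>m. (-1)^j * real (m choose j) * (LBINT z. bump r (x + real j *\<^sub>R h + z) * gker t z))"
  by (subst integral_sum) (auto intro!: integrable_mult_right int)
 also have "... = (\<Sum>j\<le>m. (-1)^j * real (m choose j) * (LBINT w. bump r w * gker t (x + real j *\<^sub>R h - w)))"
  by (simp only: shift)
 also have "... = (LBINT w. (\<Sum>j\<le>m. (-1)^j * real (m choose j) * (bump r w * gker t (x + real j *\<^sub>R h - w))))"
  by (subst integral_sum) (auto intro!: integrable_mult_right shift)
 also have "... = (LBINT w. bump r w * fdiff m h (gker t) (x - w))"
  unfolding fdiff_def by (intro integral_cong) (auto simp: sum_distrib_left algebra_simps)
 finally show ?thesis .
qed

lemma heat_fdiff_bump_decay:
 fixes h :: "'a::euclidean_space"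
 assumes r: "0 < r"
 obtains C where "C \<ge> 0" "\<And>t x. 1 \<le> t ==> \<bar>heat (fdiff m h (bump r)) t x\<bar> \<le> C / (sqrt t + norm x) ^ (DIM('a) + m)"
proof -
 define L where "L = DIM('a) + m"
 obtain C where C: "C \<ge> 0" "\<And>t y. 1 \<le> t ==> \<bar>fdiff m h (gker t) y\<bar> \<le> C / (sqrt t + norm y) ^ L"
  unfolding L_def using fdiff_gker_bound [of m h] by blast
 define I where "I = (LBINT (z::'a). bump r z)"
 have I: "I > 0" unfolding I_def by (rule integral_bump_pos [OF r])
 show thesis
 proof (rule that [of "C * (1 + r) ^ L * I"], unfold L_def [symmetric])
  show "0 \<le> C * (1 + r) ^ L * I" using C r I by simp
  fix t :: real and x :: 'a assume t: "1 \<le> t"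
  then have t0: "0 < t" by simp
  have st: "1 \<le> sqrt t" using t by simp
  have pt: "\<bar>bump r w * fdiff m h (gker t) (x - w)\<bar> \<le> (C * (1 + r) ^ L / (sqrt t + norm x) ^ L) * bump r w" for w
  proof (cases "norm w < r")
   case True
   have sx: "0 < sqrt t + norm x" "0 < sqrt t + norm (x - w)" using st by (simp_all add: add_pos_nonneg)
   have "sqrt t + norm x \<le> sqrt t + norm (x - w) + r"
    using True norm_triangle_ineq [of "x - w" w] by simp
   also have "... \<le> (1 + r) * (sqrt t + norm (x - w))"
   proof -
    have "r * 1 \<le> r * (sqrt t + norm (x - w))" using r st by (intro mult_left_mono) (auto intro: add_increasing2)
    then show ?thesis by (simp add: algebra_simps)
   qed
   finally have "(sqrt t + norm x) ^ L \<le> ((1 + r) * (sqrt t + norm (x - w))) ^ L"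
    using sx by (intro power_mono) auto
   then have le: "1 / (sqrt t + norm (x - w)) ^ L \<le> (1 + r) ^ L / (sqrt t + norm x) ^ L"
    using sx by (simp add: power_mult_distrib divide_simps mult.commute)
   have "\<bar>fdiff m h (gker t) (x - w)\<bar> \<le> C * (1 / (sqrt t + norm (x - w)) ^ L)" using C(2) [OF t] by simp
   also have "... \<le> C * ((1 + r) ^ L / (sqrt t + norm x) ^ L)" using C(1) by (intro mult_left_mono le)
   finally have "\<bar>fdiff m h (gker t) (x - w)\<bar> \<le> C * (1 + r) ^ L / (sqrt t + norm x) ^ L" by simp
   from mult_right_mono [OF this bump_nonneg [of r w]] show ?thesis
    by (simp add: abs_mult abs_of_nonneg [OF bump_nonneg] mult.commute)
  qed (simp add: bump_eq_0 r)
  have bi: "integrable lborel (\<lambda>w::'a. (C * (1 + r) ^ L / (sqrt t + norm x) ^ L) * bump r w)"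
   by (intro integrable_mult_right integrable_bump r)
  have "\<bar>heat (fdiff m h (bump r)) t x\<bar> \<le> (LBINT w. \<bar>bump r w * fdiff m h (gker t) (x - w)\<bar>)"
   unfolding heat_fdiff_bump [OF r t0] by (rule integral_abs_bound)
  also have "... \<le> (LBINT (w::'a). (C * (1 + r) ^ L / (sqrt t + norm x) ^ L) * bump r w)"
   by (rule integral_mono' [OF bi pt order.trans [OF abs_ge_zero pt]])
  also have "... = C * (1 + r) ^ L / (sqrt t + norm x) ^ L * I"
   unfolding I_def by (rule integral_mult_right_zero)
  finally show "\<bar>heat (fdiff m h (bump r)) t x\<bar> \<le> C * (1 + r) ^ L * I / (sqrt t + norm x) ^ L" by simp
 qed
qed

lemma fdiff_bump_decay:
 fixes h :: "'a::euclidean_space"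
 assumes r: "0 < r"
 shows "\<bar>fdiff m h (bump r) y\<bar> \<le> 2 ^ m * (1 + r + real m * norm h) ^ L / (1 + norm y) ^ L"
proof -
 have "\<bar>fdiff m h (bump r) y\<bar> \<le> 2 ^ m * ((1 + r + real m * norm h) ^ L / (1 + norm y) ^ L)"
 proof (rule fdiff_abs_le)
  fix j assume j: "j \<le> m"
  have n: "norm (real j *\<^sub>R h) \<le> real m * norm h" using j by (auto intro: mult_right_mono)
  have yp: "0 < (1 + norm y) ^ L" by (simp add: add_pos_nonneg)
  show "\<bar>bump r (y + real j *\<^sub>R h)\<bar> \<le> (1 + r + real m * norm h) ^ L / (1 + norm y) ^ L"
  proof (cases "norm (y + real j *\<^sub>R h) < r")
   case True
   have "norm y \<le> norm (y + real j *\<^sub>R h) + norm (real j *\<^sub>R h)"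
    using norm_triangle_ineq4 [of "y + real j *\<^sub>R h" "real j *\<^sub>R h"] by simp
   then have "(1 + norm y) ^ L \<le> (1 + r + real m * norm h) ^ L" using True n by (intro power_mono) auto
   then have "1 \<le> (1 + r + real m * norm h) ^ L / (1 + norm y) ^ L" using yp by simp
   then show ?thesis using bump_le_1 [of r "y + real j *\<^sub>R h"] bump_nonneg [of r "y + real j *\<^sub>R h"] by linarith
  next
   case False
   then show ?thesis using r by (simp add: bump_eq_0)
  qed
 qed
 then show ?thesis by simp
qed

text \<open>\<open>\<sigma> - heat \<sigma> t\<close> for \<open>\<sigma> = fdiff m h (bump r)\<close>: small time by second differences, large time by the decay above.\<close>

lemma heat_defect_bound:
 fixes h :: "'a::euclidean_space"
 assumes r: "0 < r"
 obtains C where "C \<ge> 0" "\<And>t y. 0 < t ==>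
  \<bar>fdiff m h (bump r) y - heat (fdiff m h (bump r)) t y\<bar> \<le> C * min 1 t / (1 + norm y) ^ (DIM('a) + m)"
proof -
 define L where "L = DIM('a) + m"
 let ?\<sigma> = "fdiff m h (bump r)"
 obtain C1 where C1: "C1 \<ge> 0" "\<And>t x. 1 \<le> t ==> \<bar>heat ?\<sigma> t x\<bar> \<le> C1 / (sqrt t + norm x) ^ L"
  unfolding L_def using heat_fdiff_bump_decay [OF r, of m h] by blast
 define C2 where "C2 = 2 ^ m * (1 + r + real m * norm h) ^ L"
 have C2: "C2 \<ge> 0" "\<And>y. \<bar>?\<sigma> y\<bar> \<le> C2 / (1 + norm y) ^ L"
  unfolding C2_def using r by (auto simp: fdiff_bump_decay)
 obtain C3 where C3: "C3 \<ge> 0" "\<And>t. 0 < t ==> t \<le> 1 ==>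
  (LBINT (z::'a). (norm z)^2 * (1 + norm z) ^ L * gker t z) \<le> C3 * t"
  using gker_second_moment [where p = L and 'a = 'a] by blast
 define C4 where "C4 = 2 ^ m * (156 / r^2 * (1 + r) ^ L * (1 + real m * norm h) ^ L)"
 have C4: "C4 \<ge> 0" using r by (simp add: C4_def)
 have sd: "\<bar>sdiff ?\<sigma> y z\<bar> \<le> C4 * ((norm z)^2 * (1 + norm z) ^ L) / (1 + norm y) ^ L" for y z
 proof -
  have "\<bar>fdiff m h (\<lambda>y. sdiff (bump r) y z) y\<bar> \<le> 2 ^ m * ((156 / r^2 * (1 + r) ^ L) * (norm z)^2 * (1 + norm z) ^ L *
    ((1 + real m * norm h) ^ L / (1 + norm y) ^ L))"
  proof (rule fdiff_abs_le)
   fix j assume j: "j \<le> m"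
   have n: "norm (real j *\<^sub>R h) \<le> real m * norm h" using j by (auto intro: mult_right_mono)
   have "\<bar>sdiff (bump r) (y + real j *\<^sub>R h) z\<bar> \<le> (156 / r^2 * (1 + r) ^ L) * (norm z)^2 * (1 + norm z) ^ L * (1 / (1 + norm (y + real j *\<^sub>R h)) ^ L)"
    using sdiff_bump_weighted [OF r, of "y + real j *\<^sub>R h" z L] by simp
   also have "... \<le> (156 / r^2 * (1 + r) ^ L) * (norm z)^2 * (1 + norm z) ^ L * ((1 + real m * norm h) ^ L / (1 + norm y) ^ L)"
    using r by (intro mult_left_mono inverse_weight_shift n) auto
   finally show "\<bar>sdiff (bump r) (y + real j *\<^sub>R h) z\<bar> \<le> (156 / r^2 * (1 + r) ^ L) * (norm z)^2 * (1 + norm z) ^ L * ((1 + real m * norm h) ^ L / (1 + norm y) ^ L)" .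
  qed
  then show ?thesis unfolding sdiff_fdiff by (simp add: C4_def mult_ac)
 qed
 have sb: "\<bar>?\<sigma> y\<bar> \<le> C2" for y
 proof -
  have "\<bar>?\<sigma> y\<bar> \<le> C2 / (1 + norm y) ^ L" by (rule C2(2))
  also have "... \<le> C2 / 1" using C2(1) by (intro divide_left_mono) (auto simp: one_le_power add_pos_nonneg)
  finally show ?thesis by simp
 qed
 have small: "\<bar>?\<sigma> y - heat ?\<sigma> t y\<bar> \<le> C4 * C3 * t / (1 + norm y) ^ L" if t: "0 < t" "t \<le> 1" for t y
 proof -
  have yp: "0 < (1 + norm y) ^ L" by (simp add: add_pos_nonneg)
  have mi: "integrable lborel (\<lambda>z::'a. (norm z)^2 * (1 + norm z) ^ L * gker t z)"
  proof (rule integrable_bound [OF integrable_power_gker [OF t(1), of "2 + L"]])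
   show "AE z::'a in lborel. norm ((norm z)^2 * (1 + norm z) ^ L * gker t z) \<le> norm ((1 + norm z) ^ (2 + L) * gker t z)"
   proof (intro AE_I2)
    fix z :: 'a
    have "(norm z)^2 * (1 + norm z) ^ L \<le> (1 + norm z)^2 * (1 + norm z) ^ L"
     by (intro mult_right_mono power_mono) auto
    then have "(norm z)^2 * (1 + norm z) ^ L * gker t z \<le> (1 + norm z) ^ (2 + L) * gker t z"
     unfolding power_add using t by (intro mult_right_mono gker_nonneg) auto
    then show "norm ((norm z)^2 * (1 + norm z) ^ L * gker t z) \<le> norm ((1 + norm z) ^ (2 + L) * gker t z)"
     using gker_nonneg [of t z] t by (simp add: abs_mult)
   qed
  qed measurable
  have "2 * (?\<sigma> y - heat ?\<sigma> t y) = (LBINT z. sdiff ?\<sigma> y z * gker t z)"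
   using integral_sdiff_gker [of t ?\<sigma> C2 y] t sb by (simp add: heat_def)
  also have "\<bar>...\<bar> \<le> (LBINT z. \<bar>sdiff ?\<sigma> y z * gker t z\<bar>)" by (rule integral_abs_bound)
  also have "... \<le> (LBINT (z::'a). C4 / (1 + norm y) ^ L * ((norm z)^2 * (1 + norm z) ^ L * gker t z))"
  proof (rule integral_mono')
   show "integrable lborel (\<lambda>z::'a. C4 / (1 + norm y) ^ L * ((norm z)^2 * (1 + norm z) ^ L * gker t z))"
    by (intro integrable_mult_right mi)
   fix z :: 'a
   have g: "0 \<le> gker t z" using t by (intro gker_nonneg) auto
   from mult_right_mono [OF sd [of y z] g]
   show "\<bar>sdiff ?\<sigma> y z * gker t z\<bar> \<le> C4 / (1 + norm y) ^ L * ((norm z)^2 * (1 + norm z) ^ L * gker t z)"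
    using g by (simp add: abs_mult)
   show "0 \<le> C4 / (1 + norm y) ^ L * ((norm z)^2 * (1 + norm z) ^ L * gker t z)"
    using g C4 yp by simp
  qed
  also have "... = C4 / (1 + norm y) ^ L * (LBINT (z::'a). (norm z)^2 * (1 + norm z) ^ L * gker t z)"
   by (rule integral_mult_right_zero)
  also have "... \<le> C4 / (1 + norm y) ^ L * (C3 * t)"
   using C4 yp by (intro mult_left_mono C3(2) t) auto
  finally have "\<bar>2 * (?\<sigma> y - heat ?\<sigma> t y)\<bar> \<le> C4 * C3 * t / (1 + norm y) ^ L" by simp
  moreover have "\<bar>a\<bar> \<le> \<bar>2 * a\<bar>" for a :: real by simp
  ultimately show ?thesis by (rule order.trans [rotated])
 qed
 have large: "\<bar>?\<sigma> y - heat ?\<sigma> t y\<bar> \<le> (C2 + C1) / (1 + norm y) ^ L" if t: "1 \<le> t" for t y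
 proof -
  have "(1 + norm y) ^ L \<le> (sqrt t + norm y) ^ L" using t by (intro power_mono) auto
  then have "C1 / (sqrt t + norm y) ^ L \<le> C1 / (1 + norm y) ^ L"
   using C1(1) t by (intro divide_left_mono mult_pos_pos zero_less_power add_pos_nonneg) auto
  then have "\<bar>heat ?\<sigma> t y\<bar> \<le> C1 / (1 + norm y) ^ L" using C1(2) [OF t, of y] by linarith
  then show ?thesis using C2(2) [of y] by (simp add: add_divide_distrib)
 qed
 show thesis
 proof (rule that [of "C4 * C3 + (C2 + C1)"], unfold L_def [symmetric])
  show "0 \<le> C4 * C3 + (C2 + C1)" using C1 C2 C3 C4 by simp
  fix t :: real and y :: 'a assume t: "0 < t"
  have yp: "0 < (1 + norm y) ^ L" by (simp add: add_pos_nonneg)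
  show "\<bar>?\<sigma> y - heat ?\<sigma> t y\<bar> \<le> (C4 * C3 + (C2 + C1)) * min 1 t / (1 + norm y) ^ L"
  proof (cases "t \<le> 1")
   case True
   have "C4 * C3 * t / (1 + norm y) ^ L \<le> (C4 * C3 + (C2 + C1)) * t / (1 + norm y) ^ L"
    using C1 C2 yp t by (intro divide_right_mono mult_right_mono) auto
   then show ?thesis using small [OF t True, of y] True by (simp add: min_def)
  next
   case False
   have "(C2 + C1) / (1 + norm y) ^ L \<le> (C4 * C3 + (C2 + C1)) / (1 + norm y) ^ L"
    using C3 C4 yp by (intro divide_right_mono) auto
   then show ?thesis using large [of t y] False by (simp add: min_def)
  qed
 qed
qed

text \<open>A positive value forces a global maximum of F on [0, \<infinity>), because F tends to 0.
  At the maximum the integrand is nonnegative with integral 0, so F keeps its maximal value at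
  almost every later time, against the decay.\<close>

lemma mixture_maximum_principle:
 fixes F :: "real => real"
 assumes s: "0 < s" and cont: "\<And>T. continuous_on {0..T} F" and lim: "(F \<longlongrightarrow> 0) at_top"
  and int: "\<And>t. 0 \<le> t ==> integrable lborel (\<lambda>\<tau>. lweight s \<tau> * (F t - F (t + \<tau>)))"
  and eq: "\<And>t. 0 \<le> t ==> (LBINT \<tau>. lweight s \<tau> * (F t - F (t + \<tau>))) = 0"
  and t0: "0 \<le> t0"
 shows "F t0 \<le> 0"
proof (rule ccontr)
 assume "\<not> F t0 \<le> 0"
 then have pos: "0 < F t0" by simp
 obtain T where T: "\<And>t. t \<ge> T ==> F t < F t0"
  using order_tendstoD(2) [OF lim pos] by (auto simp: eventually_at_top_linorder)
 define K where "K = max T t0"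
 have K: "0 \<le> K" "T \<le> K" "t0 \<le> K" using t0 by (auto simp: K_def)
 obtain m where m: "m \<in> {0..K}" "\<And>t. t \<in> {0..K} ==> F t \<le> F m"
  using continuous_attains_sup [of "{0..K}" F] cont [of K] K by fastforce
 have "F t0 \<le> F m" using m K t0 by auto
 have max: "F t \<le> F m" if "0 \<le> t" for t
 proof (cases "t \<le> K")
  case False
  then show ?thesis using T [of t] K \<open>F t0 \<le> F m\<close> by simp
 qed (use m that in auto)
 have m0: "0 \<le> m" using m by simp
 have nonneg: "0 \<le> lweight s \<tau> * (F m - F (m + \<tau>))" for \<tau>
 proof (cases "\<tau> > 0")
  case True
  then show ?thesis using max [of "m + \<tau>"] m0 by (simp add: lweight_nonneg)
 qed (simp add: lweight_def)
 have "AE \<tau> in lborel. lweight s \<tau> * (F m - F (m + \<tau>)) = 0"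
  using integral_nonneg_eq_0_iff_AE [OF int [OF m0]] nonneg eq [OF m0] by simp
 \<comment> \<open>For \<tau> > K the time m + \<tau> is beyond T, where F is below F t0 \<le> F m.
   Any set of such \<tau> of positive measure gives the contradiction.\<close>
 then have "AE \<tau> in lborel. \<tau> \<notin> {K<..<K + 1}"
 proof eventually_elim
  case (elim \<tau>)
  show ?case
  proof
   assume \<tau>: "\<tau> \<in> {K<..<K + 1}"
   then have "F (m + \<tau>) < F t0" using T [of "m + \<tau>"] m0 K by simp
   then have "F m - F (m + \<tau>) \<noteq> 0" using \<open>F t0 \<le> F m\<close> by linarith
   then show False using elim \<tau> K by (auto simp: lweight_def)
  qed
 qed
 then have "emeasure lborel {K<..<K + 1} = 0"
  by (subst (asm) AE_iff_measurable [where N = "{K<..<K + 1}"]) auto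
 then show False by simp
qed

section \<open>Pairing a growing function with the heat evolution of a differenced bump\<close>

text \<open>Integrating u against \<sigma> (x - y) yields \<Delta>_h^m of the mollified u at x.
  \<open>F x\<close> replaces \<sigma> by its heat evolution and \<open>Dd x\<close> by its defect
  \<sigma> - \<open>heat \<sigma> t\<close>. The order n + m of the weight is that of the decay of
  these kernels.\<close>

locale heat_average =
 fixes s r :: real and m :: nat and h :: "'a::euclidean_space" and u :: "'a => real"
 assumes s: "0 < s" "s < 1" and r: "0 < r"
  and um [measurable]: "u \<in> borel_measurable borel"
  and ui: "integrable lborel (\<lambda>y. \<bar>u y\<bar> / (1 + norm y) ^ (DIM('a) + m))"
begin

definition "L = DIM('a) + m"
definition "\<sigma> = fdiff m h (bump r)"
definition "defect t y = \<sigma> y - heat \<sigma> t y"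
definition "U = (LBINT y. \<bar>u y\<bar> / (1 + norm y) ^ L)"
definition "Dd x t = (LBINT y. u y * defect t (x - y))"
definition "F x t = (LBINT y. u y * heat \<sigma> t (x - y))"

lemma ui': "integrable lborel (\<lambda>y. \<bar>u y\<bar> / (1 + norm y) ^ L)"
 unfolding L_def by (rule ui)

lemma U_nonneg: "0 \<le> U" unfolding U_def by simp

lemma \<sigma>_measurable [measurable]: "\<sigma> \<in> borel_measurable borel"
 unfolding \<sigma>_def by measurable

lemma heat\<sigma>_measurable [measurable]: "(\<lambda>(t, x). heat \<sigma> t x) \<in> borel_measurable (borel \<Otimes>\<^sub>M borel)"
 by measurable

lemma defect_measurable [measurable]: "(\<lambda>(t, x). defect t x) \<in> borel_measurable (borel \<Otimes>\<^sub>M borel)"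
 unfolding defect_def by measurable

lemma obtain_bounds:
 obtains C where "C > 0" "\<And>t y. 0 < t ==> \<bar>defect t y\<bar> \<le> C * min 1 t / (1 + norm y) ^ L"
  "\<And>y. \<bar>\<sigma> y\<bar> \<le> C / (1 + norm y) ^ L"
  "\<And>t y. \<bar>heat \<sigma> t y\<bar> \<le> C / (1 + norm y) ^ L"
  "\<And>t y. 1 \<le> t ==> \<bar>heat \<sigma> t y\<bar> \<le> C / (sqrt t + norm y) ^ L"
proof -
 obtain C1 where C1: "C1 \<ge> 0" "\<And>t y. 0 < t ==> \<bar>defect t y\<bar> \<le> C1 * min 1 t / (1 + norm y) ^ L"
  unfolding defect_def \<sigma>_def L_def using heat_defect_bound [OF r, of m h] by blast
 obtain C2 where C2: "C2 \<ge> 0" "\<And>t y. 1 \<le> t ==> \<bar>heat \<sigma> t y\<bar> \<le> C2 / (sqrt t + norm y) ^ L"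
  unfolding \<sigma>_def L_def using heat_fdiff_bump_decay [OF r, of m h] by blast
 define C3 where "C3 = 2 ^ m * (1 + r + real m * norm h) ^ L"
 have C3: "C3 \<ge> 0" "\<And>y. \<bar>\<sigma> y\<bar> \<le> C3 / (1 + norm y) ^ L"
  unfolding C3_def \<sigma>_def using r by (auto simp: fdiff_bump_decay)
 have wp: "0 < (1 + norm y) ^ L" for y :: 'a by (simp add: add_pos_nonneg)
 define C where "C = C1 + C2 + C3 + 1"
 have C: "C > 0" "C1 \<le> C" "C2 \<le> C" "C3 \<le> C" "C1 + C3 \<le> C" using C1 C2 C3 by (auto simp: C_def)
 show thesis
 proof (rule that [OF C(1)])
  show "\<bar>defect t y\<bar> \<le> C * min 1 t / (1 + norm y) ^ L" if t: "0 < t" for t y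
  proof -
   have "C1 * min 1 t / (1 + norm y) ^ L \<le> C * min 1 t / (1 + norm y) ^ L"
    using C t wp [of y] by (intro divide_right_mono mult_right_mono) auto
   then show ?thesis using C1(2) [OF t, of y] by linarith
  qed
  show sb: "\<bar>\<sigma> y\<bar> \<le> C / (1 + norm y) ^ L" for y
  proof -
   have "C3 / (1 + norm y) ^ L \<le> C / (1 + norm y) ^ L"
    using C wp [of y] by (intro divide_right_mono) auto
   then show ?thesis using C3(2) [of y] by linarith
  qed
  show "\<bar>heat \<sigma> t y\<bar> \<le> C / (1 + norm y) ^ L" for t y
  proof (cases "t > 0")
   case True
   have "C1 * min 1 t / (1 + norm y) ^ L \<le> C1 * 1 / (1 + norm y) ^ L"
    using C1 wp [of y] by (intro divide_right_mono mult_left_mono) auto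
   then have "\<bar>heat \<sigma> t y\<bar> \<le> C1 / (1 + norm y) ^ L + C3 / (1 + norm y) ^ L"
    using C1(2) [OF True, of y] C3(2) [of y] unfolding defect_def by simp
   also have "... = (C1 + C3) / (1 + norm y) ^ L" by (simp add: add_divide_distrib)
   also have "... \<le> C / (1 + norm y) ^ L" using C wp [of y] by (intro divide_right_mono) auto
   finally show ?thesis .
  next
   case False
   then show ?thesis using sb [of y] by (simp add: heat_def)
  qed
  show "\<bar>heat \<sigma> t y\<bar> \<le> C / (sqrt t + norm y) ^ L" if t: "1 \<le> t" for t y
  proof -
   have "C2 / (sqrt t + norm y) ^ L \<le> C / (sqrt t + norm y) ^ L"
    using C t by (intro divide_right_mono) auto
   then show ?thesis using C2(2) [OF t, of y] by linarith
  qed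
 qed
qed

lemma weight_translate: "\<bar>u y\<bar> / (1 + norm (x - y)) ^ L \<le> (1 + norm x) ^ L * (\<bar>u y\<bar> / (1 + norm y) ^ L)"
proof -
 have "1 / (1 + norm (x - y)) ^ L = 1 / (1 + norm (y + (- x))) ^ L" by (simp add: norm_minus_commute)
 also have "... \<le> (1 + norm x) ^ L / (1 + norm y) ^ L" by (rule inverse_weight_shift) simp
 finally have "\<bar>u y\<bar> * (1 / (1 + norm (x - y)) ^ L) \<le> \<bar>u y\<bar> * ((1 + norm x) ^ L / (1 + norm y) ^ L)"
  by (intro mult_left_mono) auto
 then show ?thesis by (simp add: mult_ac)
qed

lemma integrable_weighted:
 assumes [measurable]: "k \<in> borel_measurable borel" and k: "\<And>y. \<bar>k y\<bar> \<le> C / (1 + norm y) ^ L" and C: "0 \<le> C"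
 shows "integrable lborel (\<lambda>y. u y * k (x - y))"
  and "\<bar>LBINT y. u y * k (x - y)\<bar> \<le> C * (1 + norm x) ^ L * U"
proof -
 have bi: "integrable lborel (\<lambda>y. C * (1 + norm x) ^ L * (\<bar>u y\<bar> / (1 + norm y) ^ L))"
  by (intro integrable_mult_right ui')
 have le: "\<bar>u y * k (x - y)\<bar> \<le> C * (1 + norm x) ^ L * (\<bar>u y\<bar> / (1 + norm y) ^ L)" for y
 proof -
  have "\<bar>u y * k (x - y)\<bar> \<le> \<bar>u y\<bar> * (C / (1 + norm (x - y)) ^ L)"
   unfolding abs_mult by (intro mult_left_mono k) auto
  also have "... = C * (\<bar>u y\<bar> / (1 + norm (x - y)) ^ L)" by simp
  also have "... \<le> C * ((1 + norm x) ^ L * (\<bar>u y\<bar> / (1 + norm y) ^ L))"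
   by (intro mult_left_mono weight_translate C)
  finally show ?thesis by (simp add: mult.assoc)
 qed
 show "integrable lborel (\<lambda>y. u y * k (x - y))"
 proof (rule integrable_bound [OF bi])
  show "AE y in lborel. norm (u y * k (x - y)) \<le> norm (C * (1 + norm x) ^ L * (\<bar>u y\<bar> / (1 + norm y) ^ L))"
   unfolding real_norm_def by (intro AE_I2 order.trans [OF le abs_ge_self])
 qed measurable
 have "\<bar>LBINT y. u y * k (x - y)\<bar> \<le> (LBINT y. \<bar>u y * k (x - y)\<bar>)" by (rule integral_abs_bound)
 also have "... \<le> (LBINT y. C * (1 + norm x) ^ L * (\<bar>u y\<bar> / (1 + norm y) ^ L))"
  by (rule integral_mono' [OF bi le order.trans [OF abs_ge_zero le]])
 also have "... = C * (1 + norm x) ^ L * U" unfolding U_def by (rule integral_mult_right_zero)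
 finally show "\<bar>LBINT y. u y * k (x - y)\<bar> \<le> C * (1 + norm x) ^ L * U" .
qed

lemma heat_semigroup:
 assumes a: "0 < a" and b: "0 < b"
 shows "heat \<sigma> (a + b) y = (LBINT z. gker a z * heat \<sigma> b (y + z))"
proof -
 obtain C where C: "C > 0" "\<And>y. \<bar>\<sigma> y\<bar> \<le> C / (1 + norm y) ^ L"
  using obtain_bounds by metis
 have sb: "\<bar>\<sigma> y\<bar> \<le> C" for y
 proof -
  have "C / (1 + norm y) ^ L \<le> C / 1" using C(1) by (intro divide_left_mono) (auto simp: one_le_power add_pos_nonneg)
  then show ?thesis using C(2) [of y] by simp
 qed
 let ?G = "\<lambda>(z, w). \<sigma> (y + w) * (gker a z * gker b (w - z))"
 have joint: "integrable (lborel \<Otimes>\<^sub>M lborel) ?G"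
 proof (rule lborel_pair.Fubini_integrable)
  show "?G \<in> borel_measurable (lborel \<Otimes>\<^sub>M lborel)" by measurable
  have i: "integrable lborel (\<lambda>w. gker b (w - z))" for z :: 'a
   using integrable_lborel_shift_iff [of "gker b" "- z"] integrable_gker [OF b, where 'a = 'a] by simp
  have i2: "integrable lborel (\<lambda>w. \<sigma> (y + w) * (gker a z * gker b (w - z)))" for z
   by (rule integrable_bound [OF integrable_mult_right [OF i, of "C * gker a z" z]])
     (use sb C gker_nonneg [of a z] gker_nonneg [of b] a b in
     \<open>auto intro!: AE_I2 mult_right_mono simp: abs_mult mult.assoc\<close>)
  then show "AE z in lborel. integrable lborel (\<lambda>w. case (z, w) of (z, w) => \<sigma> (y + w) * (gker a z * gker b (w - z)))"
   by simp
  show "integrable lborel (\<lambda>z. LBINT w. norm (case (z, w) of (z, w) => \<sigma> (y + w) * (gker a z * gker b (w - z))))"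
  proof (rule integrable_bound [OF integrable_mult_right [OF integrable_gker [OF a], of C]])
   show "AE z in lborel. norm (LBINT w. norm (case (z, w) of (z, w) => \<sigma> (y + w) * (gker a z * gker b (w - z)))) \<le> norm (C * gker a (z::'a))" (is "AE z in _. ?P z")
   proof (intro AE_I2)
    fix z :: 'a
    have "(LBINT w. \<bar>\<sigma> (y + w) * (gker a z * gker b (w - z))\<bar>) \<le> (LBINT w. C * gker a z * gker b (w - z))"
    proof (rule integral_mono' [OF integrable_mult_right [OF i]])
     fix w
     have g: "0 \<le> gker a z * gker b (w - z)" using a b by (simp add: gker_nonneg)
     from mult_right_mono [OF sb [of "y + w"] g]
     show "\<bar>\<sigma> (y + w) * (gker a z * gker b (w - z))\<bar> \<le> C * gker a z * gker b (w - z)"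
      by (simp add: abs_mult abs_of_nonneg [OF gker_nonneg] a b less_imp_le mult.assoc)
     show "0 \<le> C * gker a z * gker b (w - z)" using C g by (simp add: mult.assoc)
    qed
    also have "... = C * gker a z * (LBINT w. gker b (- z + w))" by simp
    also have "(LBINT w. gker b (- z + w)) = 1"
     by (subst integral_lborel_shift) (rule integral_gker [OF b])
    finally show "?P z"
     using C gker_nonneg [of a z] a by simp
   qed
  qed measurable
 qed
 have "heat \<sigma> (a + b) y = (LBINT w. \<sigma> (y + w) * gker (a + b) w)" using a b by (simp add: heat_def)
 also have "... = (LBINT w. LBINT z. ?G (z, w))" by (simp add: gker_convolution [OF a b])
 also have "... = (LBINT z. LBINT w. ?G (z, w))" using lborel_pair.Fubini_integral [OF joint] by simp
 also have "... = (LBINT z. gker a z * heat \<sigma> b (y + z))"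
 proof (intro integral_cong refl)
  fix z
  have "(LBINT w. \<sigma> (y + w) * gker b (w - z)) = (LBINT w. \<sigma> (y + z + w) * gker b w)"
   using integral_lborel_shift [of "\<lambda>w. \<sigma> (y + w) * gker b (w - z)" z] by (simp add: add.assoc)
  then show "(LBINT w. ?G (z, w)) = gker a z * heat \<sigma> b (y + z)"
   using b by (simp add: heat_def mult.left_commute)
 qed
 finally show ?thesis .
qed

text \<open>By the semigroup property the change of \<open>heat \<sigma>\<close> from t to t +
  \<tau> is the evolution over time t of the defect at \<tau>. So an increment of F at time t and
  one point is an average of increments from time 0 over all translates, which transfers an equation
  valid at every x to later times.\<close>

lemma heat_average_step:
 assumes t: "0 < t" and \<tau>: "0 < \<tau>"
 shows "F x t - F x (t + \<tau>) = (LBINT z. gker t z * Dd (x + z) \<tau>)"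
proof -
 obtain C where C: "C > 0" "\<And>t y. 0 < t ==> \<bar>defect t y\<bar> \<le> C * min 1 t / (1 + norm y) ^ L"
  "\<And>t y. \<bar>heat \<sigma> t y\<bar> \<le> C / (1 + norm y) ^ L" using obtain_bounds by metis
 have hm: "heat \<sigma> t \<in> borel_measurable borel" for t
  using measurable_compose_Pair1 [OF _ heat\<sigma>_measurable, of t] by simp
 have wp: "0 < (1 + norm y) ^ L" for y :: 'a by (simp add: add_pos_nonneg)
 have hb: "\<bar>heat \<sigma> t y\<bar> \<le> C" for t y
 proof -
  have "C / (1 + norm y) ^ L \<le> C / 1" using C(1) by (intro divide_left_mono) (auto simp: one_le_power add_pos_nonneg)
  then show ?thesis using C(3) [of t y] by simp
 qed
 have gi: "integrable lborel (\<lambda>z. gker t z * heat \<sigma> \<tau>' (y + z))" for y \<tau>'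
 proof (rule integrable_bound [OF integrable_mult_right [OF integrable_gker [OF t], of C]])
  have [measurable]: "heat \<sigma> \<tau>' \<in> borel_measurable borel" by (rule hm)
  show "(\<lambda>z. gker t z * heat \<sigma> \<tau>' (y + z)) \<in> borel_measurable lborel" by measurable
  show "AE z in lborel. norm (gker t z * heat \<sigma> \<tau>' (y + z)) \<le> norm (C * gker t z)" (is "AE z in _. ?P z")
  proof (intro AE_I2)
   fix z :: 'a
   have g: "0 \<le> gker t z" using t by (simp add: gker_nonneg)
   from mult_right_mono [OF hb [of \<tau>' "y + z"] g] g C(1)
   show "?P z" by (simp add: abs_mult mult.commute)
  qed
 qed
 have pt: "heat \<sigma> t y - heat \<sigma> (t + \<tau>) y = (LBINT z. gker t z * defect \<tau> (y + z))" for y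
 proof -
  have "heat \<sigma> t y = (LBINT z. gker t z * heat \<sigma> 0 (y + z))"
   using t by (simp add: heat_def mult.commute)
  then have "heat \<sigma> t y - heat \<sigma> (t + \<tau>) y = (LBINT z. gker t z * heat \<sigma> 0 (y + z) - gker t z * heat \<sigma> \<tau> (y + z))"
   unfolding heat_semigroup [OF t \<tau>] by (simp add: gi)
  also have "... = (LBINT z. gker t z * defect \<tau> (y + z))"
   by (intro integral_cong) (auto simp: defect_def heat_def algebra_simps)
  finally show ?thesis .
 qed
 let ?H = "\<lambda>(y, z). u y * (gker t z * defect \<tau> (x + z - y))"
 have joint: "integrable (lborel \<Otimes>\<^sub>M lborel) ?H"
 proof (rule integrable_bound)
  have "integrable (lborel \<Otimes>\<^sub>M lborel) (\<lambda>(y, z). (\<bar>u y\<bar> / (1 + norm y) ^ L) * (C * (1 + norm x) ^ L * ((1 + norm (z::'a)) ^ L * gker t z)))"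
   by (intro integrable_lborel_product ui' integrable_mult_right integrable_power_gker t)
  then show "integrable (lborel \<Otimes>\<^sub>M lborel) (\<lambda>p :: 'a \<times> 'a. (\<bar>u (fst p)\<bar> / (1 + norm (fst p)) ^ L) * (C * (1 + norm x) ^ L * ((1 + norm (snd p)) ^ L * gker t (snd p))))"
   by (simp only: case_prod_unfold)
  show "AE p :: 'a \<times> 'a in lborel \<Otimes>\<^sub>M lborel. norm (?H p) \<le>
    norm ((\<bar>u (fst p)\<bar> / (1 + norm (fst p)) ^ L) * (C * (1 + norm x) ^ L * ((1 + norm (snd p)) ^ L * gker t (snd p))))"
  proof (intro AE_I2)
   fix p :: "'a \<times> 'a"
   obtain y z where p: "p = (y, z)" by fastforce
   have g: "0 \<le> gker t z" using t by (simp add: gker_nonneg)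
   have "C * min 1 \<tau> / (1 + norm (x + z - y)) ^ L \<le> C * 1 / (1 + norm (x + z - y)) ^ L"
    using C(1) wp by (intro divide_right_mono mult_left_mono) (auto simp: less_imp_le)
   then have "\<bar>defect \<tau> (x + z - y)\<bar> \<le> C / (1 + norm (x + z - y)) ^ L"
    using C(2) [OF \<tau>, of "x + z - y"] by simp
   then have "\<bar>u y\<bar> * \<bar>defect \<tau> (x + z - y)\<bar> \<le> \<bar>u y\<bar> * (C / (1 + norm (x + z - y)) ^ L)"
    by (intro mult_left_mono) auto
   also have "... = C * (\<bar>u y\<bar> / (1 + norm (x + z - y)) ^ L)" by simp
   also have "... \<le> C * ((1 + norm (x + z)) ^ L * (\<bar>u y\<bar> / (1 + norm y) ^ L))"
    using C(1) by (intro mult_left_mono weight_translate) auto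
   also have "... \<le> C * (((1 + norm x) * (1 + norm z)) ^ L * (\<bar>u y\<bar> / (1 + norm y) ^ L))"
   proof -
    have "norm (x + z) \<le> norm x + norm z" by (rule norm_triangle_ineq)
    moreover have "0 \<le> norm x * norm z" by simp
    moreover have "(1 + norm x) * (1 + norm z) = 1 + norm x + norm z + norm x * norm z" by (simp add: algebra_simps)
    ultimately have "1 + norm (x + z) \<le> (1 + norm x) * (1 + norm z)" by linarith
    then show ?thesis using C(1) wp [of y] by (intro mult_left_mono mult_right_mono power_mono) (auto simp: less_imp_le)
   qed
   finally have "\<bar>u y\<bar> * \<bar>defect \<tau> (x + z - y)\<bar> \<le> C * (((1 + norm x) * (1 + norm z)) ^ L * (\<bar>u y\<bar> / (1 + norm y) ^ L))" .
   from mult_right_mono [OF this g]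
   have "\<bar>u y\<bar> * \<bar>defect \<tau> (x + z - y)\<bar> * gker t z \<le> (\<bar>u y\<bar> / (1 + norm y) ^ L) * (C * (1 + norm x) ^ L * ((1 + norm z) ^ L * gker t z))"
    by (simp add: power_mult_distrib mult_ac)
   moreover have "norm (?H p) = \<bar>u y\<bar> * \<bar>defect \<tau> (x + z - y)\<bar> * gker t z"
    using g by (simp add: p abs_mult mult_ac)
   ultimately have "norm (?H p) \<le> (\<bar>u y\<bar> / (1 + norm y) ^ L) * (C * (1 + norm x) ^ L * ((1 + norm z) ^ L * gker t z))"
    by (simp only:)
   also have "... \<le> norm ..." unfolding real_norm_def by (rule abs_ge_self)
   finally show "norm (?H p) \<le>
    norm ((\<bar>u (fst p)\<bar> / (1 + norm (fst p)) ^ L) * (C * (1 + norm x) ^ L * ((1 + norm (snd p)) ^ L * gker t (snd p))))"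
    by (simp only: p fst_conv snd_conv)
  qed
 qed measurable
 have "F x t - F x (t + \<tau>) = (LBINT y. u y * (heat \<sigma> t (x - y) - heat \<sigma> (t + \<tau>) (x - y)))"
  unfolding F_def right_diff_distrib
  using C(1) by (intro integral_diff [symmetric] integrable_weighted(1) [OF hm C(3)]) auto
 also have "... = (LBINT y. LBINT z. ?H (y, z))"
  unfolding pt by (simp add: algebra_simps)
 also have "... = (LBINT z. LBINT y. ?H (y, z))" using lborel_pair.Fubini_integral [OF joint] by simp
 also have "... = (LBINT z. gker t z * Dd (x + z) \<tau>)"
 proof (intro integral_cong refl)
  fix z
  have "(LBINT y. ?H (y, z)) = (LBINT y. gker t z * (u y * defect \<tau> (x + z - y)))"
   by (intro integral_cong) auto
  then show "(LBINT y. ?H (y, z)) = gker t z * Dd (x + z) \<tau>" by (simp add: Dd_def)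
 qed
 finally show ?thesis .
qed

end

context heat_average
begin

lemma heat\<sigma>_borel: "heat \<sigma> t \<in> borel_measurable borel"
 using measurable_compose_Pair1 [OF _ heat\<sigma>_measurable, of t] by simp

lemma defect_borel: "defect t \<in> borel_measurable borel"
 using measurable_compose_Pair1 [OF _ defect_measurable, of t] by simp

lemma F_measurable [measurable]: "F x \<in> borel_measurable borel"
 unfolding F_def [abs_def] by measurable

lemma Dd_measurable [measurable]: "(\<lambda>(x, t). Dd x t) \<in> borel_measurable (borel \<Otimes>\<^sub>M borel)"
 unfolding Dd_def by measurable

lemma Dd_bound:
 obtains C where "C > 0" "\<And>x t. 0 < t ==> \<bar>Dd x t\<bar> \<le> C * min 1 t * (1 + norm x) ^ L"
proof -
 obtain C where C: "C > 0" "\<And>t y. 0 < t ==> \<bar>defect t y\<bar> \<le> C * min 1 t / (1 + norm y) ^ L"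
  using obtain_bounds by metis
 have "\<bar>Dd x t\<bar> \<le> C * (U + 1) * min 1 t * (1 + norm x) ^ L" if t: "0 < t" for x t
 proof -
  have "\<bar>Dd x t\<bar> \<le> C * min 1 t * (1 + norm x) ^ L * U"
   unfolding Dd_def by (rule integrable_weighted(2) [OF defect_borel C(2) [OF t]]) (use C(1) t in simp)
  also have "... \<le> C * min 1 t * (1 + norm x) ^ L * (U + 1)"
   using C(1) t by (intro mult_left_mono) auto
  finally show ?thesis by (simp add: mult_ac)
 qed
 moreover have "C * (U + 1) > 0" using C(1) U_nonneg by simp
 ultimately show thesis using that by blast
qed

lemma F_increment_0: "0 < \<tau> ==> F x 0 - F x \<tau> = Dd x \<tau>"
proof -
 assume \<tau>: "0 < \<tau>"
 obtain C where C: "C > 0" "\<And>t y. \<bar>heat \<sigma> t y\<bar> \<le> C / (1 + norm y) ^ L"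
  using obtain_bounds by metis
 have "F x 0 - F x \<tau> = (LBINT y. u y * heat \<sigma> 0 (x - y) - u y * heat \<sigma> \<tau> (x - y))"
  unfolding F_def using C(1)
  by (intro integral_diff [symmetric] integrable_weighted(1) [OF heat\<sigma>_borel C(2)]) auto
 also have "... = Dd x \<tau>"
  unfolding Dd_def by (intro integral_cong) (auto simp: defect_def heat_def algebra_simps)
 finally show ?thesis .
qed

lemma one_plus_norm_add_power:
 "(1 + norm (x + z)) ^ p \<le> (1 + norm (x::'a)) ^ p * (1 + norm z) ^ p"
proof -
 have "norm (x + z) \<le> norm x + norm z" by (rule norm_triangle_ineq)
 moreover have "0 \<le> norm x * norm z" by simp
 moreover have "(1 + norm x) * (1 + norm z) = 1 + norm x + norm z + norm x * norm z" by (simp add: algebra_simps)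
 ultimately have "1 + norm (x + z) \<le> (1 + norm x) * (1 + norm z)" by linarith
 then have "(1 + norm (x + z)) ^ p \<le> ((1 + norm x) * (1 + norm z)) ^ p" by (intro power_mono) auto
 then show ?thesis by (simp add: power_mult_distrib)
qed

text \<open>The factor min 1 \<tau> serves twice: it makes \<open>F x\<close> Lipschitz on bounded
  time intervals, and its increments integrable against \<open>lweight\<close>. The growth of
  \<open>Dd\<close> in space is paid by Gaussian moments, uniformly up to time T.\<close>

lemma F_increment_bound:
 obtains K where "K \<ge> 0" "\<And>t \<tau>. 0 \<le> t ==> t \<le> T ==> 0 < \<tau> ==> \<bar>F x t - F x (t + \<tau>)\<bar> \<le> K * min 1 \<tau>"
proof -
 obtain C where C: "C > 0" "\<And>x t. 0 < t ==> \<bar>Dd x t\<bar> \<le> C * min 1 t * (1 + norm x) ^ L"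
  using Dd_bound by blast
 define S where "S = max T 1"
 have S: "0 < S" "T \<le> S" by (auto simp: S_def)
 define J where "J = (LBINT (z::'a). (1 + norm z) ^ L * gker S z)"
 have J: "J \<ge> 0" unfolding J_def using S gker_nonneg [of S, where 'a = 'a]
  by (intro integral_nonneg) auto
 define A where "A = C * (1 + norm x) ^ L"
 have A: "A \<ge> 0" using C by (simp add: A_def)
 show thesis
 proof (rule that [of "A * (1 + J)"])
  show "0 \<le> A * (1 + J)" using A J by simp
  fix t \<tau> :: real assume t: "0 \<le> t" "t \<le> T" and \<tau>: "0 < \<tau>"
  show "\<bar>F x t - F x (t + \<tau>)\<bar> \<le> A * (1 + J) * min 1 \<tau>"
  proof (cases "t = 0")
   case True
   have "\<bar>F x t - F x (t + \<tau>)\<bar> \<le> A * min 1 \<tau>"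
    using True F_increment_0 [OF \<tau>, of x] C(2) [OF \<tau>, of x] by (simp add: A_def mult_ac)
   also have "... \<le> A * (1 + J) * min 1 \<tau>"
    using A J \<tau> by (intro mult_right_mono) (auto simp: mult_le_cancel_left1)
   finally show ?thesis .
  next
   case False
   then have t0: "0 < t" using t by simp
   have bi: "integrable lborel (\<lambda>z::'a. A * min 1 \<tau> * ((1 + norm z) ^ L * gker t z))"
    by (intro integrable_mult_right integrable_power_gker t0)
   have le: "\<bar>gker t z * Dd (x + z) \<tau>\<bar> \<le> A * min 1 \<tau> * ((1 + norm z) ^ L * gker t z)" for z
   proof -
    have g: "0 \<le> gker t z" using t0 by (simp add: gker_nonneg)
    have "\<bar>Dd (x + z) \<tau>\<bar> \<le> C * min 1 \<tau> * (1 + norm (x + z)) ^ L" by (rule C(2) [OF \<tau>])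
    also have "... \<le> C * min 1 \<tau> * ((1 + norm x) ^ L * (1 + norm z) ^ L)"
     using C(1) \<tau> by (intro mult_left_mono one_plus_norm_add_power) auto
    finally have "\<bar>Dd (x + z) \<tau>\<bar> * gker t z \<le> C * min 1 \<tau> * ((1 + norm x) ^ L * (1 + norm z) ^ L) * gker t z"
     by (rule mult_right_mono [OF _ g])
    then show ?thesis using g by (simp add: A_def abs_mult mult_ac)
   qed
   have "\<bar>F x t - F x (t + \<tau>)\<bar> \<le> (LBINT z. \<bar>gker t z * Dd (x + z) \<tau>\<bar>)"
    unfolding heat_average_step [OF t0 \<tau>] by (rule integral_abs_bound)
   also have "... \<le> (LBINT (z::'a). A * min 1 \<tau> * ((1 + norm z) ^ L * gker t z))"
    by (rule integral_mono' [OF bi le order.trans [OF abs_ge_zero le]])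
   also have "... = A * min 1 \<tau> * (LBINT (z::'a). (1 + norm z) ^ L * gker t z)"
    by (rule integral_mult_right_zero)
   also have "... \<le> A * min 1 \<tau> * J"
    unfolding J_def using A \<tau> t S by (intro mult_left_mono integral_power_gker_le t0) auto
   also have "... \<le> A * min 1 \<tau> * (1 + J)" using A \<tau> by (intro mult_left_mono) auto
   finally show ?thesis by (simp add: mult_ac)
  qed
 qed
qed

lemma F_tendsto_0: "(F x \<longlongrightarrow> 0) at_top"
proof -
 obtain C where C: "C > 0" "\<And>t y. \<bar>heat \<sigma> t y\<bar> \<le> C / (1 + norm y) ^ L"
  "\<And>t y. 1 \<le> t ==> \<bar>heat \<sigma> t y\<bar> \<le> C / (sqrt t + norm y) ^ L"
  using obtain_bounds by metis
 have bi: "integrable lborel (\<lambda>y. C * (1 + norm x) ^ L * (\<bar>u y\<bar> / (1 + norm y) ^ L))"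
  by (intro integrable_mult_right ui')
 have "((\<lambda>t. LBINT y. u y * heat \<sigma> t (x - y)) \<longlongrightarrow> (LBINT (y::'a). 0)) at_top"
 proof (rule integral_dominated_convergence_at_top [OF _ _ bi])
  show "(\<lambda>y. u y * heat \<sigma> t (x - y)) \<in> borel_measurable lborel" for t
   using borel_measurable_integrable [OF integrable_weighted(1) [OF heat\<sigma>_borel C(2)]] C(1) by simp
  show "\<forall>\<^sub>F t in at_top. AE y in lborel. norm (u y * heat \<sigma> t (x - y)) \<le> C * (1 + norm x) ^ L * (\<bar>u y\<bar> / (1 + norm y) ^ L)"
  proof (intro always_eventually allI AE_I2)
   fix t y
   have "\<bar>u y * heat \<sigma> t (x - y)\<bar> \<le> \<bar>u y\<bar> * (C / (1 + norm (x - y)) ^ L)"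
    unfolding abs_mult by (intro mult_left_mono C(2)) auto
   also have "... = C * (\<bar>u y\<bar> / (1 + norm (x - y)) ^ L)" by simp
   also have "... \<le> C * ((1 + norm x) ^ L * (\<bar>u y\<bar> / (1 + norm y) ^ L))"
    using C(1) by (intro mult_left_mono weight_translate) auto
   finally show "norm (u y * heat \<sigma> t (x - y)) \<le> C * (1 + norm x) ^ L * (\<bar>u y\<bar> / (1 + norm y) ^ L)"
    by (simp add: mult.assoc)
  qed
  show "AE y in lborel. ((\<lambda>t. u y * heat \<sigma> t (x - y)) \<longlongrightarrow> 0) at_top" (is "AE y in _. ?P y")
  proof (intro AE_I2)
   fix y
   have "((\<lambda>t. C / sqrt t) \<longlongrightarrow> 0) at_top" by real_asymp
   moreover have "\<forall>\<^sub>F t in at_top. norm (heat \<sigma> t (x - y)) \<le> C / sqrt t"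
    using eventually_ge_at_top [of 1]
   proof eventually_elim
    case (elim t)
    have st: "1 \<le> sqrt t" using elim by simp
    have "sqrt t ^ 1 \<le> sqrt t ^ L" using st by (intro power_increasing) (auto simp: L_def Suc_le_eq)
    also have "... \<le> (sqrt t + norm (x - y)) ^ L" using st by (intro power_mono) auto
    finally have "C / (sqrt t + norm (x - y)) ^ L \<le> C / sqrt t"
     using C(1) st elim by (intro divide_left_mono mult_pos_pos zero_less_power add_pos_nonneg) auto
    then show ?case using C(3) [OF elim, of "x - y"] by simp
   qed
   ultimately have "((\<lambda>t. heat \<sigma> t (x - y)) \<longlongrightarrow> 0) at_top"
    by (rule Lim_null_comparison [rotated])
   from tendsto_mult_left [OF this, of "u y"]
   show "?P y" by simp
  qed
 qed measurable
 then show ?thesis by (simp add: F_def [abs_def])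
qed

text \<open>The hypothesis is the equation at time 0 at every point. Averaged with
  \<open>gker t\<close> around x it becomes the equation at time t at x, and the maximum principle
  applies to both \<open>F x\<close> and its negative. The conclusion is
  \<open>F x 0 = 0\<close>.\<close>

theorem liouville:
 assumes eq: "\<And>x. (LBINT t. lweight s t * Dd x t) = 0"
 shows "(LBINT y. u y * \<sigma> (x - y)) = 0"
proof -
 obtain C where C: "C > 0" "\<And>x t. 0 < t ==> \<bar>Dd x t\<bar> \<le> C * min 1 t * (1 + norm x) ^ L"
  using Dd_bound by blast
 have cont: "continuous_on {0..T} (F x)" for T
 proof -
  obtain K where K: "K \<ge> 0" "\<And>t \<tau>. 0 \<le> t ==> t \<le> T ==> 0 < \<tau> ==> \<bar>F x t - F x (t + \<tau>)\<bar> \<le> K * min 1 \<tau>"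
   using F_increment_bound [where T = T and x = x] by blast
  have *: "\<bar>F x a - F x b\<bar> \<le> K * \<bar>a - b\<bar>" if "0 \<le> a" "a < b" "b \<le> T" for a b
  proof -
   have "\<bar>F x a - F x (a + (b - a))\<bar> \<le> K * min 1 (b - a)" using that by (intro K) auto
   also have "... \<le> K * (b - a)" using K(1) by (intro mult_left_mono) auto
   finally show ?thesis using that by simp
  qed
  have "K-lipschitz_on {0..T} (F x)"
  proof (rule lipschitz_onI)
   fix a b assume ab: "a \<in> {0..T}" "b \<in> {0..T}"
   show "dist (F x a) (F x b) \<le> K * dist a b"
    using *[of a b] *[of b a] ab by (cases a b rule: linorder_cases) (auto simp: dist_real_def abs_minus_commute)
  qed (rule K)
  then show ?thesis by (rule lipschitz_on_continuous_on)
 qed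
 have int: "integrable lborel (\<lambda>\<tau>. lweight s \<tau> * (F x t - F x (t + \<tau>)))" if t: "0 \<le> t" for t
 proof -
  obtain K where K: "K \<ge> 0" "\<And>t' \<tau>. 0 \<le> t' ==> t' \<le> t ==> 0 < \<tau> ==> \<bar>F x t' - F x (t' + \<tau>)\<bar> \<le> K * min 1 \<tau>"
   using F_increment_bound [where T = t and x = x] by blast
  show ?thesis
  proof (rule integrable_bound)
   show "integrable lborel (\<lambda>\<tau>. K * (lweight s \<tau> * min 1 \<tau>))" by (intro integrable_mult_right integrable_lweight s)
   show "AE \<tau> in lborel. norm (lweight s \<tau> * (F x t - F x (t + \<tau>))) \<le> norm (K * (lweight s \<tau> * min 1 \<tau>))"
   proof (intro AE_I2)
    fix \<tau> :: real
    show "norm (lweight s \<tau> * (F x t - F x (t + \<tau>))) \<le> norm (K * (lweight s \<tau> * min 1 \<tau>))"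
    proof (cases "\<tau> > 0")
     case True
     from mult_left_mono [OF K(2) [OF t order_refl True] lweight_nonneg [of s \<tau>]]
     show ?thesis using K(1) True by (simp add: abs_mult abs_of_nonneg [OF lweight_nonneg] mult_ac)
    qed (simp add: lweight_def)
   qed
  qed measurable
 qed
 have zero: "(LBINT \<tau>. lweight s \<tau> * (F x t - F x (t + \<tau>))) = 0" if t: "0 \<le> t" for t
 proof (cases "t = 0")
  case True
  have D: "lweight s \<tau> * (F x t - F x (t + \<tau>)) = lweight s \<tau> * Dd x \<tau>" for \<tau>
   using True F_increment_0 [of \<tau> x] by (cases "\<tau> > 0") (auto simp: lweight_def)
  show ?thesis unfolding D by (rule eq)
 next
  case False
  then have t0: "0 < t" using t by simp
  let ?H = "\<lambda>(\<tau>, z). lweight s \<tau> * (gker t z * Dd (x + z) \<tau>)"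
  have joint: "integrable (lborel \<Otimes>\<^sub>M lborel) ?H"
  proof (rule integrable_bound)
   have "integrable (lborel \<Otimes>\<^sub>M lborel) (\<lambda>(\<tau>, z::'a). (lweight s \<tau> * min 1 \<tau>) * (C * (1 + norm x) ^ L * ((1 + norm z) ^ L * gker t z)))"
    by (intro integrable_lborel_product integrable_lweight s integrable_mult_right integrable_power_gker t0)
   then show "integrable (lborel \<Otimes>\<^sub>M lborel) (\<lambda>p :: real \<times> 'a. (lweight s (fst p) * min 1 (fst p)) * (C * (1 + norm x) ^ L * ((1 + norm (snd p)) ^ L * gker t (snd p))))"
    by (simp only: case_prod_unfold)
   show "AE p :: real \<times> 'a in lborel \<Otimes>\<^sub>M lborel. norm (?H p) \<le>
    norm ((lweight s (fst p) * min 1 (fst p)) * (C * (1 + norm x) ^ L * ((1 + norm (snd p)) ^ L * gker t (snd p))))"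
   proof (intro AE_I2)
    fix p :: "real \<times> 'a"
    obtain \<tau> z where p: "p = (\<tau>, z)" by fastforce
    have g: "0 \<le> gker t z" using t0 by (simp add: gker_nonneg)
    show "norm (?H p) \<le> norm ((lweight s (fst p) * min 1 (fst p)) * (C * (1 + norm x) ^ L * ((1 + norm (snd p)) ^ L * gker t (snd p))))"
    proof (cases "\<tau> > 0")
     case True
     have "\<bar>Dd (x + z) \<tau>\<bar> \<le> C * min 1 \<tau> * (1 + norm (x + z)) ^ L" by (rule C(2) [OF True])
     also have "... \<le> C * min 1 \<tau> * ((1 + norm x) ^ L * (1 + norm z) ^ L)"
      using C(1) True by (intro mult_left_mono one_plus_norm_add_power) auto
     finally have "lweight s \<tau> * (\<bar>Dd (x + z) \<tau>\<bar> * gker t z) \<le> lweight s \<tau> * (C * min 1 \<tau> * ((1 + norm x) ^ L * (1 + norm z) ^ L) * gker t z)"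
      by (intro mult_left_mono mult_right_mono g lweight_nonneg)
     moreover have "norm (?H p) = lweight s \<tau> * (\<bar>Dd (x + z) \<tau>\<bar> * gker t z)"
      using g by (simp add: p abs_mult abs_of_nonneg [OF lweight_nonneg] mult_ac)
     moreover have "norm ((lweight s (fst p) * min 1 (fst p)) * (C * (1 + norm x) ^ L * ((1 + norm (snd p)) ^ L * gker t (snd p))))
       = lweight s \<tau> * (C * min 1 \<tau> * ((1 + norm x) ^ L * (1 + norm z) ^ L) * gker t z)"
      using g True C(1) by (simp add: p abs_mult abs_of_nonneg [OF lweight_nonneg] mult_ac)
     ultimately show ?thesis by linarith
    qed (simp add: p lweight_def)
   qed
  qed measurable
  have "(LBINT \<tau>. lweight s \<tau> * (F x t - F x (t + \<tau>))) = (LBINT \<tau>. LBINT z. ?H (\<tau>, z))"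
  proof (intro integral_cong refl)
   fix \<tau> :: real
   show "lweight s \<tau> * (F x t - F x (t + \<tau>)) = (LBINT z. ?H (\<tau>, z))"
    using heat_average_step [OF t0, of \<tau> x] by (cases "\<tau> > 0") (simp_all add: lweight_def)
  qed
  also have "... = (LBINT z. LBINT \<tau>. ?H (\<tau>, z))" using lborel_pair.Fubini_integral [OF joint] by simp
  also have "... = (LBINT z. gker t z * (LBINT \<tau>. lweight s \<tau> * Dd (x + z) \<tau>))"
  proof (intro integral_cong refl)
   fix z :: 'a
   have "(LBINT \<tau>. ?H (\<tau>, z)) = (LBINT \<tau>. gker t z * (lweight s \<tau> * Dd (x + z) \<tau>))"
    by (intro integral_cong) auto
   then show "(LBINT \<tau>. ?H (\<tau>, z)) = gker t z * (LBINT \<tau>. lweight s \<tau> * Dd (x + z) \<tau>)" by simp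
  qed
  also have "... = 0" by (simp add: eq)
  finally show ?thesis .
 qed
 have "F x 0 \<le> 0"
  by (rule mixture_maximum_principle [OF s(1) cont F_tendsto_0 int zero]) auto
 moreover have "- F x 0 \<le> 0"
 proof (rule mixture_maximum_principle [OF s(1), where F = "\<lambda>t. - F x t"])
  show "continuous_on {0..T} (\<lambda>t. - F x t)" for T by (intro continuous_on_minus cont)
  show "((\<lambda>t. - F x t) \<longlongrightarrow> 0) at_top" using tendsto_minus [OF F_tendsto_0 [of x]] by simp
  fix t :: real assume t: "0 \<le> t"
  have eq': "lweight s \<tau> * (- F x t - - F x (t + \<tau>)) = - (lweight s \<tau> * (F x t - F x (t + \<tau>)))" for \<tau>
   by (simp add: algebra_simps)
  show "integrable lborel (\<lambda>\<tau>. lweight s \<tau> * (- F x t - - F x (t + \<tau>)))"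
   unfolding eq' using int [OF t] by (rule integrable_minus)
  show "(LBINT \<tau>. lweight s \<tau> * (- F x t - - F x (t + \<tau>))) = 0"
   unfolding eq' using zero [OF t] by simp
 qed simp
 ultimately have "F x 0 = 0" by simp
 then show ?thesis by (simp add: F_def heat_def)
qed

end

section \<open>Solutions are polynomials\<close>

lemma moll_close:
 fixes f :: "'a::euclidean_space => real"
 assumes r: "0 < r" and [measurable]: "f \<in> borel_measurable borel"
  and e: "\<And>y. norm (x - y) < r ==> \<bar>f y - f x\<bar> \<le> e"
 shows "\<bar>moll r f x - f x * (LBINT (z::'a). bump r z)\<bar> \<le> e * (LBINT (z::'a). bump r z)"
proof -
 have e0: "0 \<le> e" using e [of x] r by simp
 have i1: "integrable lborel (\<lambda>y. f y * bump r (x - y))"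
 proof (rule integrable_mult_bump [OF r])
  fix y assume "norm (x - y) < r"
  then show "\<bar>f y\<bar> \<le> \<bar>f x\<bar> + e" using e [of y] by linarith
 qed measurable
 have i2: "integrable lborel (\<lambda>y. c * bump r (x - y))" for c by (intro integrable_mult_right integrable_bump_shift r)
 have "moll r f x - f x * (LBINT (z::'a). bump r z) = (LBINT y. f y * bump r (x - y) - f x * bump r (x - y))"
  using i1 i2 [of "f x"] by (simp add: moll_def integral_bump_shift)
 also have "... = (LBINT y. (f y - f x) * bump r (x - y))" by (simp add: left_diff_distrib)
 also have "\<bar>...\<bar> \<le> (LBINT y. \<bar>(f y - f x) * bump r (x - y)\<bar>)" by (rule integral_abs_bound)
 also have "... \<le> (LBINT y. e * bump r (x - y))"
 proof (rule integral_mono' [OF i2])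
  fix y
  show "\<bar>(f y - f x) * bump r (x - y)\<bar> \<le> e * bump r (x - y)"
  proof (cases "norm (x - y) < r")
   case True
   from mult_right_mono [OF e [OF this] bump_nonneg [of r "x - y"]]
   show ?thesis by (simp add: abs_mult abs_of_nonneg [OF bump_nonneg])
  qed (simp add: bump_eq_0 r)
  show "0 \<le> e * bump r (x - y)" using e0 by (simp add: bump_nonneg)
 qed
 also have "... = e * (LBINT (z::'a). bump r z)" by (simp add: integral_bump_shift)
 finally show ?thesis .
qed

text \<open>At a point of continuity the mollification divided by the mass of the bump is close to
  the value, so a bound for all small radii passes to the function. With C = 0 it shows that the
  function vanishes.\<close>

lemma moll_bound_imp_bound:
 fixes f :: "'a::euclidean_space => real"
 assumes [measurable]: "f \<in> borel_measurable borel" and c: "isCont f x"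
  and b: "\<And>r. 0 < r ==> r < r0 ==> \<bar>moll r f x\<bar> \<le> C * (LBINT (z::'a). bump r z)" and r0: "0 < r0"
 shows "\<bar>f x\<bar> \<le> C"
proof (rule field_le_epsilon)
 fix e :: real assume e: "0 < e"
 obtain d where d: "d > 0" "\<And>y. dist y x < d ==> dist (f y) (f x) < e"
  using c e unfolding continuous_at_eps_delta by metis
 define r where "r = min d r0 / 2"
 have r: "0 < r" "r < d" "r < r0" using d r0 by (auto simp: r_def)
 define I where "I = (LBINT (z::'a). bump r z)"
 have I: "I > 0" unfolding I_def by (rule integral_bump_pos [OF r(1)])
 have "\<bar>moll r f x - f x * I\<bar> \<le> e * I"
  unfolding I_def
 proof (rule moll_close [OF r(1)])
  fix y assume "norm (x - y) < r"
  then show "\<bar>f y - f x\<bar> \<le> e" using d(2) [of y] r by (simp add: dist_norm norm_minus_commute)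
 qed measurable
 moreover have "\<bar>moll r f x\<bar> \<le> C * I" unfolding I_def by (rule b) (use r in auto)
 ultimately have "\<bar>f x * I\<bar> \<le> (C + e) * I" unfolding distrib_right by linarith
 then have "\<bar>f x\<bar> * I \<le> (C + e) * I" using I by (simp add: abs_mult)
 then show "\<bar>f x\<bar> \<le> C + e" using I by simp
qed

lemma fdiff_convolution:
 fixes f K :: "'a::euclidean_space => real"
 assumes int: "\<And>j. j \<le> m ==> integrable lborel (\<lambda>y. f y * K (x + real j *\<^sub>R h - y))"
 shows "fdiff m h (\<lambda>z. LBINT y. f y * K (z - y)) x = (LBINT y. f y * fdiff m h K (x - y))"
proof -
 have "fdiff m h (\<lambda>z. LBINT y. f y * K (z - y)) x =
   (LBINT y. (\<Sum>j\<le>m. (-1)^j * real (m choose j) * (f y * K (x + real j *\<^sub>R h - y))))"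
  unfolding fdiff_def
  by (subst integral_sum) (auto intro!: integrable_mult_right int)
 also have "... = (LBINT y. f y * fdiff m h K (x - y))"
  unfolding fdiff_def by (intro integral_cong) (auto simp: sum_distrib_left algebra_simps)
 finally show ?thesis .
qed

lemma fdiff_moll:
 fixes f :: "'a::euclidean_space => real"
 assumes int: "\<And>j. j \<le> m ==> integrable lborel (\<lambda>y. f y * bump r (x + real j *\<^sub>R h - y))"
 shows "fdiff m h (moll r f) x = (LBINT y. f y * fdiff m h (bump r) (x - y))"
  and "fdiff m h (moll r f) x = moll r (fdiff m h f) x"
proof -
 show "fdiff m h (moll r f) x = (LBINT y. f y * fdiff m h (bump r) (x - y))"
  unfolding moll_def [abs_def] by (rule fdiff_convolution [OF int])
 have int': "integrable lborel (\<lambda>y. f (y + real j *\<^sub>R h) * bump r (x - y))" if "j \<le> m" for j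
  using integrable_lborel_shift_iff [of "\<lambda>y. f y * bump r (x + real j *\<^sub>R h - y)" "real j *\<^sub>R h"] int [OF that]
  by (simp add: algebra_simps)
 have "fdiff m h (moll r f) x = (LBINT y. (\<Sum>j\<le>m. (-1)^j * real (m choose j) * (f (y + real j *\<^sub>R h) * bump r (x - y))))"
  unfolding fdiff_def moll_shift
  by (subst integral_sum) (auto intro!: integrable_mult_right int')
 also have "... = moll r (fdiff m h f) x"
  unfolding fdiff_def moll_def by (intro integral_cong) (auto simp: sum_distrib_right mult.assoc)
 finally show "fdiff m h (moll r f) x = moll r (fdiff m h f) x" .
qed

lemma flap_fdiff:
 fixes f :: "'a::euclidean_space => real"
 assumes "\<And>j. j \<le> m ==> integrable lborel (\<lambda>z. sdiff f (x + real j *\<^sub>R h) z * rker s z)"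
 shows "flap s (fdiff m h f) x = fdiff m h (flap s f) x"
proof -
 have "(LBINT z. sdiff (fdiff m h f) x z * rker s z) =
  (LBINT z. (\<Sum>j\<le>m. (-1)^j * real (m choose j) * (sdiff f (x + real j *\<^sub>R h) z * rker s z)))"
  unfolding sdiff_fdiff by (simp add: fdiff_def sum_distrib_right mult.assoc)
 also have "... = (\<Sum>j\<le>m. (-1)^j * real (m choose j) * (LBINT z. sdiff f (x + real j *\<^sub>R h) z * rker s z))"
  by (subst integral_sum) (auto intro!: integrable_mult_right assms)
 finally show ?thesis by (simp add: flap_def fdiff_def sum_divide_distrib)
qed

lemma flap_diff:
 assumes "integrable lborel (\<lambda>z. sdiff f x z * rker s z)" "integrable lborel (\<lambda>z. sdiff g x z * rker s z)"
 shows "flap s (\<lambda>y. f y - g y) x = flap s f x - flap s g x"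
proof -
 have "(LBINT z. sdiff (\<lambda>y. f y - g y) x z * rker s z) = (LBINT z. sdiff f x z * rker s z - sdiff g x z * rker s z)"
  by (intro integral_cong) (auto simp: sdiff_def algebra_simps)
 then show ?thesis using assms by (simp add: flap_def diff_divide_distrib)
qed

lemma fdiff_minus: "fdiff m h (\<lambda>y. f y - g y) x = fdiff m h f x - fdiff m h g x"
 by (simp add: fdiff_def right_diff_distrib sum_subtractf)

section \<open>Far fields and cut-off functions\<close>

text \<open>Where f vanishes near x the singularity of the kernel is not met, and the operator is
  minus the convolution with \<open>rker\<close>.\<close>

lemma flap_far:
 fixes f :: "'a::euclidean_space => real"
 assumes s: "0 < s" "s < 1" and [measurable]: "f \<in> borel_measurable borel" and B: "\<And>y. \<bar>f y\<bar> \<le> B"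
  and d: "0 < d" "\<And>y. norm (y - x) < d ==> f y = 0"
 shows "integrable lborel (\<lambda>y. f y * rker s (x - y))" "flap s f x = - (LBINT y. f y * rker s (x - y))"
proof -
 have eq: "indicator (- ball 0 d) h * (f (x + h) * rker s h) = f (x + h) * rker s h" for h
  using d(2) [of "x + h"] by (auto simp: indicator_def)
 have i: "integrable lborel (\<lambda>h. f (x + h) * rker s h)"
  using integrable_off_ball [OF s d(1), of "\<lambda>h. f (x + h)" B] B unfolding eq by simp
 have i': "integrable lborel (\<lambda>h. f (x - h) * rker s h)"
  using integrable_lborel_reflect_iff [of "\<lambda>h. f (x + h) * rker s h" 0] i by (simp add: rker_minus)
 have eq2: "f (x + h) * rker s (x - (x + h)) = f (x + h) * rker s h" for h by (simp add: rker_minus)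
 show "integrable lborel (\<lambda>y. f y * rker s (x - y))"
  using integrable_lborel_shift_iff [of "\<lambda>y. f y * rker s (x - y)" x] i unfolding eq2 by simp
 have 1: "(LBINT h. f (x + h) * rker s h) = (LBINT y. f y * rker s (x - y))"
  using integral_lborel_shift [of "\<lambda>y. f y * rker s (x - y)" x] unfolding eq2 .
 have 2: "(LBINT h. f (x - h) * rker s h) = (LBINT h. f (x + h) * rker s h)"
  using integral_lborel_reflect [of "\<lambda>h. f (x + h) * rker s h" 0] by (simp add: rker_minus)
 have "f x = 0" using d by simp
 then have "(LBINT h. sdiff f x h * rker s h) = (LBINT h. - (f (x + h) * rker s h) - f (x - h) * rker s h)"
  by (intro integral_cong) (auto simp: sdiff_def algebra_simps)
 also have "... = - 2 * (LBINT y. f y * rker s (x - y))"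
  using i i' by (simp add: 1 2)
 finally show "flap s f x = - (LBINT y. f y * rker s (x - y))" by (simp add: flap_def)
qed

text \<open>The form with a summand 0 is the case \<epsilon> = 0 of
  \<open>fdiff_inverse_power_bound\<close>.\<close>

lemma rker_eq: "rker s (z::'a::euclidean_space) = (0 + (norm z)^2) powr (- ((real DIM('a) + 2 * s) / 2))"
proof (cases "z = 0")
 case False
 have sq: "(norm z)^2 = norm z powr 2" using False by simp
 have "(0 + (norm z)^2) powr (- ((real DIM('a) + 2 * s) / 2)) = norm z powr (2 * (- ((real DIM('a) + 2 * s) / 2)))"
  by (simp only: sq add_0_left powr_powr)
 also have "2 * (- ((real DIM('a) + 2 * s) / 2)) = - (real DIM('a) + 2 * s)" by (simp add: field_simps)
 finally show ?thesis by (simp only: rker_def powr_minus_divide)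
qed (simp add: rker_0)

lemma fdiff_rker_bound:
 fixes h :: "'a::euclidean_space"
 assumes s: "0 < s"
 obtains C where "C \<ge> 0" "\<And>y::'a. 8 * (real m + 1) * norm h \<le> norm y ==> 1 \<le> norm y ==>
  \<bar>fdiff m h (rker s) y\<bar> \<le> C * norm y powr (- (real (DIM('a) + m) + 2 * s))"
proof -
 define b where "b = (real DIM('a) + 2 * s) / 2"
 have b: "b > 0" using s by (simp add: b_def add_pos_pos)
 obtain C where C: "C \<ge> 0" "\<And>(y::'a) h \<epsilon>. 0 \<le> \<epsilon> ==> 0 < \<epsilon> + (norm y)^2 ==> 8 * (real m + 1) * norm h \<le> sqrt (\<epsilon> + (norm y)^2) ==>
   \<bar>fdiff m h (\<lambda>z. (\<epsilon> + (norm z)^2) powr (- b)) y\<bar>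
    \<le> C * (\<epsilon> + (norm y)^2) powr (- b) * (norm h / sqrt (\<epsilon> + (norm y)^2)) ^ m"
  using fdiff_inverse_power_bound [OF b, of m, where 'a = 'a] by blast
 show thesis
 proof (rule that [of "C * norm h ^ m"])
  show "0 \<le> C * norm h ^ m" using C by simp
  fix y :: 'a assume y: "8 * (real m + 1) * norm h \<le> norm y" "1 \<le> norm y"
  have p: "0 < norm y" using y(2) by linarith
  have rk: "rker s = (\<lambda>z::'a. (0 + (norm z)^2) powr (- b))" by (rule ext) (simp only: rker_eq b_def)
  have "\<bar>fdiff m h (rker s) y\<bar> \<le> C * (0 + (norm y)^2) powr (- b) * (norm h / sqrt (0 + (norm y)^2)) ^ m"
   unfolding rk by (rule C(2)) (use y p in auto)
  also have "... = C * rker s y * (norm h / norm y) ^ m" by (simp add: rk)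
  also have "... = C * norm h ^ m * (rker s y * (1 / norm y ^ m))" by (simp add: power_divide)
  also have "1 / norm y ^ m = norm y powr (- real m)" using p by (simp add: powr_minus_divide powr_realpow)
  also have "rker s y = norm y powr (- (real DIM('a) + 2 * s))" by (simp only: rker_def powr_minus_divide)
  also have "norm y powr (- (real DIM('a) + 2 * s)) * norm y powr (- real m) = norm y powr (- (real (DIM('a) + m) + 2 * s))"
   by (simp only: powr_add [symmetric]) (simp add: algebra_simps)
  finally show "\<bar>fdiff m h (rker s) y\<bar> \<le> C * norm h ^ m * norm y powr (- (real (DIM('a) + m) + 2 * s))" .
 qed
qed

lemma AE_norm_neq: "AE h::'a::euclidean_space in lborel. norm (x + h) \<noteq> R"
proof -
 have "sphere (- x) R \<in> null_sets lebesgue"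
  using negligible_sphere [of "- x" R] by (simp add: negligible_iff_null_sets)
 then have "sphere (- x) R \<in> null_sets lborel"
  by (subst (asm) null_sets_completion_iff) auto
 from AE_not_in [OF this] show ?thesis
 proof eventually_elim
  case (elim h)
  have "dist (- x) h = norm (x + h)" by (simp add: dist_norm norm_minus_commute add.commute)
  then show ?case using elim by auto
 qed
qed

lemma isCont_cutoff:
 fixes u :: "'a::euclidean_space => real"
 assumes u: "continuous_on UNIV u" and y: "norm y \<noteq> R"
 shows "isCont (\<lambda>y. indicator (ball 0 R) y * u y) y"
proof -
 have uc: "isCont u y" using u by (simp add: continuous_on_eq_continuous_at)
 consider "norm y < R" | "norm y > R" using y by linarith
 then show ?thesis
 proof cases
  case 1
  have "\<forall>\<^sub>F z in nhds y. z \<in> ball 0 R" using 1 by (intro eventually_nhds_in_open) auto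
  then have "\<forall>\<^sub>F z in nhds y. u z = indicator (ball 0 R) z * u z" by eventually_elim simp
  with uc show ?thesis by (subst (asm) isCont_cong)
 next
  case 2
  have "\<forall>\<^sub>F z in nhds y. z \<in> - cball 0 R" using 2 by (intro eventually_nhds_in_open) auto
  then have "\<forall>\<^sub>F z in nhds y. 0 = indicator (ball 0 R) z * u z" by eventually_elim auto
  then show ?thesis using continuous_const [of "at y" "0::real"] by (subst (asm) isCont_cong [of "\<lambda>_. 0"])
 qed
qed

lemma AE_isCont_cutoff:
 fixes u :: "'a::euclidean_space => real"
 assumes u: "continuous_on UNIV u"
 shows "AE y in lborel. isCont (\<lambda>y. indicator (ball 0 R) y * u y) y"
 using AE_norm_neq [of 0 R] by eventually_elim (simp add: isCont_cutoff [OF u])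

lemma cutoff_bounded:
 fixes u :: "'a::euclidean_space => real"
 assumes u: "continuous_on UNIV u"
 obtains B where "B \<ge> 0" "\<And>y. \<bar>indicator (ball 0 R) y * u y\<bar> \<le> B"
proof -
 have "compact (u ` cball 0 R)" by (intro compact_continuous_image continuous_on_subset [OF u]) auto
 then have "bounded (u ` cball 0 R)" by (rule compact_imp_bounded)
 then obtain B where "\<forall>v \<in> u ` cball 0 R. norm v \<le> B" unfolding bounded_iff by blast
 then have B: "\<And>y. y \<in> cball 0 R ==> \<bar>u y\<bar> \<le> B" unfolding real_norm_def by blast
 have "\<bar>indicator (ball 0 R) y * u y\<bar> \<le> \<bar>B\<bar>" for y
  using B [of y] by (auto simp: indicator_def)
 then show thesis by (intro that [of "\<bar>B\<bar>"]) auto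
qed

lemma visc_frac_laplacian_eq_cong:
 assumes "visc_frac_laplacian_eq s \<Omega> w g" "\<And>x. x \<in> \<Omega> ==> g x = g' x"
 shows "visc_frac_laplacian_eq s \<Omega> w g'"
proof -
 have "continuous_on \<Omega> g = continuous_on \<Omega> g'" by (rule continuous_on_cong) (use assms in auto)
 then show ?thesis using assms unfolding visc_frac_laplacian_eq_def by auto
qed

lemma inverse_weight_le:
 fixes y :: "'a::euclidean_space"
 assumes a: "0 < a" "a \<le> real L"
 shows "1 / (1 + norm y) ^ L \<le> 2 / (1 + norm y powr a)"
proof -
 have "norm y powr a \<le> (1 + norm y) powr a" using a by (intro powr_mono2) auto
 moreover have "1 \<le> (1 + norm y) powr a" using a by (intro ge_one_powr_ge_zero) auto
 moreover have "(1 + norm y) powr a \<le> (1 + norm y) powr (real L)" using a by (intro powr_mono) auto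
 moreover have "(1 + norm y) powr (real L) = (1 + norm y) ^ L" by (rule powr_realpow) (simp add: add_pos_nonneg)
 ultimately have "1 + norm y powr a \<le> 2 * (1 + norm y) ^ L" by linarith
 moreover have "0 < 1 + norm y powr a" by (simp add: add_pos_nonneg)
 moreover have "0 < (1 + norm y) ^ L" by (simp add: add_pos_nonneg)
 ultimately show ?thesis by (simp add: divide_simps)
qed

lemma fdiff_abs_le_ball:
 assumes "norm x + real m * norm h < M" "j \<le> m"
 shows "norm (x + real j *\<^sub>R h) < M"
proof -
 have "norm (x + real j *\<^sub>R h) \<le> norm x + real j * norm h" using norm_triangle_ineq [of x "real j *\<^sub>R h"] by simp
 also have "... \<le> norm x + real m * norm h" using assms(2) by (intro add_left_mono mult_right_mono) auto
 finally show ?thesis using assms(1) by simp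
qed

lemma bounded_on_cball:
 fixes g :: "'a::euclidean_space => real"
 assumes "continuous_on (ball 0 M) g" "R < M"
 obtains B where "\<And>y. norm y \<le> R ==> \<bar>g y\<bar> \<le> B"
proof -
 have "compact (g ` cball 0 R)"
  using assms by (intro compact_continuous_image continuous_on_subset [OF assms(1)]) auto
 then have "bounded (g ` cball 0 R)" by (rule compact_imp_bounded)
 then obtain B where "\<forall>v \<in> g ` cball 0 R. norm v \<le> B" unfolding bounded_iff by blast
 then have "\<And>y. y \<in> cball 0 R ==> \<bar>g y\<bar> \<le> B" unfolding real_norm_def by blast
 then show thesis by (intro that [of B]) auto
qed

section \<open>Passing to the limit in the equations of the cut-offs\<close>

context heat_average
begin

text \<open>A bump of radius at most 1 moves mass by at most 1, where the weight changes by a factor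
  2^L at most.\<close>

lemma weighted_moll:
 assumes [measurable]: "W \<in> borel_measurable borel" and W: "\<And>y. \<bar>W y\<bar> \<le> \<bar>u y\<bar>" and \<rho>: "0 < \<rho>" "\<rho> \<le> 1"
 shows "integrable lborel (\<lambda>y. \<bar>moll \<rho> W y\<bar> / (1 + norm y) ^ L)"
  "(LBINT y. \<bar>moll \<rho> W y\<bar> / (1 + norm y) ^ L) \<le> 2 ^ L * U * (LBINT (z::'a). bump \<rho> z)"
proof -
 define q where "q z = 2 ^ L * (\<bar>u z\<bar> / (1 + norm z) ^ L)" for z
 have qi: "integrable lborel q"
  unfolding q_def [abs_def] by (intro integrable_mult_right ui')
 then have q [measurable]: "q \<in> borel_measurable borel" by auto
 have q0: "0 \<le> q z" for z by (simp add: q_def)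
 have qI: "(LBINT z. q z) = 2 ^ L * U"
  unfolding q_def U_def by (rule integral_mult_right_zero)
 let ?G = "\<lambda>(z, y). q z * bump \<rho> (y - z)"
 have bi: "integrable lborel (\<lambda>y. bump \<rho> (y - z))" for z :: 'a
  using integrable_lborel_shift_iff [of "bump \<rho>" "- z"] integrable_bump [OF \<rho>(1), where 'a = 'a] by simp
 have bI: "(LBINT y. bump \<rho> (y - z)) = (LBINT (y::'a). bump \<rho> y)" for z :: 'a
  using integral_lborel_shift [of "bump \<rho>" "- z"] by simp
 have joint: "integrable (lborel \<Otimes>\<^sub>M lborel) ?G"
 proof (rule lborel_pair.Fubini_integrable)
  show "?G \<in> borel_measurable (lborel \<Otimes>\<^sub>M lborel)" by measurable
  have "(LBINT y. norm (case (z, y) of (z, y) => q z * bump \<rho> (y - z))) = q z * (LBINT (y::'a). bump \<rho> y)" for z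
   using bI [of z] q0 [of z] by (simp add: abs_mult abs_of_nonneg [OF bump_nonneg])
  then show "integrable lborel (\<lambda>z. LBINT y. norm (case (z, y) of (z, y) => q z * bump \<rho> (y - z)))"
   using integrable_mult_left [OF qi, of "LBINT (y::'a). bump \<rho> y"] by simp
  show "AE z in lborel. integrable lborel (\<lambda>y. case (z, y) of (z, y) => q z * bump \<rho> (y - z))"
   by (intro AE_I2) (auto intro!: integrable_mult_right bi)
 qed
 have bigi: "integrable lborel (\<lambda>y. LBINT z. ?G (z, y))"
  using lborel_pair.integrable_snd [OF joint] by simp
 have ae: "AE y in lborel. \<bar>moll \<rho> W y\<bar> / (1 + norm y) ^ L \<le> (LBINT z. ?G (z, y))"
  using lborel_pair.AE_integrable_snd [OF joint]
 proof eventually_elim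
  case (elim y)
  have p: "0 < (1 + norm y) ^ L" by (simp add: add_pos_nonneg)
  have le: "\<bar>W z * bump \<rho> (y - z)\<bar> * (1 / (1 + norm y) ^ L) \<le> ?G (z, y)" for z
  proof (cases "norm (y - z) < \<rho>")
   case True
   have "1 / (1 + norm y) ^ L = 1 / (1 + norm (z + (y - z))) ^ L" by simp
   also have "... \<le> (1 + 1) ^ L / (1 + norm z) ^ L" using True \<rho> by (intro inverse_weight_shift) auto
   finally have "\<bar>W z\<bar> * (1 / (1 + norm y) ^ L) \<le> \<bar>u z\<bar> * (2 ^ L / (1 + norm z) ^ L)"
    using W p by (intro mult_mono) auto
   from mult_right_mono [OF this bump_nonneg [of \<rho> "y - z"]]
   show ?thesis by (simp add: q_def abs_mult abs_of_nonneg [OF bump_nonneg] mult_ac)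
  qed (simp add: bump_eq_0 \<rho>)
  have "\<bar>moll \<rho> W y\<bar> \<le> (LBINT z. \<bar>W z * bump \<rho> (y - z)\<bar>)" unfolding moll_def by (rule integral_abs_bound)
  then have "\<bar>moll \<rho> W y\<bar> * (1 / (1 + norm y) ^ L) \<le> (LBINT z. \<bar>W z * bump \<rho> (y - z)\<bar>) * (1 / (1 + norm y) ^ L)"
   using p by (intro mult_right_mono) auto
  also have "... = (LBINT z. \<bar>W z * bump \<rho> (y - z)\<bar> * (1 / (1 + norm y) ^ L))"
   by (rule integral_mult_left_zero [symmetric])
  also have "... \<le> (LBINT z. ?G (z, y))"
  proof (rule integral_mono')
   show "integrable lborel (\<lambda>z. ?G (z, y))" using elim by simp
   show "\<bar>W z * bump \<rho> (y - z)\<bar> * (1 / (1 + norm y) ^ L) \<le> ?G (z, y)" for z by (rule le)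
   show "0 \<le> ?G (z, y)" for z by (simp add: q0 bump_nonneg)
  qed
  finally show ?case by simp
 qed
 show mi: "integrable lborel (\<lambda>y. \<bar>moll \<rho> W y\<bar> / (1 + norm y) ^ L)"
 proof (rule integrable_bound [OF bigi])
  show "AE y in lborel. norm (\<bar>moll \<rho> W y\<bar> / (1 + norm y) ^ L) \<le> norm (LBINT z. ?G (z, y))"
   using ae by eventually_elim (simp add: abs_of_nonneg order.trans [OF _ abs_ge_self])
 qed measurable
 have "(LBINT y. \<bar>moll \<rho> W y\<bar> / (1 + norm y) ^ L) \<le> (LBINT y. LBINT z. ?G (z, y))"
  by (rule integral_mono_AE [OF mi bigi ae])
 also have "... = (LBINT z. LBINT y. ?G (z, y))" using lborel_pair.Fubini_integral [OF joint] by simp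
 also have "... = 2 ^ L * U * (LBINT (z::'a). bump \<rho> z)" by (simp add: bI qI)
 finally show "(LBINT y. \<bar>moll \<rho> W y\<bar> / (1 + norm y) ^ L) \<le> 2 ^ L * U * (LBINT (z::'a). bump \<rho> z)" .
qed

text \<open>The constant K depends neither on the supremum B of W nor on \<rho>. Since W vanishes
  near the points considered, the m-th difference can be put on the kernel, which then decays at
  least like the weight of order n + m in which u is integrable.\<close>

lemma fdiff_flap_far:
 assumes M: "0 < M"
 obtains K where "K \<ge> 0"
  "\<And>W B N \<rho> a. W \<in> borel_measurable borel ==> (\<And>y. \<bar>W y\<bar> \<le> \<bar>u y\<bar>) ==> (\<And>y. \<bar>W y\<bar> \<le> B) ==>
   0 < \<rho> ==> \<rho> \<le> 1 ==> (\<And>y. norm y < N ==> W y = 0) ==> 2 * M + 16 * (real m + 1) * norm h + 4 \<le> N ==>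
   norm a + real m * norm h < M ==>
   \<bar>fdiff m h (flap s (moll \<rho> W)) a\<bar> \<le> K * (LBINT (z::'a). bump \<rho> z)"
proof -
 obtain C where C: "C \<ge> 0" "\<And>y::'a. 8 * (real m + 1) * norm h \<le> norm y ==> 1 \<le> norm y ==>
  \<bar>fdiff m h (rker s) y\<bar> \<le> C * norm y powr (- (real (DIM('a) + m) + 2 * s))"
  using fdiff_rker_bound [OF s(1), of m h] by blast
 define K where "K = C * 4 ^ L * (2 ^ L * U)"
 have "\<bar>fdiff m h (flap s (moll \<rho> W)) a\<bar> \<le> K * (LBINT (z::'a). bump \<rho> z)"
  if Wm [measurable]: "W \<in> borel_measurable borel" and W: "\<And>y. \<bar>W y\<bar> \<le> \<bar>u y\<bar>" and B: "\<And>y. \<bar>W y\<bar> \<le> B"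
   and \<rho>: "0 < \<rho>" "\<rho> \<le> 1" and W0: "\<And>y. norm y < N ==> W y = 0"
   and N: "2 * M + 16 * (real m + 1) * norm h + 4 \<le> N" and a: "norm a + real m * norm h < M" for W B N \<rho> a
 proof -
  define f where "f = moll \<rho> W"
  have fm [measurable]: "f \<in> borel_measurable borel" unfolding f_def by measurable
  have fB: "\<bar>f y\<bar> \<le> B * (LBINT (z::'a). bump \<rho> z)" for y
   unfolding f_def by (rule moll_bound [OF \<rho>(1) Wm B])
  \<comment> \<open>Mollification with \<rho> \<le> 1 shrinks the zero set by at most 1.\<close>
  have f0: "f y = 0" if "norm y < N - 1" for y
  proof -
   have z0: "W z * bump \<rho> (y - z) = 0" for z
   proof (cases "norm (y - z) < \<rho>")
    case True
    then have "norm z < N" using that \<rho> norm_triangle_ineq2 [of z y] by (simp add: norm_minus_commute)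
    then show ?thesis by (simp add: W0)
   qed (simp add: bump_eq_0 \<rho>)
   show ?thesis unfolding f_def moll_def z0 by simp
  qed
  have h0: "0 \<le> 16 * (real m + 1) * norm h" by simp
  have mh: "0 \<le> real m * norm h" by simp
  have near: "f y = 0" if "norm (y - z) < 1" "norm z < M" for y z
  proof (rule f0)
   have "norm y \<le> norm z + norm (y - z)" using norm_triangle_ineq [of z "y - z"] by simp
   then show "norm y < N - 1" using that N h0 M by linarith
  qed
  have zM: "norm (a + real j *\<^sub>R h) < M" if "j \<le> m" for j by (rule fdiff_abs_le_ball [OF a that])
  have fl: "flap s f z = - (LBINT y. f y * rker s (z - y))" "integrable lborel (\<lambda>y. f y * rker s (z - y))" if "norm z < M" for z
   using flap_far [OF s fm fB, of 1 z] near that by auto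
  have "fdiff m h (flap s f) a = - fdiff m h (\<lambda>z. LBINT y. f y * rker s (z - y)) a"
   unfolding fdiff_def sum_negf [symmetric] by (intro sum.cong refl) (simp add: fl zM)
  also have "... = - (LBINT y. f y * fdiff m h (rker s) (a - y))"
   using fl(2) zM by (subst fdiff_convolution) auto
  finally have "\<bar>fdiff m h (flap s f) a\<bar> \<le> (LBINT y. \<bar>f y * fdiff m h (rker s) (a - y)\<bar>)"
   using integral_abs_bound [of lborel "\<lambda>y. f y * fdiff m h (rker s) (a - y)"] by simp
  also have "... \<le> (LBINT y. C * 4 ^ L * (\<bar>f y\<bar> / (1 + norm y) ^ L))"
  proof (rule integral_mono')
   show "integrable lborel (\<lambda>y. C * 4 ^ L * (\<bar>f y\<bar> / (1 + norm y) ^ L))"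
    unfolding f_def by (intro integrable_mult_right weighted_moll Wm W \<rho>)
   show "0 \<le> C * 4 ^ L * (\<bar>f y\<bar> / (1 + norm y) ^ L)" for y using C(1) by simp
   fix y
   show "\<bar>f y * fdiff m h (rker s) (a - y)\<bar> \<le> C * 4 ^ L * (\<bar>f y\<bar> / (1 + norm y) ^ L)"
   proof (cases "norm y < N - 1")
    case False
    have yp: "0 < (1 + norm y) ^ L" by (simp add: add_pos_nonneg)
    \<comment> \<open>From |y| \<ge> N - 1 and the lower bound on N it follows that |a - y| is at
      least |y| / 2, at least 1, at least the multiple of |h| required by the kernel estimate, and
      at least (1 + |y|) / 4; the last bound is the origin of 4^L.\<close>
    have 1: "norm y - norm a \<le> norm (a - y)" using norm_triangle_ineq2 [of y a] by (simp add: norm_minus_commute)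
    have 2: "norm y / 2 \<le> norm (a - y)" using 1 False N a h0 mh by linarith
    have 3: "8 * (real m + 1) * norm h \<le> norm (a - y)" using 2 False N M by linarith
    have 4: "1 \<le> norm (a - y)" using 2 False N M h0 by linarith
    have "3 \<le> norm y" using False N M h0 by linarith
    then have "(1 + norm y) / 4 \<le> norm y / 2" by simp
    then have 5: "(1 + norm y) / 4 \<le> norm (a - y)" using 2 by (rule order.trans)
    have "norm (a - y) powr (- (real (DIM('a) + m) + 2 * s)) \<le> norm (a - y) powr (- real L)"
     using 4 s by (intro powr_mono) (auto simp: L_def)
    also have "... = 1 / norm (a - y) ^ L"
    proof -
     have "0 < norm (a - y)" using 4 by linarith
     then show ?thesis by (simp only: powr_minus_divide powr_realpow)
    qed
    also have "... \<le> 1 / ((1 + norm y) / 4) ^ L"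
     using 5 4 yp by (intro divide_left_mono power_mono mult_pos_pos zero_less_power) (auto simp: add_pos_nonneg)
    also have "... = 4 ^ L / (1 + norm y) ^ L" by (simp add: power_divide)
    finally have "C * norm (a - y) powr (- (real (DIM('a) + m) + 2 * s)) \<le> C * (4 ^ L / (1 + norm y) ^ L)"
     by (rule mult_left_mono [OF _ C(1)])
    then have "\<bar>fdiff m h (rker s) (a - y)\<bar> \<le> C * (4 ^ L / (1 + norm y) ^ L)"
     using C(2) [OF 3 4] by linarith
    from mult_left_mono [OF this abs_ge_zero [of "f y"]]
    show ?thesis by (simp add: abs_mult mult_ac)
   qed (simp add: f0)
  qed
  also have "... = C * 4 ^ L * (LBINT y. \<bar>f y\<bar> / (1 + norm y) ^ L)"
   by (rule integral_mult_right_zero)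
  also have "... \<le> C * 4 ^ L * (2 ^ L * U * (LBINT (z::'a). bump \<rho> z))"
   unfolding f_def using C(1) by (intro mult_left_mono weighted_moll Wm W \<rho>) auto
  finally show ?thesis by (simp add: f_def K_def mult.assoc)
 qed
 moreover have "K \<ge> 0" using C(1) U_nonneg by (simp add: K_def)
 ultimately show thesis by (rule that [rotated])
qed

text \<open>Bochner's formula for V, the m-th difference of the mollified w. The heat average is
  taken over from V to \<sigma> by Fubini, and the difference of the two is the integral of w
  against the defect.\<close>

lemma flap_fdiff_moll_mixture:
 assumes [measurable]: "w \<in> borel_measurable borel" and B: "\<And>y. \<bar>w y\<bar> \<le> B" and w: "integrable lborel w"
 shows "integrable lborel (\<lambda>t. lweight s t * (LBINT y. w y * defect t (x - y)))"
  and "mix_const TYPE('a) s * flap s (fdiff m h (moll r w)) x = (LBINT t. lweight s t * (LBINT y. w y * defect t (x - y)))"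
proof -
 define V where "V = fdiff m h (moll r w)"
 define I where "I = (LBINT (z::'a). bump r z)"
 obtain C1 where C1: "C1 \<ge> 0" "\<And>(f :: 'a => real) B x h. f \<in> borel_measurable borel ==>
   (\<And>y. \<bar>f y\<bar> \<le> B) ==> \<bar>sdiff (moll r f) x h\<bar> \<le> B * C1 * min 1 ((norm h)^2)"
  using sdiff_moll_bound [OF r, where 'a = 'a] by blast
 obtain C where C: "C > 0" "\<And>y. \<bar>\<sigma> y\<bar> \<le> C / (1 + norm y) ^ L" "\<And>t y. \<bar>heat \<sigma> t y\<bar> \<le> C / (1 + norm y) ^ L"
  using obtain_bounds by metis
 have C_le: "C / (1 + norm y) ^ L \<le> C" for y :: 'a
 proof -
  have "C / (1 + norm y) ^ L \<le> C / 1" using C(1) by (intro divide_left_mono) (auto simp: one_le_power add_pos_nonneg)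
  then show ?thesis by simp
 qed
 have sb: "\<bar>\<sigma> y\<bar> \<le> C" for y using C(2) [of y] C_le [of y] by linarith
 have hb: "\<bar>heat \<sigma> t y\<bar> \<le> C" for t y using C(3) [of t y] C_le [of y] by linarith
 have Vm [measurable]: "V \<in> borel_measurable borel" unfolding V_def by measurable
 have VB: "\<bar>V y\<bar> \<le> 2 ^ m * (B * I)" for y
  unfolding V_def I_def by (intro fdiff_abs_le moll_bound r B) measurable
 have VS: "\<bar>sdiff V x z\<bar> \<le> (2 ^ m * (B * C1)) * min 1 ((norm z)^2)" for z
 proof -
  have "\<bar>sdiff V x z\<bar> \<le> 2 ^ m * (B * C1 * min 1 ((norm z)^2))"
   unfolding V_def sdiff_fdiff by (intro fdiff_abs_le C1(2) B) measurable
  then show ?thesis by (simp add: mult.assoc)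
 qed
 have wi: "integrable lborel (\<lambda>y. w y * k (c - y))" if [measurable]: "k \<in> borel_measurable borel" and "\<And>y. \<bar>k y\<bar> \<le> C" for k c
 proof (rule integrable_bound [OF integrable_mult_left [OF w, of C]])
  show "AE y in lborel. norm (w y * k (c - y)) \<le> norm (w y * C)"
   using that(2) C(1) by (intro AE_I2) (auto simp: abs_mult intro!: mult_left_mono)
 qed measurable
 have Veq: "V z = (LBINT y. w y * \<sigma> (z - y))" for z
  unfolding V_def \<sigma>_def by (intro fdiff_moll(1) integrable_mult_bump [OF r _ B]) measurable
 have heatV: "(LBINT z. V (x + z) * gker t z) = (LBINT y. w y * heat \<sigma> t (x - y))" if t: "0 < t" for t
 proof -
  let ?H = "\<lambda>(y, z). w y * (\<sigma> (x + z - y) * gker t z)"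
  have joint: "integrable (lborel \<Otimes>\<^sub>M lborel) ?H"
  proof (rule integrable_bound)
   have "integrable (lborel \<Otimes>\<^sub>M lborel) (\<lambda>(y, z::'a). w y * (C * gker t z))"
    by (intro integrable_lborel_product w integrable_mult_right integrable_gker t)
   then show "integrable (lborel \<Otimes>\<^sub>M lborel) (\<lambda>p :: 'a \<times> 'a. w (fst p) * (C * gker t (snd p)))"
    by (simp only: case_prod_unfold)
   show "AE p :: 'a \<times> 'a in lborel \<Otimes>\<^sub>M lborel. norm (?H p) \<le> norm (w (fst p) * (C * gker t (snd p)))"
   proof (intro AE_I2)
    fix p :: "'a \<times> 'a"
    obtain y z where p: "p = (y, z)" by fastforce
    have g: "0 \<le> gker t z" using t by (simp add: gker_nonneg)
    have "\<bar>w y\<bar> * (\<bar>\<sigma> (x + z - y)\<bar> * gker t z) \<le> \<bar>w y\<bar> * (C * gker t z)"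
     by (intro mult_left_mono mult_right_mono sb g) auto
    then show "norm (?H p) \<le> norm (w (fst p) * (C * gker t (snd p)))"
     using g C(1) by (simp add: p abs_mult)
   qed
  qed measurable
  have "(LBINT z. V (x + z) * gker t z) = (LBINT z. LBINT y. ?H (y, z))"
  proof (intro integral_cong refl)
   fix z :: 'a
   have "(LBINT y. ?H (y, z)) = (LBINT y. w y * \<sigma> (x + z - y) * gker t z)" by (simp add: mult.assoc)
   then show "V (x + z) * gker t z = (LBINT y. ?H (y, z))" by (simp add: Veq)
  qed
  also have "... = (LBINT y. LBINT z. ?H (y, z))" using lborel_pair.Fubini_integral [OF joint] by simp
  also have "... = (LBINT y. w y * heat \<sigma> t (x - y))"
  proof (intro integral_cong refl)
   fix y
   have e: "x + z - y = x - y + z" for z :: 'a by simp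
   show "(LBINT z. ?H (y, z)) = w y * heat \<sigma> t (x - y)" using t unfolding heat_def by (simp add: e)
  qed
  finally show ?thesis .
 qed
 have eq: "lweight s t * (V x - (LBINT z. V (x + z) * gker t z)) = lweight s t * (LBINT y. w y * defect t (x - y))" for t
 proof (cases "t > 0")
  case True
  have "(LBINT y. w y * defect t (x - y)) = (LBINT y. w y * \<sigma> (x - y) - w y * heat \<sigma> t (x - y))"
   by (simp add: defect_def right_diff_distrib)
  also have "... = V x - (LBINT z. V (x + z) * gker t z)"
   unfolding heatV [OF True] Veq [of x]
   by (intro integral_diff wi heat\<sigma>_borel hb sb) measurable
  finally show ?thesis by simp
 qed (simp add: lweight_def)
 show "integrable lborel (\<lambda>t. lweight s t * (LBINT y. w y * defect t (x - y)))"
  using flap_mixture(1) [OF s Vm VB VS] unfolding eq .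
 show "mix_const TYPE('a) s * flap s (fdiff m h (moll r w)) x = (LBINT t. lweight s t * (LBINT y. w y * defect t (x - y)))"
  using flap_mixture(2) [OF s Vm VB VS] unfolding eq unfolding V_def .
qed

end

lemma cutoff_measurable [measurable]:
 fixes u :: "'a::euclidean_space => real"
 assumes [measurable]: "u \<in> borel_measurable borel"
 shows "(\<lambda>y. indicator (ball 0 R) y * u y) \<in> borel_measurable borel"
proof -
 have [measurable]: "ball (0::'a) R \<in> sets borel" by simp
 show ?thesis by measurable
qed

lemma cutoff_integrable:
 fixes u :: "'a::euclidean_space => real"
 assumes u: "continuous_on UNIV u"
 shows "integrable lborel (\<lambda>y. indicator (ball 0 R) y * u y)"
proof -
 obtain B where B: "B \<ge> 0" "\<And>y. \<bar>indicator (ball 0 R) y * u y\<bar> \<le> B" using cutoff_bounded [OF u, of R] by blast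
 have um: "u \<in> borel_measurable borel" using u by (rule borel_measurable_continuous_onI)
 have "integrable lborel (\<lambda>y::'a. indicator (ball 0 R) y * B)"
  by (intro integrable_mult_left integrable_real_indicator) (use emeasure_bounded_finite [OF bounded_ball] in auto)
 then show ?thesis
 proof (rule integrable_bound)
  show "AE y in lborel. norm (indicator (ball 0 R) y * u y) \<le> norm (indicator (ball 0 R) y * B)"
  proof (intro AE_I2)
   fix y show "norm (indicator (ball 0 R) y * u y) \<le> norm (indicator (ball 0 R) y * B)"
    using B(2) [of y] by (cases "y \<in> ball 0 R") auto
  qed
 qed (use cutoff_measurable [OF um] in simp)
qed

text \<open>The definition evaluated at integer radii. The right-hand side is meaningful only on the
  ball, so g is cut off there to be measurable everywhere. As P_R has degree less than k \<le> m,
  the m-th difference leaves only F_R, which tends to 0.\<close>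

lemma cutoff_data:
 fixes u :: "real ^ 'n => real"
 assumes s: "0 < s" "s < 1" and u: "continuous_on UNIV u"
  and eq: "frac_laplacian_eq_mod_on s k M u (\<lambda>_. 0)" and km: "k \<le> m"
 obtains g :: "nat => real ^ 'n => real" and N0 where
  "\<And>i. g i \<in> borel_measurable borel" "\<And>i. N0 \<le> i ==> continuous_on (ball 0 M) (g i)"
  "\<And>i \<rho> z. N0 \<le> i ==> 0 < \<rho> ==> norm z + \<rho> < M ==>
    flap s (moll \<rho> (\<lambda>y. indicator (ball 0 (real i)) y * u y)) z = moll \<rho> (g i) z"
  "\<And>z h. norm z + real m * norm h < M ==> (\<lambda>i. fdiff m h (g i) z) \<longlonglongrightarrow> 0"
proof -
 obtain P F where ev: "\<forall>\<^sub>F R in at_top. polynomial_deg_le (int k - 1) (P R) \<and>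
   visc_frac_laplacian_eq s (ball 0 M) (\<lambda>y. indicator (ball 0 R) y * u y) (\<lambda>x. F R x + P R x)"
  and lim: "\<And>x. x \<in> ball 0 M ==> ((\<lambda>R. F R x) \<longlongrightarrow> 0) at_top"
  using eq unfolding frac_laplacian_eq_mod_on_def by blast
 obtain R0 where R0: "\<And>R. R0 \<le> R ==> polynomial_deg_le (int k - 1) (P R)"
  "\<And>R. R0 \<le> R ==> visc_frac_laplacian_eq s (ball 0 M) (\<lambda>y. indicator (ball 0 R) y * u y) (\<lambda>x. F R x + P R x)"
  using ev unfolding eventually_at_top_linorder by blast
 define N0 where "N0 = nat \<lceil>R0\<rceil>"
 have N0: "R0 \<le> real i" if "N0 \<le> i" for i
  using that unfolding N0_def by linarith
 define g where "g i y = (if N0 \<le> i then indicator (ball 0 M) y *\<^sub>R (F (real i) y + P (real i) y) else 0)" for i y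
 have gb: "g i y = F (real i) y + P (real i) y" if "N0 \<le> i" "y \<in> ball 0 M" for i y
  using that by (simp add: g_def)
 have visc: "visc_frac_laplacian_eq s (ball 0 M) (\<lambda>y. indicator (ball 0 (real i)) y * u y) (g i)" if "N0 \<le> i" for i
  using R0(2) [OF N0 [OF that]] by (rule visc_frac_laplacian_eq_cong) (simp add: gb that)
 have gc: "continuous_on (ball 0 M) (g i)" if "N0 \<le> i" for i
  using visc [OF that] by (simp add: visc_frac_laplacian_eq_def)
 have gm: "g i \<in> borel_measurable borel" for i
 proof (cases "N0 \<le> i")
  case True
  have "continuous_on (ball 0 M) (\<lambda>y. F (real i) y + P (real i) y)"
   using R0(2) [OF N0 [OF True]] by (simp add: visc_frac_laplacian_eq_def)
  then have "(\<lambda>y. indicator (ball 0 M) y *\<^sub>R (F (real i) y + P (real i) y)) \<in> borel_measurable borel"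
   by (rule borel_measurable_continuous_on_indicator [rotated]) simp
  moreover have "g i = (\<lambda>y. indicator (ball 0 M) y *\<^sub>R (F (real i) y + P (real i) y))"
   using True by (simp add: g_def fun_eq_iff)
  ultimately show ?thesis by simp
 next
  case False
  then have "g i = (\<lambda>_. 0)" by (simp add: g_def fun_eq_iff)
  then show ?thesis by simp
 qed
 have um: "u \<in> borel_measurable borel" using u by (rule borel_measurable_continuous_onI)
 have fl: "flap s (moll \<rho> (\<lambda>y. indicator (ball 0 (real i)) y * u y)) z = moll \<rho> (g i) z"
  if i: "N0 \<le> i" and \<rho>: "0 < \<rho>" "norm z + \<rho> < M" for i \<rho> z
 proof -
  obtain B where "B \<ge> 0" and B: "\<And>y. \<bar>indicator (ball 0 (real i)) y * u y\<bar> \<le> B" using cutoff_bounded [OF u, of "real i"] by blast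
  show ?thesis
   by (rule visc_flap_moll_eq [OF s \<rho>(1) visc [OF i] cutoff_measurable [OF um] B AE_isCont_cutoff [OF u] gm \<rho>(2)])
 qed
 have lm: "(\<lambda>i. fdiff m h (g i) z) \<longlonglongrightarrow> 0" if z: "norm z + real m * norm h < M" for z h
 proof -
  have zb: "z + real j *\<^sub>R h \<in> ball 0 M" if "j \<le> m" for j
   using fdiff_abs_le_ball [OF z that] by simp
  have "(\<lambda>i. \<Sum>j\<le>m. (-1)^j * real (m choose j) * F (real i) (z + real j *\<^sub>R h)) \<longlonglongrightarrow> (\<Sum>j\<le>m. (-1)^j * real (m choose j) * 0)"
   by (intro tendsto_sum tendsto_mult tendsto_const filterlim_compose [OF lim filterlim_real_sequentially] zb) auto
  moreover have "\<forall>\<^sub>F i in sequentially. (\<Sum>j\<le>m. (-1)^j * real (m choose j) * F (real i) (z + real j *\<^sub>R h)) = fdiff m h (g i) z"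
   using eventually_ge_at_top [of N0]
  proof eventually_elim
   case (elim i)
   have "fdiff m h (g i) z = fdiff m h (\<lambda>y. F (real i) y + P (real i) y) z"
    unfolding fdiff_def by (intro sum.cong refl) (simp add: gb [OF elim zb])
   also have "... = fdiff m h (F (real i)) z + fdiff m h (P (real i)) z"
    by (simp add: fdiff_def distrib_left sum.distrib)
   also have "fdiff m h (P (real i)) z = 0"
    using R0(1) [OF N0 [OF elim]] km by (intro fdiff_polynomial_eq_0) auto
   finally show ?case by (simp add: fdiff_def)
  qed
  ultimately show ?thesis by (simp add: tendsto_cong)
 qed
 show thesis by (rule that [OF gm gc fl lm])
qed

context heat_average
begin

text \<open>The integral of \<open>A i\<close> over t has two limits. By the equation it is a
  multiple of the mollified differenced right-hand side, which tends to 0; by dominated convergence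
  it tends to the integral of \<open>Dd\<close> formed with u itself.\<close>

lemma cutoff_limit:
 assumes uc: "continuous_on UNIV u" and M: "norm x + r + real m * norm h < M"
  and gm [measurable]: "\<And>i. g i \<in> borel_measurable borel" and gc: "\<And>i. N0 \<le> i ==> continuous_on (ball 0 M) (g i)"
  and fl: "\<And>i \<rho> z. N0 \<le> i ==> 0 < \<rho> ==> norm z + \<rho> < M ==>
    flap s (moll \<rho> (\<lambda>y. indicator (ball 0 (real i)) y * u y)) z = moll \<rho> (g i) z"
  and lim: "\<And>z. norm z + real m * norm h < M ==> (\<lambda>i. fdiff m h (g i) z) \<longlonglongrightarrow> 0"
 shows "(LBINT t. lweight s t * Dd x t) = 0"
proof -
 define w where "w i = (\<lambda>y. indicator (ball 0 (real i)) y * u y)" for i :: nat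
 define e where "e i = fdiff m h (g i)" for i
 have wm [measurable]: "w i \<in> borel_measurable borel" for i
  unfolding w_def by (rule cutoff_measurable [OF um])
 have wle: "\<bar>w i y\<bar> \<le> \<bar>u y\<bar>" for i y by (simp add: w_def indicator_def)
 have em [measurable]: "e i \<in> borel_measurable borel" for i unfolding e_def by measurable
 have "\<exists>B. \<forall>y. \<bar>w i y\<bar> \<le> B" for i
  unfolding w_def using cutoff_bounded [OF uc, of "real i"] by blast
 then obtain Bw where Bw: "\<And>i y. \<bar>w i y\<bar> \<le> Bw i" by metis
 have M0: "0 < M"
 proof -
  have "0 \<le> norm x" "0 \<le> real m * norm h" by auto
  then show ?thesis using M r by linarith
 qed
 have sint: "integrable lborel (\<lambda>z. sdiff (moll \<rho> f) a z * rker s z)"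
  if \<rho>: "0 < \<rho>" and fm [measurable]: "f \<in> borel_measurable borel" and B: "\<And>y. \<bar>f y\<bar> \<le> B" for f :: "'a => real" and \<rho> a B
 proof -
  obtain C1 where C1: "C1 \<ge> 0" "\<And>(f :: 'a => real) B x h. f \<in> borel_measurable borel ==>
    (\<And>y. \<bar>f y\<bar> \<le> B) ==> \<bar>sdiff (moll \<rho> f) x h\<bar> \<le> B * C1 * min 1 ((norm h)^2)"
   using sdiff_moll_bound [OF \<rho>, where 'a = 'a] by blast
  have C: "\<bar>sdiff (moll \<rho> f) a z\<bar> \<le> (B * C1) * min 1 ((norm z)^2)" for z
   by (rule C1(2) [OF fm B])
  show ?thesis by (rule integrable_near_0 [OF s _ C]) measurable
 qed
 have gB: "\<exists>B. \<forall>y. norm y \<le> R \<longrightarrow> \<bar>g i y\<bar> \<le> B" if "N0 \<le> i" "R < M" for i R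
  using bounded_on_cball [OF gc [OF that(1)] that(2)] by blast
 have shift: "norm (y + real j *\<^sub>R h) \<le> norm a + \<rho> + real m * norm h" if "norm (a - y) < \<rho>" "j \<le> m" for a y \<rho> j
 proof -
  have "norm (y + real j *\<^sub>R h) \<le> norm y + real j * norm h" using norm_triangle_ineq [of y "real j *\<^sub>R h"] by simp
  moreover have "real j * norm h \<le> real m * norm h" using that(2) by (intro mult_right_mono) auto
  moreover have "norm y \<le> norm a + norm (a - y)" using norm_triangle_sub [of y a] by (simp add: norm_minus_commute)
  ultimately show ?thesis using that(1) by linarith
 qed
 have eint: "integrable lborel (\<lambda>y. e i y * bump \<rho> (a - y))"
  and em_eq: "moll \<rho> (e i) a = fdiff m h (flap s (moll \<rho> (w i))) a"
  if i: "N0 \<le> i" and \<rho>: "0 < \<rho>" and a: "norm a + \<rho> + real m * norm h < M" for i \<rho> a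
 proof -
  obtain B where B: "\<And>y. norm y \<le> norm a + \<rho> + real m * norm h ==> \<bar>g i y\<bar> \<le> B"
   using gB [OF i a] by blast
  have eB: "\<bar>e i y\<bar> \<le> 2 ^ m * B" if "norm (a - y) < \<rho>" for y
   unfolding e_def by (intro fdiff_abs_le B shift that)
  show "integrable lborel (\<lambda>y. e i y * bump \<rho> (a - y))"
   by (rule integrable_mult_bump [OF \<rho> em eB])
  have gi: "integrable lborel (\<lambda>y. g i y * bump \<rho> (a + real j *\<^sub>R h - y))" if j: "j \<le> m" for j
  proof (rule integrable_mult_bump [OF \<rho> gm])
   fix y assume y: "norm (a + real j *\<^sub>R h - y) < \<rho>"
   have "norm y \<le> norm (a + real j *\<^sub>R h) + norm (a + real j *\<^sub>R h - y)"
    using norm_triangle_sub [of y "a + real j *\<^sub>R h"] by (simp add: norm_minus_commute)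
   moreover have "norm (a + real j *\<^sub>R h) \<le> norm a + real j * norm h" using norm_triangle_ineq [of a "real j *\<^sub>R h"] by simp
   moreover have "real j * norm h \<le> real m * norm h" using j by (intro mult_right_mono) auto
   ultimately show "\<bar>g i y\<bar> \<le> B" using y by (intro B) linarith
  qed
  have "moll \<rho> (e i) a = fdiff m h (moll \<rho> (g i)) a"
   unfolding e_def by (rule fdiff_moll(2) [OF gi, symmetric])
  also have "... = fdiff m h (flap s (moll \<rho> (w i))) a"
  proof -
   have "moll \<rho> (g i) (a + real j *\<^sub>R h) = flap s (moll \<rho> (w i)) (a + real j *\<^sub>R h)" if "j \<le> m" for j
   proof -
    have "norm (a + real j *\<^sub>R h) < M - \<rho>" using a that by (intro fdiff_abs_le_ball) auto
    then show ?thesis unfolding w_def by (intro fl [symmetric] i \<rho>) simp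
   qed
   then show ?thesis by (auto simp: fdiff_def intro!: sum.cong)
  qed
  finally show "moll \<rho> (e i) a = fdiff m h (flap s (moll \<rho> (w i))) a" .
 qed
 obtain K where K: "K \<ge> 0"
  "\<And>W B N \<rho> a. W \<in> borel_measurable borel ==> (\<And>y. \<bar>W y\<bar> \<le> \<bar>u y\<bar>) ==> (\<And>y. \<bar>W y\<bar> \<le> B) ==>
   0 < \<rho> ==> \<rho> \<le> 1 ==> (\<And>y. norm y < N ==> W y = 0) ==> 2 * M + 16 * (real m + 1) * norm h + 4 \<le> N ==>
   norm a + real m * norm h < M ==>
   \<bar>fdiff m h (flap s (moll \<rho> W)) a\<bar> \<le> K * (LBINT (z::'a). bump \<rho> z)"
  using fdiff_flap_far [OF M0] by blast
 define N where "N = max N0 (nat \<lceil>2 * M + 16 * (real m + 1) * norm h + 4\<rceil>)"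
 have N: "N0 \<le> N" "2 * M + 16 * (real m + 1) * norm h + 4 \<le> real N"
  unfolding N_def by linarith+
 \<comment> \<open>The functions e i converge only pointwise, and this is the uniform bound they
   lack. The cut-offs w i and w N agree on the ball of radius N, so \<open>fdiff_flap_far\<close>
   bounds the mollifications of e i - e N at all small radii, and continuity gives the bound for e i
   - e N itself.\<close>
 have osc: "\<bar>e i a - e N a\<bar> \<le> K" if i: "N \<le> i" and a: "norm a + real m * norm h < M" for i a
 proof -
  have i0: "N0 \<le> i" using i N(1) by simp
  define W where "W y = w i y - w N y" for y
  have Wm [measurable]: "W \<in> borel_measurable borel" unfolding W_def by measurable
  have Weq: "W y = (if norm y < real N then 0 else w i y)" for y
   using i by (auto simp: W_def w_def indicator_def)
  have Wu: "\<bar>W y\<bar> \<le> \<bar>u y\<bar>" for y using wle [of i y] by (auto simp: Weq)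
  have WB: "\<bar>W y\<bar> \<le> Bw i" for y using Bw [of i y] by (auto simp: Weq)
  have W0: "W y = 0" if "norm y < real N" for y using that by (simp add: Weq)
  define \<rho>0 where "\<rho>0 = min 1 (M - norm a - real m * norm h)"
  have \<rho>0: "0 < \<rho>0" using a by (simp add: \<rho>0_def)
  have econt: "isCont (e j) a" if j: "N0 \<le> j" for j
  proof -
   have "isCont (\<lambda>z. g j (z + real l *\<^sub>R h)) a" if "l \<le> m" for l
   proof (rule isCont_o2 [where g = "g j"])
    have "a + real l *\<^sub>R h \<in> ball 0 M" using fdiff_abs_le_ball [OF a that] by simp
    then show "isCont (g j) (a + real l *\<^sub>R h)"
     using gc [OF j] continuous_on_eq_continuous_at [OF open_ball] by blast
   qed simp
   then show ?thesis unfolding e_def fdiff_def [abs_def] by (intro continuous_intros) auto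
  qed
  have "\<bar>moll \<rho> (\<lambda>z. e i z - e N z) a\<bar> \<le> K * (LBINT (z::'a). bump \<rho> z)" if \<rho>: "0 < \<rho>" "\<rho> < \<rho>0" for \<rho>
  proof -
   have ar: "norm a + \<rho> + real m * norm h < M" and \<rho>1: "\<rho> \<le> 1" using \<rho> by (auto simp: \<rho>0_def)
   have "moll \<rho> (\<lambda>z. e i z - e N z) a = moll \<rho> (e i) a - moll \<rho> (e N) a"
    unfolding moll_def left_diff_distrib
    by (intro integral_diff eint i0 N(1) \<rho> ar)
   also have "... = fdiff m h (\<lambda>z. flap s (moll \<rho> (w i)) z - flap s (moll \<rho> (w N)) z) a"
    by (simp only: em_eq [OF i0 \<rho>(1) ar] em_eq [OF N(1) \<rho>(1) ar] fdiff_minus)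
   also have "(\<lambda>z. flap s (moll \<rho> (w i)) z - flap s (moll \<rho> (w N)) z) = flap s (moll \<rho> W)"
   proof
    fix z
    have "moll \<rho> W = (\<lambda>y. moll \<rho> (w i) y - moll \<rho> (w N) y)"
    proof
     fix y
     show "moll \<rho> W y = moll \<rho> (w i) y - moll \<rho> (w N) y"
      unfolding moll_def W_def left_diff_distrib
      by (intro integral_diff integrable_mult_bump [OF \<rho>(1) wm Bw])
    qed
    then show "flap s (moll \<rho> (w i)) z - flap s (moll \<rho> (w N)) z = flap s (moll \<rho> W) z"
     using flap_diff [OF sint [OF \<rho>(1) wm [of i] Bw] sint [OF \<rho>(1) wm [of N] Bw]] by simp
   qed
   also have "\<bar>fdiff m h (flap s (moll \<rho> W)) a\<bar> \<le> K * (LBINT (z::'a). bump \<rho> z)"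
    by (rule K(2) [OF Wm Wu WB \<rho>(1) \<rho>1 W0 N(2) a])
   finally show ?thesis .
  qed
  then show ?thesis
   by (intro moll_bound_imp_bound [of "\<lambda>z. e i z - e N z" a \<rho>0 K] continuous_intros econt i0 N(1) \<rho>0) auto
 qed
 have nx: "norm x + r + real m * norm h < M" by (rule M)
 have near: "norm y + real m * norm h < M" if "norm (x - y) < r" for y
 proof -
  have "norm y \<le> norm x + norm (x - y)" using norm_triangle_sub [of y x] by (simp add: norm_minus_commute)
  then show ?thesis using that M by linarith
 qed
 \<comment> \<open>The fixed function e N plus the constant K is the majorant.\<close>
 have lim1: "(\<lambda>i. moll r (e (i + N)) x) \<longlonglongrightarrow> (\<integral>y. 0 \<partial>(lborel :: 'a measure))"
  unfolding moll_def
 proof (rule integral_dominated_convergence)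
  show "integrable lborel (\<lambda>y. \<bar>e N y * bump r (x - y)\<bar> + K * bump r (x - y))"
   by (intro integrable_add integrable_abs integrable_mult_right eint N(1) r nx integrable_bump_shift)
  show "AE y in lborel. (\<lambda>i. e (i + N) y * bump r (x - y)) \<longlonglongrightarrow> 0" (is "AE y in _. ?P y")
  proof (intro AE_I2)
   fix y
   show "?P y"
   proof (cases "norm (x - y) < r")
    case True
    then have "(\<lambda>i. e (i + N) y) \<longlonglongrightarrow> 0"
     unfolding e_def by (intro LIMSEQ_ignore_initial_segment lim near)
    then show ?thesis by (rule tendsto_mult_left_zero)
   qed (simp add: bump_eq_0 r)
  qed
  show "AE y in lborel. norm (e (i + N) y * bump r (x - y)) \<le> \<bar>e N y * bump r (x - y)\<bar> + K * bump r (x - y)" (is "AE y in _. ?P y") for i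
  proof (intro AE_I2)
   fix y
   show "?P y"
   proof (cases "norm (x - y) < r")
    case True
    have "\<bar>e (i + N) y\<bar> \<le> \<bar>e N y\<bar> + K" using osc [of "i + N" y] near [OF True] by simp
    from mult_right_mono [OF this bump_nonneg [of r "x - y"]]
    show ?thesis by (simp add: abs_mult abs_of_nonneg [OF bump_nonneg] distrib_right)
   qed (simp add: bump_eq_0 r)
  qed
 qed measurable
 define A where "A i t = lweight s t * (LBINT y. w i y * defect t (x - y))" for i t
 have mix: "integrable lborel (A i)" "mix_const TYPE('a) s * flap s (fdiff m h (moll r (w i))) x = (LBINT t. A i t)" for i
 proof -
  have wi: "integrable lborel (w i)" unfolding w_def by (rule cutoff_integrable [OF uc])
  show "integrable lborel (A i)" "mix_const TYPE('a) s * flap s (fdiff m h (moll r (w i))) x = (LBINT t. A i t)"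
   unfolding A_def using flap_fdiff_moll_mixture [OF wm Bw wi] by auto
 qed
 have A_eq: "(LBINT t. A i t) = mix_const TYPE('a) s * moll r (e i) x" if "N0 \<le> i" for i
 proof -
  have "flap s (fdiff m h (moll r (w i))) x = fdiff m h (flap s (moll r (w i))) x"
   by (rule flap_fdiff) (rule sint [OF r wm Bw])
  then show ?thesis using mix(2) [of i] em_eq [OF that r nx] by simp
 qed
 have "(\<lambda>i. LBINT t. A (i + N) t) \<longlonglongrightarrow> mix_const TYPE('a) s * 0"
 proof -
  have "(\<lambda>i. mix_const TYPE('a) s * moll r (e (i + N)) x) \<longlonglongrightarrow> mix_const TYPE('a) s * 0"
   using lim1 by (intro tendsto_mult tendsto_const) simp
  moreover have "(LBINT t. A (i + N) t) = mix_const TYPE('a) s * moll r (e (i + N)) x" for i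
   using N(1) by (intro A_eq) simp
  ultimately show ?thesis by simp
 qed
 \<comment> \<open>Since |w i| \<le> |u|, the estimate of the defect gives the majorant
   \<open>lweight s t * min 1 t\<close>, up to a constant, for all i.\<close>
 moreover have "(\<lambda>i. LBINT t. A (i + N) t) \<longlonglongrightarrow> (LBINT t. lweight s t * Dd x t)"
 proof -
  obtain C where C: "C > 0" "\<And>t y. 0 < t ==> \<bar>defect t y\<bar> \<le> C * min 1 t / (1 + norm y) ^ L"
   using obtain_bounds by metis
  have dm [measurable]: "defect t \<in> borel_measurable borel" for t by (rule defect_borel)
  have ud: "integrable lborel (\<lambda>y. u y * defect t (x - y))" if "0 < t" for t
   using C that by (intro integrable_weighted(1) [OF defect_borel C(2)]) auto
  have le: "\<bar>w i y * defect t (x - y)\<bar> \<le> \<bar>u y * defect t (x - y)\<bar>" for i y t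
   unfolding abs_mult by (intro mult_right_mono wle) auto
  have bnd: "\<bar>LBINT y. w i y * defect t (x - y)\<bar> \<le> C * (1 + norm x) ^ L * U * min 1 t" if t: "0 < t" for i t
  proof -
   have "\<bar>LBINT y. w i y * defect t (x - y)\<bar> \<le> (LBINT y. \<bar>w i y * defect t (x - y)\<bar>)" by (rule integral_abs_bound)
   also have "... \<le> (LBINT y. C * min 1 t * (1 + norm x) ^ L * (\<bar>u y\<bar> / (1 + norm y) ^ L))"
   proof (rule integral_mono')
    show "integrable lborel (\<lambda>y. C * min 1 t * (1 + norm x) ^ L * (\<bar>u y\<bar> / (1 + norm y) ^ L))"
     by (intro integrable_mult_right ui')
    show "0 \<le> C * min 1 t * (1 + norm x) ^ L * (\<bar>u y\<bar> / (1 + norm y) ^ L)" for y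
     using C(1) t by simp
    fix y
    have "\<bar>w i y * defect t (x - y)\<bar> \<le> \<bar>u y\<bar> * (C * min 1 t / (1 + norm (x - y)) ^ L)"
     unfolding abs_mult by (intro mult_mono wle C(2) t) auto
    also have "... = C * min 1 t * (\<bar>u y\<bar> / (1 + norm (x - y)) ^ L)" by simp
    also have "... \<le> C * min 1 t * ((1 + norm x) ^ L * (\<bar>u y\<bar> / (1 + norm y) ^ L))"
     using C(1) t by (intro mult_left_mono weight_translate) auto
    finally show "\<bar>w i y * defect t (x - y)\<bar> \<le> C * min 1 t * (1 + norm x) ^ L * (\<bar>u y\<bar> / (1 + norm y) ^ L)"
     by (simp only: mult.assoc)
   qed
   also have "... = C * min 1 t * (1 + norm x) ^ L * U"
    unfolding U_def by (rule integral_mult_right_zero)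
   finally show ?thesis by (simp only: mult_ac)
  qed
  show ?thesis
  proof (rule integral_dominated_convergence)
   show "integrable lborel (\<lambda>t. C * (1 + norm x) ^ L * U * (lweight s t * min 1 t))"
    by (intro integrable_mult_right integrable_lweight s)
   show "A (i + N) \<in> borel_measurable lborel" for i using mix(1) [of "i + N"] by (rule borel_measurable_integrable)
   show "AE t in lborel. norm (A (i + N) t) \<le> C * (1 + norm x) ^ L * U * (lweight s t * min 1 t)" (is "AE t in _. ?P t") for i
   proof (intro AE_I2)
    fix t
    show "?P t"
    proof (cases "0 < t")
     case True
     from mult_left_mono [OF bnd [OF True, of "i + N"] lweight_nonneg [of s t]]
     show ?thesis by (simp add: A_def abs_mult abs_of_nonneg [OF lweight_nonneg] mult_ac)
    qed (simp add: A_def lweight_def)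
   qed
   show "AE t in lborel. (\<lambda>i. A (i + N) t) \<longlonglongrightarrow> lweight s t * Dd x t" (is "AE t in _. ?P t")
   proof (intro AE_I2)
    fix t
    show "?P t"
    proof (cases "0 < t")
     case True
     have "(\<lambda>i. LBINT y. w (i + N) y * defect t (x - y)) \<longlonglongrightarrow> Dd x t"
      unfolding Dd_def
     proof (rule integral_dominated_convergence)
      show "integrable lborel (\<lambda>y. \<bar>u y * defect t (x - y)\<bar>)" by (intro integrable_abs ud True)
      show "AE y in lborel. norm (w (i + N) y * defect t (x - y)) \<le> \<bar>u y * defect t (x - y)\<bar>" for i
       using le by simp
      show "AE y in lborel. (\<lambda>i. w (i + N) y * defect t (x - y)) \<longlonglongrightarrow> u y * defect t (x - y)"
      proof (intro AE_I2 tendsto_mult tendsto_const tendsto_eventually)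
       fix y :: 'a
       have "\<forall>\<^sub>F i in sequentially. nat \<lceil>norm y + 1\<rceil> \<le> i" by (rule eventually_ge_at_top)
       then show "\<forall>\<^sub>F i in sequentially. w (i + N) y = u y"
       proof eventually_elim
        case (elim i)
        then have "norm y < real (i + N)" by linarith
        then show ?case by (simp add: w_def)
       qed
      qed
     qed measurable
     then show ?thesis unfolding A_def by (intro tendsto_mult tendsto_const)
    qed (simp add: A_def lweight_def)
   qed
   show "(\<lambda>t. lweight s t * Dd x t) \<in> borel_measurable lborel" by measurable
  qed
 qed
 ultimately show ?thesis using LIMSEQ_unique by fastforce
qed

end

text \<open>For each radius r the Liouville property makes the m-th difference of the mollified u
  vanish. The difference commutes with mollification, so r can be sent to 0, and Frechet's theorem
  concludes.\<close>

theorem frac_laplacian_eq_mod_imp_polynomial: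
 fixes u :: "real ^ 'n => real"
 assumes s: "0 < s" "s < 1" and u: "continuous_on UNIV u"
  and ui: "integrable lborel (\<lambda>y. \<bar>u y\<bar> / (1 + norm y powr (real CARD('n) + 2 * s + real k)))"
  and eq: "frac_laplacian_eq_mod s k u (\<lambda>_. 0)"
  and m: "2 * s + real k \<le> real m"
 shows "polynomial_deg_le (int m - 1) u"
proof (rule frechet_polynomial [OF u])
 fix x0 h :: "real ^ 'n"
 have um [measurable]: "u \<in> borel_measurable borel" using u by (rule borel_measurable_continuous_onI)
 have km: "k \<le> m" using m s by linarith
 have wi: "integrable lborel (\<lambda>y. \<bar>u y\<bar> / (1 + norm y) ^ (DIM(real ^ 'n) + m))"
 proof (rule integrable_bound [OF integrable_mult_right [OF ui, of 2]])
  show "AE y in lborel. norm (\<bar>u y\<bar> / (1 + norm y) ^ (DIM(real ^ 'n) + m)) \<le>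
    norm (2 * (\<bar>u y\<bar> / (1 + norm y powr (real CARD('n) + 2 * s + real k))))" (is "AE y in _. ?P y")
  proof (intro AE_I2)
   fix y :: "real ^ 'n"
   have "1 / (1 + norm y) ^ (DIM(real ^ 'n) + m) \<le> 2 / (1 + norm y powr (real CARD('n) + 2 * s + real k))"
    using m s by (intro inverse_weight_le) (auto simp: add_pos_nonneg)
   from mult_left_mono [OF this abs_ge_zero [of "u y"]]
   show "?P y"
    by (simp add: abs_of_nonneg add_nonneg_nonneg mult.commute)
  qed
 qed measurable
 have uB: "\<exists>B. \<forall>y. norm y \<le> R \<longrightarrow> \<bar>u y\<bar> \<le> B" for R
  using bounded_on_cball [OF continuous_on_subset [OF u], of "R + 1" R] by auto
 have "moll r (fdiff m h u) x0 = 0" if r: "0 < r" for r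
 proof -
  interpret heat_average s r m h u
   by unfold_locales (use s r um wi in auto)
  have "(LBINT t. lweight s t * Dd x t) = 0" for x
  proof -
   \<comment> \<open>The Liouville property needs the limit equation at every x, so the ball has to
     grow with x; this uses the equation in all balls.\<close>
   define M where "M = norm x + r + real m * norm h + 1"
   have M: "norm x + r + real m * norm h < M" by (simp add: M_def)
   have "0 < M" using r unfolding M_def by (intro add_nonneg_pos add_nonneg_nonneg) auto
   then have "frac_laplacian_eq_mod_on s k M u (\<lambda>_. 0)" using eq by (simp add: frac_laplacian_eq_mod_def)
   then obtain g N0 where g: "\<And>i. g i \<in> borel_measurable borel" "\<And>i. N0 \<le> i ==> continuous_on (ball 0 M) (g i)"
    "\<And>i \<rho> z. N0 \<le> i ==> 0 < \<rho> ==> norm z + \<rho> < M ==>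
      flap s (moll \<rho> (\<lambda>y. indicator (ball 0 (real i)) y * u y)) z = moll \<rho> (g i) z"
    "\<And>z h. norm z + real m * norm h < M ==> (\<lambda>i. fdiff m h (g i) z) \<longlonglongrightarrow> 0"
    using cutoff_data [OF s u _ km] by blast
   show ?thesis by (rule cutoff_limit [OF u M g(1) g(2) g(3) g(4)])
  qed
  then have "(LBINT y. u y * \<sigma> (x0 - y)) = 0" by (rule liouville)
  moreover have ub: "integrable lborel (\<lambda>y. u y * bump r (x0 + real j *\<^sub>R h - y))" for j
  proof -
   obtain B where B: "\<And>y. norm y \<le> norm (x0 + real j *\<^sub>R h) + r ==> \<bar>u y\<bar> \<le> B" using uB by blast
   show ?thesis
   proof (rule integrable_mult_bump [OF r um])
    fix y assume "norm (x0 + real j *\<^sub>R h - y) < r"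
    moreover have "norm y \<le> norm (x0 + real j *\<^sub>R h) + norm (x0 + real j *\<^sub>R h - y)"
     using norm_triangle_sub [of y "x0 + real j *\<^sub>R h"] by (simp add: norm_minus_commute)
    ultimately show "\<bar>u y\<bar> \<le> B" by (intro B) linarith
   qed
  qed
  ultimately show ?thesis
   using fdiff_moll [OF ub, of m] unfolding \<sigma>_def by simp
 qed
 moreover have "isCont (fdiff m h u) x0"
 proof -
  have "continuous_on UNIV (fdiff m h u)"
   unfolding fdiff_def [abs_def]
   by (intro continuous_on_sum continuous_on_mult continuous_on_const continuous_on_compose2 [OF u] continuous_intros) auto
  then show ?thesis by (simp add: continuous_on_eq_continuous_at)
 qed
 ultimately have "\<bar>fdiff m h u x0\<bar> \<le> 0"
  using moll_bound_imp_bound [of "fdiff m h u" x0 1 0] by simp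
 then show "fdiff m h u x0 = 0" by simp
qed

section \<open>Polynomials are solutions\<close>

lemma frac_pos_part_uminus: "frac_pos_part s (\<lambda>y. - v y) x e = frac_neg_part s v x e"
 unfolding frac_pos_part_def frac_neg_part_def
 by (simp add: minus_divide_left)

lemma frac_neg_part_uminus: "frac_neg_part s (\<lambda>y. - v y) x e = frac_pos_part s v x e"
 unfolding frac_pos_part_def frac_neg_part_def
 by (simp add: minus_divide_left)

text \<open>A difference of extended reals changes sign with its terms unless it is of the form
  \<infinity> - \<infinity>, which the first conjunct of the definition excludes.\<close>

lemma has_frac_laplacian_uminus:
 assumes "has_frac_laplacian s v x L"
 shows "has_frac_laplacian s (\<lambda>y. - v y) x (- L)"
proof -
 have fin: "frac_pos_part s v x e < \<infinity> \<or> frac_neg_part s v x e < \<infinity>" if "e > 0" for e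
  using assms that by (simp add: has_frac_laplacian_def)
 have lim: "((\<lambda>e. enn2ereal (frac_pos_part s v x e) - enn2ereal (frac_neg_part s v x e)) \<longlongrightarrow> L) (at_right 0)"
  using assms by (simp add: has_frac_laplacian_def)
 have "((\<lambda>e. enn2ereal (frac_neg_part s v x e) - enn2ereal (frac_pos_part s v x e)) \<longlongrightarrow> - L) (at_right 0)"
 proof (rule Lim_transform_eventually [OF tendsto_uminus_ereal [OF lim]])
  have "\<forall>\<^sub>F e in at_right 0. (0::real) < e" by (rule eventually_at_right_less)
  then show "\<forall>\<^sub>F e in at_right 0. - (enn2ereal (frac_pos_part s v x e) - enn2ereal (frac_neg_part s v x e)) =
    enn2ereal (frac_neg_part s v x e) - enn2ereal (frac_pos_part s v x e)"
  proof eventually_elim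
   case (elim e)
   have "enn2ereal a \<noteq> \<infinity>" if "a < \<infinity>" for a :: ennreal
    using that by (cases a rule: ennreal_cases) (auto simp: enn2ereal_ennreal)
   then have "enn2ereal (frac_pos_part s v x e) \<noteq> \<infinity> \<or> enn2ereal (frac_neg_part s v x e) \<noteq> \<infinity>"
    using fin [OF elim] by blast
   moreover have "enn2ereal (frac_pos_part s v x e) \<noteq> - \<infinity>" "enn2ereal (frac_neg_part s v x e) \<noteq> - \<infinity>"
    using enn2ereal_nonneg [of "frac_pos_part s v x e"] enn2ereal_nonneg [of "frac_neg_part s v x e"] by auto
   ultimately show ?case by (intro ereal_minus_diff_eq) auto
  qed
 qed
 then show ?thesis
  using fin unfolding has_frac_laplacian_def frac_pos_part_uminus frac_neg_part_uminus by blast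
qed

text \<open>Differentiability of the derivative D1 at x bounds its variation near x by (norm (D2 x)
  + 1) |y - x|. The mean value inequality turns this into a first-order Taylor estimate, and the
  linear terms cancel between h and - h.\<close>

lemma C2_on_second_difference:
 fixes \<phi> :: "real ^ 'n => real"
 assumes C2: "C2_on N \<phi>" and N: "open N" "x \<in> N"
 obtains \<delta> C where "0 < \<delta>" "ball x \<delta> \<subseteq> N" "0 \<le> C" "\<And>h. norm h < \<delta> ==> \<bar>sdiff \<phi> x h\<bar> \<le> C * (norm h)^2"
proof -
 obtain D1 :: "real ^ 'n => (real ^ 'n) \<Rightarrow>\<^sub>L real" and D2 :: "real ^ 'n => (real ^ 'n) \<Rightarrow>\<^sub>L ((real ^ 'n) \<Rightarrow>\<^sub>L real)"
  where D1: "\<And>y. y \<in> N ==> (\<phi> has_derivative blinfun_apply (D1 y)) (at y)"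
   and D2: "\<And>y. y \<in> N ==> (D1 has_derivative blinfun_apply (D2 y)) (at y)"
  using C2 unfolding C2_on_def by blast
 obtain \<delta>1 where \<delta>1: "0 < \<delta>1" "ball x \<delta>1 \<subseteq> N" using N open_contains_ball by blast
 obtain \<delta>2 where \<delta>2: "0 < \<delta>2"
  "\<And>y. norm (y - x) < \<delta>2 ==> norm (D1 y - D1 x - blinfun_apply (D2 x) (y - x)) \<le> 1 * norm (y - x)"
  using D2 [OF N(2)] unfolding has_derivative_at_alt by (metis zero_less_one)
 define \<delta> where "\<delta> = min \<delta>1 \<delta>2"
 define C where "C = norm (D2 x) + 1"
 have \<delta>: "0 < \<delta>" "ball x \<delta> \<subseteq> N" using \<delta>1 \<delta>2(1) by (auto simp: \<delta>_def)
 have lip: "norm (D1 y - D1 x) \<le> C * norm (y - x)" if "norm (y - x) < \<delta>" for y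
 proof -
  have "norm (D1 y - D1 x) \<le> norm (D1 y - D1 x - blinfun_apply (D2 x) (y - x)) + norm (blinfun_apply (D2 x) (y - x))"
   using norm_triangle_sub [of "D1 y - D1 x" "blinfun_apply (D2 x) (y - x)"] by simp
  also have "... \<le> norm (y - x) + norm (D2 x) * norm (y - x)"
   using \<delta>2(2) [of y] that norm_blinfun [of "D2 x" "y - x"] by (auto simp: \<delta>_def intro!: add_mono)
  finally show ?thesis by (simp add: C_def algebra_simps)
 qed
 have taylor: "\<bar>\<phi> (x + h) - \<phi> x - blinfun_apply (D1 x) h\<bar> \<le> C * (norm h)^2" if h: "norm h < \<delta>" for h
 proof -
  have sub: "cball x (norm h) \<subseteq> ball x \<delta>" using h by auto
  have "norm (\<phi> (x + h) - \<phi> x - blinfun_apply (D1 x) (x + h - x)) \<le> norm (x + h - x) * (C * norm h)"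
  proof (rule differentiable_bound_linearization [where ?x0.0 = x and S = "cball x (norm h)" and f' = "\<lambda>y. blinfun_apply (D1 y)"])
   fix t :: real assume "t \<in> {0..1}"
   then show "x + t *\<^sub>R (x + h - x) \<in> cball x (norm h)"
    by (auto simp: dist_norm abs_of_nonneg mult_left_le_one_le)
  next
   fix y assume y: "y \<in> cball x (norm h)"
   then have "y \<in> N" using sub \<delta>(2) by blast
   then show "(\<phi> has_derivative blinfun_apply (D1 y)) (at y within cball x (norm h))"
    using D1 has_derivative_at_withinI by blast
  next
   fix y assume y: "y \<in> cball x (norm h)"
   then have ny: "norm (y - x) \<le> norm h" by (simp add: dist_norm norm_minus_commute)
   have "onorm (blinfun_apply (D1 y) - blinfun_apply (D1 x)) = norm (D1 y - D1 x)"
    by (simp add: norm_blinfun.rep_eq minus_blinfun.rep_eq fun_diff_def)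
   also have "... \<le> C * norm (y - x)" using ny h by (intro lip) simp
   also have "... \<le> C * norm h" using ny by (intro mult_left_mono) (auto simp: C_def)
   finally show "onorm (blinfun_apply (D1 y) - blinfun_apply (D1 x)) \<le> C * norm h" .
  qed simp
  then show ?thesis by (simp add: power2_eq_square mult_ac)
 qed
 show thesis
 proof (rule that [OF \<delta>, of "2 * C"])
  fix h :: "real ^ 'n" assume h: "norm h < \<delta>"
  have "\<bar>\<phi> (x - h) - \<phi> x + blinfun_apply (D1 x) h\<bar> \<le> C * (norm h)^2"
   using taylor [of "- h"] h by (simp add: blinfun.minus_right)
  then show "\<bar>sdiff \<phi> x h\<bar> \<le> 2 * C * (norm h)^2"
   using taylor [OF h] unfolding sdiff_def by linarith
 qed (simp add: C_def)
qed

text \<open>A test function may fail to be integrable near the boundary of its neighbourhood; its fractional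
 Laplacian is then \<open>-\<infinity>\<close>, and the inequality still holds.\<close>

lemma touching_above_has_frac_laplacian:
 fixes w :: "real ^ 'n => real"
 assumes s: "0 < s" "s < 1" and [measurable]: "w \<in> borel_measurable borel" and B: "\<And>y. \<bar>w y\<bar> \<le> B"
  and S: "integrable lborel (\<lambda>h. sdiff w x h * rker s h)"
  and N: "open N" "x \<in> N" and C2: "C2_on N \<phi>" and eq: "\<phi> x = w x" and le: "\<And>y. y \<in> N ==> w y \<le> \<phi> y"
 shows "\<exists>L. has_frac_laplacian s (\<lambda>y. if y \<in> N then \<phi> y else w y) x L \<and> L \<le> ereal (flap s w x)"
proof -
 define v where "v y = (if y \<in> N then \<phi> y else w y)" for y
 have vx: "v x = w x" using N eq by (simp add: v_def)
 have vw: "w y \<le> v y" for y using le by (simp add: v_def)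
 have "continuous_on N \<phi>"
  using C2 unfolding C2_on_def by (metis N(1) continuous_on_eq_continuous_at has_derivative_continuous)
 then have "(\<lambda>y. indicator N y *\<^sub>R \<phi> y) \<in> borel_measurable borel"
  using N(1) by (intro borel_measurable_continuous_on_indicator) auto
 moreover have [measurable]: "N \<in> sets borel" using N(1) by simp
 ultimately have "(\<lambda>y. indicator N y *\<^sub>R \<phi> y + indicator (- N) y *\<^sub>R w y) \<in> borel_measurable borel" by measurable
 moreover have "v = (\<lambda>y. indicator N y *\<^sub>R \<phi> y + indicator (- N) y *\<^sub>R w y)" by (auto simp: v_def fun_eq_iff)
 ultimately have vm [measurable]: "v \<in> borel_measurable borel" by simp
 obtain \<delta> C where C: "0 < \<delta>" "ball x \<delta> \<subseteq> N" "0 \<le> C" "\<And>h. norm h < \<delta> ==> \<bar>sdiff \<phi> x h\<bar> \<le> C * (norm h)^2"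
  by (rule C2_on_second_difference [OF C2 N]) (rule that)
 define I where "I e h = indicator (- ball 0 e) h * ((v x - v (x + h)) * rker s h)" for e and h :: "real ^ 'n"
 have bm [measurable]: "ball (0::real^'n) e \<in> sets borel" for e by simp
 have Im [measurable]: "I e \<in> borel_measurable borel" for e unfolding I_def [abs_def] by measurable
 \<comment> \<open>Since v lies above w and agrees with it at x, v x - v (x + h) is at most 2 B,
   although v itself may be unbounded. Only the negative part can be infinite.\<close>
 have pos: "(\<integral>\<^sup>+h. ennreal (I e h) \<partial>lborel) < \<infinity>" if e: "0 < e" for e
 proof -
  have "integrable lborel (\<lambda>h::real^'n. indicator (- ball 0 e) h * (2 * B * rker s h))"
   by (rule integrable_off_ball [OF s e, where B = "\<bar>2 * B\<bar>"]) auto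
  then have "(\<integral>\<^sup>+h. ennreal (norm (indicator (- ball (0::real^'n) e) h * (2 * B * rker s h))) \<partial>lborel) < \<infinity>"
   by (simp add: integrable_iff_bounded)
  moreover have "(\<integral>\<^sup>+h. ennreal (I e h) \<partial>lborel) \<le> (\<integral>\<^sup>+h. ennreal (norm (indicator (- ball (0::real^'n) e) h * (2 * B * rker s h))) \<partial>lborel)"
  proof (intro nn_integral_mono ennreal_leI)
   fix h :: "real ^ 'n"
   have "v x - v (x + h) \<le> 2 * B" using vx vw [of "x + h"] B [of x] B [of "x + h"] by linarith
   then have "I e h \<le> indicator (- ball 0 e) h * (2 * B * rker s h)"
    unfolding I_def by (intro mult_left_mono mult_right_mono rker_nonneg) auto
   then show "I e h \<le> norm (indicator (- ball 0 e) h * (2 * B * rker s h))" by simp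
  qed
  ultimately show ?thesis by (rule le_less_trans [rotated])
 qed
 have parts: "frac_pos_part s v x e = (\<integral>\<^sup>+h. ennreal (I e h) \<partial>lborel)"
  "frac_neg_part s v x e = (\<integral>\<^sup>+h. ennreal (- I e h) \<partial>lborel)" for e
  unfolding I_def by (rule frac_pos_part_eq [OF vm] frac_neg_part_eq [OF vm])+
 show ?thesis
 proof (cases "\<forall>e>0. integrable lborel (I e)")
  case True
  then have Ii: "integrable lborel (I e)" if "0 < e" for e using that by blast
  have Sv: "integrable lborel (\<lambda>h. sdiff v x h * rker s h)"
  proof (rule integrable_bound)
   have "integrable lborel (\<lambda>h. I \<delta> (0 - h))" using Ii [OF C(1)] by (simp only: integrable_lborel_reflect_iff)
   then show "integrable lborel (\<lambda>h::real^'n. C * (indicator (ball 0 \<delta>) h * ((norm h)^2 * rker s h)) + (\<bar>I \<delta> h\<bar> + \<bar>I \<delta> (0 - h)\<bar>))"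
    by (intro integrable_add integrable_mult_right integrable_ball_moment s integrable_abs Ii C(1))
   show "AE h in lborel. norm (sdiff v x h * rker s h) \<le>
     norm (C * (indicator (ball 0 \<delta>) h * ((norm h)^2 * rker s h)) + (\<bar>I \<delta> h\<bar> + \<bar>I \<delta> (0 - h)\<bar>))" (is "AE h in _. ?P h")
   proof (intro AE_I2)
    fix h :: "real ^ 'n"
    show "?P h"
    proof (cases "norm h < \<delta>")
     case True
     then have "x + h \<in> N" "x - h \<in> N" using C(2) by (auto simp: dist_norm)
     then have "sdiff v x h = sdiff \<phi> x h" using N(2) by (simp add: sdiff_def v_def)
     then have "\<bar>sdiff v x h\<bar> * rker s h \<le> C * (norm h)^2 * rker s h"
      using C(4) [OF True] by (intro mult_right_mono rker_nonneg) simp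
     then show ?thesis using True C(3) by (simp add: I_def abs_mult abs_of_nonneg [OF rker_nonneg] mult.assoc)
    next
     case False
     have "sdiff v x h * rker s h = I \<delta> h + I \<delta> (0 - h)"
      using False by (simp add: I_def sdiff_def rker_minus algebra_simps)
     then show ?thesis using False by simp
    qed
   qed
  qed measurable
  have "has_frac_laplacian s v x (ereal (flap s v x))"
   by (rule has_frac_laplacian_flap [OF vm _ Sv]) (use Ii in \<open>simp add: I_def [abs_def]\<close>)
  moreover have "flap s v x \<le> flap s w x"
  proof -
   have "(LBINT h. sdiff v x h * rker s h) \<le> (LBINT h. sdiff w x h * rker s h)"
   proof (rule integral_mono [OF Sv S])
    fix h
    have "sdiff v x h \<le> sdiff w x h" using vx vw [of "x + h"] vw [of "x - h"] unfolding sdiff_def by linarith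
    then show "sdiff v x h * rker s h \<le> sdiff w x h * rker s h" by (intro mult_right_mono rker_nonneg)
   qed
   then show ?thesis by (simp add: flap_def)
  qed
  ultimately show ?thesis unfolding v_def by auto
 next
  case False
  then obtain e0 where e0: "0 < e0" "\<not> integrable lborel (I e0)" by blast
  \<comment> \<open>The positive part is finite, so failure of integrability at e0 means an infinite
    negative part, and a smaller hole can only enlarge it.\<close>
  have neg: "(\<integral>\<^sup>+h. ennreal (- I e h) \<partial>lborel) = \<infinity>" if e: "0 < e" "e \<le> e0" for e
  proof -
   have "(\<integral>\<^sup>+h. ennreal (- I e0 h) \<partial>lborel) = \<infinity>"
    using e0 pos [OF e0(1)] by (auto simp: real_integrable_def)
   moreover have "(\<integral>\<^sup>+h. ennreal (- I e0 h) \<partial>lborel) \<le> (\<integral>\<^sup>+h. ennreal (- I e h) \<partial>lborel)"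
   proof (rule nn_integral_mono)
    fix h :: "real ^ 'n"
    show "ennreal (- I e0 h) \<le> ennreal (- I e h)"
     using e(2) by (cases "norm h < e0") (auto simp: I_def)
   qed
   ultimately show ?thesis by (simp add: top.extremum_unique)
  qed
  have "((\<lambda>e. enn2ereal (frac_pos_part s v x e) - enn2ereal (frac_neg_part s v x e)) \<longlongrightarrow> - \<infinity>) (at_right 0)"
  proof (rule tendsto_eventually)
   have "\<forall>\<^sub>F e in at_right 0. e \<in> {0<..<e0}" using e0(1) by (rule eventually_at_right_real)
   then show "\<forall>\<^sub>F e in at_right 0. enn2ereal (frac_pos_part s v x e) - enn2ereal (frac_neg_part s v x e) = - \<infinity>"
   proof eventually_elim
    case (elim e)
    have "frac_neg_part s v x e = \<infinity>" using neg [of e] elim parts by simp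
    moreover obtain p where "0 \<le> p" "frac_pos_part s v x e = ennreal p"
     using pos [of e] elim parts by (cases "frac_pos_part s v x e" rule: ennreal_cases) auto
    ultimately show ?case by (simp add: enn2ereal_ennreal)
   qed
  qed
  then have "has_frac_laplacian s v x (- \<infinity>)"
   using pos parts by (simp add: has_frac_laplacian_def)
  then show ?thesis unfolding v_def by (intro exI [of _ "- \<infinity>"]) simp
 qed
qed

lemma C2_on_uminus:
 fixes \<phi> :: "real ^ 'n => real"
 assumes "C2_on N \<phi>"
 shows "C2_on N (\<lambda>y. - \<phi> y)"
proof -
 obtain D1 :: "real ^ 'n => (real ^ 'n) \<Rightarrow>\<^sub>L real" and D2 :: "real ^ 'n => (real ^ 'n) \<Rightarrow>\<^sub>L ((real ^ 'n) \<Rightarrow>\<^sub>L real)"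
  where D: "\<And>y. y \<in> N ==> (\<phi> has_derivative blinfun_apply (D1 y)) (at y)"
   "\<And>y. y \<in> N ==> (D1 has_derivative blinfun_apply (D2 y)) (at y)" "continuous_on N D2"
  using assms unfolding C2_on_def by blast
 have "\<forall>y\<in>N. ((\<lambda>y. - \<phi> y) has_derivative blinfun_apply (- D1 y)) (at y)"
  using D(1) by (auto simp: uminus_blinfun.rep_eq intro!: has_derivative_minus)
 moreover have "\<forall>y\<in>N. ((\<lambda>y. - D1 y) has_derivative blinfun_apply (- D2 y)) (at y)"
  using D(2) by (auto simp: uminus_blinfun.rep_eq intro!: has_derivative_minus)
 moreover have "continuous_on N (\<lambda>y. - D2 y)" by (intro continuous_intros D(3))
 ultimately show ?thesis
  unfolding C2_on_def by (intro exI [of _ "\<lambda>y. - D1 y"] exI [of _ "\<lambda>y. - D2 y"] conjI)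
qed

lemma classical_imp_visc:
 fixes w :: "real ^ 'n => real"
 assumes s: "0 < s" "s < 1" and wm: "w \<in> borel_measurable borel" and B: "\<And>y. \<bar>w y\<bar> \<le> B"
  and \<Omega>: "open \<Omega>" "continuous_on \<Omega> w" "continuous_on \<Omega> (flap s w)" and wi: "weighted_integrable (2 * s) w"
  and S: "\<And>x. x \<in> \<Omega> ==> integrable lborel (\<lambda>h. sdiff w x h * rker s h)"
 shows "visc_frac_laplacian_eq s \<Omega> w (flap s w)"
 unfolding visc_frac_laplacian_eq_def
proof (intro conjI ballI allI impI \<Omega> wi)
 fix x N \<phi>
 assume x: "x \<in> \<Omega>" and *: "open N \<and> x \<in> N \<and> N \<subseteq> \<Omega> \<and> C2_on N \<phi> \<and> \<phi> x = w x"
 show "\<exists>L. has_frac_laplacian s (\<lambda>y. if y \<in> N then \<phi> y else w y) x L \<and> L \<le> ereal (flap s w x)" if "\<forall>y\<in>N. w y \<le> \<phi> y"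
  by (rule touching_above_has_frac_laplacian [OF s wm B S [OF x]]) (use * that in auto)
 show "\<exists>L. has_frac_laplacian s (\<lambda>y. if y \<in> N then \<phi> y else w y) x L \<and> ereal (flap s w x) \<le> L" if le: "\<forall>y\<in>N. \<phi> y \<le> w y"
 proof -
  have "(\<lambda>y. - w y) \<in> borel_measurable borel" using wm by simp
  moreover have "sdiff (\<lambda>y. - w y) x h * rker s h = - (sdiff w x h * rker s h)" for h
   by (simp add: sdiff_def algebra_simps)
  then have "integrable lborel (\<lambda>h. sdiff (\<lambda>y. - w y) x h * rker s h)" using S [OF x] by simp
  ultimately obtain L where L: "has_frac_laplacian s (\<lambda>y. if y \<in> N then - \<phi> y else - w y) x L" "L \<le> ereal (flap s (\<lambda>y. - w y) x)"
   using touching_above_has_frac_laplacian [OF s, of "\<lambda>y. - w y" B x N "\<lambda>y. - \<phi> y"] * le B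
   by (auto simp: C2_on_uminus)
  have "(\<lambda>y. - (if y \<in> N then - \<phi> y else - w y)) = (\<lambda>y. if y \<in> N then \<phi> y else w y)" by auto
  then have "has_frac_laplacian s (\<lambda>y. if y \<in> N then \<phi> y else w y) x (- L)"
   using has_frac_laplacian_uminus [OF L(1)] by simp
  moreover have "ereal (flap s w x) \<le> - L"
   using L(2) unfolding flap_uminus by (metis ereal_minus_le_minus ereal_uminus_uminus uminus_ereal.simps(1))
  ultimately show ?thesis by blast
 qed
qed

section \<open>Cut-off polynomials\<close>

text \<open>Bounded second derivatives on bounded sets, expressed by first and second differences.
  The first differences are included because the Leibniz rule for second differences needs them; the
  class is then an algebra containing the coordinates, hence all polynomials.\<close>

definition locally_C11 :: "('a::real_normed_vector => real) => bool" where
 "locally_C11 p \<longleftrightarrow> (\<forall>\<rho>. \<exists>C\<ge>0. \<forall>x h. norm x \<le> \<rho> \<longrightarrow> norm h \<le> \<rho> \<longrightarrow>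
   \<bar>p x\<bar> \<le> C \<and> \<bar>p (x + h) - p x\<bar> \<le> C * norm h \<and> \<bar>sdiff p x h\<bar> \<le> C * (norm h)^2)"

lemma locally_C11_const: "locally_C11 (\<lambda>_. c)"
 unfolding locally_C11_def by (intro allI exI [of _ "\<bar>c\<bar>"]) (auto simp: sdiff_def)

lemma locally_C11_coord: "locally_C11 (\<lambda>x :: real ^ 'n. x $ i)"
 unfolding locally_C11_def
proof
 fix \<rho> :: real
 have "\<bar>x $ i\<bar> \<le> max 1 \<rho> \<and> \<bar>(x + h) $ i - x $ i\<bar> \<le> max 1 \<rho> * norm h \<and> \<bar>sdiff (\<lambda>x. x $ i) x h\<bar> \<le> max 1 \<rho> * (norm h)^2"
  if "norm x \<le> \<rho>" for x h :: "real ^ 'n"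
 proof -
  have "\<bar>h $ i\<bar> \<le> max 1 \<rho> * norm h"
   using component_le_norm_cart [of h i] mult_right_mono [of 1 "max 1 \<rho>" "norm h"] by simp
  then show ?thesis using component_le_norm_cart [of x i] that by (simp add: sdiff_def)
 qed
 then show "\<exists>C\<ge>0. \<forall>x h. norm x \<le> \<rho> \<longrightarrow> norm h \<le> \<rho> \<longrightarrow>
   \<bar>(x :: real ^ 'n) $ i\<bar> \<le> C \<and> \<bar>(x + h) $ i - x $ i\<bar> \<le> C * norm h \<and> \<bar>sdiff (\<lambda>x. x $ i) x h\<bar> \<le> C * (norm h)^2"
  by (intro exI [of _ "max 1 \<rho>"]) auto
qed

lemma locally_C11_add:
 assumes "locally_C11 p" "locally_C11 q"
 shows "locally_C11 (\<lambda>x. p x + q x)"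
 unfolding locally_C11_def
proof
 fix \<rho>
 obtain C where C: "C \<ge> 0" "\<And>x h. norm x \<le> \<rho> ==> norm h \<le> \<rho> ==>
   \<bar>p x\<bar> \<le> C \<and> \<bar>p (x + h) - p x\<bar> \<le> C * norm h \<and> \<bar>sdiff p x h\<bar> \<le> C * (norm h)^2"
  using assms(1) unfolding locally_C11_def by blast
 obtain D where D: "D \<ge> 0" "\<And>x h. norm x \<le> \<rho> ==> norm h \<le> \<rho> ==>
   \<bar>q x\<bar> \<le> D \<and> \<bar>q (x + h) - q x\<bar> \<le> D * norm h \<and> \<bar>sdiff q x h\<bar> \<le> D * (norm h)^2"
  using assms(2) unfolding locally_C11_def by blast
 show "\<exists>C\<ge>0. \<forall>x h. norm x \<le> \<rho> \<longrightarrow> norm h \<le> \<rho> \<longrightarrow>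
   \<bar>p x + q x\<bar> \<le> C \<and> \<bar>p (x + h) + q (x + h) - (p x + q x)\<bar> \<le> C * norm h \<and> \<bar>sdiff (\<lambda>x. p x + q x) x h\<bar> \<le> C * (norm h)^2"
 proof (intro exI [of _ "C + D"] conjI allI impI)
  fix x h :: 'a assume xh: "norm x \<le> \<rho>" "norm h \<le> \<rho>"
  have "sdiff (\<lambda>x. p x + q x) x h = sdiff p x h + sdiff q x h" by (simp add: sdiff_def)
  then show "\<bar>sdiff (\<lambda>x. p x + q x) x h\<bar> \<le> (C + D) * (norm h)^2"
   using C(2) [OF xh] D(2) [OF xh] unfolding distrib_right by linarith
  show "\<bar>p (x + h) + q (x + h) - (p x + q x)\<bar> \<le> (C + D) * norm h"
   using C(2) [OF xh] D(2) [OF xh] unfolding distrib_right by linarith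
  show "\<bar>p x + q x\<bar> \<le> C + D" using C(2) [OF xh] D(2) [OF xh] by linarith
 qed (use C(1) D(1) in auto)
qed

lemma locally_C11_mult:
 assumes "locally_C11 p" "locally_C11 q"
 shows "locally_C11 (\<lambda>x. p x * q x)"
 unfolding locally_C11_def
proof
 fix \<rho>
 obtain C where C: "C \<ge> 0" "\<And>x h. norm x \<le> \<rho> ==> norm h \<le> \<rho> ==>
   \<bar>p x\<bar> \<le> C \<and> \<bar>p (x + h) - p x\<bar> \<le> C * norm h \<and> \<bar>sdiff p x h\<bar> \<le> C * (norm h)^2"
  using assms(1) unfolding locally_C11_def by blast
 obtain D where D: "D \<ge> 0" "\<And>x h. norm x \<le> \<rho> ==> norm h \<le> \<rho> ==>
   \<bar>q x\<bar> \<le> D \<and> \<bar>q (x + h) - q x\<bar> \<le> D * norm h \<and> \<bar>sdiff q x h\<bar> \<le> D * (norm h)^2"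
  using assms(2) unfolding locally_C11_def by blast
 have CD: "0 \<le> C * D" using C(1) D(1) by simp
 show "\<exists>C\<ge>0. \<forall>x h. norm x \<le> \<rho> \<longrightarrow> norm h \<le> \<rho> \<longrightarrow>
   \<bar>p x * q x\<bar> \<le> C \<and> \<bar>p (x + h) * q (x + h) - p x * q x\<bar> \<le> C * norm h \<and> \<bar>sdiff (\<lambda>x. p x * q x) x h\<bar> \<le> C * (norm h)^2"
 \<comment> \<open>The second difference of a product has four terms, each at most C D |h|^2. In the
   first difference the quadratic term a b has a surplus factor |h|, which is at most
   |\<rho>|.\<close>
 proof (intro exI [of _ "(4 + \<bar>\<rho>\<bar>) * (C * D)"] conjI allI impI)
  fix x h :: 'a assume xh: "norm x \<le> \<rho>" "norm h \<le> \<rho>"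
  have xh': "norm (- h) \<le> \<rho>" using xh by simp
  define a where "a = p (x + h) - p x"
  define a' where "a' = p (x - h) - p x"
  define b where "b = q (x + h) - q x"
  define b' where "b' = q (x - h) - q x"
  note P = C(2) [OF xh] note Q = D(2) [OF xh]
  have bnd: "\<bar>a\<bar> \<le> C * norm h" "\<bar>a'\<bar> \<le> C * norm h" "\<bar>b\<bar> \<le> D * norm h" "\<bar>b'\<bar> \<le> D * norm h"
   using P Q C(2) [OF xh(1) xh'] D(2) [OF xh(1) xh'] by (auto simp: a_def a'_def b_def b'_def)
  have m1: "\<bar>p x * q x\<bar> \<le> C * D" using P Q C(1) unfolding abs_mult by (intro mult_mono) auto
  have m2: "\<bar>a * q x\<bar> \<le> (C * D) * norm h" "\<bar>p x * b\<bar> \<le> (C * D) * norm h"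
   using mult_mono [OF bnd(1), of "\<bar>q x\<bar>" D] mult_mono [of "\<bar>p x\<bar>" C, OF _ bnd(3)] P Q C(1) D(1)
   by (auto simp: abs_mult mult_ac)
  have m3: "\<bar>a * b\<bar> \<le> (C * D) * (norm h)^2" "\<bar>a' * b'\<bar> \<le> (C * D) * (norm h)^2"
   using mult_mono [OF bnd(1) bnd(3)] mult_mono [OF bnd(2) bnd(4)] C(1) D(1)
   by (auto simp: abs_mult power2_eq_square mult_ac)
  have m4: "\<bar>p x * sdiff q x h\<bar> \<le> (C * D) * (norm h)^2" "\<bar>sdiff p x h * q x\<bar> \<le> (C * D) * (norm h)^2"
   using mult_mono [of "\<bar>p x\<bar>" C "\<bar>sdiff q x h\<bar>" "D * (norm h)^2"] mult_mono [of "\<bar>sdiff p x h\<bar>" "C * (norm h)^2" "\<bar>q x\<bar>" D] P Q C(1) D(1)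
   by (auto simp: abs_mult mult_ac)
  have r: "norm h \<le> \<bar>\<rho>\<bar>" using xh by simp
  have sq: "(C * D) * (norm h)^2 \<le> \<bar>\<rho>\<bar> * ((C * D) * norm h)"
   using mult_left_mono [OF mult_right_mono [OF r norm_ge_zero [of h]] CD] by (simp add: power2_eq_square mult_ac)
  have nn: "0 \<le> C * D * norm h" "0 \<le> C * D * (norm h)^2" "0 \<le> \<bar>\<rho>\<bar> * (C * D)" "0 \<le> \<bar>\<rho>\<bar> * (C * D * norm h)" "0 \<le> \<bar>\<rho>\<bar> * (C * D * (norm h)^2)"
   using CD by auto
  show "\<bar>p x * q x\<bar> \<le> (4 + \<bar>\<rho>\<bar>) * (C * D)" using m1 nn CD unfolding distrib_right by linarith
  have "p (x + h) * q (x + h) - p x * q x = a * q x + p x * b + a * b" by (simp add: a_def b_def algebra_simps)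
  then have "\<bar>p (x + h) * q (x + h) - p x * q x\<bar> \<le> 4 * (C * D * norm h) + \<bar>\<rho>\<bar> * (C * D * norm h)"
   using m2 m3(1) sq nn by linarith
  then show "\<bar>p (x + h) * q (x + h) - p x * q x\<bar> \<le> (4 + \<bar>\<rho>\<bar>) * (C * D) * norm h"
   by (simp only: distrib_right mult.assoc)
  have "sdiff (\<lambda>x. p x * q x) x h = p x * sdiff q x h + sdiff p x h * q x - a * b - a' * b'"
   by (simp add: sdiff_def a_def b_def a'_def b'_def algebra_simps)
  then have "\<bar>sdiff (\<lambda>x. p x * q x) x h\<bar> \<le> 4 * (C * D * (norm h)^2) + \<bar>\<rho>\<bar> * (C * D * (norm h)^2)"
   using m3 m4 nn by linarith
  then show "\<bar>sdiff (\<lambda>x. p x * q x) x h\<bar> \<le> (4 + \<bar>\<rho>\<bar>) * (C * D) * (norm h)^2"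
   by (simp only: distrib_right mult.assoc)
 qed (use CD in simp)
qed

lemma locally_C11_sum: "(\<And>i. i \<in> I ==> locally_C11 (p i)) ==> locally_C11 (\<lambda>x. \<Sum>i\<in>I. p i x)"
 by (induction I rule: infinite_finite_induct) (auto intro: locally_C11_const locally_C11_add)

lemma locally_C11_prod: "(\<And>i. i \<in> I ==> locally_C11 (p i)) ==> locally_C11 (\<lambda>x. \<Prod>i\<in>I. p i x)"
 by (induction I rule: infinite_finite_induct) (auto intro: locally_C11_const locally_C11_mult)

lemma locally_C11_power: "locally_C11 p ==> locally_C11 (\<lambda>x. p x ^ j)"
 by (induction j) (auto intro: locally_C11_const locally_C11_mult)

lemma polynomial_locally_C11:
 fixes p :: "real ^ 'n => real"
 assumes "polynomial_deg_le d p"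
 shows "locally_C11 p"
proof -
 obtain c where p: "p = (\<lambda>x. \<Sum>\<alpha> \<in> {\<alpha>. int (\<Sum>i\<in>UNIV. \<alpha> i) \<le> d}. c \<alpha> * (\<Prod>i\<in>UNIV. (x $ i) ^ \<alpha> i))"
  by (rule polynomial_deg_leE [OF assms])
 show ?thesis
  unfolding p by (intro locally_C11_sum locally_C11_mult locally_C11_const locally_C11_prod locally_C11_power locally_C11_coord)
qed

text \<open>For steps below \<delta> = R - R' the cut-off is not felt and u is locally C11; for
  larger steps the bound 4 B is at most 4 B |h|^2 / \<delta>^2.\<close>

lemma cutoff_sdiff_bound:
 fixes u :: "'a::euclidean_space => real"
 assumes u: "continuous_on UNIV u" "locally_C11 u" and R: "0 \<le> R'" "R' < R"
 obtains C where "C \<ge> 0" "\<And>x h. norm x \<le> R' ==>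
  \<bar>sdiff (\<lambda>y. indicator (ball 0 R) y * u y) x h\<bar> \<le> C * min 1 ((norm h)^2)"
proof -
 define w where "w = (\<lambda>y. indicator (ball 0 R) y * u y)"
 obtain B where B: "B \<ge> 0" "\<And>y. \<bar>w y\<bar> \<le> B" unfolding w_def using cutoff_bounded [OF u(1), of R] by blast
 obtain C where C: "C \<ge> 0" "\<And>x h. norm x \<le> R ==> norm h \<le> R ==> \<bar>sdiff u x h\<bar> \<le> C * (norm h)^2"
  using u(2) unfolding locally_C11_def by meson
 define \<delta> where "\<delta> = R - R'"
 have \<delta>: "0 < \<delta>" "\<delta> \<le> R" using R by (auto simp: \<delta>_def)
 show thesis
 proof (rule that [of "C + 4 * B + 4 * B / \<delta>^2"])
  show "0 \<le> C + 4 * B + 4 * B / \<delta>^2" using C(1) B(1) by simp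
  fix x h :: 'a assume x: "norm x \<le> R'"
  have b4: "\<bar>sdiff w x h\<bar> \<le> 4 * B"
   using B(2) [of x] B(2) [of "x + h"] B(2) [of "x - h"] unfolding sdiff_def by linarith
  have b: "0 \<le> 4 * B / \<delta>^2" using B(1) by simp
  have "\<bar>sdiff w x h\<bar> \<le> (C + 4 * B + 4 * B / \<delta>^2) * 1" unfolding mult_1_right using b4 b C(1) by linarith
  moreover have "\<bar>sdiff w x h\<bar> \<le> (C + 4 * B + 4 * B / \<delta>^2) * (norm h)^2"
  proof (cases "norm h < \<delta>")
   case True
   have "norm (x + h) < R" "norm (x - h) < R" "norm x < R"
    using True x R norm_triangle_ineq [of x h] norm_triangle_ineq4 [of x h] by (auto simp: \<delta>_def)
   then have "\<bar>sdiff w x h\<bar> = \<bar>sdiff u x h\<bar>" by (simp add: w_def sdiff_def)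
   also have "... \<le> C * (norm h)^2" using x R True \<delta> by (intro C(2)) auto
   also have "... \<le> (C + 4 * B + 4 * B / \<delta>^2) * (norm h)^2" using b B(1) by (intro mult_right_mono) auto
   finally show ?thesis .
  next
   case False
   have "4 * B = 4 * B / \<delta>^2 * \<delta>^2" using \<delta> by simp
   also have "... \<le> 4 * B / \<delta>^2 * (norm h)^2" using False \<delta> b by (intro mult_left_mono power_mono) auto
   also have "... \<le> (C + 4 * B + 4 * B / \<delta>^2) * (norm h)^2" using C(1) B(1) by (intro mult_right_mono) auto
   finally show ?thesis using b4 by simp
  qed
  ultimately show "\<bar>sdiff (\<lambda>y. indicator (ball 0 R) y * u y) x h\<bar> \<le> (C + 4 * B + 4 * B / \<delta>^2) * min 1 ((norm h)^2)"
   unfolding w_def [symmetric] by (simp add: min_def)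
 qed
qed

lemma cutoff_sdiff_integrable:
 fixes u :: "'a::euclidean_space => real"
 assumes s: "0 < s" "s < 1" and u: "continuous_on UNIV u" "locally_C11 u" and x: "norm x < R"
 shows "integrable lborel (\<lambda>h. sdiff (\<lambda>y. indicator (ball 0 R) y * u y) x h * rker s h)"
proof -
 have um [measurable]: "u \<in> borel_measurable borel" using u(1) by (rule borel_measurable_continuous_onI)
 obtain C where C: "C \<ge> 0" "\<And>y h. norm y \<le> norm x ==>
  \<bar>sdiff (\<lambda>y. indicator (ball 0 R) y * u y) y h\<bar> \<le> C * min 1 ((norm h)^2)"
  using cutoff_sdiff_bound [OF u norm_ge_zero x] by blast
 show ?thesis
  by (rule integrable_near_0 [OF s sdiff_measurable [OF cutoff_measurable [OF um]] C(2)]) simp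
qed

text \<open>Dominated convergence on smaller balls, where the second differences have a uniform
  bound. The jump of the cut-off is met only when x + h or x - h lies on a sphere, which is a null
  set of h.\<close>

lemma flap_cutoff_continuous:
 fixes u :: "'a::euclidean_space => real"
 assumes s: "0 < s" "s < 1" and u: "continuous_on UNIV u" "locally_C11 u"
 shows "continuous_on (ball 0 R) (flap s (\<lambda>y. indicator (ball 0 R) y * u y))"
proof -
 define w where "w = (\<lambda>y. indicator (ball 0 R) y * u y)"
 have um: "u \<in> borel_measurable borel" using u(1) by (rule borel_measurable_continuous_onI)
 have wm [measurable]: "w \<in> borel_measurable borel" unfolding w_def by (rule cutoff_measurable [OF um])
 have wc: "isCont w y" if "norm y \<noteq> R" for y unfolding w_def by (rule isCont_cutoff [OF u(1) that])
 have sub: "continuous_on (ball 0 R') (flap s w)" if R': "0 \<le> R'" "R' < R" for R'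
 proof -
  obtain C where C: "C \<ge> 0" "\<And>x h. norm x \<le> R' ==> \<bar>sdiff w x h\<bar> \<le> C * min 1 ((norm h)^2)"
   unfolding w_def using cutoff_sdiff_bound [OF u R'] by blast
  show ?thesis
   unfolding continuous_on_sequentially
  proof (intro ballI allI impI)
   fix x :: 'a and X :: "nat => 'a" assume x: "x \<in> ball 0 R'" and "(\<forall>n. X n \<in> ball 0 R') \<and> X \<longlonglongrightarrow> x"
   then have X: "\<And>n. norm (X n) < R'" "X \<longlonglongrightarrow> x" by auto
   have "(\<lambda>n. LBINT h. sdiff w (X n) h * rker s h) \<longlonglongrightarrow> (LBINT h. sdiff w x h * rker s h)"
   proof (rule integral_dominated_convergence)
    show "integrable lborel (\<lambda>h::'a. C * (min 1 ((norm h)^2) * rker s h))"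
     by (intro integrable_mult_right integrable_min_rker s)
    show "AE h in lborel. norm (sdiff w (X n) h * rker s h) \<le> C * (min 1 ((norm h)^2) * rker s h)" (is "AE h in _. ?P h") for n
    proof (intro AE_I2)
     fix h
     have "\<bar>sdiff w (X n) h\<bar> * rker s h \<le> C * min 1 ((norm h)^2) * rker s h"
      using X(1) [of n] by (intro mult_right_mono C(2) rker_nonneg) simp
     then show "?P h"
      by (simp add: abs_mult abs_of_nonneg [OF rker_nonneg] mult.assoc)
    qed
    show "AE h in lborel. (\<lambda>n. sdiff w (X n) h * rker s h) \<longlonglongrightarrow> sdiff w x h * rker s h"
     using AE_norm_neq [of x R] AE_norm_neq [of "- x" R]
    proof eventually_elim
     case (elim h)
     have "norm (x - h) \<noteq> R" using elim(2) by (metis minus_diff_eq norm_minus_cancel uminus_add_conv_diff)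
     moreover have "norm x \<noteq> R" using x R' by simp
     ultimately show ?case
      unfolding sdiff_def using elim(1)
      by (intro tendsto_mult tendsto_diff tendsto_const isCont_tendsto_compose [OF wc] tendsto_add X(2)) auto
    qed
   qed measurable
   then have "(\<lambda>n. flap s w (X n)) \<longlonglongrightarrow> flap s w x"
    unfolding flap_def by (intro tendsto_divide tendsto_const) auto
   then show "(flap s w \<circ> X) \<longlonglongrightarrow> flap s w x" by (simp add: o_def)
  qed
 qed
 have "isCont (flap s w) x" if xR: "norm x < R" for x
 proof -
  obtain R' where R': "norm x < R'" "R' < R" using dense [OF xR] by blast
  then have "0 \<le> R'" using norm_ge_zero [of x] by linarith
  show ?thesis using sub [OF \<open>0 \<le> R'\<close> R'(2)] R'(1) by (simp add: continuous_on_eq_continuous_at)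
 qed
 then show ?thesis unfolding w_def by (simp add: continuous_on_eq_continuous_at)
qed

lemma cutoff_visc:
 fixes u :: "real ^ 'n => real"
 assumes s: "0 < s" "s < 1" and u: "continuous_on UNIV u" "locally_C11 u" and M: "M \<le> R"
 shows "visc_frac_laplacian_eq s (ball 0 M) (\<lambda>y. indicator (ball 0 R) y * u y) (flap s (\<lambda>y. indicator (ball 0 R) y * u y))"
proof -
 define w where "w = (\<lambda>y. indicator (ball 0 R) y * u y)"
 have um: "u \<in> borel_measurable borel" using u(1) by (rule borel_measurable_continuous_onI)
 have wm [measurable]: "w \<in> borel_measurable borel" unfolding w_def by (rule cutoff_measurable [OF um])
 obtain B where B: "B \<ge> 0" "\<And>y. \<bar>w y\<bar> \<le> B" unfolding w_def using cutoff_bounded [OF u(1), of R] by blast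
 have wi: "integrable lborel w" unfolding w_def by (rule cutoff_integrable [OF u(1)])
 show ?thesis
  unfolding w_def [symmetric]
 proof (rule classical_imp_visc [OF s wm B(2)])
  show "continuous_on (ball 0 M) (flap s w)"
   unfolding w_def by (rule continuous_on_subset [OF flap_cutoff_continuous [OF s u] subset_ball [OF M]])
  have "continuous_on (ball 0 M) u" using u(1) continuous_on_subset by blast
  then show "continuous_on (ball 0 M) w"
   by (rule continuous_on_cong [THEN iffD1, rotated -1]) (use M in \<open>auto simp: w_def\<close>)
  have "integrable lborel (\<lambda>y. \<bar>w y\<bar> / (1 + norm y powr (real CARD('n) + 2 * s)))"
  proof (rule integrable_bound [OF wi])
   show "AE y in lborel. norm (\<bar>w y\<bar> / (1 + norm y powr (real CARD('n) + 2 * s))) \<le> norm (w y)" (is "AE y in _. ?P y")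
   proof (intro AE_I2)
    fix y :: "real ^ 'n"
    have "\<bar>w y\<bar> / (1 + norm y powr (real CARD('n) + 2 * s)) \<le> \<bar>w y\<bar> / 1"
     by (intro divide_left_mono) (auto simp: add_pos_nonneg)
    then show "?P y"
     by (simp add: abs_of_nonneg add_nonneg_nonneg)
   qed
  qed measurable
  then show "weighted_integrable (2 * s) w"
   unfolding weighted_integrable_def using wm
   by (auto simp: integrable_completion intro!: measurable_completion)
  show "integrable lborel (\<lambda>h. sdiff w x h * rker s h)" if "x \<in> ball 0 M" for x
   unfolding w_def using that M by (intro cutoff_sdiff_integrable s u) simp
 qed simp
qed

lemma integrable_bounded_support:
 fixes f :: "'a::euclidean_space => real"
 assumes [measurable]: "f \<in> borel_measurable borel" and B: "\<And>y. norm y < R ==> \<bar>f y\<bar> \<le> B"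
  and 0: "\<And>y. \<not> norm y < R ==> f y = 0"
 shows "integrable lborel f"
proof -
 have "integrable lborel (\<lambda>y::'a. indicator (ball 0 R) y * B)"
  by (intro integrable_mult_left integrable_real_indicator) (use emeasure_bounded_finite [OF bounded_ball] in auto)
 then show ?thesis
 proof (rule integrable_bound)
  show "AE y in lborel. norm (f y) \<le> norm (indicator (ball 0 R) y * B)"
  proof (intro AE_I2)
   fix y show "norm (f y) \<le> norm (indicator (ball 0 R) y * B)"
    using B [of y] 0 [of y] by (cases "norm y < R") auto
  qed
 qed measurable
qed

lemma polynomial_deg_le_continuous:
 fixes p :: "real ^ 'n => real"
 assumes "polynomial_deg_le d p"
 shows "continuous_on S p"
proof -
 obtain c where p: "p = (\<lambda>x. \<Sum>\<alpha> \<in> {\<alpha>. int (\<Sum>i\<in>UNIV. \<alpha> i) \<le> d}. c \<alpha> * (\<Prod>i\<in>UNIV. (x $ i) ^ \<alpha> i))"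
  by (rule polynomial_deg_leE [OF assms])
 show ?thesis unfolding p by (intro continuous_intros)
qed

section \<open>The Taylor expansion of the kernel and its moments\<close>

text \<open>Each factor of the inner product is a sum of x_c y_c: the coordinate x_c goes to the
  polynomial and y_c into g. This is why g varies in the induction.\<close>

lemma polynomial_deg_le_moment:
 fixes g :: "real ^ 'n => real"
 assumes "g \<in> borel_measurable borel" "\<And>y. norm y < R ==> \<bar>g y\<bar> \<le> B" "\<And>y. \<not> norm y < R ==> g y = 0"
 shows "polynomial_deg_le (int j) (\<lambda>x. LBINT y. g y * (x \<bullet> y) ^ j)"
 using assms
proof (induction j arbitrary: g B)
 case 0
 show ?case by (simp add: polynomial_deg_le_const)
next
 case (Suc j)
 note [measurable] = Suc.prems(1)
 note B = Suc.prems(2) note zero = Suc.prems(3)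
 have gB: "\<bar>g y * y $ c\<bar> \<le> \<bar>B\<bar> * \<bar>R\<bar>" if "norm y < R" for y c
  using B [OF that] component_le_norm_cart [of y c] that unfolding abs_mult by (intro mult_mono) auto
 have int: "integrable lborel (\<lambda>y. g y * y $ c * (x \<bullet> y) ^ j)" for c x
 proof (rule integrable_bounded_support)
  show "(\<lambda>y. g y * y $ c * (x \<bullet> y) ^ j) \<in> borel_measurable borel" by measurable
  show "\<bar>g y * y $ c * (x \<bullet> y) ^ j\<bar> \<le> \<bar>B\<bar> * \<bar>R\<bar> * (norm x * \<bar>R\<bar>) ^ j" if "norm y < R" for y
  proof -
   have "\<bar>x \<bullet> y\<bar> \<le> norm x * norm y" by (rule Cauchy_Schwarz_ineq2)
   also have "... \<le> norm x * \<bar>R\<bar>" using that by (intro mult_left_mono) auto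
   finally have "\<bar>(x \<bullet> y) ^ j\<bar> \<le> (norm x * \<bar>R\<bar>) ^ j" unfolding power_abs by (intro power_mono) auto
   then show ?thesis using gB [OF that, of c] unfolding abs_mult [of "g y * y $ c"] by (intro mult_mono) auto
  qed
  show "g y * y $ c * (x \<bullet> y) ^ j = 0" if "\<not> norm y < R" for y using zero [OF that] by simp
 qed
 have "(LBINT y. g y * (x \<bullet> y) ^ Suc j) = (\<Sum>c\<in>UNIV. x $ c * (LBINT y. g y * y $ c * (x \<bullet> y) ^ j))" for x
 proof -
  have "(LBINT y. g y * (x \<bullet> y) ^ Suc j) = (LBINT y. (\<Sum>c\<in>UNIV. x $ c * (g y * y $ c * (x \<bullet> y) ^ j)))"
  proof (intro integral_cong refl)
   fix y :: "real ^ 'n"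
   have "(\<Sum>c\<in>UNIV. x $ c * (g y * y $ c * (x \<bullet> y) ^ j)) = (\<Sum>c\<in>UNIV. x $ c * y $ c) * (g y * (x \<bullet> y) ^ j)"
    unfolding sum_distrib_right by (simp only: mult_ac)
   also have "(\<Sum>c\<in>UNIV. x $ c * y $ c) = x \<bullet> y" by (simp add: inner_vec_def)
   finally show "g y * (x \<bullet> y) ^ Suc j = (\<Sum>c\<in>UNIV. x $ c * (g y * y $ c * (x \<bullet> y) ^ j))" by simp
  qed
  also have "... = (\<Sum>c\<in>UNIV. LBINT y. x $ c * (g y * y $ c * (x \<bullet> y) ^ j))"
   by (intro integral_sum integrable_mult_right int)
  finally show ?thesis by simp
 qed
 moreover have "polynomial_deg_le (1 + int j) (\<lambda>x. \<Sum>c\<in>UNIV. x $ c * (LBINT y. g y * y $ c * (x \<bullet> y) ^ j))"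
 proof (intro polynomial_deg_le_sum polynomial_deg_le_mult polynomial_deg_le_coord)
  fix c
  show "polynomial_deg_le (int j) (\<lambda>x. LBINT y. g y * y $ c * (x \<bullet> y) ^ j)"
  proof (rule Suc.IH)
   show "(\<lambda>y. g y * y $ c) \<in> borel_measurable borel" by measurable
  qed (use gB zero in auto)
 qed
 ultimately show ?case by simp
qed

text \<open>The part of degree below \<open>k\<close> in \<open>x\<close> of the expansion of \<open>\<bar>x - y\<bar>\<^bsup>-n-2s\<^esup>\<close> in powers of \<open>x\<close>.\<close>

definition taylor_rker :: "nat => real => 'a::euclidean_space => 'a => real" where
 "taylor_rker k s y x = norm y powr (- (real DIM('a) + 2 * s)) *
   taylor_part (\<lambda>i. (- ((real DIM('a) + 2 * s) / 2)) gchoose i) k (- 2 * (x \<bullet> y) / (norm y)^2) ((norm x)^2 / (norm y)^2)"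

text \<open>Taking out |y|^2 gives |x - y|^2 = |y|^2 (1 + \<alpha> + \<beta>), with \<alpha> of
  first and \<beta> of second order in |x| / |y|. For 4 |x| \<le> |y| the unit \<kappa> = 2 |x| /
  |y| is at most 1/2, and 1/2 + 1/4 is within the radius of convergence.\<close>

lemma taylor_rker_bound:
 obtains C where "C \<ge> 0" "\<And>x y::'a::euclidean_space. y \<noteq> 0 ==> 4 * norm x \<le> norm y ==>
  \<bar>rker s (x - y) - taylor_rker k s y x\<bar> \<le> C * norm x ^ k * norm y powr (- (real DIM('a) + 2 * s + real k))"
proof -
 define b where "b = (real DIM('a) + 2 * s) / 2"
 obtain C0 where C0: "C0 \<ge> 0" "\<And>\<alpha> \<beta> \<kappa>. \<bar>\<alpha>\<bar> \<le> \<kappa> ==> \<bar>\<beta>\<bar> \<le> \<kappa>^2 ==> \<kappa> \<le> 1/2 ==>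
  \<bar>(1 + (\<alpha> + \<beta>)) powr (- b) - taylor_part (\<lambda>i. (- b) gchoose i) k \<alpha> \<beta>\<bar> \<le> C0 * \<kappa> ^ k"
 proof -
  have K: "0 \<le> (1/2 :: real)" "1/2 + (1/2)^2 < (1::real)" by (auto simp: power2_eq_square)
  show thesis by (rule taylor_part_bound [OF binomial_sums [of _ b] K, of k]) (assumption, rule that)
 qed
 show thesis
 proof (rule that [of "C0 * 2 ^ k"])
  show "0 \<le> C0 * 2 ^ k" using C0(1) by simp
  fix x y :: 'a assume y: "y \<noteq> 0" and xy: "4 * norm x \<le> norm y"
  define \<kappa> where "\<kappa> = 2 * norm x / norm y"
  define \<alpha> where "\<alpha> = - 2 * (x \<bullet> y) / (norm y)^2"
  define \<beta> where "\<beta> = (norm x)^2 / (norm y)^2"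
  have yp: "0 < norm y" using y by simp
  have "\<bar>x \<bullet> y\<bar> \<le> norm x * norm y" by (rule Cauchy_Schwarz_ineq2)
  then have a: "\<bar>\<alpha>\<bar> \<le> \<kappa>" using yp by (simp add: \<alpha>_def \<kappa>_def abs_mult power2_eq_square divide_simps)
  have "\<kappa>^2 = 4 * \<beta>" by (simp add: \<kappa>_def \<beta>_def power_divide power_mult_distrib)
  moreover have "0 \<le> \<beta>" by (simp add: \<beta>_def)
  ultimately have bb: "\<bar>\<beta>\<bar> \<le> \<kappa>^2" by simp
  have k: "\<kappa> \<le> 1/2" using xy yp by (simp add: \<kappa>_def divide_simps)
  have sq: "(norm (x - y))^2 = (norm y)^2 * (1 + (\<alpha> + \<beta>))"
   using yp by (simp add: \<alpha>_def \<beta>_def distrib_left right_diff_distrib power2_norm_eq_inner inner_diff_left inner_diff_right inner_commute)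
  have ysq: "((norm y)^2) powr (- b) = norm y powr (- (real DIM('a) + 2 * s))"
  proof -
   have "(norm y)^2 = norm y powr 2" using yp by simp
   moreover have "2 * (X / 2) = X" for X :: real by simp
   then have "2 * (- b) = - (real DIM('a) + 2 * s)" by (simp only: b_def mult_minus_right)
   ultimately show ?thesis by (simp only: powr_powr)
  qed
  have "rker s (x - y) = norm y powr (- (real DIM('a) + 2 * s)) * (1 + (\<alpha> + \<beta>)) powr (- b)"
   unfolding rker_eq b_def [symmetric] add_0 sq ysq [symmetric] by (rule powr_mult)
  then have "rker s (x - y) - taylor_rker k s y x = norm y powr (- (real DIM('a) + 2 * s)) *
    ((1 + (\<alpha> + \<beta>)) powr (- b) - taylor_part (\<lambda>i. (- b) gchoose i) k \<alpha> \<beta>)"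
   unfolding taylor_rker_def \<alpha>_def [symmetric] \<beta>_def [symmetric] b_def [symmetric] by (simp only: right_diff_distrib)
  then have "\<bar>rker s (x - y) - taylor_rker k s y x\<bar> \<le> norm y powr (- (real DIM('a) + 2 * s)) * (C0 * \<kappa> ^ k)"
   using C0(2) [OF a bb k] by (simp add: abs_mult mult_left_mono)
  also have "... = C0 * 2 ^ k * norm x ^ k * (norm y powr (- (real DIM('a) + 2 * s)) / norm y ^ k)"
   by (simp add: \<kappa>_def power_divide power_mult_distrib)
  also have "norm y powr (- (real DIM('a) + 2 * s)) / norm y ^ k = norm y powr (- (real DIM('a) + 2 * s) - real k)"
   using yp by (simp add: powr_diff powr_realpow)
  also have "- (real DIM('a) + 2 * s) - real k = - (real DIM('a) + 2 * s + real k)" by simp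
  finally show "\<bar>rker s (x - y) - taylor_rker k s y x\<bar> \<le> C0 * 2 ^ k * norm x ^ k * norm y powr (- (real DIM('a) + 2 * s + real k))" .
 qed
qed

lemma taylor_rker_expand:
 "taylor_rker k s y x = (\<Sum>i<k. \<Sum>l\<le>i. if i + l < k then
   ((- ((real DIM('a::euclidean_space) + 2 * s) / 2)) gchoose i) * real (i choose l) * (- 2) ^ (i - l) * ((norm x)^2) ^ l *
    (norm y powr (- (real DIM('a) + 2 * s)) * (1 / (norm y)^2) ^ i * (x \<bullet> (y::'a)) ^ (i - l)) else 0)"
proof -
 have e: "(- 2 * (x \<bullet> y) / (norm y)^2) ^ (i - l) * ((norm x)^2 / (norm y)^2) ^ l =
  (- 2) ^ (i - l) * ((norm x)^2) ^ l * ((1 / (norm y)^2) ^ i * (x \<bullet> y) ^ (i - l))" if "l \<le> i" for i l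
 proof -
  have "(1 / (norm y)^2) ^ i = (1 / (norm y)^2) ^ (i - l) * (1 / (norm y)^2) ^ l"
   using that by (simp only: power_add [symmetric] le_add_diff_inverse2)
  moreover have "(- 2 * (x \<bullet> y) / (norm y)^2) ^ (i - l) = (- 2) ^ (i - l) * (x \<bullet> y) ^ (i - l) * (1 / (norm y)^2) ^ (i - l)"
   by (simp only: power_mult_distrib [symmetric]) simp
  moreover have "((norm x)^2 / (norm y)^2) ^ l = ((norm x)^2) ^ l * (1 / (norm y)^2) ^ l"
   by (simp only: power_mult_distrib [symmetric]) simp
  ultimately show ?thesis by (simp only: mult_ac)
 qed
 show ?thesis
  unfolding taylor_rker_def taylor_part_def sum_distrib_left
 proof (intro sum.cong refl)
  fix i l assume "i \<in> {..<k}" "l \<in> {..i}"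
  then have li: "l \<le> i" by simp
  let ?c = "(- ((real DIM('a) + 2 * s) / 2)) gchoose i"
  let ?N = "norm y powr (- (real DIM('a) + 2 * s))"
  show "?N * (if i + l < k then ?c * real (i choose l) * (- 2 * (x \<bullet> y) / (norm y)^2) ^ (i - l) * ((norm x)^2 / (norm y)^2) ^ l else 0) =
     (if i + l < k then ?c * real (i choose l) * (- 2) ^ (i - l) * ((norm x)^2) ^ l *
    (?N * (1 / (norm y)^2) ^ i * (x \<bullet> y) ^ (i - l)) else 0)"
  proof (cases "i + l < k")
   case True
   show ?thesis
    unfolding if_P [OF True] mult.assoc [of "?c * real (i choose l)" "(- 2 * (x \<bullet> y) / (norm y)^2) ^ (i - l)"] e [OF li]
    by (simp only: mult_ac)
  qed simp
 qed
qed

lemma polynomial_deg_le_power: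
 fixes p :: "real ^ 'n => real"
 assumes "polynomial_deg_le (int d) p"
 shows "polynomial_deg_le (int (d * l)) (\<lambda>x. p x ^ l)"
proof (induction l)
 case 0
 show ?case by (simp add: polynomial_deg_le_const)
next
 case (Suc l)
 show ?case using polynomial_deg_le_mult [OF assms Suc] by (simp add: algebra_simps)
qed

lemma polynomial_deg_le_norm_sq: "polynomial_deg_le 2 (\<lambda>x :: real ^ 'n. (norm x)^2)"
proof -
 have "polynomial_deg_le (1 + 1) (\<lambda>x :: real ^ 'n. \<Sum>i\<in>UNIV. x $ i * x $ i)"
  by (intro polynomial_deg_le_sum polynomial_deg_le_mult polynomial_deg_le_coord)
 then show ?thesis by (simp add: power2_norm_eq_inner inner_vec_def)
qed

text \<open>In x the term with indices i and l has degree 2 l + (i - l) = i + l < k, the first part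
  from |x|^2 and the second from a moment. As g vanishes on the unit ball, the negative powers of
  |y| in the coefficients are harmless.\<close>

lemma taylor_rker_moment:
 fixes g :: "real ^ 'n => real"
 assumes s: "0 < s" and [measurable]: "g \<in> borel_measurable borel" and B: "\<And>y. norm y < R ==> \<bar>g y\<bar> \<le> B"
  and 0: "\<And>y. \<not> norm y < R ==> g y = 0" and near: "\<And>y. norm y < 1 ==> g y = 0"
 shows "integrable lborel (\<lambda>y. g y * taylor_rker k s y x)"
  and "polynomial_deg_le (int k - 1) (\<lambda>x. LBINT y. g y * taylor_rker k s y x)"
proof -
 let ?a = "real DIM(real ^ 'n) + 2 * s"
 define G where "G i y = g y * (norm y powr (- ?a) * (1 / (norm y)^2) ^ i)" for i y
 define c where "c i l = ((- (?a / 2)) gchoose i) * real (i choose l) * (- 2) ^ (i - l)" for i l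
 have Gm [measurable]: "G i \<in> borel_measurable borel" for i unfolding G_def [abs_def] by measurable
 have GB: "\<bar>G i y\<bar> \<le> \<bar>B\<bar>" if "norm y < R" for i y
 proof (cases "norm y < 1")
  case False
  have "norm y powr (- ?a) \<le> norm y powr 0" using False s by (intro powr_mono) auto
  also have "... = 1" using False by (auto simp: powr_zero_eq_one)
  finally have 1: "norm y powr (- ?a) \<le> 1" .
  have "1 / (norm y)^2 \<le> 1" using False by (simp add: divide_simps)
  then have 2: "(1 / (norm y)^2) ^ i \<le> 1" by (intro power_le_one) auto
  have "\<bar>g y\<bar> * (norm y powr (- ?a) * (1 / (norm y)^2) ^ i) \<le> \<bar>B\<bar> * (1 * 1)"
   using B [OF that] 1 2 by (intro mult_mono) auto
  then show ?thesis by (simp add: G_def abs_mult)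
 qed (simp add: G_def near)
 have G0: "G i y = 0" if "\<not> norm y < R" for i y using 0 [OF that] by (simp add: G_def)
 have Gi: "integrable lborel (\<lambda>y. G i y * (x \<bullet> y) ^ j)" for i j x
 proof (rule integrable_bounded_support [where R = R and B = "\<bar>B\<bar> * (norm x * \<bar>R\<bar>) ^ j"])
  show "(\<lambda>y. G i y * (x \<bullet> y) ^ j) \<in> borel_measurable borel" by measurable
  fix y :: "real ^ 'n"
  assume y: "norm y < R"
  have "\<bar>x \<bullet> y\<bar> \<le> norm x * norm y" by (rule Cauchy_Schwarz_ineq2)
  also have "... \<le> norm x * \<bar>R\<bar>" using y by (intro mult_left_mono) auto
  finally have "\<bar>(x \<bullet> y) ^ j\<bar> \<le> (norm x * \<bar>R\<bar>) ^ j" unfolding power_abs by (intro power_mono) auto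
  then show "\<bar>G i y * (x \<bullet> y) ^ j\<bar> \<le> \<bar>B\<bar> * (norm x * \<bar>R\<bar>) ^ j"
   using GB [OF y] unfolding abs_mult by (intro mult_mono) auto
 qed (simp add: G0)
 have eq: "g y * taylor_rker k s y x = (\<Sum>i<k. \<Sum>l\<le>i. if i + l < k then c i l * ((norm x)^2) ^ l * (G i y * (x \<bullet> y) ^ (i - l)) else 0)" for x y
  unfolding taylor_rker_expand sum_distrib_left
  by (intro sum.cong refl) (simp add: c_def G_def)
 have ti: "integrable lborel (\<lambda>y. if i + l < k then c i l * ((norm x)^2) ^ l * (G i y * (x \<bullet> y) ^ (i - l)) else 0)" for i l x
  by (cases "i + l < k") (auto intro!: integrable_mult_right Gi)
 show "integrable lborel (\<lambda>y. g y * taylor_rker k s y x)"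
  unfolding eq by (intro integrable_sum ti)
 have "(LBINT y. g y * taylor_rker k s y x) =
   (\<Sum>i<k. \<Sum>l\<le>i. if i + l < k then c i l * ((norm x)^2) ^ l * (LBINT y. G i y * (x \<bullet> y) ^ (i - l)) else 0)" for x
 proof -
  have "(LBINT y. g y * taylor_rker k s y x) = (\<Sum>i<k. \<Sum>l\<le>i. LBINT y. (if i + l < k then c i l * ((norm x)^2) ^ l * (G i y * (x \<bullet> y) ^ (i - l)) else 0))"
   unfolding eq by (simp only: integral_sum integrable_sum ti)
  also have "... = (\<Sum>i<k. \<Sum>l\<le>i. if i + l < k then c i l * ((norm x)^2) ^ l * (LBINT y. G i y * (x \<bullet> y) ^ (i - l)) else 0)"
   by (intro sum.cong refl) simp
  finally show ?thesis .
 qed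
 moreover have "polynomial_deg_le (int k - 1) (\<lambda>x. \<Sum>i<k. \<Sum>l\<le>i. if i + l < k then c i l * ((norm x)^2) ^ l * (LBINT y. G i y * (x \<bullet> y) ^ (i - l)) else 0)"
 proof (intro polynomial_deg_le_sum)
  fix i l assume "i \<in> {..<k}" "l \<in> {..i}"
  then have li: "l \<le> i" by simp
  show "polynomial_deg_le (int k - 1) (\<lambda>x. if i + l < k then c i l * ((norm x)^2) ^ l * (LBINT y. G i y * (x \<bullet> y) ^ (i - l)) else 0)"
  proof (cases "i + l < k")
   case True
   have n2: "polynomial_deg_le (int (2 * l)) (\<lambda>x :: real ^ 'n. ((norm x)^2) ^ l)"
    using polynomial_deg_le_norm_sq by (intro polynomial_deg_le_power) simp
   have "polynomial_deg_le (int (2 * l) + int (i - l)) (\<lambda>x. c i l * ((norm x)^2) ^ l * (LBINT y. G i y * (x \<bullet> y) ^ (i - l)))"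
    by (intro polynomial_deg_le_mult polynomial_deg_le_cmult n2 polynomial_deg_le_moment [OF Gm GB G0])
   then have "polynomial_deg_le (int k - 1) (\<lambda>x. c i l * ((norm x)^2) ^ l * (LBINT y. G i y * (x \<bullet> y) ^ (i - l)))"
    by (rule polynomial_deg_le_mono) (use True li in auto)
   then show ?thesis using True by simp
  qed (simp add: polynomial_deg_le_zero)
 qed
 ultimately show "polynomial_deg_le (int k - 1) (\<lambda>x. LBINT y. g y * taylor_rker k s y x)" by simp
qed

section \<open>The corrected fractional Laplacians of the cut-offs and their limit\<close>

text \<open>The degree bound k + 1 covers both cases of d(k,s). In \<open>Q\<close> the unit ball is
  left out because the Taylor coefficients of the kernel are singular at y = 0; the plus sign
  cancels the Taylor part, as the far field enters G with a minus sign. The tail \<open>T R\<close>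
  controls all errors.\<close>

locale polynomial_tail =
 fixes s :: real and k :: nat and u :: "real ^ 'n => real"
 assumes s: "0 < s" "s < 1" and poly: "polynomial_deg_le (int k + 1) u"
  and tail: "integrable lborel (\<lambda>y. \<bar>u y\<bar> * (1 + norm y) powr (- (real DIM(real ^ 'n) + 2 * s + real k)))"
begin

definition "p = real DIM(real ^ 'n) + 2 * s + real k"
definition "W y = (1 + norm (y :: real ^ 'n)) powr (- p)"
definition "w R = (\<lambda>y. indicator (ball 0 R) y * u y)"
definition "G R = flap s (w R)"
definition "Q R x = (LBINT y. indicator (- ball 0 1) y * w R y * taylor_rker k s y x)"
definition "T R = (LBINT y. indicator (- ball 0 R) y * (\<bar>u y\<bar> * W y))"
definition "Ginf x = lim (\<lambda>i. G (real i) x + Q (real i) x)"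

lemma p_pos: "0 < p" using s by (simp add: p_def add_pos_nonneg)

lemma ball_borel [measurable]: "ball (0 :: real ^ 'n) R \<in> sets borel" by simp

lemma u_cont: "continuous_on S u" by (rule polynomial_deg_le_continuous [OF poly])

lemma u_borel [measurable]: "u \<in> borel_measurable borel"
 using u_cont by (rule borel_measurable_continuous_onI)

lemma u_C11: "locally_C11 u" by (rule polynomial_locally_C11 [OF poly])

lemma w_borel [measurable]: "w R \<in> borel_measurable borel" unfolding w_def by measurable

lemma W_borel [measurable]: "W \<in> borel_measurable borel" unfolding W_def [abs_def] by measurable

lemma W_nonneg: "0 \<le> W y" by (simp add: W_def)

lemma tail_W: "integrable lborel (\<lambda>y. \<bar>u y\<bar> * W y)" using tail by (simp add: W_def p_def)

lemma w_le: "\<bar>w R y\<bar> \<le> \<bar>u y\<bar>" by (simp add: w_def indicator_def)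

lemma w_bounded: obtains B where "\<And>y. \<bar>w R y\<bar> \<le> B"
 unfolding w_def using cutoff_bounded [OF u_cont, of R] by blast

lemma sdiff_w_integrable: "norm x < R ==> integrable lborel (\<lambda>z. sdiff (w R) x z * rker s z)"
 unfolding w_def by (rule cutoff_sdiff_integrable [OF s u_cont u_C11])

lemma T_nonneg: "0 \<le> T R"
 unfolding T_def by (intro integral_nonneg) (simp add: W_nonneg)

lemma T_tendsto: "(T \<longlongrightarrow> 0) at_top"
proof -
 have "((\<lambda>R. LBINT y. indicator (- ball 0 R) y * (\<bar>u y\<bar> * W y)) \<longlongrightarrow> (\<integral>y. 0 \<partial>(lborel :: (real ^ 'n) measure))) at_top"
 proof (rule integral_dominated_convergence_at_top [OF _ _ tail_W])
  show "\<forall>\<^sub>F R in at_top. AE y in lborel. norm (indicator (- ball 0 R) y * (\<bar>u y\<bar> * W y)) \<le> \<bar>u y\<bar> * W y"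
   by (intro always_eventually allI AE_I2) (auto simp: indicator_def W_nonneg abs_mult)
  show "AE y in lborel. ((\<lambda>R. indicator (- ball 0 R) y * (\<bar>u y\<bar> * W y)) \<longlongrightarrow> 0) at_top"
  proof (intro AE_I2 tendsto_eventually)
   fix y :: "real ^ 'n"
   have "\<forall>\<^sub>F R in at_top. norm y < R" by (rule eventually_gt_at_top)
   then show "\<forall>\<^sub>F R in at_top. indicator (- ball 0 R) y * (\<bar>u y\<bar> * W y) = 0"
    by eventually_elim simp
  qed
 qed measurable
 then show ?thesis by (simp add: T_def [abs_def])
qed

lemma Q_integrand:
 shows "integrable lborel (\<lambda>y. indicator (- ball 0 1) y * w R y * taylor_rker k s y x)"
  and "polynomial_deg_le (int k - 1) (Q R)"
proof -
 obtain B where B: "\<And>y. \<bar>w R y\<bar> \<le> B" using w_bounded [of R] by blast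
 have B': "\<bar>indicator (- ball 0 1) y * w R y\<bar> \<le> B" for y
  using B [of y] by (auto simp: indicator_def)
 have m: "(\<lambda>y. indicator (- ball 0 1) y * w R y) \<in> borel_measurable borel" by measurable
 have z: "indicator (- ball 0 1) y * w R y = 0" if "\<not> norm y < R" for y using that by (simp add: w_def)
 have n: "indicator (- ball 0 1) y * w R y = 0" if "norm y < 1" for y using that by simp
 show "integrable lborel (\<lambda>y. indicator (- ball 0 1) y * w R y * taylor_rker k s y x)"
  by (rule taylor_rker_moment(1) [OF s(1) m B' z n])
 have "polynomial_deg_le (int k - 1) (\<lambda>x. LBINT y. indicator (- ball 0 1) y * w R y * taylor_rker k s y x)"
  by (rule taylor_rker_moment(2) [OF s(1) m B' z n])
 then show "polynomial_deg_le (int k - 1) (Q R)" by (simp add: Q_def [abs_def])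
qed

text \<open>Only values of u between the radii R and R' enter, integrated against the kernel minus
  its Taylor polynomial of order k. This difference decays like |y|^(-p), exactly the weight in
  which u is integrable, so a tail integral remains.\<close>

lemma increment:
 obtains C where "C \<ge> 0" "\<And>x R R'. 1 \<le> R ==> 4 * norm x \<le> R ==> R \<le> R' ==>
  \<bar>(G R' x + Q R' x) - (G R x + Q R x)\<bar> \<le> C * norm x ^ k * T R"
proof -
 obtain C where C: "C \<ge> 0" "\<And>x y::real^'n. y \<noteq> 0 ==> 4 * norm x \<le> norm y ==>
  \<bar>rker s (x - y) - taylor_rker k s y x\<bar> \<le> C * norm x ^ k * norm y powr (- p)"
  using taylor_rker_bound [where 'a = "real ^ 'n", of s k] unfolding p_def by blast
 show thesis
 proof (rule that [of "C * 2 powr p"])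
  show "0 \<le> C * 2 powr p" using C(1) by simp
  fix x :: "real ^ 'n" and R R' :: real
  assume R: "1 \<le> R" and x: "4 * norm x \<le> R" and RR: "R \<le> R'"
  have xR: "norm x < R" using R x norm_ge_zero [of x] by linarith
  define D where "D = (\<lambda>y. w R' y - w R y)"
  have D: "D y = (if norm y < R then 0 else w R' y)" for y
   using RR by (auto simp: D_def w_def indicator_def)
  have Dm [measurable]: "D \<in> borel_measurable borel" unfolding D_def by measurable
  obtain B where B: "\<And>y. \<bar>w R' y\<bar> \<le> B" using w_bounded [of R'] by blast
  have DB: "\<bar>D y\<bar> \<le> \<bar>B\<bar>" for y using B [of y] by (auto simp: D)
  have d: "D y = 0" if "norm (y - x) < R - norm x" for y
   using that norm_triangle_sub [of y x] by (simp add: D)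
  have far: "integrable lborel (\<lambda>y. D y * rker s (x - y))" "flap s D x = - (LBINT y. D y * rker s (x - y))"
   using flap_far [OF s Dm DB, of "R - norm x" x] d xR by auto
  have G: "G R' x - G R x = flap s D x"
   unfolding G_def D_def using xR RR by (intro flap_diff [symmetric] sdiff_w_integrable) auto
  have e: "indicator (- ball 0 1) y * w R' y * taylor_rker k s y x - indicator (- ball 0 1) y * w R y * taylor_rker k s y x
    = D y * taylor_rker k s y x" for y
  proof (cases "norm y < 1")
   case True
   then show ?thesis using R by (simp add: D)
  next
   case False
   then show ?thesis by (simp add: D_def left_diff_distrib)
  qed
  have Qi: "integrable lborel (\<lambda>y. D y * taylor_rker k s y x)"
   using integrable_diff [OF Q_integrand(1) [of R' x] Q_integrand(1) [of R x]] by (simp only: e)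
  have Q: "Q R' x - Q R x = (LBINT y. D y * taylor_rker k s y x)"
   unfolding Q_def integral_diff [OF Q_integrand(1) [of R' x] Q_integrand(1) [of R x], symmetric] by (simp only: e)
  have "(G R' x + Q R' x) - (G R x + Q R x) = (LBINT y. D y * taylor_rker k s y x) - (LBINT y. D y * rker s (x - y))"
   using G Q far(2) by simp
  also have "... = (LBINT y. D y * (taylor_rker k s y x - rker s (x - y)))"
   unfolding integral_diff [OF Qi far(1), symmetric] by (simp only: right_diff_distrib)
  finally have "\<bar>(G R' x + Q R' x) - (G R x + Q R x)\<bar> \<le> (LBINT y. \<bar>D y * (taylor_rker k s y x - rker s (x - y))\<bar>)"
   using integral_abs_bound [of lborel "\<lambda>y. D y * (taylor_rker k s y x - rker s (x - y))"] by simp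
  also have "... \<le> (LBINT y. C * 2 powr p * norm x ^ k * (indicator (- ball 0 R) y * (\<bar>u y\<bar> * W y)))"
  proof (rule integral_mono')
   have "integrable lborel (\<lambda>y. indicator (- ball 0 R) y * (\<bar>u y\<bar> * W y))"
    by (rule integrable_bound [OF tail_W])
      (auto intro!: AE_I2 simp: indicator_def W_nonneg abs_mult)
   then show "integrable lborel (\<lambda>y. C * 2 powr p * norm x ^ k * (indicator (- ball 0 R) y * (\<bar>u y\<bar> * W y)))"
    by (rule integrable_mult_right)
   show "0 \<le> C * 2 powr p * norm x ^ k * (indicator (- ball 0 R) y * (\<bar>u y\<bar> * W y))" for y
    using C(1) by (simp add: W_nonneg)
   fix y :: "real ^ 'n"
   show "\<bar>D y * (taylor_rker k s y x - rker s (x - y))\<bar> \<le> C * 2 powr p * norm x ^ k * (indicator (- ball 0 R) y * (\<bar>u y\<bar> * W y))"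
   proof (cases "norm y < R")
    case False
    have y1: "1 \<le> norm y" using False R by linarith
    \<comment> \<open>For |y| \<ge> 1 one has 1 + |y| \<le> 2 |y|; this is the factor 2^p.\<close>
    have "norm y powr (- p) = (2 * norm y) powr (- p) * 2 powr p"
     using y1 by (simp add: powr_mult powr_minus)
    also have "... \<le> W y * 2 powr p"
     unfolding W_def using y1 p_pos by (intro mult_right_mono powr_mono2') auto
    finally have "C * norm x ^ k * norm y powr (- p) \<le> C * norm x ^ k * (W y * 2 powr p)"
     using C(1) by (intro mult_left_mono) auto
    moreover have "\<bar>rker s (x - y) - taylor_rker k s y x\<bar> \<le> C * norm x ^ k * norm y powr (- p)"
     using y1 x False by (intro C(2)) auto
    ultimately have "\<bar>taylor_rker k s y x - rker s (x - y)\<bar> \<le> C * norm x ^ k * (W y * 2 powr p)" by linarith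
    moreover have "\<bar>D y\<bar> \<le> \<bar>u y\<bar>" using w_le [of R' y] False by (simp add: D)
    ultimately have "\<bar>D y\<bar> * \<bar>taylor_rker k s y x - rker s (x - y)\<bar> \<le> \<bar>u y\<bar> * (C * norm x ^ k * (W y * 2 powr p))"
     by (intro mult_mono) auto
    then show ?thesis using False by (simp add: abs_mult mult_ac)
   qed (simp add: D)
  qed
  also have "... = C * 2 powr p * norm x ^ k * T R"
   unfolding T_def by (rule integral_mult_right_zero)
  finally show "\<bar>(G R' x + Q R' x) - (G R x + Q R x)\<bar> \<le> C * 2 powr p * norm x ^ k * T R" .
 qed
qed

lemma T_small:
 assumes "0 < e"
 obtains N :: nat where "\<And>R. real N \<le> R ==> c * T R < e"
proof -
 have "((\<lambda>R. c * T R) \<longlongrightarrow> c * 0) at_top" by (intro tendsto_mult tendsto_const T_tendsto)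
 then have "\<forall>\<^sub>F R in at_top. c * T R < e" using assms by (simp add: order_tendstoD(2))
 then obtain R0 where R0: "\<And>R. R0 \<le> R ==> c * T R < e" unfolding eventually_at_top_linorder by blast
 show thesis
 proof (rule that [of "nat \<lceil>R0\<rceil>"])
  fix R assume "real (nat \<lceil>R0\<rceil>) \<le> R"
  then show "c * T R < e" by (intro R0) linarith
 qed
qed

lemma Ginf_limit: "(\<lambda>i. G (real i) x + Q (real i) x) \<longlonglongrightarrow> Ginf x"
proof -
 obtain C where C: "C \<ge> 0" "\<And>x R R'. 1 \<le> R ==> 4 * norm x \<le> R ==> R \<le> R' ==>
  \<bar>(G R' x + Q R' x) - (G R x + Q R x)\<bar> \<le> C * norm x ^ k * T R"
  using increment by blast
 have "Cauchy (\<lambda>i. G (real i) x + Q (real i) x)"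
 proof (rule CauchyI')
  fix e :: real assume e: "0 < e"
  obtain N where N: "\<And>R. real N \<le> R ==> C * norm x ^ k * T R < e"
   using T_small [OF e, of "C * norm x ^ k"] by blast
  define N' where "N' = max N (max 1 (nat \<lceil>4 * norm x\<rceil>))"
  have "norm (G (real i) x + Q (real i) x - (G (real j) x + Q (real j) x)) < e" if "N' \<le> i" "i < j" for i j
  proof -
   have "1 \<le> real i" "4 * norm x \<le> real i" "real N \<le> real i" using that(1) unfolding N'_def by linarith+
   then have "\<bar>(G (real j) x + Q (real j) x) - (G (real i) x + Q (real i) x)\<bar> < e"
    using C(2) [of "real i" x "real j"] N [of "real i"] that(2) by fastforce
   then show ?thesis by (simp add: abs_minus_commute)
  qed
  then show "\<exists>M. \<forall>i\<ge>M. \<forall>j>i. dist (G (real i) x + Q (real i) x) (G (real j) x + Q (real j) x) < e"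
   unfolding dist_norm by blast
 qed
 then show ?thesis unfolding Ginf_def by (simp add: Cauchy_convergent convergent_LIMSEQ_iff [symmetric])
qed

lemma Ginf_close:
 obtains C where "C \<ge> 0" "\<And>x R. 1 \<le> R ==> 4 * norm x \<le> R ==> \<bar>Ginf x - (G R x + Q R x)\<bar> \<le> C * norm x ^ k * T R"
proof -
 obtain C where C: "C \<ge> 0" "\<And>x R R'. 1 \<le> R ==> 4 * norm x \<le> R ==> R \<le> R' ==>
  \<bar>(G R' x + Q R' x) - (G R x + Q R x)\<bar> \<le> C * norm x ^ k * T R"
  using increment by blast
 show thesis
 proof (rule that [OF C(1)])
  fix x :: "real ^ 'n" and R :: real assume R: "1 \<le> R" "4 * norm x \<le> R"
  have "(\<lambda>i. \<bar>(G (real i) x + Q (real i) x) - (G R x + Q R x)\<bar>) \<longlonglongrightarrow> \<bar>Ginf x - (G R x + Q R x)\<bar>"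
   by (intro tendsto_rabs tendsto_diff tendsto_const Ginf_limit)
  moreover have "\<forall>\<^sub>F i in sequentially. \<bar>(G (real i) x + Q (real i) x) - (G R x + Q R x)\<bar> \<le> C * norm x ^ k * T R"
   using eventually_ge_at_top [of "nat \<lceil>R\<rceil>"]
  proof eventually_elim
   case (elim i)
   then show ?case by (intro C(2) R) linarith
  qed
  ultimately show "\<bar>Ginf x - (G R x + Q R x)\<bar> \<le> C * norm x ^ k * T R"
   by (rule tendsto_upperbound) simp
 qed
qed

lemma G_continuous: "continuous_on (ball 0 R) (G R)"
 unfolding G_def w_def by (rule flap_cutoff_continuous [OF s u_cont u_C11])

lemma Ginf_continuous: "continuous_on UNIV Ginf"
proof -
 obtain C where C: "C \<ge> 0" "\<And>x R. 1 \<le> R ==> 4 * norm x \<le> R ==> \<bar>Ginf x - (G R x + Q R x)\<bar> \<le> C * norm x ^ k * T R"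
  using Ginf_close by blast
 have "continuous_on (ball 0 \<rho>) Ginf" for \<rho> :: real
 proof (rule uniform_limit_theorem)
  show "\<forall>\<^sub>F i in sequentially. continuous_on (ball 0 \<rho>) (\<lambda>x. G (real i) x + Q (real i) x)"
   using eventually_ge_at_top [of "nat \<lceil>\<rho>\<rceil>"]
  proof eventually_elim
   case (elim i)
   then have "\<rho> \<le> real i" by linarith
   then show ?case
    by (intro continuous_on_add continuous_on_subset [OF G_continuous subset_ball] polynomial_deg_le_continuous [OF Q_integrand(2)])
  qed
  show "uniform_limit (ball 0 \<rho>) (\<lambda>i x. G (real i) x + Q (real i) x) Ginf sequentially"
   unfolding uniform_limit_iff
  proof (intro allI impI)
   fix e :: real assume e: "0 < e"
   obtain N where N: "\<And>R. real N \<le> R ==> C * \<bar>\<rho>\<bar> ^ k * T R < e"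
    using T_small [OF e, of "C * \<bar>\<rho>\<bar> ^ k"] by blast
   show "\<forall>\<^sub>F i in sequentially. \<forall>x\<in>ball 0 \<rho>. dist (G (real i) x + Q (real i) x) (Ginf x) < e"
    using eventually_ge_at_top [of "max N (max 1 (nat \<lceil>4 * \<rho>\<rceil>))"]
   proof eventually_elim
    case (elim i)
    show ?case
    proof
     fix x :: "real ^ 'n" assume "x \<in> ball 0 \<rho>"
     then have x: "norm x < \<rho>" by simp
     have i: "1 \<le> real i" "4 * norm x \<le> real i" "real N \<le> real i" using elim x by linarith+
     have "C * norm x ^ k * T (real i) \<le> C * \<bar>\<rho>\<bar> ^ k * T (real i)"
      using x C(1) T_nonneg by (intro mult_right_mono mult_left_mono power_mono) auto
     then show "dist (G (real i) x + Q (real i) x) (Ginf x) < e"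
      using C(2) [OF i(1,2)] N [OF i(3)] by (simp add: dist_real_def abs_minus_commute)
    qed
   qed
  qed
 qed simp
 then have "isCont Ginf x" for x
  using continuous_on_eq_continuous_at [OF open_ball, of 0 "norm x + 1" Ginf] by fastforce
 then show ?thesis by (simp add: continuous_on_eq_continuous_at)
qed

end

text \<open>The kernel \<open>\<bar>z\<bar>\<^bsup>-n-2s\<^esup>\<close> equals \<open>(R\<^sup>2 + \<bar>z\<bar>\<^sup>2)\<^bsup>-b\<^esup> (1 - t)\<^bsup>-b\<^esup>\<close> with \<open>b = n/2 + s\<close> and
 \<open>t = R\<^sup>2 / (R\<^sup>2 + \<bar>z\<bar>\<^sup>2)\<close>; truncating the binomial series after \<open>k\<close> terms leaves a kernel that is
 smooth at scale \<open>R\<close> and differs from the original one by a rapidly decaying remainder.\<close>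

definition smooth_rker :: "real => nat => real => 'a::euclidean_space => real" where
 "smooth_rker s k R z = (let b = (real DIM('a) + 2 * s) / 2 in
   \<Sum>i<k. ((- b) gchoose i) * (- 1) ^ i * (R^2) ^ i * (R^2 + (norm z)^2) powr (- (b + real i)))"

lemma smooth_rker_measurable [measurable]: "smooth_rker s k R \<in> borel_measurable borel"
 unfolding smooth_rker_def Let_def by measurable

lemma smooth_rker_minus: "smooth_rker s k R (- z) = smooth_rker s k R z"
 by (simp add: smooth_rker_def)

lemma power_mult_powr_le:
 fixes X :: real
 assumes "0 \<le> Y" "Y \<le> X" "0 < X"
 shows "Y ^ i * X powr (- (b + real i)) \<le> X powr (- b)"
proof -
 have "Y ^ i * X powr (- (b + real i)) \<le> X ^ i * X powr (- (b + real i))"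
  using assms by (intro mult_right_mono power_mono) auto
 also have "... = X powr (real i) * X powr (- (b + real i))" using assms by (simp add: powr_realpow)
 also have "... = X powr (real i + - (b + real i))" by (rule powr_add [symmetric])
 also have "real i + - (b + real i) = - b" by simp
 finally show ?thesis .
qed

lemma smooth_rker_bound:
 fixes s :: real and T :: "'a::euclidean_space itself"
 obtains A where "A \<ge> 0" "\<And>R (z::'a). 0 < R ==>
  \<bar>smooth_rker s k R z\<bar> \<le> A * (R^2 + (norm z)^2) powr (- ((real DIM('a) + 2 * s) / 2))"
proof -
 define b where "b = (real DIM('a) + 2 * s) / 2"
 show thesis
 proof (rule that [of "\<Sum>i<k. \<bar>(- b) gchoose i\<bar>"])
  fix R :: real and z :: 'a assume R: "0 < R"
  have X: "0 < R^2 + (norm z)^2" using R by (simp add: add_pos_nonneg)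
  have "\<bar>smooth_rker s k R z\<bar> \<le> (\<Sum>i<k. \<bar>((- b) gchoose i) * (- 1) ^ i * (R^2) ^ i * (R^2 + (norm z)^2) powr (- (b + real i))\<bar>)"
   unfolding smooth_rker_def Let_def b_def [symmetric] by (rule sum_abs)
  also have "... \<le> (\<Sum>i<k. \<bar>(- b) gchoose i\<bar> * (R^2 + (norm z)^2) powr (- b))"
  proof (rule sum_mono)
   fix i
   have "(R^2) ^ i * (R^2 + (norm z)^2) powr (- (b + real i)) \<le> (R^2 + (norm z)^2) powr (- b)"
    using X by (intro power_mult_powr_le) auto
   from mult_left_mono [OF this abs_ge_zero [of "(- b) gchoose i"]]
   show "\<bar>((- b) gchoose i) * (- 1) ^ i * (R^2) ^ i * (R^2 + (norm z)^2) powr (- (b + real i))\<bar> \<le> \<bar>(- b) gchoose i\<bar> * (R^2 + (norm z)^2) powr (- b)"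
    by (simp add: abs_mult power_abs mult.assoc)
  qed
  finally show "\<bar>smooth_rker s k R z\<bar> \<le> (\<Sum>i<k. \<bar>(- b) gchoose i\<bar>) * (R^2 + (norm z)^2) powr (- ((real DIM('a) + 2 * s) / 2))"
   unfolding b_def [symmetric] by (simp only: sum_distrib_right)
 qed (simp add: sum_nonneg)
qed

lemma integrable_regular_rker:
 assumes s: "0 < s" "s < 1"
 shows "integrable lborel (\<lambda>z::'a::euclidean_space. (1 + (norm z)^2) powr (- ((real DIM('a) + 2 * s) / 2)))"
proof (rule integrable_bound)
 define b where "b = (real DIM('a) + 2 * s) / 2"
 have b: "0 < b" using s by (simp add: b_def add_nonneg_pos)
 have [measurable]: "ball (0::'a) 1 \<in> sets borel" by simp
 have "integrable lborel (\<lambda>z::'a. indicator (ball 0 1) z * (1::real))"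
  by (intro integrable_mult_left integrable_real_indicator) (use emeasure_bounded_finite [OF bounded_ball] in auto)
 moreover have "integrable lborel (\<lambda>z::'a. indicator (- ball 0 1) z * (1 * rker s z))"
  by (rule integrable_off_ball [OF s, where B = 1]) auto
 ultimately show "integrable lborel (\<lambda>z::'a. indicator (ball 0 1) z * (1::real) + indicator (- ball 0 1) z * (1 * rker s z))"
  by (rule integrable_add)
 show "AE z in lborel. norm ((1 + (norm z)^2) powr (- ((real DIM('a) + 2 * s) / 2))) \<le>
   norm (indicator (ball (0::'a) 1) z * (1::real) + indicator (- ball 0 1) z * (1 * rker s z))"
  unfolding b_def [symmetric]
 proof (intro AE_I2)
  fix z :: 'a
  show "norm ((1 + (norm z)^2) powr (- b)) \<le> norm (indicator (ball 0 1) z * (1::real) + indicator (- ball 0 1) z * (1 * rker s z))"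
  proof (cases "norm z < 1")
   case True
   have "(1 + (norm z)^2) powr (- b) \<le> 1 powr (- b)" using b by (intro powr_mono2') auto
   then show ?thesis using True by simp
  next
   case False
   then have "z \<noteq> 0" by auto
   then have z: "0 < (norm z)^2" by simp
   have "(1 + (norm z)^2) powr (- b) \<le> (0 + (norm z)^2) powr (- b)" using b z by (intro powr_mono2') auto
   then show ?thesis using False by (simp add: rker_eq b_def [symmetric])
  qed
 qed
qed measurable

lemma smooth_rker_integrable:
 assumes s: "0 < s" "s < 1" and R: "1 \<le> R"
 shows "integrable lborel (smooth_rker s k R :: 'a::euclidean_space => real)"
proof -
 define b where "b = (real DIM('a) + 2 * s) / 2"
 have b: "0 < b" using s by (simp add: b_def add_nonneg_pos)
 obtain A where A: "A \<ge> 0" "\<And>R (z::'a). 0 < R ==> \<bar>smooth_rker s k R z\<bar> \<le> A * (R^2 + (norm z)^2) powr (- b)"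
  using smooth_rker_bound [where 'a = 'a, of s k] unfolding b_def by blast
 have "integrable lborel (\<lambda>z::'a. A * (1 + (norm z)^2) powr (- b))"
  unfolding b_def by (intro integrable_mult_right integrable_regular_rker s)
 then show ?thesis
 proof (rule integrable_bound)
  show "AE z in lborel. norm (smooth_rker s k R z) \<le> norm (A * (1 + (norm (z::'a))^2) powr (- b))" (is "AE z in _. ?P z")
  proof (intro AE_I2)
   fix z :: 'a
   have "1 \<le> R^2" using R by simp
   then have "(R^2 + (norm z)^2) powr (- b) \<le> (1 + (norm z)^2) powr (- b)" using b by (intro powr_mono2') (auto simp: add_pos_nonneg)
   then have "A * (R^2 + (norm z)^2) powr (- b) \<le> A * (1 + (norm z)^2) powr (- b)" by (rule mult_left_mono [OF _ A(1)])
   moreover have "\<bar>smooth_rker s k R z\<bar> \<le> A * (R^2 + (norm z)^2) powr (- b)" using R by (intro A(2)) simp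
   ultimately show "?P z" using A(1) by simp
  qed
 qed measurable
qed

lemma powr_neg_square_tendsto_0:
 assumes "0 < c"
 shows "(\<lambda>i. ((real (i + N))^2) powr (- c)) \<longlonglongrightarrow> 0"
proof (rule tendsto_neg_powr)
 show "- c < 0" using assms by simp
 have "filterlim (\<lambda>i. real (i + N)) at_top sequentially"
  by (intro filterlim_compose [OF filterlim_real_sequentially] filterlim_add_const_nat_at_top)
 then show "filterlim (\<lambda>i. (real (i + N))^2) at_top sequentially"
  by (intro filterlim_pow_at_top) auto
qed

text \<open>By homogeneity the mass is a multiple of R^(-2s). Here the limit comes from dominated
  convergence with a multiple of (1 + |z|^2)^(-b) as majorant.\<close>

lemma smooth_rker_mass_tendsto:
 assumes s: "0 < s" "s < 1" and N: "1 \<le> N"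
 shows "(\<lambda>i. LBINT (z::'a::euclidean_space). smooth_rker s k (real (i + N)) z) \<longlonglongrightarrow> 0"
proof -
 define b where "b = (real DIM('a) + 2 * s) / 2"
 have b: "0 < b" using s by (simp add: b_def add_nonneg_pos)
 obtain A where A: "A \<ge> 0" "\<And>R (z::'a). 0 < R ==> \<bar>smooth_rker s k R z\<bar> \<le> A * (R^2 + (norm z)^2) powr (- b)"
  using smooth_rker_bound [where 'a = 'a, of s k] unfolding b_def by blast
 have "(\<lambda>i. LBINT (z::'a). smooth_rker s k (real (i + N)) z) \<longlonglongrightarrow> (\<integral>z. 0 \<partial>(lborel :: 'a measure))"
 proof (rule integral_dominated_convergence)
  show "integrable lborel (\<lambda>z::'a. A * (1 + (norm z)^2) powr (- b))"
   unfolding b_def by (intro integrable_mult_right integrable_regular_rker s)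
  show "AE z in lborel. norm (smooth_rker s k (real (i + N)) z) \<le> A * (1 + (norm (z::'a))^2) powr (- b)" (is "AE z in _. ?P z") for i
  proof (intro AE_I2)
   fix z :: 'a
   have R: "1 \<le> real (i + N)" using N by simp
   then have "1 \<le> (real (i + N))^2" by (rule one_le_power)
   then have "((real (i + N))^2 + (norm z)^2) powr (- b) \<le> (1 + (norm z)^2) powr (- b)" using b by (intro powr_mono2') (auto simp: add_pos_nonneg)
   then have "A * ((real (i + N))^2 + (norm z)^2) powr (- b) \<le> A * (1 + (norm z)^2) powr (- b)" by (rule mult_left_mono [OF _ A(1)])
   moreover have "\<bar>smooth_rker s k (real (i + N)) z\<bar> \<le> A * ((real (i + N))^2 + (norm z)^2) powr (- b)" using R by (intro A(2)) linarith
   ultimately show "?P z" by simp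
  qed
  show "AE z :: 'a in lborel. (\<lambda>i. smooth_rker s k (real (i + N)) z) \<longlonglongrightarrow> 0" (is "AE z in _. ?P z")
  proof (intro AE_I2)
   fix z :: 'a
   show "?P z"
   proof (rule Lim_null_comparison)
    show "\<forall>\<^sub>F i in sequentially. norm (smooth_rker s k (real (i + N)) z) \<le> A * ((real (i + N))^2) powr (- b)"
    proof (intro always_eventually allI)
     fix i
     have R: "0 < real (i + N)" using N by simp
     then have "((real (i + N))^2 + (norm z)^2) powr (- b) \<le> ((real (i + N))^2) powr (- b)"
      using b by (intro powr_mono2') (auto intro!: zero_less_power)
     then have "A * ((real (i + N))^2 + (norm z)^2) powr (- b) \<le> A * ((real (i + N))^2) powr (- b)" by (rule mult_left_mono [OF _ A(1)])
     with A(2) [OF R, of z] show "norm (smooth_rker s k (real (i + N)) z) \<le> A * ((real (i + N))^2) powr (- b)" by simp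
    qed
    show "(\<lambda>i. A * ((real (i + N))^2) powr (- b)) \<longlonglongrightarrow> 0"
     by (intro tendsto_mult_right_zero powr_neg_square_tendsto_0 b)
   qed
  qed
 qed measurable
 then show ?thesis by simp
qed

text \<open>Every summand is an inverse power with \<epsilon> = R^2, and h is small against R. So
  the estimate holds for all z, also at the origin, where the original kernel is singular; the
  smoothing is made for this.\<close>

lemma fdiff_smooth_rker_bound:
 fixes h :: "'a::euclidean_space"
 assumes s: "0 < s"
 obtains A where "A \<ge> 0" "\<And>R z. 1 \<le> R ==> 8 * (real m + 1) * norm h \<le> R ==>
  \<bar>fdiff m h (smooth_rker s k R) z\<bar> \<le> A * (R^2 + (norm z)^2) powr (- ((real DIM('a) + 2 * s + real m) / 2))"
proof -
 define b where "b = (real DIM('a) + 2 * s) / 2"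
 have b: "0 < b" using s by (simp add: b_def add_nonneg_pos)
 have "\<exists>C\<ge>0. \<forall>(y::'a) h \<epsilon>. 0 \<le> \<epsilon> \<longrightarrow> 0 < \<epsilon> + (norm y)^2 \<longrightarrow> 8 * (real m + 1) * norm h \<le> sqrt (\<epsilon> + (norm y)^2) \<longrightarrow>
   \<bar>fdiff m h (\<lambda>z. (\<epsilon> + (norm z)^2) powr (- (b + real i))) y\<bar>
    \<le> C * (\<epsilon> + (norm y)^2) powr (- (b + real i)) * (norm h / sqrt (\<epsilon> + (norm y)^2)) ^ m" for i
 proof -
  have "0 < b + real i" using b by simp
  from fdiff_inverse_power_bound [OF this, where 'a = 'a and m = m] show ?thesis by metis
 qed
 then obtain C where C: "\<And>i. C i \<ge> 0" "\<And>i (y::'a) h \<epsilon>. 0 \<le> \<epsilon> ==> 0 < \<epsilon> + (norm y)^2 ==> 8 * (real m + 1) * norm h \<le> sqrt (\<epsilon> + (norm y)^2) ==>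
   \<bar>fdiff m h (\<lambda>z. (\<epsilon> + (norm z)^2) powr (- (b + real i))) y\<bar>
    \<le> C i * (\<epsilon> + (norm y)^2) powr (- (b + real i)) * (norm h / sqrt (\<epsilon> + (norm y)^2)) ^ m"
  by metis
 show thesis
 proof (rule that [of "\<Sum>i<k. \<bar>(- b) gchoose i\<bar> * C i * norm h ^ m"])
  show "0 \<le> (\<Sum>i<k. \<bar>(- b) gchoose i\<bar> * C i * norm h ^ m)" using C(1) by (intro sum_nonneg) simp
  fix R :: real and z :: 'a assume R: "1 \<le> R" and h: "8 * (real m + 1) * norm h \<le> R"
  define X where "X = R^2 + (norm z)^2"
  have R2: "1 \<le> R^2" using R by (rule one_le_power)
  have X: "0 < X" "R^2 \<le> X" using R2 zero_le_power2 [of "norm z"] unfolding X_def by linarith+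
  have "R \<le> sqrt X" using X(2) R by (intro real_le_rsqrt)
  then have hX: "8 * (real m + 1) * norm h \<le> sqrt X" using h by simp
  have m2: "1 / sqrt X ^ m = X powr (- (real m / 2))"
  proof -
   have "sqrt X ^ m = (X powr (1/2)) powr (real m)" using X by (simp add: powr_half_sqrt powr_realpow)
   also have "... = X powr (real m / 2)" by (simp add: powr_powr)
   finally show ?thesis by (simp add: powr_minus_divide)
  qed
  have "fdiff m h (smooth_rker s k R) z = (\<Sum>i<k. ((- b) gchoose i) * (- 1) ^ i * (R^2) ^ i *
    fdiff m h (\<lambda>z. (R^2 + (norm z)^2) powr (- (b + real i))) z)"
  proof -
   have "fdiff m h (smooth_rker s k R) z = (\<Sum>j\<le>m. \<Sum>i<k. (- 1) ^ j * real (m choose j) *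
     (((- b) gchoose i) * (- 1) ^ i * (R^2) ^ i * (R^2 + (norm (z + real j *\<^sub>R h))^2) powr (- (b + real i))))"
    unfolding fdiff_def smooth_rker_def Let_def b_def [symmetric] sum_distrib_left ..
   also have "... = (\<Sum>i<k. \<Sum>j\<le>m. (- 1) ^ j * real (m choose j) *
     (((- b) gchoose i) * (- 1) ^ i * (R^2) ^ i * (R^2 + (norm (z + real j *\<^sub>R h))^2) powr (- (b + real i))))"
    by (rule sum.swap)
   also have "... = (\<Sum>i<k. ((- b) gchoose i) * (- 1) ^ i * (R^2) ^ i *
    fdiff m h (\<lambda>z. (R^2 + (norm z)^2) powr (- (b + real i))) z)"
    unfolding fdiff_def sum_distrib_left by (intro sum.cong refl) (simp only: mult_ac)
   finally show ?thesis .
  qed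
  then have "\<bar>fdiff m h (smooth_rker s k R) z\<bar> \<le> (\<Sum>i<k. \<bar>((- b) gchoose i) * (- 1) ^ i * (R^2) ^ i *
    fdiff m h (\<lambda>z. (R^2 + (norm z)^2) powr (- (b + real i))) z\<bar>)" by (simp only: sum_abs)
  also have "... \<le> (\<Sum>i<k. \<bar>(- b) gchoose i\<bar> * C i * norm h ^ m * X powr (- (b + real m / 2)))"
  proof (rule sum_mono)
   fix i
   have "\<bar>fdiff m h (\<lambda>z. (R^2 + (norm z)^2) powr (- (b + real i))) z\<bar> \<le> C i * X powr (- (b + real i)) * (norm h / sqrt X) ^ m"
    unfolding X_def using X hX unfolding X_def by (intro C(2)) auto
   then have "(R^2) ^ i * \<bar>fdiff m h (\<lambda>z. (R^2 + (norm z)^2) powr (- (b + real i))) z\<bar> \<le>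
     (R^2) ^ i * (C i * X powr (- (b + real i)) * (norm h / sqrt X) ^ m)" by (intro mult_left_mono) auto
   also have "... = C i * (norm h / sqrt X) ^ m * ((R^2) ^ i * X powr (- (b + real i)))" by (simp only: mult_ac)
   also have "... \<le> C i * (norm h / sqrt X) ^ m * X powr (- b)"
    using X C(1) by (intro mult_left_mono power_mult_powr_le) auto
   also have "... = C i * norm h ^ m * (X powr (- b) * (1 / sqrt X ^ m))" by (simp add: power_divide)
   also have "X powr (- b) * (1 / sqrt X ^ m) = X powr (- (b + real m / 2))"
    unfolding m2 by (simp add: powr_add [symmetric])
   finally have "(R^2) ^ i * \<bar>fdiff m h (\<lambda>z. (R^2 + (norm z)^2) powr (- (b + real i))) z\<bar> \<le> C i * norm h ^ m * X powr (- (b + real m / 2))" .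
   from mult_left_mono [OF this abs_ge_zero [of "(- b) gchoose i"]]
   show "\<bar>((- b) gchoose i) * (- 1) ^ i * (R^2) ^ i * fdiff m h (\<lambda>z. (R^2 + (norm z)^2) powr (- (b + real i))) z\<bar>
    \<le> \<bar>(- b) gchoose i\<bar> * C i * norm h ^ m * X powr (- (b + real m / 2))"
    by (simp add: abs_mult power_abs mult.assoc)
  qed
  also have "... = (\<Sum>i<k. \<bar>(- b) gchoose i\<bar> * C i * norm h ^ m) * X powr (- (b + real m / 2))"
   by (simp only: sum_distrib_right)
  also have "b + real m / 2 = (real DIM('a) + 2 * s + real m) / 2" by (simp add: b_def add_divide_distrib)
  finally show "\<bar>fdiff m h (smooth_rker s k R) z\<bar> \<le> (\<Sum>i<k. \<bar>(- b) gchoose i\<bar> * C i * norm h ^ m) *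
    (R^2 + (norm z)^2) powr (- ((real DIM('a) + 2 * s + real m) / 2))" unfolding X_def .
 qed
qed

text \<open>The condition R \<le> 2 |z| gives t = R^2 / (R^2 + |z|^2) \<le> 4/5, away from the
  radius of convergence, and the remainder after k terms is of order t^k.\<close>

lemma smooth_rker_remainder:
 assumes s: "0 < s"
 obtains C where "C \<ge> 0" "\<And>R (z::'a::euclidean_space). 0 < R ==> R \<le> 2 * norm z ==>
  \<bar>rker s z - smooth_rker s k R z\<bar> \<le> C * (R^2) ^ k * (R^2 + (norm z)^2) powr (- ((real DIM('a) + 2 * s) / 2 + real k))"
proof -
 define b where "b = (real DIM('a) + 2 * s) / 2"
 obtain C where C: "C \<ge> 0" "\<And>z. \<bar>z\<bar> \<le> 4/5 ==> \<bar>(1 + z) powr (- b) - (\<Sum>i<k. ((- b) gchoose i) * z ^ i)\<bar> \<le> C * \<bar>z\<bar> ^ k"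
 proof -
  have K: "(0::real) \<le> 4/5" "4/5 < (1::real)" by auto
  show thesis by (rule power_series_tail_bound [OF binomial_sums [of _ b] K, of k]) (assumption, rule that)
 qed
 show thesis
 proof (rule that [OF C(1)])
  fix R :: real and z :: 'a assume R: "0 < R" "R \<le> 2 * norm z"
  define X where "X = R^2 + (norm z)^2"
  define t where "t = R^2 / X"
  have z: "0 < norm z" using R by linarith
  have X: "0 < X" using R by (simp add: X_def add_pos_nonneg)
  have t0: "0 \<le> t" using X by (simp add: t_def)
  have "R^2 \<le> (2 * norm z)^2" using R by (intro power_mono) auto
  then have "5 * R^2 \<le> 4 * X" by (simp add: X_def power_mult_distrib)
  then have t: "\<bar>- t\<bar> \<le> 4/5" using X t0 by (simp add: t_def divide_simps)
  have tX: "R^2 = t * X" using X by (simp add: t_def)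
  have "X * (1 + - t) = X - t * X" by (simp add: algebra_simps)
  also have "... = (norm z)^2" unfolding tX [symmetric] by (simp add: X_def)
  finally have "(norm z)^2 = X * (1 + - t)" by simp
  then have r: "rker s z = X powr (- b) * (1 + - t) powr (- b)"
   unfolding rker_eq b_def [symmetric] add_0 by (simp only: powr_mult)
  have sm: "smooth_rker s k R z = X powr (- b) * (\<Sum>i<k. ((- b) gchoose i) * (- t) ^ i)"
   unfolding smooth_rker_def Let_def b_def [symmetric] X_def [symmetric] sum_distrib_left
  proof (intro sum.cong refl)
   fix i
   have "X powr (- (b + real i)) * X ^ i = X powr (- (b + real i)) * X powr (real i)" using X by (simp add: powr_realpow)
   also have "... = X powr (- (b + real i) + real i)" by (rule powr_add [symmetric])
   also have "- (b + real i) + real i = - b" by simp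
   finally have e: "X powr (- (b + real i)) * X ^ i = X powr (- b)" .
   have "((- b) gchoose i) * (- 1) ^ i * (R^2) ^ i * X powr (- (b + real i)) =
     ((- b) gchoose i) * ((- 1) ^ i * t ^ i) * (X powr (- (b + real i)) * X ^ i)"
    unfolding tX power_mult_distrib by (simp only: mult_ac)
   also have "(- 1) ^ i * t ^ i = (- t) ^ i" by (simp add: power_minus [of t])
   finally show "((- b) gchoose i) * (- 1) ^ i * (R^2) ^ i * X powr (- (b + real i)) = X powr (- b) * (((- b) gchoose i) * (- t) ^ i)"
    unfolding e by (simp only: mult_ac)
  qed
  have "\<bar>rker s z - smooth_rker s k R z\<bar> = X powr (- b) * \<bar>(1 + - t) powr (- b) - (\<Sum>i<k. ((- b) gchoose i) * (- t) ^ i)\<bar>"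
   unfolding r sm right_diff_distrib [symmetric] by (simp add: abs_mult)
  also have "... \<le> X powr (- b) * (C * \<bar>- t\<bar> ^ k)" by (intro mult_left_mono C(2) t) simp
  also have "... = C * (R^2) ^ k * (X powr (- b) / X ^ k)"
   using t0 X by (simp add: t_def power_divide)
  also have "X powr (- b) / X ^ k = X powr (- (b + real k))"
  proof -
   have "X powr (- b) / X ^ k = X powr (- b) / X powr (real k)" using X by (simp add: powr_realpow)
   also have "... = X powr (- b - real k)" by (simp add: powr_diff)
   finally show ?thesis by simp
  qed
  finally show "\<bar>rker s z - smooth_rker s k R z\<bar> \<le> C * (R^2) ^ k * (R^2 + (norm z)^2) powr (- ((real DIM('a) + 2 * s) / 2 + real k))"
   unfolding X_def b_def .
 qed
qed

text \<open>Evenness identifies integration over x + z against K z with convolution, so that the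
  difference may pass from f to K.\<close>

lemma fdiff_convolution_even:
 fixes f K :: "'a::euclidean_space => real"
 assumes even: "\<And>z. K (- z) = K z"
  and int: "\<And>j. j \<le> m ==> integrable lborel (\<lambda>y. f y * K (x + real j *\<^sub>R h - y))"
 shows "integrable lborel (\<lambda>z. fdiff m h f (x + z) * K z)"
  and "(LBINT z. fdiff m h f (x + z) * K z) = (LBINT y. f y * fdiff m h K (x - y))"
proof -
 have e: "f (x + z + real j *\<^sub>R h) * K z = (\<lambda>y. f y * K (x + real j *\<^sub>R h - y)) ((x + real j *\<^sub>R h) + z)" for j z
  by (simp add: even add_ac)
 have i: "integrable lborel (\<lambda>z. f (x + z + real j *\<^sub>R h) * K z)"
  "(LBINT z. f (x + z + real j *\<^sub>R h) * K z) = (LBINT y. f y * K (x + real j *\<^sub>R h - y))" if "j \<le> m" for j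
 proof -
  show "integrable lborel (\<lambda>z. f (x + z + real j *\<^sub>R h) * K z)"
   unfolding e using int [OF that] by (subst integrable_lborel_shift_iff)
  show "(LBINT z. f (x + z + real j *\<^sub>R h) * K z) = (LBINT y. f y * K (x + real j *\<^sub>R h - y))"
   unfolding e by (rule integral_lborel_shift)
 qed
 have s: "fdiff m h f (x + z) * K z = (\<Sum>j\<le>m. (-1)^j * real (m choose j) * (f (x + z + real j *\<^sub>R h) * K z))" for z
  unfolding fdiff_def sum_distrib_right by (simp only: mult.assoc)
 show "integrable lborel (\<lambda>z. fdiff m h f (x + z) * K z)"
  unfolding s by (intro integrable_sum integrable_mult_right i) simp
 have "(LBINT z. fdiff m h f (x + z) * K z) = (\<Sum>j\<le>m. (-1)^j * real (m choose j) * (LBINT z. f (x + z + real j *\<^sub>R h) * K z))"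
 proof -
  have "(LBINT z. fdiff m h f (x + z) * K z) = (\<Sum>j\<le>m. LBINT z. (-1)^j * real (m choose j) * (f (x + z + real j *\<^sub>R h) * K z))"
   unfolding s by (intro integral_sum integrable_mult_right i) simp
  then show ?thesis by (simp only: integral_mult_right_zero)
 qed
 also have "... = fdiff m h (\<lambda>z. LBINT y. f y * K (z - y)) x"
  unfolding fdiff_def by (intro sum.cong refl) (simp add: i)
 also have "... = (LBINT y. f y * fdiff m h K (x - y))" by (rule fdiff_convolution [OF int])
 finally show "(LBINT z. fdiff m h f (x + z) * K z) = (LBINT y. f y * fdiff m h K (x - y))" .
qed

lemma integral_reflect_even:
 fixes f K :: "'a::euclidean_space => real"
 assumes even: "\<And>z. K (- z) = K z" and int: "integrable lborel (\<lambda>z. f (x + z) * K z)"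
 shows "integrable lborel (\<lambda>z. f (x - z) * K z)"
  and "(LBINT z. f (x - z) * K z) = (LBINT z. f (x + z) * K z)"
proof -
 have e: "f (x - z) * K z = (\<lambda>z. f (x + z) * K z) (0 - z)" for z by (simp add: even)
 show "integrable lborel (\<lambda>z. f (x - z) * K z)"
  unfolding e using int by (subst integrable_lborel_reflect_iff)
 show "(LBINT z. f (x - z) * K z) = (LBINT z. f (x + z) * K z)"
  unfolding e by (rule integral_lborel_reflect)
qed

section \<open>Differences of order k of the fractional Laplacian of the cut-off\<close>

context polynomial_tail
begin

text \<open>With d = |x - y| one has 1 + |y| \<le> 2 R + d, and (2 R + d)^2 \<le> 8 (R^2 +
  d^2).\<close>

lemma weight_bound:
 assumes R: "1 \<le> R" and x: "norm x \<le> R"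
 shows "(R^2 + (norm (x - y))^2) powr (- (p / 2)) \<le> 8 powr (p / 2) * W y"
proof -
 define d where "d = norm (x - y)"
 have "norm y \<le> norm x + d" using norm_triangle_sub [of y x] by (simp add: d_def norm_minus_commute)
 then have "1 + norm y \<le> 2 * R + d" using R x by linarith
 then have "(1 + norm y)^2 \<le> (2 * R + d)^2" by (intro power_mono) auto
 also have "... \<le> 8 * (R^2 + d^2)"
 proof -
  have "8 * (R^2 + d^2) - (2 * R + d)^2 = (2 * R - d)^2 + 6 * d^2" by (simp add: power2_eq_square algebra_simps)
  moreover have "0 \<le> (2 * R - d)^2 + 6 * d^2" by simp
  ultimately show ?thesis by linarith
 qed
 finally have le: "(1 + norm y)^2 * (1/8) \<le> R^2 + d^2" by simp
 have y: "0 < 1 + norm y" by (simp add: add_pos_nonneg)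
 have "(R^2 + d^2) powr (- (p / 2)) \<le> ((1 + norm y)^2 * (1/8)) powr (- (p / 2))"
  using le y p_pos by (intro powr_mono2') auto
 also have "... = ((1 + norm y)^2) powr (- (p / 2)) * (1/8) powr (- (p / 2))" by (rule powr_mult)
 also have "(1 + norm y)^2 = (1 + norm y) powr 2" using y by simp
 also have "((1 + norm y) powr 2) powr (- (p / 2)) = W y" unfolding powr_powr W_def by simp
 also have "(1/8 :: real) powr (- (p / 2)) = 8 powr (p / 2)" by (simp add: powr_minus_divide powr_divide)
 finally show ?thesis unfolding d_def by (simp only: mult.commute)
qed

definition "v R = (\<lambda>y. indicator (- ball 0 R) y * u y)"

lemma v_borel [measurable]: "v R \<in> borel_measurable borel" unfolding v_def by measurable

lemma v_le: "\<bar>v R y\<bar> \<le> \<bar>u y\<bar>" by (simp add: v_def indicator_def)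

lemma u_split: "u y = w R y + v R y" by (simp add: w_def v_def indicator_def)

lemma integrable_tail_bound:
 assumes [measurable]: "f \<in> borel_measurable borel" and "\<And>y. \<bar>f y\<bar> \<le> C * (\<bar>u y\<bar> * W y)"
 shows "integrable lborel f"
proof (rule integrable_bound [OF integrable_mult_right [OF tail_W, of C]])
 show "AE y in lborel. norm (f y) \<le> norm (C * (\<bar>u y\<bar> * W y))"
  using assms(2) by (intro AE_I2) (simp add: order.trans [OF _ abs_ge_self])
qed measurable

lemma fdiff_smooth_weighted:
 obtains A where "A \<ge> 0" "\<And>R x y. 1 \<le> R ==> norm x \<le> R ==> 8 * (real k + 1) * norm h \<le> R ==>
  \<bar>fdiff k h (smooth_rker s k R) (x - y)\<bar> \<le> A * W y"
  "\<And>R z. 1 \<le> R ==> 8 * (real k + 1) * norm h \<le> R ==>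
  \<bar>fdiff k h (smooth_rker s k R) z\<bar> \<le> A * (R^2) powr (- (p / 2))"
proof -
 obtain A where A: "A \<ge> 0" "\<And>R z. 1 \<le> R ==> 8 * (real k + 1) * norm h \<le> R ==>
  \<bar>fdiff k h (smooth_rker s k R) z\<bar> \<le> A * (R^2 + (norm z)^2) powr (- (p / 2))"
  using fdiff_smooth_rker_bound [OF s(1), where 'a = "real ^ 'n" and h = h and k = k and m = k] unfolding p_def by blast
 show thesis
 proof (rule that [of "A * (8 powr (p / 2) + 1)"])
  show "0 \<le> A * (8 powr (p / 2) + 1)" using A(1) by (simp add: add_nonneg_nonneg)
  fix R :: real and x y z :: "real ^ 'n"
  assume R: "1 \<le> R" and h: "8 * (real k + 1) * norm h \<le> R"
  show "\<bar>fdiff k h (smooth_rker s k R) (x - y)\<bar> \<le> A * (8 powr (p / 2) + 1) * W y" if x: "norm x \<le> R"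
  proof -
   have "\<bar>fdiff k h (smooth_rker s k R) (x - y)\<bar> \<le> A * (R^2 + (norm (x - y))^2) powr (- (p / 2))" by (rule A(2) [OF R h])
   also have "... \<le> A * (8 powr (p / 2) * W y)" by (intro mult_left_mono weight_bound R x A(1))
   also have "... \<le> A * ((8 powr (p / 2) + 1) * W y)" using A(1) W_nonneg [of y] by (intro mult_left_mono mult_right_mono) auto
   finally show ?thesis by (simp only: mult.assoc)
  qed
  have "\<bar>fdiff k h (smooth_rker s k R) z\<bar> \<le> A * (R^2 + (norm z)^2) powr (- (p / 2))" by (rule A(2) [OF R h])
  also have "... \<le> A * (R^2) powr (- (p / 2))"
  proof (intro mult_left_mono A(1) powr_mono2')
   show "0 < R^2" using R by simp
  qed (use p_pos in auto)
  also have "... \<le> A * (8 powr (p / 2) + 1) * (R^2) powr (- (p / 2))"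
   using A(1) by (intro mult_right_mono) (auto simp: mult_le_cancel_left1)
  finally show "\<bar>fdiff k h (smooth_rker s k R) z\<bar> \<le> A * (8 powr (p / 2) + 1) * (R^2) powr (- (p / 2))" .
 qed
qed

lemma fdiff_rker_weighted:
 obtains C where "C \<ge> 0" "\<And>R x y. 2 \<le> R ==> 2 * norm x \<le> R ==> 16 * (real k + 1) * norm h \<le> R ==>
  \<bar>v R y * fdiff k h (rker s) (x - y)\<bar> \<le> C * (\<bar>u y\<bar> * W y)"
proof -
 obtain C where C: "C \<ge> 0" "\<And>z::real^'n. 8 * (real k + 1) * norm h \<le> norm z ==> 1 \<le> norm z ==>
  \<bar>fdiff k h (rker s) z\<bar> \<le> C * norm z powr (- (real (DIM(real^'n) + k) + 2 * s))"
  using fdiff_rker_bound [OF s(1), of k h] by blast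
 have pe: "real (DIM(real^'n) + k) + 2 * s = p" by (simp add: p_def)
 show thesis
 proof (rule that [of "C * 4 powr p"])
  show "0 \<le> C * 4 powr p" using C(1) by simp
  fix R :: real and x y :: "real ^ 'n"
  assume R: "2 \<le> R" and x: "2 * norm x \<le> R" and h: "16 * (real k + 1) * norm h \<le> R"
  show "\<bar>v R y * fdiff k h (rker s) (x - y)\<bar> \<le> C * 4 powr p * (\<bar>u y\<bar> * W y)"
  proof (cases "norm y < R")
   case False
   have "norm y - norm x \<le> norm (x - y)" using norm_triangle_ineq2 [of y x] by (simp add: norm_minus_commute)
   then have z: "norm y / 2 \<le> norm (x - y)" using False x by linarith
   have z1: "1 \<le> norm (x - y)" "8 * (real k + 1) * norm h \<le> norm (x - y)" using z False R h by linarith+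
   have "1 \<le> norm y" using False R by linarith
   then have "(1 + norm y) * (1/4) \<le> norm y / 2" by simp
   then have z4: "(1 + norm y) * (1/4) \<le> norm (x - y)" using z by (rule order.trans)
   have y: "0 < 1 + norm y" by (simp add: add_pos_nonneg)
   have "norm (x - y) powr (- p) \<le> ((1 + norm y) * (1/4)) powr (- p)"
    using z4 y p_pos by (intro powr_mono2') auto
   also have "... = W y * (1/4) powr (- p)" by (simp only: powr_mult W_def)
   also have "(1/4 :: real) powr (- p) = 4 powr p" by (simp add: powr_minus_divide powr_divide)
   finally have "C * norm (x - y) powr (- p) \<le> C * (W y * 4 powr p)" by (rule mult_left_mono [OF _ C(1)])
   then have "\<bar>fdiff k h (rker s) (x - y)\<bar> \<le> C * (W y * 4 powr p)" using C(2) [OF z1(2,1)] unfolding pe by linarith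
   then have "\<bar>v R y\<bar> * \<bar>fdiff k h (rker s) (x - y)\<bar> \<le> \<bar>u y\<bar> * (C * (W y * 4 powr p))"
    by (intro mult_mono v_le) auto
   then show ?thesis by (simp add: abs_mult mult_ac)
  next
   case True
   then show ?thesis using C(1) by (simp add: v_def W_nonneg)
  qed
 qed
qed

text \<open>The obstacle is that u outside B_R need not be integrable against the full kernel, so
  the difference cannot be moved onto it directly. The kernel is split into J1 + J2, with J2 the
  smooth kernel. Against J1, which decays fast enough, the second difference is expressed by the
  outer part \<open>v R\<close> of u; against J2, which is integrable, by the bounded inner part
  \<open>w R\<close>. The difference is moved onto each piece separately, and the pieces are
  recombined.\<close>

lemma fdiff_G:
 assumes R: "2 \<le> R" and xh: "norm x + real k * norm h < R / 2" and h: "16 * (real k + 1) * norm h \<le> R"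
 shows "fdiff k h (G R) x = fdiff k h u x * (LBINT z. smooth_rker s k R (z :: real ^ 'n))
   - (LBINT y. u y * fdiff k h (smooth_rker s k R) (x - y)) + (LBINT y. v R y * fdiff k h (rker s) (x - y))"
proof -
 define J2 :: "real ^ 'n => real" where "J2 = smooth_rker s k R"
 define J1 :: "real ^ 'n => real" where "J1 z = rker s z - J2 z" for z
 have [measurable]: "J2 \<in> borel_measurable borel" unfolding J2_def by measurable
 have [measurable]: "J1 \<in> borel_measurable borel" unfolding J1_def [abs_def] by measurable
 have even2: "J2 (- z) = J2 z" for z by (simp add: J2_def smooth_rker_minus)
 have even1: "J1 (- z) = J1 z" for z by (simp add: J1_def even2 rker_minus)
 have R1: "1 \<le> R" "0 < R" using R by auto
 have h0: "0 \<le> real k * norm h" "0 \<le> 8 * (real k + 1) * norm h" by auto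
 have xR: "2 * norm x \<le> R" "norm x \<le> R" "norm x < R" using xh h0 R1 norm_ge_zero [of x] by linarith+
 have h8: "8 * (real k + 1) * norm h \<le> R" using h h0 by linarith
 have xj: "norm (x + real j *\<^sub>R h) < R / 2" if "j \<le> k" for j by (rule fdiff_abs_le_ball [OF xh that])
 have vJ1: "integrable lborel (\<lambda>y. v R y * J1 (x + real j *\<^sub>R h - y))" if j: "j \<le> k" for j
 proof -
  define z where "z = x + real j *\<^sub>R h"
  have z: "norm z < R / 2" unfolding z_def by (rule xj [OF j])
  define b where "b = (real DIM(real ^ 'n) + 2 * s) / 2"
  have bp: "p / 2 \<le> b + real k" by (simp add: p_def b_def add_divide_distrib)
  obtain C where C: "C \<ge> 0" "\<And>R (z::real ^ 'n). 0 < R ==> R \<le> 2 * norm z ==>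
   \<bar>rker s z - smooth_rker s k R z\<bar> \<le> C * (R^2) ^ k * (R^2 + (norm z)^2) powr (- (b + real k))"
   using smooth_rker_remainder [OF s(1), where 'a = "real ^ 'n" and k = k] unfolding b_def by blast
  have "\<bar>v R y * J1 (z - y)\<bar> \<le> C * (R^2) ^ k * 8 powr (p / 2) * (\<bar>u y\<bar> * W y)" for y
  proof (cases "norm y < R")
   case False
   have "norm y - norm z \<le> norm (z - y)" using norm_triangle_ineq2 [of y z] by (simp add: norm_minus_commute)
   then have zy: "R \<le> 2 * norm (z - y)" using False z by linarith
   have "1 \<le> R^2" using R1(1) by (rule one_le_power)
   then have X: "1 \<le> R^2 + (norm (z - y))^2" using zero_le_power2 [of "norm (z - y)"] by linarith
   have "\<bar>J1 (z - y)\<bar> \<le> C * (R^2) ^ k * (R^2 + (norm (z - y))^2) powr (- (b + real k))"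
    unfolding J1_def J2_def by (rule C(2) [OF R1(2) zy])
   also have "... \<le> C * (R^2) ^ k * (R^2 + (norm (z - y))^2) powr (- (p / 2))"
    using X bp C(1) by (intro mult_left_mono powr_mono) auto
   also have "... \<le> C * (R^2) ^ k * (8 powr (p / 2) * W y)"
    using z R1 C(1) by (intro mult_left_mono weight_bound) auto
   finally have "\<bar>v R y\<bar> * \<bar>J1 (z - y)\<bar> \<le> \<bar>u y\<bar> * (C * (R^2) ^ k * (8 powr (p / 2) * W y))"
    by (intro mult_mono v_le) auto
   then show ?thesis by (simp add: abs_mult mult_ac)
  next
   case True
   then show ?thesis using C(1) by (simp add: v_def W_nonneg)
  qed
  then show ?thesis unfolding z_def [symmetric] by (rule integrable_tail_bound [rotated]) measurable
 qed
 have J2i: "integrable lborel J2" unfolding J2_def by (rule smooth_rker_integrable [OF s R1(1)])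
 have wJ2: "integrable lborel (\<lambda>y. w R y * J2 (z - y))" for z
 proof -
  obtain B where B: "\<And>y. \<bar>w R y\<bar> \<le> B" using w_bounded [of R] by blast
  have "integrable lborel (\<lambda>y. B * J2 (z - y))"
   using J2i by (intro integrable_mult_right) (simp only: integrable_lborel_reflect_iff)
  then show ?thesis
  proof (rule integrable_bound)
   have "\<bar>w R y\<bar> * \<bar>J2 (z - y)\<bar> \<le> \<bar>B\<bar> * \<bar>J2 (z - y)\<bar>" for y
    using B [of y] by (intro mult_right_mono) auto
   then show "AE y in lborel. norm (w R y * J2 (z - y)) \<le> norm (B * J2 (z - y))"
    by (intro AE_I2) (simp add: abs_mult)
  qed measurable
 qed
 define V where "V = fdiff k h (w R)"
 define v' where "v' = fdiff k h (v R)"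
 have V_eq: "V z = fdiff k h u z - v' z" for z
  unfolding V_def v'_def fdiff_minus [symmetric] by (simp add: u_split [where R = R])
 have v'0: "v' x = 0"
 proof -
  have "v R (x + real j *\<^sub>R h) = 0" if "j \<le> k" for j using xj [OF that] R1 by (simp add: v_def)
  then show ?thesis by (simp add: v'_def fdiff_def)
 qed
 have Vx: "V x = fdiff k h u x" by (simp add: V_eq v'0)
 \<comment> \<open>The second difference of \<Delta>_h^k u is \<Delta>_h^k of a polynomial of degree
   k + 1 - 2 < k, hence zero. So V has the same second difference at x as - v', and v' x =
   0.\<close>
 have sd: "sdiff V x z = v' (x + z) + v' (x - z)" for z
 proof -
  have "sdiff (fdiff k h u) x z = fdiff k h (\<lambda>y. sdiff u y z) x" by (rule sdiff_fdiff)
  also have "... = 0" using polynomial_deg_le_sdiff [OF poly] by (rule fdiff_polynomial_eq_0) simp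
  finally show ?thesis by (simp add: sdiff_def V_eq v'0)
 qed
 note A = fdiff_convolution_even [where K = J1 and f = "v R" and m = k and h = h and x = x, OF even1 vJ1, folded v'_def]
 note B = fdiff_convolution_even [where K = J2 and f = "w R" and m = k and h = h and x = x, OF even2 wJ2, folded V_def]
 note A' = integral_reflect_even [OF even1 A(1)]
 note B' = integral_reflect_even [OF even2 B(1)]
 define I1 where "I1 = (LBINT y. v R y * fdiff k h J1 (x - y))"
 define I2 where "I2 = (LBINT y. w R y * fdiff k h J2 (x - y))"
 define mass where "mass = (LBINT z. J2 z)"
 have part1: "integrable lborel (\<lambda>z. sdiff V x z * J1 z)" "(LBINT z. sdiff V x z * J1 z) = 2 * I1"
  unfolding sd distrib_right
  using A A' by (simp_all add: I1_def)
 have part2: "integrable lborel (\<lambda>z. sdiff V x z * J2 z)" "(LBINT z. sdiff V x z * J2 z) = 2 * (V x * mass - I2)"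
 proof -
  have e: "sdiff V x z * J2 z = 2 * V x * J2 z - V (x + z) * J2 z - V (x - z) * J2 z" for z
   by (simp add: sdiff_def algebra_simps)
  show "integrable lborel (\<lambda>z. sdiff V x z * J2 z)" unfolding e
   by (intro integrable_diff integrable_mult_right J2i B(1) B'(1))
  show "(LBINT z. sdiff V x z * J2 z) = 2 * (V x * mass - I2)"
   unfolding e using B B' J2i by (simp add: I2_def mass_def)
 qed
 have "fdiff k h (G R) x = flap s V x"
  unfolding G_def V_def
  by (intro flap_fdiff [symmetric] sdiff_w_integrable) (use xj R1 in fastforce)
 also have "... = (LBINT z. sdiff V x z * J1 z + sdiff V x z * J2 z) / 2"
  unfolding flap_def J1_def by (simp add: algebra_simps)
 also have "... = I1 + V x * mass - I2"
  unfolding integral_add [OF part1(1) part2(1)] part1(2) part2(2) by simp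
 \<comment> \<open>Writing J1 as \<open>rker s\<close> - J2 joins the J2 integral over
   \<open>v R\<close> to that over \<open>w R\<close>, and together they are an integral over
   u.\<close>
 also have "I1 - I2 = (LBINT y. v R y * fdiff k h (rker s) (x - y)) - (LBINT y. u y * fdiff k h J2 (x - y))"
 proof -
  obtain A where A: "A \<ge> 0" "\<And>R x y. 1 \<le> R ==> norm x \<le> R ==> 8 * (real k + 1) * norm h \<le> R ==>
   \<bar>fdiff k h (smooth_rker s k R) (x - y)\<bar> \<le> A * W y"
   by (rule fdiff_smooth_weighted [of h]) (rule that)
  have fJ2: "\<bar>f y * fdiff k h J2 (x - y)\<bar> \<le> A * (\<bar>u y\<bar> * W y)" if "\<And>y. \<bar>f y\<bar> \<le> \<bar>u y\<bar>" for f y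
  proof -
   have "\<bar>f y\<bar> * \<bar>fdiff k h J2 (x - y)\<bar> \<le> \<bar>u y\<bar> * (A * W y)"
    unfolding J2_def using that by (intro mult_mono A(2) R1 xR h8) auto
   then show ?thesis by (simp add: abs_mult mult_ac)
  qed
  have i: "integrable lborel (\<lambda>y. w R y * fdiff k h J2 (x - y))" "integrable lborel (\<lambda>y. v R y * fdiff k h J2 (x - y))"
   by (rule integrable_tail_bound [OF _ fJ2 [OF w_le]], measurable) (rule integrable_tail_bound [OF _ fJ2 [OF v_le]], measurable)
  obtain C where C: "C \<ge> 0" "\<And>R x y. 2 \<le> R ==> 2 * norm x \<le> R ==> 16 * (real k + 1) * norm h \<le> R ==>
   \<bar>v R y * fdiff k h (rker s) (x - y)\<bar> \<le> C * (\<bar>u y\<bar> * W y)"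
   by (rule fdiff_rker_weighted [of h]) (rule that)
  have ir: "integrable lborel (\<lambda>y. v R y * fdiff k h (rker s) (x - y))"
   by (rule integrable_tail_bound [OF _ C(2) [OF R xR(1) h]]) measurable
  have "fdiff k h J1 z = fdiff k h (rker s) z - fdiff k h J2 z" for z
   unfolding J1_def [abs_def] by (rule fdiff_minus)
  then have "I1 = (LBINT y. v R y * fdiff k h (rker s) (x - y)) - (LBINT y. v R y * fdiff k h J2 (x - y))"
   unfolding I1_def by (simp add: right_diff_distrib integral_diff [OF ir i(2)])
  moreover have "(LBINT y. u y * fdiff k h J2 (x - y)) = I2 + (LBINT y. v R y * fdiff k h J2 (x - y))"
  proof -
   have "u y * c = w R y * c + v R y * c" for y c by (metis distrib_right u_split)
   then show ?thesis unfolding I2_def integral_add [OF i, symmetric] by (simp only:)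
  qed
  ultimately show ?thesis by simp
 qed
 then have "I1 + V x * mass - I2 = V x * mass - (LBINT y. u y * fdiff k h J2 (x - y)) + (LBINT y. v R y * fdiff k h (rker s) (x - y))" by simp
 finally show ?thesis unfolding Vx mass_def J2_def .
qed

text \<open>Each of the three terms of \<open>fdiff_G\<close> tends to 0: the mass of the smooth
  kernel vanishes, its k-th differences vanish pointwise under the majorant A |u| W, and
  \<open>v R\<close> vanishes on every bounded set for large R.\<close>

lemma fdiff_G_tendsto: "(\<lambda>i. fdiff k h (G (real i)) x) \<longlonglongrightarrow> 0"
proof -
 obtain A where A: "A \<ge> 0" "\<And>R x y. 1 \<le> R ==> norm x \<le> R ==> 8 * (real k + 1) * norm h \<le> R ==>
   \<bar>fdiff k h (smooth_rker s k R) (x - y)\<bar> \<le> A * W y"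
  "\<And>R z. 1 \<le> R ==> 8 * (real k + 1) * norm h \<le> R ==>
   \<bar>fdiff k h (smooth_rker s k R) z\<bar> \<le> A * (R^2) powr (- (p / 2))"
  by (rule fdiff_smooth_weighted [of h]) (rule that)
 obtain C where C: "C \<ge> 0" "\<And>R x y. 2 \<le> R ==> 2 * norm x \<le> R ==> 16 * (real k + 1) * norm h \<le> R ==>
   \<bar>v R y * fdiff k h (rker s) (x - y)\<bar> \<le> C * (\<bar>u y\<bar> * W y)"
  by (rule fdiff_rker_weighted [of h]) (rule that)
 define c where "c = 8 * (real k + 1) * norm h"
 define d where "d = norm x + real k * norm h"
 define N where "N = nat \<lceil>2 + 2 * d + 2 * c\<rceil> + 1"
 have c: "0 \<le> c" "16 * (real k + 1) * norm h = 2 * c" by (auto simp: c_def)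
 have d: "norm x \<le> d" "0 \<le> d" by (auto simp: d_def)
 have NN: "2 + 2 * d + 2 * c < real N" unfolding N_def by linarith
 have large: "2 \<le> r" "norm x + real k * norm h < r / 2" "16 * (real k + 1) * norm h \<le> r"
  "1 \<le> r" "norm x \<le> r" "8 * (real k + 1) * norm h \<le> r" "2 * norm x \<le> r" if "real N \<le> r" for r
  unfolding c(2) d_def [symmetric] c_def [symmetric] using that NN c(1) d by linarith+
 have big: "2 \<le> real (i + N)" "norm x + real k * norm h < real (i + N) / 2" "16 * (real k + 1) * norm h \<le> real (i + N)"
  "1 \<le> real (i + N)" "norm x \<le> real (i + N)" "8 * (real k + 1) * norm h \<le> real (i + N)" "2 * norm x \<le> real (i + N)" for i
  by (rule large, simp)+
 have l1: "(\<lambda>i. LBINT (z :: real ^ 'n). smooth_rker s k (real (i + N)) z) \<longlonglongrightarrow> 0"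
  by (rule smooth_rker_mass_tendsto [OF s]) (simp add: N_def)
 have l2: "(\<lambda>i. LBINT y. u y * fdiff k h (smooth_rker s k (real (i + N))) (x - y)) \<longlonglongrightarrow> (\<integral>y. 0 \<partial>(lborel :: (real ^ 'n) measure))"
 proof (rule integral_dominated_convergence)
  show "integrable lborel (\<lambda>y. A * (\<bar>u y\<bar> * W y))" by (intro integrable_mult_right tail_W)
  show "AE y in lborel. norm (u y * fdiff k h (smooth_rker s k (real (i + N))) (x - y)) \<le> A * (\<bar>u y\<bar> * W y)" (is "AE y in _. ?P y") for i
  proof (intro AE_I2)
   fix y
   from mult_left_mono [OF A(2) [OF big(4,5,6), of i y] abs_ge_zero [of "u y"]]
   show "?P y"
    by (simp add: abs_mult mult_ac)
  qed
  show "AE y in lborel. (\<lambda>i. u y * fdiff k h (smooth_rker s k (real (i + N))) (x - y)) \<longlonglongrightarrow> 0"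
  proof (intro AE_I2 tendsto_mult_right_zero)
   fix y
   show "(\<lambda>i. fdiff k h (smooth_rker s k (real (i + N))) (x - y)) \<longlonglongrightarrow> 0"
   proof (rule Lim_null_comparison)
    show "\<forall>\<^sub>F i in sequentially. norm (fdiff k h (smooth_rker s k (real (i + N))) (x - y)) \<le> A * ((real (i + N))^2) powr (- (p / 2))"
     using A(3) [OF big(4,6)] by (intro always_eventually allI) simp
    show "(\<lambda>i. A * ((real (i + N))^2) powr (- (p / 2))) \<longlonglongrightarrow> 0"
     using p_pos by (intro tendsto_mult_right_zero powr_neg_square_tendsto_0) simp
   qed
  qed
 qed measurable
 have l3: "(\<lambda>i. LBINT y. v (real (i + N)) y * fdiff k h (rker s) (x - y)) \<longlonglongrightarrow> (\<integral>y. 0 \<partial>(lborel :: (real ^ 'n) measure))"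
 proof (rule integral_dominated_convergence)
  show "integrable lborel (\<lambda>y. C * (\<bar>u y\<bar> * W y))" by (intro integrable_mult_right tail_W)
  show "AE y in lborel. norm (v (real (i + N)) y * fdiff k h (rker s) (x - y)) \<le> C * (\<bar>u y\<bar> * W y)" for i
   using C(2) [OF big(1,7,3)] by (intro AE_I2) simp
  show "AE y in lborel. (\<lambda>i. v (real (i + N)) y * fdiff k h (rker s) (x - y)) \<longlonglongrightarrow> 0"
  proof (intro AE_I2 tendsto_eventually)
   fix y :: "real ^ 'n"
   have "\<forall>\<^sub>F i in sequentially. nat \<lceil>norm y + 1\<rceil> \<le> i" by (rule eventually_ge_at_top)
   then show "\<forall>\<^sub>F i in sequentially. v (real (i + N)) y * fdiff k h (rker s) (x - y) = 0"
   proof eventually_elim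
    case (elim i)
    then have "norm y < real (i + N)" by linarith
    then show ?case by (simp add: v_def)
   qed
  qed
 qed measurable
 have "(\<lambda>i. fdiff k h (G (real (i + N))) x) \<longlonglongrightarrow> fdiff k h u x * 0 - 0 + 0"
  unfolding fdiff_G [OF big(1,2,3)]
  using l1 l2 l3 by (intro tendsto_add tendsto_diff tendsto_mult tendsto_const) simp_all
 then have "(\<lambda>i. fdiff k h (G (real (i + N))) x) \<longlonglongrightarrow> 0" by simp
 then show ?thesis by (rule LIMSEQ_offset)
qed

lemma Ginf_polynomial: "polynomial_deg_le (int k - 1) Ginf"
proof (rule frechet_polynomial [OF Ginf_continuous])
 fix x h :: "real ^ 'n"
 have "(\<lambda>i. fdiff k h (\<lambda>z. G (real i) z + Q (real i) z) x) \<longlonglongrightarrow> fdiff k h Ginf x"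
  unfolding fdiff_def by (intro tendsto_sum tendsto_mult tendsto_const Ginf_limit)
 moreover have "fdiff k h (\<lambda>z. G (real i) z + Q (real i) z) x = fdiff k h (G (real i)) x" for i
 proof -
  have "fdiff k h (\<lambda>z. G (real i) z + Q (real i) z) x = fdiff k h (G (real i)) x + fdiff k h (Q (real i)) x"
   by (simp add: fdiff_def distrib_left sum.distrib)
  also have "fdiff k h (Q (real i)) x = 0" by (rule fdiff_polynomial_eq_0 [OF Q_integrand(2)]) simp
  finally show ?thesis by simp
 qed
 ultimately have "(\<lambda>i. fdiff k h (G (real i)) x) \<longlonglongrightarrow> fdiff k h Ginf x" by simp
 then show "fdiff k h Ginf x = 0" using fdiff_G_tendsto LIMSEQ_unique by blast
qed

theorem frac_laplacian_eq_mod_polynomial: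
 assumes wi: "weighted_integrable (2 * s + real k) u"
 shows "frac_laplacian_eq_mod s k u (\<lambda>_. 0)"
 unfolding frac_laplacian_eq_mod_def frac_laplacian_eq_mod_on_def
proof (intro allI impI conjI wi u_cont)
 fix M :: real assume "0 < M"
 obtain C where C: "C \<ge> 0" "\<And>x R. 1 \<le> R ==> 4 * norm x \<le> R ==> \<bar>Ginf x - (G R x + Q R x)\<bar> \<le> C * norm x ^ k * T R"
  using Ginf_close by blast
 define P where "P R x = Ginf x - Q R x" for R x
 define F where "F R x = G R x + Q R x - Ginf x" for R x
 have "\<forall>\<^sub>F R in at_top. polynomial_deg_le (int k - 1) (P R) \<and>
   visc_frac_laplacian_eq s (ball 0 M) (\<lambda>y. indicator (ball 0 R) y * u y) (\<lambda>x. F R x + P R x)"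
  using eventually_ge_at_top [of M]
 proof eventually_elim
  case (elim R)
  have "polynomial_deg_le (int k - 1) (P R)"
   unfolding P_def [abs_def] by (intro polynomial_deg_le_diff Ginf_polynomial Q_integrand(2))
  moreover have "(\<lambda>x. F R x + P R x) = flap s (\<lambda>y. indicator (ball 0 R) y * u y)"
   by (simp add: F_def P_def G_def w_def fun_eq_iff)
  ultimately show ?case using cutoff_visc [OF s u_cont u_C11 elim] by simp
 qed
 moreover have "((\<lambda>R. F R x) \<longlongrightarrow> 0) at_top" for x
 proof (rule Lim_null_comparison)
  show "\<forall>\<^sub>F R in at_top. norm (F R x) \<le> C * norm x ^ k * T R"
   using eventually_ge_at_top [of "max 1 (4 * norm x)"]
  proof eventually_elim
   case (elim R)
   then show ?case using C(2) [of R x] by (simp add: F_def abs_minus_commute)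
  qed
  show "((\<lambda>R. C * norm x ^ k * T R) \<longlongrightarrow> 0) at_top" by (intro tendsto_mult_right_zero T_tendsto)
 qed
 ultimately show "\<exists>P F. (\<forall>\<^sub>F R in at_top. polynomial_deg_le (int k - 1) (P R) \<and>
   visc_frac_laplacian_eq s (ball 0 M) (\<lambda>y. indicator (ball 0 R) y * u y) (\<lambda>x. F R x + P R x)) \<and>
   (\<forall>x\<in>ball 0 M. ((\<lambda>R. F R x) \<longlongrightarrow> 0) at_top)"
  by blast
qed

end

theorem theorem1p5:
  fixes s :: real and k :: nat and u :: "real ^ 'n \<Rightarrow> real"
  assumes "0 < s" and "s < 1"
    and "continuous_on UNIV u"
    and "integrable lebesgue (\<lambda>y. \<bar>u y\<bar> / (1 + norm y powr (real CARD('n) + 2 * s + real k)))"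
  shows "frac_laplacian_eq_mod s k u (\<lambda>_. 0) \<longleftrightarrow>
    polynomial_deg_le (int (liouville_degree k s)) u"
proof -
  define a where "a = real CARD('n) + 2 * s + real k"
  have a: "0 < a" using assms(1) by (simp add: a_def add_pos_nonneg)
  have um [measurable]: "u \<in> borel_measurable borel"
    using assms(3) by (rule borel_measurable_continuous_onI)
  have ui: "integrable lborel (\<lambda>y. \<bar>u y\<bar> / (1 + norm y powr a))"
    using assms(4) unfolding a_def [symmetric] by (subst (asm) integrable_completion) auto
  show ?thesis
  proof
    assume eq: "frac_laplacian_eq_mod s k u (\<lambda>_. 0)"
    \<comment> \<open>Here the two cases meet: 2 s is at most 1 for s \<le> 1/2 and less than 2
      otherwise.\<close>
    have "2 * s + real k \<le> real (liouville_degree k s + 1)"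
      using assms(2) by (simp add: liouville_degree_def)
    from frac_laplacian_eq_mod_imp_polynomial [OF assms(1,2,3) ui [unfolded a_def] eq this]
    show "polynomial_deg_le (int (liouville_degree k s)) u" by simp
  next
    assume "polynomial_deg_le (int (liouville_degree k s)) u"
    then have "polynomial_deg_le (int k + 1) u"
      by (rule polynomial_deg_le_mono) (simp add: liouville_degree_def)
    moreover have "integrable lborel (\<lambda>y. \<bar>u y\<bar> * (1 + norm y) powr (- a))"
    proof (rule integrable_bound [OF integrable_mult_right [OF ui, of 2]])
      show "AE y in lborel. norm (\<bar>u y\<bar> * (1 + norm y) powr (- a)) \<le> norm (2 * (\<bar>u y\<bar> / (1 + norm y powr a)))" (is "AE y in _. ?P y")
      proof (intro AE_I2)
        fix y :: "real ^ 'n"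
        have "norm y powr a \<le> (1 + norm y) powr a" using a by (intro powr_mono2) auto
        moreover have "1 \<le> (1 + norm y) powr a" using a by (intro ge_one_powr_ge_zero) auto
        ultimately have "1 + norm y powr a \<le> 2 * (1 + norm y) powr a" by linarith
        moreover have "0 < 1 + norm y powr a" by (simp add: add_pos_nonneg)
        ultimately have "(1 + norm y) powr (- a) \<le> 2 / (1 + norm y powr a)"
          using \<open>1 \<le> (1 + norm y) powr a\<close> by (simp add: powr_minus_divide divide_simps)
        from mult_left_mono [OF this abs_ge_zero [of "u y"]]
        show "?P y"
          by (simp add: abs_mult abs_of_nonneg add_nonneg_nonneg mult.commute)
      qed
    qed measurable
    ultimately interpret polynomial_tail s k u
      using assms(1,2) by unfold_locales (simp_all add: a_def)
    have "weighted_integrable (2 * s + real k) u"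
      using assms(4) um unfolding weighted_integrable_def
      by (auto simp: add.assoc intro: measurable_completion)
    then show "frac_laplacian_eq_mod s k u (\<lambda>_. 0)" by (rule frac_laplacian_eq_mod_polynomial)
  qed
qed

end
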